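(* Consider the switched DAE $$E_\sigma \dot x = A_\sigma x + B_\sigma u,\qquad y = C_\sigma x + D_\sigma u$$ with all matrix pairs $(E_k,A_k)$ regular, and let $0\le p<q$ be integers such that the system is $[t_p,t_q)$-detectable with class $\mathcal{KL}$ function $\beta$. Let $(x,u,y)$ be a solution on $[t_p,t_q)$ and let $(\widehat x,\widehat y)$ be a solution of the system copy $$E_\sigma\dot{\widehat x}=A_\sigma\widehat x+B_\sigma u,\qquad \widehat y=C_\sigma\widehat x+D_\sigma u$$ on $[t_p,t_q)$ (with the same input $u$). Based on the output mismatch $y^e:=\widehat y-y$, let $$\xi:=\Phi_p^q\,\mathcal{O}_p^{q-1}\,\mathbf{z}_p^{q-1},\qquad \mathbf{z}_p^{q-1}=\begin{pmatrix}z_p\\ z_{p+1}\\ \vdots\\ z_{q-1}\end{pmatrix},\qquad z_k=\mathfrak{O}_k\big(y^e_{[t_k,t_{k+1})}\big),\quad k=p,\dots,q-1,$$ where $\Phi_p^q$, $\mathcal{O}_p^{q-1}$ and $\mathfrak{O}_k$ are defined in the context. Then $$|\widehat x(t_q^-)-\xi-x(t_q^-)|\le\beta\big(|\widehat x(t_p^-)-x(t_p^-)|,\,t_q-t_p\big)<|\widehat x(t_p^-)-x(t_p^-)|,$$ i.e. the correction term $\xi$ indeed reduces the estimation error at the end of the interval in comparison to the estimation error at the beginning of the interval.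
   Context: **Switched DAE.** $x,u,y$ are the state, input and output, of dimensions $n,\mathtt{u},\mathtt{y}$. The switching signal $\sigma:[0,\infty)\to\mathbb{N}$ is piecewise constant and right-continuous (finitely many switches in each bounded interval), with switching times $0<t_1<t_2<\cdots$ and $t_0:=0$; $\tau_k:=t_{k+1}-t_k$. On $[t_k,t_{k+1})$ the active mode is given by real matrices $(E_k,A_k,B_k,C_k,D_k)$ of sizes $n\times n$, $n\times n$, $n\times \mathtt{u}$, $\mathtt{y}\times n$, $\mathtt{y}\times \mathtt{u}$. $(E_k,A_k)$ is regular if $\det(sE_k-A_k)$ is not the zero polynomial. **Piecewise-smooth distributions.** $\mathbb{D}_{\mathrm{pw}\mathcal{C}^\infty}$ is the space of distributions on $\mathbb{R}$ of the form $D=f_{\mathbb{D}}+\sum_{t\in T}D_t$, where $f$ is a piecewise-smooth function, $f_{\mathbb D}$ the distribution induced by $f$, $T\subseteq\mathbb{R}$ is discrete and $D_t\in\mathrm{span}\{\delta_t,\delta_t',\delta_t'',\dots\}$. One sets $D(t^\pm):=f(t^\pm)$ (one-sided limits), $D[t]:=D_t$ for $t\in T$ and $D[t]:=0$ otherwise. The restriction to an interval $\mathcal{I}$ is $D_{\mathcal I}:=(\mathbb{1}_{\mathcal I}f)_{\mathbb D}+\sum_{t\in T\cap \mathcal I}D_t$. Derivatives are distributional. **Solutions.** $(x,u,y)$ with all components in $\mathbb{D}_{\mathrm{pw}\mathcal{C}^\infty}$ is a solution on an interval $\mathcal{I}\subseteq[0,\infty)$ if the switched DAE restricted to $\mathcal{I}$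 holds as an equality of distributions, i.e. for each $k$ and $J=\mathcal{I}\cap[t_k,t_{k+1})$: $(E_k\dot x)_J=(A_kx+B_ku)_J$ and $y_J=(C_kx+D_ku)_J$. The left value $x(t_p^-)$ is arbitrary. **Class $\mathcal{KL}$.** $\beta:\mathbb{R}_{\ge0}\times\mathbb{R}_{\ge0}\to\mathbb{R}_{\ge0}$ is of class $\mathcal{KL}$ if 1) for each $t\ge0$, $\beta(\cdot,t)$ is continuous, strictly increasing, with $\beta(0,t)=0$; and 2) for each $r\ge0$, $\beta(r,\cdot)$ is decreasing and converging to zero as $t\to\infty$. **Interval-detectability.** The switched DAE is $[t_p,t_q)$-detectable with class $\mathcal{KL}$ function $\beta$ if $\beta(r,t_q-t_p)<r$ for all $r>0$ and for any solution $(x,u=0,y=0)$ on $[t_p,t_q)$ one has $|x(t^+)|\le\beta(|x(t_p^-)|,t-t_p)$ for all $t\in[t_p,t_q)$. $|\cdot|$ is the Euclidean norm. **Matrices of each mode.** For regular $(E_k,A_k)$ there are invertible $S,T$ with $SE_kT=\begin{bmatrix}I&0\\0&N\end{bmatrix}$, $SA_kT=\begin{bmatrix}J&0\\0&I\end{bmatrix}$, $N$ nilpotent. Set $$\Pi_k=T\begin{bmatrix}I&0\\0&0\end{bmatrix}T^{-1},\quad A_k^{\mathrm{diff}}=T\begin{bmatrix}J&0\\0&0\end{bmatrix}T^{-1},\quad E_k^{\mathrm{imp}}=T\begin{bmatrix}0&0\\0&N\end{bmatrix}T^{-1},\quad C_k^{\mathrm{diff}}=C_k\Pi_k.$$ Let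 $O_k^{\mathrm{diff}}$ be the stacking of $C_k^{\mathrm{diff}}(A_k^{\mathrm{diff}})^j$, $j=0,\dots,n-1$, and $O_k^{\mathrm{imp}}$ the stacking of $C_k(E_k^{\mathrm{imp}})^j$, $j=1,\dots,n-1$. **Local unobservable space and $\mathfrak{O}_k$.** $\mathcal{W}_k:=\Pi_k^{-1}(\ker O_k^{\mathrm{diff}})\cap\ker O_k^{\mathrm{imp}}$ ($\Pi_k^{-1}$ denotes preimage); equivalently, $\mathcal{W}_k$ is the set of $e(t_k^-)$ for solutions of the homogeneous system $E_\sigma\dot e=A_\sigma e$, $y^e=C_\sigma e$ on $[t_k,t_{k+1})$ with $y^e=0$ there. $Z_k,Z_k^{\mathrm{diff}},Z_k^{\mathrm{imp}}$ are matrices with orthonormal columns and $\operatorname{im}Z_k=\mathcal{W}_k^\perp$, $\operatorname{im}Z_k^{\mathrm{diff}}=\operatorname{im}(O_k^{\mathrm{diff}})^\top$, $\operatorname{im}Z_k^{\mathrm{imp}}=\operatorname{im}(O_k^{\mathrm{imp}})^\top$. Choose $U_k^{\mathrm{obs}}$ with $Z_k=[\Pi_k^\top Z_k^{\mathrm{diff}},\ Z_k^{\mathrm{imp}}]U_k^{\mathrm{obs}}$ and $U_k^{\mathrm{imp}}$ with $-(O_k^{\mathrm{imp}})^\top U_k^{\mathrm{imp}}=Z_k^{\mathrm{imp}}$. For an output $y^e$ of the homogeneous system on $[t_k,t_{k+1})$: let $\mathbf{z}_k^{\mathrm{diff}}$ be the unique function on $(t_k,t_{k+1})$ with $\dot{\mathbf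 z}_k^{\mathrm{diff}}=S_k^{\mathrm{diff}}\mathbf z_k^{\mathrm{diff}}$, $y^e=R_k^{\mathrm{diff}}\mathbf z_k^{\mathrm{diff}}$, where $S_k^{\mathrm{diff}}=(Z_k^{\mathrm{diff}})^\top A_k^{\mathrm{diff}}Z_k^{\mathrm{diff}}$, $R_k^{\mathrm{diff}}=C_k^{\mathrm{diff}}Z_k^{\mathrm{diff}}$ (an observable pair), and put $z_k^{\mathrm{diff}}:=\mathbf z_k^{\mathrm{diff}}(t_k^+)$; write $y^e[t_k]=\sum_{j=0}^{n-2}\eta_k^j\delta_{t_k}^{(j)}$, let $\boldsymbol\eta_k$ be the stacking of $\eta_k^0,\dots,\eta_k^{n-2}$, and put $z_k^{\mathrm{imp}}:=(U_k^{\mathrm{imp}})^\top\boldsymbol\eta_k$. Then $\mathfrak{O}_k(y^e_{[t_k,t_{k+1})}):=(U_k^{\mathrm{obs}})^\top\begin{pmatrix} z_k^{\mathrm{diff}} \\ z_k^{\mathrm{imp}} \end{pmatrix}$. (If $e$ is a solution of the homogeneous system on $[t_k,t_{k+1})$ with output $y^e$, this equals $Z_k^\top e(t_k^-)$.) **The matrix $\mathcal{O}_p^{q-1}$.** Define $\mathcal{N}_{q-1}^q:=\mathcal{W}_{q-1}$ and $\mathcal{N}_k^q:=\mathcal{W}_k\cap\Pi_k^{-1}\big(e^{-A_k^{\mathrm{diff}}\tau_k}\mathcal{N}_{k+1}^q\big)$ for $k=q-2,\dots,p$. Let $M_k^q$ have orthonormal columns with $\operatorname{im}M_k^q=(\mathcal{N}_k^q)^\perp$,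 where $M_{q-1}^q:=Z_{q-1}$. For $p\le k\le q-2$ choose $\Theta_k^q$ with $\operatorname{im}\Theta_k^q=\big(e^{-A_k^{\mathrm{diff}}\tau_k}\mathcal{N}_{k+1}^q\big)^\perp$ and $U_k^q$ with $M_k^q=[Z_k,\ \Pi_k^\top\Theta_k^q]U_k^q$ (such $U_k^q$ exists). Given vectors $z_p,\dots,z_{q-1}$, set $\mu_{q-1}:=z_{q-1}$ and, for $k=q-2,\dots,p$, $$\mu_k:=(U_k^q)^\top\begin{pmatrix} z_k \\ (\Theta_k^q)^\top e^{-A_k^{\mathrm{diff}}\tau_k}M_{k+1}^q\mu_{k+1}\end{pmatrix}.$$ $\mathcal{O}_p^{q-1}$ is the matrix of the linear map $(z_p/\cdots/z_{q-1})\mapsto M_p^q\mu_p$ (acting on stacked vectors). **The matrix $\Phi_p^q$.** $\Phi_p^p:=I$ and $\Phi_p^{k+1}:=e^{A_k^{\mathrm{diff}}\tau_k}\Pi_k\Phi_p^k$ for $k=p,\dots,q-1$.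
   Formalization: The strict inequality is claimed only when the estimation error at t_p^- is nonzero (it reads 0<0 otherwise), and each β(r,·) is assumed left-continuous at t_q−t_p, without which the first inequality fails (ẋ=0, y=0, β jumping down from 2r to r/2 at t_q−t_p). *)

theory Defs
  imports
    "HOL-Analysis.Analysis"
    "HOL-Library.Function_Algebras"
    "Jordan_Normal_Form.Matrix"
    "Jordan_Normal_Form.Determinant"
    "Jordan_Normal_Form.Matrix_Kernel"
begin

text \<open>
  Matrices and vectors are those of \<^theory>\<open>Jordan_Normal_Form.Matrix\<close>, because several matrices
  below (orthonormal bases, coefficient matrices) have a number of columns that varies with the
  mode index. The clashing names of the Cartesian-product library are hidden.
\<close>

unbundle no vec_syntax
unbundle no inner_syntax
hide_type (open) Finite_Cartesian_Product.vec
hide_const (open) Finite_Cartesian_Product.vec Finite_Cartesian_Product.mat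
  Finite_Cartesian_Product.row Determinants.det Finite_Cartesian_Product.transpose

section \<open>Distributions\<close>

definition smooth :: "(real \<Rightarrow> real) \<Rightarrow> bool" where
  "smooth f \<longleftrightarrow> (\<forall>k. (deriv ^^ k) f differentiable_on UNIV)"

typedef test_fun = "{\<phi> :: real \<Rightarrow> real. smooth \<phi> \<and> bounded {s. \<phi> s \<noteq> 0}}"
  morphisms tf Abs_test_fun
proof -
  have "(deriv ^^ k) (\<lambda>_ :: real. 0 :: real) = (\<lambda>_. 0)" for k
    by (induction k) simp_all
  then have "smooth (\<lambda>_. 0)"
    by (simp add: smooth_def)
  then have "(\<lambda>_. 0) \<in> {\<phi> :: real \<Rightarrow> real. smooth \<phi> \<and> bounded {s. \<phi> s \<noteq> 0}}"
    by simp
  then show ?thesis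
    by (rule exI[where x = "\<lambda>_. 0"])
qed

setup_lifting type_definition_test_fun

lift_definition tf_deriv :: "test_fun \<Rightarrow> test_fun" is deriv
proof -
  fix f :: "real \<Rightarrow> real"
  assume f: "smooth f \<and> bounded {s. f s \<noteq> 0}"
  have "(deriv ^^ k) (deriv f) differentiable_on UNIV" for k
    using f[unfolded smooth_def, THEN conjunct1, rule_format, of "Suc k"]
    by (simp only: funpow_Suc_right o_apply)
  then have "smooth (deriv f)"
    by (simp add: smooth_def)
  moreover have "{s. deriv f s \<noteq> 0} \<subseteq> closure {s. f s \<noteq> 0}"
  proof
    fix s assume s: "s \<in> {s. deriv f s \<noteq> 0}"
    show "s \<in> closure {s. f s \<noteq> 0}"
    proof (rule ccontr)
      assume "s \<notin> closure {s. f s \<noteq> 0}"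
      then have "eventually (\<lambda>r. r \<in> - closure {s. f s \<noteq> 0}) (nhds s)"
        by (intro eventually_nhds_in_open) auto
      then have "eventually (\<lambda>r. f r = 0) (nhds s)"
      proof (rule eventually_mono)
        fix r assume "r \<in> - closure {s. f s \<noteq> 0}"
        then have "r \<notin> {s. f s \<noteq> 0}"
          using closure_subset[of "{s. f s \<noteq> 0}"] by (meson ComplD in_mono)
        then show "f r = 0"
          by simp
      qed
      then have "deriv f s = deriv (\<lambda>_. 0) s"
        by (rule deriv_cong_ev) simp
      with s show False
        by simp
    qed
  qed
  then have "bounded {s. deriv f s \<noteq> 0}"
    by (rule bounded_subset[rotated]) (simp add: f bounded_closure)
  ultimately show "smooth (deriv f) \<and> bounded {s. deriv f s \<noteq> 0}"
    by (rule conjI)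
qed

text \<open>
  Functionals on test functions, with the pointwise vector space operations. Only the members of
  \<open>pw_smooth_dists\<close> below are used; they are linear and continuous by their very form.
\<close>

type_synonym distr = "test_fun \<Rightarrow> real"

definition fun_dist :: "(real \<Rightarrow> real) \<Rightarrow> distr" where
  "fun_dist f = (\<lambda>\<phi>. integral\<^sup>L lborel (\<lambda>s. f s * tf \<phi> s))"

definition dist_deriv :: "distr \<Rightarrow> distr" where
  "dist_deriv D = (\<lambda>\<phi>. - D (tf_deriv \<phi>))"

definition dirac :: "real \<Rightarrow> distr" where
  "dirac t = (\<lambda>\<phi>. tf \<phi> t)"

definition dirac_comb :: "nat \<Rightarrow> (nat \<Rightarrow> real) \<Rightarrow> real \<Rightarrow> distr" where
  "dirac_comb m c t = (\<lambda>\<phi>. \<Sum>j<m. c j * (dist_deriv ^^ j) (dirac t) \<phi>)"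

definition dirac_span :: "real \<Rightarrow> distr set" where
  "dirac_span t = {D. \<exists>m c. D = dirac_comb m c t}"

text \<open>
  Piecewise smooth: finitely many pieces in each bounded interval, each piece being the restriction
  of a function that is smooth on the whole line, so that all one-sided limits exist. The values at
  the break points do not affect the induced distribution and are fixed by right continuity.
\<close>

definition pw_smooth_fun :: "(real \<Rightarrow> real) \<Rightarrow> bool" where
  "pw_smooth_fun f \<longleftrightarrow> (\<exists>(r :: int \<Rightarrow> real) g. strict_mono r \<and>
     filterlim r at_top at_top \<and> filterlim r at_bot at_bot \<and>
     (\<forall>i. smooth (g i) \<and> (\<forall>s\<in>{r i..<r (i + 1)}. f s = g i s)))"

definition locally_finite_set :: "real set \<Rightarrow> bool" where
  "locally_finite_set T \<longleftrightarrow> (\<forall>a b. finite (T \<inter> {a..b}))"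

text \<open>
  Since \<open>T\<close> is locally finite and test functions have bounded support, only finitely many summands
  of the infinite sum are nonzero.
\<close>

definition pw_decomp :: "distr \<Rightarrow> (real \<Rightarrow> real) \<Rightarrow> real set \<Rightarrow> (real \<Rightarrow> distr) \<Rightarrow> bool" where
  "pw_decomp D f T Dt \<longleftrightarrow> pw_smooth_fun f \<and> locally_finite_set T \<and>
     (\<forall>t\<in>T. Dt t \<in> dirac_span t) \<and> D = fun_dist f + (\<lambda>\<phi>. \<Sum>\<^sub>\<infinity>t\<in>T. Dt t \<phi>)"

definition pw_smooth_dists :: "distr set" where
  "pw_smooth_dists = {D. \<exists>f T Dt. pw_decomp D f T Dt}"

definition regular_part :: "distr \<Rightarrow> real \<Rightarrow> real" where
  "regular_part D = (THE f. \<exists>T Dt. pw_decomp D f T Dt)"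

definition impulse_at :: "distr \<Rightarrow> real \<Rightarrow> distr" where
  "impulse_at D t = (THE P. \<exists>f T Dt. pw_decomp D f T Dt \<and> P = (if t \<in> T then Dt t else 0))"

definition dist_restrict :: "real set \<Rightarrow> distr \<Rightarrow> distr" where
  "dist_restrict I D =
     fun_dist (\<lambda>s. indicator I s * regular_part D s) + (\<lambda>\<phi>. \<Sum>\<^sub>\<infinity>t\<in>I. impulse_at D t \<phi>)"

subsection \<open>Vectors of distributions\<close>

definition pw_smooth_vecs :: "nat \<Rightarrow> distr vec set" where
  "pw_smooth_vecs n = {x \<in> carrier_vec n. \<forall>i<n. x $ i \<in> pw_smooth_dists}"

definition left_value :: "distr vec \<Rightarrow> real \<Rightarrow> real vec" where
  "left_value x t = map_vec (\<lambda>D. Lim (at_left t) (regular_part D)) x"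

definition right_value :: "distr vec \<Rightarrow> real \<Rightarrow> real vec" where
  "right_value x t = map_vec (\<lambda>D. Lim (at_right t) (regular_part D)) x"

definition vec_restrict :: "real set \<Rightarrow> distr vec \<Rightarrow> distr vec" where
  "vec_restrict I x = map_vec (dist_restrict I) x"

definition vec_deriv :: "distr vec \<Rightarrow> distr vec" where
  "vec_deriv x = map_vec dist_deriv x"

definition mat_dist :: "real mat \<Rightarrow> distr vec \<Rightarrow> distr vec" where
  "mat_dist A x = vec (dim_row A) (\<lambda>i \<phi>. \<Sum>j<dim_col A. A $$ (i, j) * (x $ j) \<phi>)"

definition fun_dist_vec :: "nat \<Rightarrow> (real \<Rightarrow> real vec) \<Rightarrow> distr vec" where
  "fun_dist_vec n f = vec n (\<lambda>i. fun_dist (\<lambda>s. f s $ i))"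

section \<open>Linear algebra\<close>

definition vnorm :: "real vec \<Rightarrow> real" where
  "vnorm v = sqrt (v \<bullet> v)"

definition mat_image :: "real mat \<Rightarrow> real vec set" where
  "mat_image A = (\<lambda>v. A *\<^sub>v v) ` carrier_vec (dim_col A)"

definition preimage :: "real mat \<Rightarrow> real vec set \<Rightarrow> real vec set" where
  "preimage A V = {v \<in> carrier_vec (dim_col A). A *\<^sub>v v \<in> V}"

definition orth_compl :: "nat \<Rightarrow> real vec set \<Rightarrow> real vec set" where
  "orth_compl n V = {v \<in> carrier_vec n. \<forall>w\<in>V. v \<bullet> w = 0}"

definition orthonormal_basis_mat :: "nat \<Rightarrow> real mat \<Rightarrow> real vec set \<Rightarrow> bool" where
  "orthonormal_basis_mat n Z V \<longleftrightarrow>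
     dim_row Z = n \<and> transpose_mat Z * Z = 1\<^sub>m (dim_col Z) \<and> mat_image Z = V"

definition hcat :: "real mat \<Rightarrow> real mat \<Rightarrow> real mat" where
  "hcat X Y = mat_of_cols (dim_row X) (cols X @ cols Y)"

definition mat_inv :: "real mat \<Rightarrow> real mat" where
  "mat_inv T = (THE R. inverts_mat T R \<and> inverts_mat R T)"

definition mat_exp :: "real mat \<Rightarrow> real mat" where
  "mat_exp A = mat (dim_row A) (dim_row A) (\<lambda>(i, j). \<Sum>l. (A ^\<^sub>m l) $$ (i, j) / fact l)"

definition nilpotent_mat :: "real mat \<Rightarrow> bool" where
  "nilpotent_mat N \<longleftrightarrow> square_mat N \<and> (\<exists>l. N ^\<^sub>m l = 0\<^sub>m (dim_row N) (dim_row N))"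

section \<open>Switched DAEs\<close>

text \<open>
  \<open>ts\<close> lists the initial time and the switching times; \<open>E k, A k, B k, C k, D k\<close> are the matrices
  of the mode that is active on \<open>[ts k, ts (k + 1))\<close>. Consecutive modes may coincide, so a signal
  with finitely many switches is covered by adding fictitious switching times after the last one.
\<close>

definition switched_dae :: "nat \<Rightarrow> nat \<Rightarrow> nat \<Rightarrow> (nat \<Rightarrow> real) \<Rightarrow>
    (nat \<Rightarrow> real mat) \<Rightarrow> (nat \<Rightarrow> real mat) \<Rightarrow> (nat \<Rightarrow> real mat) \<Rightarrow> (nat \<Rightarrow> real mat) \<Rightarrow>
    (nat \<Rightarrow> real mat) \<Rightarrow> bool" where
  "switched_dae n nu ny ts E A B C D \<longleftrightarrow>
     ts 0 = 0 \<and> strict_mono ts \<and> filterlim ts at_top sequentially \<and>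
     (\<forall>k. E k \<in> carrier_mat n n \<and> A k \<in> carrier_mat n n \<and> B k \<in> carrier_mat n nu \<and>
          C k \<in> carrier_mat ny n \<and> D k \<in> carrier_mat ny nu)"

definition regular_pair :: "real mat \<Rightarrow> real mat \<Rightarrow> bool" where
  "regular_pair E A \<longleftrightarrow> det (map_mat (\<lambda>e. [:0, e:]) E - map_mat (\<lambda>a. [:a:]) A) \<noteq> 0"

definition dae_solution :: "nat \<Rightarrow> nat \<Rightarrow> nat \<Rightarrow> (nat \<Rightarrow> real) \<Rightarrow>
    (nat \<Rightarrow> real mat) \<Rightarrow> (nat \<Rightarrow> real mat) \<Rightarrow> (nat \<Rightarrow> real mat) \<Rightarrow> (nat \<Rightarrow> real mat) \<Rightarrow>
    (nat \<Rightarrow> real mat) \<Rightarrow> real set \<Rightarrow> distr vec \<Rightarrow> distr vec \<Rightarrow> distr vec \<Rightarrow> bool" where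
  "dae_solution n nu ny ts E A B C D I x u y \<longleftrightarrow>
     x \<in> pw_smooth_vecs n \<and> u \<in> pw_smooth_vecs nu \<and> y \<in> pw_smooth_vecs ny \<and>
     (\<forall>k. let J = I \<inter> {ts k..<ts (Suc k)} in
        vec_restrict J (mat_dist (E k) (vec_deriv x)) =
          vec_restrict J (mat_dist (A k) x + mat_dist (B k) u) \<and>
        vec_restrict J y = vec_restrict J (mat_dist (C k) x + mat_dist (D k) u))"

definition class_KL :: "(real \<Rightarrow> real \<Rightarrow> real) \<Rightarrow> bool" where
  "class_KL \<beta> \<longleftrightarrow>
     (\<forall>r\<ge>0. \<forall>t\<ge>0. 0 \<le> \<beta> r t) \<and>
     (\<forall>t\<ge>0. continuous_on {0..} (\<lambda>r. \<beta> r t) \<and> strict_mono_on {0..} (\<lambda>r. \<beta> r t) \<and> \<beta> 0 t = 0) \<and>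
     (\<forall>r\<ge>0. antimono_on {0..} (\<beta> r) \<and> (\<beta> r \<longlongrightarrow> 0) at_top)"

definition interval_detectable :: "nat \<Rightarrow> nat \<Rightarrow> nat \<Rightarrow> (nat \<Rightarrow> real) \<Rightarrow>
    (nat \<Rightarrow> real mat) \<Rightarrow> (nat \<Rightarrow> real mat) \<Rightarrow> (nat \<Rightarrow> real mat) \<Rightarrow> (nat \<Rightarrow> real mat) \<Rightarrow>
    (nat \<Rightarrow> real mat) \<Rightarrow> nat \<Rightarrow> nat \<Rightarrow> (real \<Rightarrow> real \<Rightarrow> real) \<Rightarrow> bool" where
  "interval_detectable n nu ny ts E A B C D p q \<beta> \<longleftrightarrow>
     class_KL \<beta> \<and> (\<forall>r>0. \<beta> r (ts q - ts p) < r) \<and>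
     (\<forall>x. dae_solution n nu ny ts E A B C D {ts p..<ts q} x (0\<^sub>v nu) (0\<^sub>v ny) \<longrightarrow>
        (\<forall>t\<in>{ts p..<ts q}. vnorm (right_value x t) \<le> \<beta> (vnorm (left_value x (ts p))) (t - ts p)))"

section \<open>Matrices of a mode\<close>

definition quasi_weierstrass :: "nat \<Rightarrow> real mat \<Rightarrow> real mat \<Rightarrow> real mat \<Rightarrow> real mat \<Rightarrow> nat \<Rightarrow>
    real mat \<Rightarrow> real mat \<Rightarrow> bool" where
  "quasi_weierstrass n E A S T r J N \<longleftrightarrow>
     S \<in> carrier_mat n n \<and> invertible_mat S \<and> T \<in> carrier_mat n n \<and> invertible_mat T \<and>
     r \<le> n \<and> J \<in> carrier_mat r r \<and> N \<in> carrier_mat (n - r) (n - r) \<and> nilpotent_mat N \<and>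
     S * E * T = four_block_mat (1\<^sub>m r) (0\<^sub>m r (n - r)) (0\<^sub>m (n - r) r) N \<and>
     S * A * T = four_block_mat J (0\<^sub>m r (n - r)) (0\<^sub>m (n - r) r) (1\<^sub>m (n - r))"

text \<open>\<open>P\<close> is the consistency projector, \<open>Ad\<close> and \<open>Ei\<close> the flow and impulse matrices.\<close>

definition mode_matrices :: "nat \<Rightarrow> real mat \<Rightarrow> real mat \<Rightarrow> real mat \<Rightarrow> real mat \<Rightarrow> real mat \<Rightarrow> bool"
  where
  "mode_matrices n E A P Ad Ei \<longleftrightarrow> (\<exists>S T r J N. quasi_weierstrass n E A S T r J N \<and>
     (let m = n - r in
       P = T * four_block_mat (1\<^sub>m r) (0\<^sub>m r m) (0\<^sub>m m r) (0\<^sub>m m m) * mat_inv T \<and>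
       Ad = T * four_block_mat J (0\<^sub>m r m) (0\<^sub>m m r) (0\<^sub>m m m) * mat_inv T \<and>
       Ei = T * four_block_mat (0\<^sub>m r r) (0\<^sub>m r m) (0\<^sub>m m r) N * mat_inv T))"

definition O_diff :: "nat \<Rightarrow> nat \<Rightarrow> real mat \<Rightarrow> real mat \<Rightarrow> real mat \<Rightarrow> real mat" where
  "O_diff n ny C P Ad =
     mat (n * ny) n (\<lambda>(i, j). (C * P * Ad ^\<^sub>m (i div ny)) $$ (i mod ny, j))"

definition O_imp :: "nat \<Rightarrow> nat \<Rightarrow> real mat \<Rightarrow> real mat \<Rightarrow> real mat" where
  "O_imp n ny C Ei =
     mat ((n - 1) * ny) n (\<lambda>(i, j). (C * Ei ^\<^sub>m (i div ny + 1)) $$ (i mod ny, j))"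

definition local_unobs :: "real mat \<Rightarrow> real mat \<Rightarrow> real mat \<Rightarrow> real vec set" where
  "local_unobs P Od Oi = preimage P (mat_kernel Od) \<inter> mat_kernel Oi"

section \<open>Local partial observations\<close>

definition z_diff_fun :: "real mat \<Rightarrow> real mat \<Rightarrow> real \<Rightarrow> real \<Rightarrow> distr vec \<Rightarrow> real \<Rightarrow> real vec" where
  "z_diff_fun Sd Rd a b w = (THE z.
     z \<in> {a<..<b} \<rightarrow>\<^sub>E carrier_vec (dim_row Sd) \<and>
     (\<forall>s\<in>{a<..<b}. \<forall>i<dim_row Sd.
        ((\<lambda>s'. z s' $ i) has_real_derivative (Sd *\<^sub>v z s) $ i) (at s)) \<and>
     vec_restrict {a<..<b} w =
       fun_dist_vec (dim_row Rd) (\<lambda>s. indicator {a<..<b} s \<cdot>\<^sub>v (Rd *\<^sub>v z s)))"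

definition z_diff :: "real mat \<Rightarrow> real mat \<Rightarrow> real \<Rightarrow> real \<Rightarrow> distr vec \<Rightarrow> real vec" where
  "z_diff Sd Rd a b w =
     vec (dim_row Sd) (\<lambda>i. Lim (at_right a) (\<lambda>s. z_diff_fun Sd Rd a b w s $ i))"

text \<open>
  The stacked impulse coefficients of \<open>w\<close> at \<open>a\<close>; the coefficient of the \<open>j\<close>-th derivative of the
  Dirac impulse in the \<open>i\<close>-th component sits at position \<open>j * dim_vec w + i\<close>.
\<close>

definition impulse_coeffs :: "nat \<Rightarrow> real \<Rightarrow> distr vec \<Rightarrow> real vec" where
  "impulse_coeffs n a w = (THE \<eta>. \<eta> \<in> carrier_vec ((n - 1) * dim_vec w) \<and>
     (\<forall>i<dim_vec w. impulse_at (w $ i) a = dirac_comb (n - 1) (\<lambda>j. \<eta> $ (j * dim_vec w + i)) a))"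

definition frak_O :: "nat \<Rightarrow> real mat \<Rightarrow> real mat \<Rightarrow> real mat \<Rightarrow> real mat \<Rightarrow> real mat \<Rightarrow> real mat \<Rightarrow>
    real \<Rightarrow> real \<Rightarrow> distr vec \<Rightarrow> real vec" where
  "frak_O n C P Ad Zd Uobs Uimp a b w =
     (let Sd = transpose_mat Zd * Ad * Zd; Rd = C * P * Zd in
       transpose_mat Uobs *\<^sub>v
         (z_diff Sd Rd a b w @\<^sub>v (transpose_mat Uimp *\<^sub>v impulse_coeffs n a w)))"

section \<open>Combining the local observations\<close>

text \<open>
  In the following definitions \<open>F k\<close> stands for \<open>exp (- A\<^sub>k\<^sup>d\<^sup>i\<^sup>f\<^sup>f \<tau>\<^sub>k)\<close>. For \<open>k < q\<close>, the space
  \<open>\<N>\<^sub>k\<^sup>q\<close> is \<open>unobs_space F P W (q - 1 - k) k\<close> and \<open>\<mu>\<^sub>k\<close> is \<open>mu F M \<Theta> U z (q - 1 - k) k\<close>: the recursion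
  runs over the number of intervals remaining after the \<open>k\<close>-th one.
\<close>

primrec unobs_space :: "(nat \<Rightarrow> real mat) \<Rightarrow> (nat \<Rightarrow> real mat) \<Rightarrow> (nat \<Rightarrow> real vec set) \<Rightarrow>
    nat \<Rightarrow> nat \<Rightarrow> real vec set" where
  "unobs_space F P W 0 k = W k"
| "unobs_space F P W (Suc m) k =
     W k \<inter> preimage (P k) ((\<lambda>v. F k *\<^sub>v v) ` unobs_space F P W m (Suc k))"

primrec mu :: "(nat \<Rightarrow> real mat) \<Rightarrow> (nat \<Rightarrow> real mat) \<Rightarrow> (nat \<Rightarrow> real mat) \<Rightarrow> (nat \<Rightarrow> real mat) \<Rightarrow>
    (nat \<Rightarrow> real vec) \<Rightarrow> nat \<Rightarrow> nat \<Rightarrow> real vec" where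
  "mu F M \<Theta> U z 0 k = z k"
| "mu F M \<Theta> U z (Suc m) k = transpose_mat (U k) *\<^sub>v
     (z k @\<^sub>v (transpose_mat (\<Theta> k) *\<^sub>v (F k *\<^sub>v (M (Suc k) *\<^sub>v mu F M \<Theta> U z m (Suc k)))))"

definition stack :: "nat \<Rightarrow> nat \<Rightarrow> (nat \<Rightarrow> real vec) \<Rightarrow> real vec" where
  "stack p q z = vec_of_list (concat (map (\<lambda>k. list_of_vec (z k)) [p..<q]))"

text \<open>The blocks, of sizes \<open>d p, d (p + 1), \<dots>\<close>, of a stacked vector.\<close>

definition unstack :: "(nat \<Rightarrow> nat) \<Rightarrow> nat \<Rightarrow> real vec \<Rightarrow> nat \<Rightarrow> real vec" where
  "unstack d p v k = vec (d k) (\<lambda>i. v $ ((\<Sum>l=p..<k. d l) + i))"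

definition O_mat :: "nat \<Rightarrow> (nat \<Rightarrow> nat) \<Rightarrow> (nat \<Rightarrow> real mat) \<Rightarrow> (nat \<Rightarrow> real mat) \<Rightarrow>
    (nat \<Rightarrow> real mat) \<Rightarrow> (nat \<Rightarrow> real mat) \<Rightarrow> nat \<Rightarrow> nat \<Rightarrow> real mat" where
  "O_mat n d F M \<Theta> U p q = (let m = (\<Sum>l=p..<q. d l) in
     mat n m (\<lambda>(i, j). (M p *\<^sub>v mu F M \<Theta> U (unstack d p (unit_vec m j)) (q - 1 - p) p) $ i))"

text \<open>With \<open>G k\<close> standing for \<open>exp (A\<^sub>k\<^sup>d\<^sup>i\<^sup>f\<^sup>f \<tau>\<^sub>k)\<close>, \<open>Phi n G P p m\<close> is \<open>\<Phi>\<^sub>p\<^sup>q\<close> with \<open>q = p + m\<close>.\<close>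

primrec Phi :: "nat \<Rightarrow> (nat \<Rightarrow> real mat) \<Rightarrow> (nat \<Rightarrow> real mat) \<Rightarrow> nat \<Rightarrow> nat \<Rightarrow> real mat" where
  "Phi n G P p 0 = 1\<^sub>m n"
| "Phi n G P p (Suc m) = G (p + m) * P (p + m) * Phi n G P p m"

end

(* The error e = xh - x solves the homogeneous switched DAE with output y^e. Multiplying
   E e' = A e by T S splits it into e' = Adiff e with e = Pi e, and a nilpotent part that forces
   e(t_k^+) = Pi_k e(t_k^-) and the impulse coefficients -(Eimp_k)^(j+1) e(t_k^-) at t_k.
   Hence z_k = Z_k^T e(t_k^-), and downward induction gives mu_k = (M_k^q)^T e(t_k^-). So
   n_0 = e(t_p^-) - M_p^q mu_p is the orthogonal projection of e(t_p^-) onto the unobservable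
   space N_p^q. The solution that starts in n_0 has zero output and ends in
   Phi_p^q n_0 = e(t_q^-) - xi; detectability bounds it before t_q, and left continuity of beta
   in time carries the bound over to the left limit. *)

theory Submission
  imports Defs
begin

section \<open>Smooth functions and test functions\<close>

text \<open>The obstacle is that regular parts, impulses and local observer states are all given by
  definite descriptions, and that distributions can be compared only through integrals. Everything
  therefore rests on unique coordinates: a right-continuous regular part together with the
  coefficients of all derivatives of Dirac impulses at all times. Right continuity turns equality
  almost everywhere into equality at every point, so a DAE restricted to an interval becomes a
  family of pointwise linear equations, and linear algebra and linear ODEs remain. Two choices keep
  the algebra elementary: every unobservable space is presented as an orthogonal complement, so that
  its double complement needs no dimension count, and orbits of matrices satisfy linear recurrences,
  so that finitely many powers suffice. Detectability bounds the end value by the length of n_0;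
  Pythagoras and the monotonicity of beta in its first argument replace this length by that of the
  initial error.\<close>

lemma smooth_has_derivative:
  assumes "smooth f"
  shows "(f has_real_derivative deriv f x) (at x)"
proof -
  have "(deriv ^^ 0) f differentiable_on UNIV"
    using assms unfolding smooth_def by blast
  then have "f differentiable at x"
    by (simp add: differentiable_on_def)
  then show ?thesis
    by (simp add: DERIV_deriv_iff_real_differentiable)
qed

lemma smooth_deriv:
  assumes "smooth f"
  shows "smooth (deriv f)"
  using assms unfolding smooth_def by (metis funpow_Suc_right o_apply)

lemma smooth_isCont: "smooth f \<Longrightarrow> isCont f x"
  using DERIV_isCont smooth_has_derivative by blast

lemma smooth_continuous_on: "smooth f \<Longrightarrow> continuous_on S f"
  by (simp add: continuous_at_imp_continuous_on smooth_isCont)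

text \<open>Unfolding the definition would require a formula for every iterate of
  \<open>deriv\<close>. A class closed under differentiation serves as an invariant instead:
  derivatives are unique, so each iterate stays in the class.\<close>

lemma smooth_coinduct:
  assumes "Q f" and step: "\<And>f. Q f \<Longrightarrow> \<exists>f'. Q f' \<and> (\<forall>x. (f has_real_derivative f' x) (at x))"
  shows "smooth f"
proof -
  have Q: "Q ((deriv ^^ k) f)" for k
  proof (induction k)
    case 0
    show ?case using assms(1) by simp
  next
    case (Suc k)
    from step[OF Suc] obtain f' where f': "Q f'"
      "\<forall>x. ((deriv ^^ k) f has_real_derivative f' x) (at x)" by blast
    then have "deriv ((deriv ^^ k) f) = f'"
      by (intro ext DERIV_imp_deriv) simp
    with f' show ?case by simp
  qed
  have "(deriv ^^ k) f differentiable_on UNIV" for k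
    using step[OF Q[of k]]
    by (metis differentiable_at_imp_differentiable_on real_differentiable_def)
  then show ?thesis
    by (simp add: smooth_def)
qed

text \<open>The algebra generated by smooth functions is closed under differentiation, so the
  coinduction rule yields all closure properties at once.\<close>

inductive smooth_alg :: "(real \<Rightarrow> real) \<Rightarrow> bool" where
  base: "smooth f \<Longrightarrow> smooth_alg (\<lambda>x. f (a * x + b))"
| add: "smooth_alg f \<Longrightarrow> smooth_alg g \<Longrightarrow> smooth_alg (\<lambda>x. f x + g x)"
| mult: "smooth_alg f \<Longrightarrow> smooth_alg g \<Longrightarrow> smooth_alg (\<lambda>x. f x * g x)"

lemma smooth_const [simp]: "smooth (\<lambda>_. c)"
  by (rule smooth_coinduct[where Q = "\<lambda>f. \<exists>c. f = (\<lambda>_. c)"]) (auto intro!: exI[of _ "\<lambda>_. 0"])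

lemma smooth_alg_const: "smooth_alg (\<lambda>_. c)"
  using smooth_alg.base[OF smooth_const[of c]] .

lemma smooth_alg_smooth: 
  assumes "smooth_alg f"
  shows "smooth f"
proof (rule smooth_coinduct[where Q = smooth_alg, OF assms])
  fix f assume "smooth_alg f"
  then show "\<exists>f'. smooth_alg f' \<and> (\<forall>x. (f has_real_derivative f' x) (at x))"
  proof induction
    case (base f a b)
    have "smooth_alg (\<lambda>x. a * deriv f (a * x + b))"
      by (rule smooth_alg.mult[OF smooth_alg_const smooth_alg.base]) (rule smooth_deriv[OF base])
    moreover have "((\<lambda>x. f (a * x + b)) has_real_derivative a * deriv f (a * x + b)) (at x)" for x
    proof -
      have "((\<lambda>x. f (a * x + b)) has_real_derivative deriv f (a * x + b) * a) (at x)"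
        by (rule DERIV_chain2[where f = f, OF smooth_has_derivative[OF base]])
          (auto intro!: derivative_eq_intros)
      then show ?thesis by (simp add: mult.commute)
    qed
    ultimately show ?case by blast
  next
    case (add f g)
    then obtain f' g' where "smooth_alg f'" "\<forall>x. (f has_real_derivative f' x) (at x)"
      "smooth_alg g'" "\<forall>x. (g has_real_derivative g' x) (at x)" by blast
    then show ?case
      by (intro exI[of _ "\<lambda>x. f' x + g' x"])
        (auto intro: smooth_alg.add derivative_intros)
  next
    case (mult f g)
    then obtain f' g' where *: "smooth_alg f'" "\<forall>x. (f has_real_derivative f' x) (at x)"
      "smooth_alg g'" "\<forall>x. (g has_real_derivative g' x) (at x)" by blast
    show ?case
      by (rule exI[of _ "\<lambda>x. f' x * g x + g' x * f x"])
        (use * mult.hyps in \<open>auto intro!: smooth_alg.add smooth_alg.mult DERIV_mult'[THEN DERIV_cong]\<close>)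
  qed
qed

lemma smooth_affine: "smooth f \<Longrightarrow> smooth (\<lambda>x. f (a * x + b))"
  by (rule smooth_alg_smooth, erule smooth_alg.base)

lemma smooth_imp_alg:
  assumes "smooth f"
  shows "smooth_alg f"
  using smooth_alg.base[OF assms, of 1 0] by simp

lemma smooth_add: "smooth f \<Longrightarrow> smooth g \<Longrightarrow> smooth (\<lambda>x. f x + g x)"
  by (rule smooth_alg_smooth[OF smooth_alg.add[OF smooth_imp_alg smooth_imp_alg]])

lemma smooth_mult: "smooth f \<Longrightarrow> smooth g \<Longrightarrow> smooth (\<lambda>x. f x * g x)"
  by (rule smooth_alg_smooth[OF smooth_alg.mult[OF smooth_imp_alg smooth_imp_alg]])

lemma smooth_ident: "smooth (\<lambda>x. x)"
proof (rule smooth_coinduct[where Q = "\<lambda>f. f = (\<lambda>x. x) \<or> smooth f"])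
  fix f :: "real \<Rightarrow> real"
  assume "f = (\<lambda>x. x) \<or> smooth f"
  then show "\<exists>f'. (f' = (\<lambda>x. x) \<or> smooth f') \<and> (\<forall>x. (f has_real_derivative f' x) (at x))"
  proof
    assume "f = (\<lambda>x. x)"
    then show ?thesis
      using DERIV_ident smooth_const[of 1] by blast
  next
    assume "smooth f"
    then show ?thesis
      using smooth_deriv smooth_has_derivative by blast
  qed
qed simp

lemma smooth_power: "smooth f \<Longrightarrow> smooth (\<lambda>x. f x ^ k)"
  by (induction k) (auto intro: smooth_mult)

text \<open>Agreement near a point is an open condition: it persists at all nearby points and so
  passes to the derivatives there. Locally smooth functions thus form an invariant class for
  \<open>smooth_coinduct\<close>, which makes it possible to glue germs.\<close>

lemma smooth_locally:
  assumes "\<And>s. \<exists>g. smooth g \<and> (\<forall>\<^sub>F u in nhds s. f u = g u)"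
  shows "smooth f"
proof (rule smooth_coinduct[where Q = "\<lambda>f. \<forall>s. \<exists>g. smooth g \<and> (\<forall>\<^sub>F u in nhds s. f u = g u)"])
  fix f :: "real \<Rightarrow> real"
  assume loc: "\<forall>s. \<exists>g. smooth g \<and> (\<forall>\<^sub>F u in nhds s. f u = g u)"
  have *: "(f has_real_derivative deriv g u) (at u)" if "smooth g" "\<forall>\<^sub>F v in nhds u. f v = g v" for g u
    using that DERIV_cong_ev[of u u f g "deriv g u" "deriv g u"] smooth_has_derivative[of g u] by auto
  show "\<exists>f'. (\<forall>s. \<exists>g. smooth g \<and> (\<forall>\<^sub>F u in nhds s. f' u = g u)) \<and>
      (\<forall>x. (f has_real_derivative f' x) (at x))"
  proof (rule exI[of _ "deriv f"], intro conjI allI)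
    fix s
    from loc obtain g where g: "smooth g" "\<forall>\<^sub>F u in nhds s. f u = g u" by blast
    from g(2) have "\<forall>\<^sub>F u in nhds s. \<forall>\<^sub>F v in nhds u. f v = g v"
      by (simp add: eventually_eventually)
    then have "\<forall>\<^sub>F u in nhds s. deriv f u = deriv g u"
      by (rule eventually_mono) (rule DERIV_imp_deriv[OF *[OF g(1)]])
    with g(1) show "\<exists>g. smooth g \<and> (\<forall>\<^sub>F u in nhds s. deriv f u = g u)"
      by (blast intro: smooth_deriv)
    show "(f has_real_derivative deriv f s) (at s)"
      using *[OF g] DERIV_imp_deriv by metis
  qed
qed (use assms in blast)

section \<open>Bump functions and test functions of prescribed vanishing order\<close>

definition flat :: "real poly \<Rightarrow> real \<Rightarrow> real" where
  "flat p x = (if x > 0 then poly p (1 / x) * exp (- (1 / x)) else 0)"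

lemma poly_times_exp_tendsto_0: "((\<lambda>t. poly p t * exp (- t)) \<longlongrightarrow> (0 :: real)) at_top"
proof -
  have "((\<lambda>t. \<Sum>i\<le>degree p. coeff p i * (t ^ i / exp t)) \<longlongrightarrow> (\<Sum>i\<le>degree p. coeff p i * 0)) at_top"
    by (intro tendsto_intros tendsto_power_div_exp_0)
  then show ?thesis
    by (simp add: poly_altdef sum_distrib_right exp_minus divide_inverse mult.assoc)
qed

text \<open>The polynomial parameter closes the family under differentiation: with t = 1/x, the
  derivative of p(t) exp(-t) is t^2 (p(t) - p'(t)) exp(-t). For p = 1 this is the classical flat
  function exp(-1/x).\<close>

lemma flat_has_derivative:
  "(flat p has_real_derivative flat (monom 1 2 * (p - pderiv p)) x) (at x)"
proof -
  consider "x > 0" | "x < 0" | "x = 0" by linarith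
  then show ?thesis
  proof cases
    case 1
    have "((\<lambda>x. poly p (1 / x) * exp (- (1 / x))) has_real_derivative
        flat (monom 1 2 * (p - pderiv p)) x) (at x)"
    proof -
      have inv: "((\<lambda>x. 1 / x) has_real_derivative - (1 / x\<^sup>2)) (at x)"
        using 1 by (auto intro!: derivative_eq_intros simp: power2_eq_square)
      have "((\<lambda>x. poly p (1 / x) * exp (- (1 / x))) has_real_derivative
          poly p (1 / x) * (exp (- (1 / x)) * - (- (1 / x\<^sup>2))) +
          poly (pderiv p) (1 / x) * (- (1 / x\<^sup>2)) * exp (- (1 / x))) (at x)"
        by (rule DERIV_mult' DERIV_chain2[OF poly_DERIV inv] DERIV_chain2[OF DERIV_exp DERIV_minus[OF inv]])+
      also have "poly p (1 / x) * (exp (- (1 / x)) * - (- (1 / x\<^sup>2))) +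
          poly (pderiv p) (1 / x) * (- (1 / x\<^sup>2)) * exp (- (1 / x)) = flat (monom 1 2 * (p - pderiv p)) x"
        using 1 by (simp add: flat_def poly_monom algebra_simps power_one_over)
      finally show ?thesis .
    qed
    moreover have "\<forall>\<^sub>F y in nhds x. flat p y = poly p (1 / y) * exp (- (1 / y))"
      by (rule eventually_mono[OF order_tendstoD(1)[OF filterlim_ident 1]]) (simp add: flat_def)
    ultimately show ?thesis
      using DERIV_cong_ev[of x x "flat p"] by simp
  next
    case 2
    have "\<forall>\<^sub>F y in nhds x. flat p y = 0"
      by (rule eventually_mono[OF order_tendstoD(2)[OF filterlim_ident 2]]) (simp add: flat_def)
    then have "(flat p has_real_derivative 0) (at x)"
      using DERIV_cong_ev[of x x "flat p" "\<lambda>_. 0" 0 0] by simp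
    then show ?thesis using 2 by (simp add: flat_def)
  next
    case 3
    \<comment> \<open>\<open>pCons 0 p\<close> multiplies p by its argument 1/y, which absorbs the
      denominator of the difference quotient at 0.\<close>
    have "((\<lambda>y. poly (pCons 0 p) (inverse y) * exp (- inverse y)) \<longlongrightarrow> 0) (at_right 0)"
      by (rule filterlim_compose[OF poly_times_exp_tendsto_0 filterlim_inverse_at_top_right])
    then have "((\<lambda>y. flat p y / y) \<longlongrightarrow> 0) (at_right 0)"
      by (rule tendsto_cong[THEN iffD1, rotated])
        (auto simp: eventually_at_right_less flat_def divide_inverse intro!: eventually_at_rightI[of 0 1])
    moreover have "((\<lambda>y. flat p y / y) \<longlongrightarrow> 0) (at_left 0)"
      by (rule tendsto_eventually) (auto simp: flat_def intro!: eventually_at_leftI[of "-1" 0])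
    ultimately have "((\<lambda>y. flat p y / y) \<longlongrightarrow> 0) (at 0)"
      by (simp add: filterlim_at_split)
    then show ?thesis using 3
      by (simp add: has_field_derivative_iff flat_def)
  qed
qed

lemma smooth_flat: "smooth (flat p)"
  by (rule smooth_coinduct[where Q = "\<lambda>f. \<exists>p. f = flat p"]) (use flat_has_derivative in blast)+

definition bump :: "real \<Rightarrow> real \<Rightarrow> real \<Rightarrow> real" where
  "bump a b s = flat 1 (s - a) * flat 1 (b - s)"

lemma smooth_bump: "smooth (bump a b)"
  using smooth_mult[OF smooth_affine[OF smooth_flat[of 1], of 1 "- a"] smooth_affine[OF smooth_flat[of 1], of "- 1" b]]
  by (simp add: bump_def[abs_def])

lemma bump_pos: "a < s \<Longrightarrow> s < b \<Longrightarrow> bump a b s > 0"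
  by (simp add: bump_def flat_def)

lemma bump_zero: "s \<notin> {a<..<b} \<Longrightarrow> bump a b s = 0"
  by (auto simp: bump_def flat_def)

lemma bump_nonneg: "bump a b s \<ge> 0"
  by (simp add: bump_def flat_def)

lemma test_fun_ex:
  assumes "smooth f"
  shows "\<exists>\<phi>. tf \<phi> = (\<lambda>s. f s * bump a b s)"
proof -
  have "{s. f s * bump a b s \<noteq> 0} \<subseteq> {a<..<b}"
    by (intro subsetI, rule ccontr) (simp add: bump_zero)
  then have "bounded {s. f s * bump a b s \<noteq> 0}"
    by (rule bounded_subset[rotated]) (rule bounded_subset[OF bounded_closed_interval[of a b]], auto)
  then have "(\<lambda>s. f s * bump a b s) \<in> {\<phi>. smooth \<phi> \<and> bounded {s. \<phi> s \<noteq> 0}}"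
    using smooth_mult[OF assms smooth_bump] by simp
  then show ?thesis
    using Abs_test_fun_inverse by blast
qed

lemma smooth_tf: "smooth (tf \<phi>)"
  using tf[of \<phi>] by simp

lemma deriv_funpow_eq_0:
  assumes "open U" "\<And>s. s \<in> U \<Longrightarrow> f s = 0" "s \<in> U"
  shows "(deriv ^^ k) f s = (0 :: real)"
  using assms(3)
proof (induction k arbitrary: s)
  case (Suc k)
  have "\<forall>\<^sub>F u in nhds s. (deriv ^^ k) f u = 0"
    using Suc by (auto simp: eventually_nhds intro!: exI[of _ U] assms(1))
  then have "deriv ((deriv ^^ k) f) s = deriv (\<lambda>_. 0) s"
    by (rule deriv_cong_ev) simp
  then show ?case by simp
qed (simp add: assms(2))

text \<open>Every differentiation costs one factor s - t and leaves a smooth cofactor. Its value at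
  t is tracked because for m > 0 the derivative vanishes at t, whereas for m = 0 it is a nonzero
  multiple of \<open>g t\<close>.\<close>

lemma deriv_funpow_mult_power:
  assumes "smooth g"
  shows "\<exists>h. smooth h \<and> (\<forall>s. (deriv ^^ j) (\<lambda>s. (s - t) ^ (j + m) * g s) s = (s - t) ^ m * h s) \<and>
    h t = (\<Prod>i=1..j. real (m + i)) * g t"
  using assms
proof (induction j arbitrary: g)
  case 0
  then show ?case by (auto intro!: exI[of _ g])
next
  case (Suc j)
  define g1 where "g1 s = real (Suc j + m) * g s + (s - t) * deriv g s" for s
  have s1: "smooth (\<lambda>s. s - t)"
    using smooth_affine[OF smooth_ident, of 1 "- t"] by simp
  have g1: "smooth g1"
    unfolding g1_def using Suc.prems s1
    by (intro smooth_add smooth_mult smooth_deriv) auto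
  have d: "deriv (\<lambda>s. (s - t) ^ (Suc j + m) * g s) = (\<lambda>s. (s - t) ^ (j + m) * g1 s)"
  proof (rule ext, rule DERIV_imp_deriv)
    fix s
    show "((\<lambda>s. (s - t) ^ (Suc j + m) * g s) has_real_derivative (s - t) ^ (j + m) * g1 s) (at s)"
      by (rule derivative_eq_intros smooth_has_derivative[OF Suc.prems] refl)+
        (simp add: g1_def algebra_simps)
  qed
  from Suc.IH[OF g1] obtain h where h: "smooth h"
    "\<forall>s. (deriv ^^ j) (\<lambda>s. (s - t) ^ (j + m) * g1 s) s = (s - t) ^ m * h s"
    "h t = (\<Prod>i=1..j. real (m + i)) * g1 t" by blast
  have "(deriv ^^ Suc j) (\<lambda>s. (s - t) ^ (Suc j + m) * g s) = (deriv ^^ j) (\<lambda>s. (s - t) ^ (j + m) * g1 s)"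
    using d by (simp only: funpow_Suc_right o_apply)
  with h show ?case
    by (intro exI[of _ h]) (simp add: g1_def prod.nat_ivl_Suc' algebra_simps)
qed

text \<open>Such a test function detects the leading coefficient of an impulse: if l is the highest
  order present at t, the lower orders are annihilated and only the top one survives. A small
  support keeps other impulses out.\<close>

lemma test_fun_order_ex:
  assumes "a < t" "t < b"
  shows "\<exists>\<phi>. (\<forall>s. s \<notin> {a<..<b} \<longrightarrow> tf \<phi> s = 0) \<and> (\<forall>j<l. (deriv ^^ j) (tf \<phi>) t = 0) \<and>
    (deriv ^^ l) (tf \<phi>) t \<noteq> 0"
proof -
  have "smooth (\<lambda>s. (s - t) ^ l)"
    using smooth_power[OF smooth_affine[OF smooth_ident, of 1 "- t"]] by simp
  then obtain \<phi> where \<phi>: "tf \<phi> = (\<lambda>s. (s - t) ^ l * bump a b s)"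
    using test_fun_ex by blast
  have "(deriv ^^ j) (tf \<phi>) t = 0" if "j < l" for j
  proof -
    from that have "l = j + (l - j)" by simp
    with deriv_funpow_mult_power[OF smooth_bump[of a b], of j t "l - j"] that
    show ?thesis by (auto simp: \<phi>)
  qed
  moreover have "(deriv ^^ l) (tf \<phi>) t \<noteq> 0"
  proof -
    have "(\<Prod>i=1..l. real i) \<noteq> 0"
      by simp
    then show ?thesis
    using deriv_funpow_mult_power[OF smooth_bump[of a b], of l t 0] bump_pos[OF assms]
    by (auto simp: \<phi>)
  qed
  ultimately show ?thesis
    by (intro exI[of _ \<phi>]) (auto simp: \<phi> bump_zero)
qed

section \<open>Piecewise smooth functions\<close>

lemma eventually_nhds_split:
  fixes s :: real
  shows "eventually Q (nhds s) \<longleftrightarrow> eventually Q (at_left s) \<and> eventually Q (at_right s) \<and> Q s"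
  by (auto simp: eventually_nhds_conv_at eventually_at_split)

text \<open>One-sided punctured neighbourhoods of s are open intervals, so a germ given to the right
  of s is a full germ at every nearby point.\<close>

lemma eventually_at_right_nhds:
  fixes s :: real
  assumes "eventually Q (at_right s)"
  shows "\<forall>\<^sub>F u in at_right s. eventually Q (nhds u)"
proof -
  from assms obtain b where "b > s" "\<And>y. s < y \<Longrightarrow> y < b \<Longrightarrow> Q y"
    by (auto simp: eventually_at_right_field)
  then show ?thesis
    unfolding eventually_at_right_field
    by (intro exI[of _ b]) (auto simp: eventually_nhds intro!: exI[of _ "{s<..<b}"])
qed

lemma eventually_at_left_nhds:
  fixes s :: real
  assumes "eventually Q (at_left s)"
  shows "\<forall>\<^sub>F u in at_left s. eventually Q (nhds u)"
proof -
  from assms obtain b where "b < s" "\<And>y. b < y \<Longrightarrow> y < s \<Longrightarrow> Q y"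
    by (auto simp: eventually_at_left_field)
  then show ?thesis
    unfolding eventually_at_left_field
    by (intro exI[of _ b]) (auto simp: eventually_nhds intro!: exI[of _ "{b<..<s}"])
qed

text \<open>By compactness, infinitely many exceptions in a closed interval would accumulate. Local
  finiteness can thus be stated through the filter \<open>at s\<close>, in which form it propagates
  easily.\<close>

lemma finite_exceptions:
  fixes a b :: real
  assumes "\<And>s. \<forall>\<^sub>F u in at s. Q u"
  shows "finite ({a..b} \<inter> {u. \<not> Q u})"
proof (rule finite_not_islimpt_in_compact)
  fix s :: real
  from assms[of s] show "\<not> s islimpt {u. \<not> Q u}"
    by (simp add: islimpt_iff_eventually)
qed simp

text \<open>A local characterization of \<^const>\<open>pw_smooth_fun\<close>, under which closure properties need no
  common refinement of the break points.\<close>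

definition pws :: "(real \<Rightarrow> real) \<Rightarrow> bool" where
  "pws f \<longleftrightarrow> (\<forall>s. (\<exists>g. smooth g \<and> (\<forall>\<^sub>F u in at_left s. f u = g u)) \<and>
     (\<exists>g. smooth g \<and> f s = g s \<and> (\<forall>\<^sub>F u in at_right s. f u = g u)))"

definition smooth_near :: "(real \<Rightarrow> real) \<Rightarrow> real \<Rightarrow> bool" where
  "smooth_near f s \<longleftrightarrow> (\<exists>g. smooth g \<and> (\<forall>\<^sub>F u in nhds s. f u = g u))"

lemma pws_leftE:
  assumes "pws f"
  obtains g where "smooth g" "\<forall>\<^sub>F u in at_left s. f u = g u"
  using assms unfolding pws_def by blast

lemma pws_rightE:
  assumes "pws f"
  obtains g where "smooth g" "f s = g s" "\<forall>\<^sub>F u in at_right s. f u = g u"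
  using assms unfolding pws_def by blast

lemma smooth_imp_pws: "smooth f \<Longrightarrow> pws f"
  unfolding pws_def by (auto intro!: exI[of _ f])

lemma pws_add:
  assumes "pws f" "pws g"
  shows "pws (\<lambda>s. f s + g s)"
  unfolding pws_def
proof (intro allI conjI)
  fix s
  obtain f1 g1 where *: "smooth f1" "\<forall>\<^sub>F u in at_left s. f u = f1 u"
    "smooth g1" "\<forall>\<^sub>F u in at_left s. g u = g1 u"
    by (rule pws_leftE[OF assms(1)], rule pws_leftE[OF assms(2)])
  from *(2,4) have "\<forall>\<^sub>F u in at_left s. f u + g u = f1 u + g1 u"
    by eventually_elim simp
  with * show "\<exists>h. smooth h \<and> (\<forall>\<^sub>F u in at_left s. f u + g u = h u)"
    using smooth_add by blast
  obtain f1 g1 where *: "smooth f1" "f s = f1 s" "\<forall>\<^sub>F u in at_right s. f u = f1 u"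
    "smooth g1" "g s = g1 s" "\<forall>\<^sub>F u in at_right s. g u = g1 u"
    by (rule pws_rightE[OF assms(1)], rule pws_rightE[OF assms(2)])
  from *(3,6) have "\<forall>\<^sub>F u in at_right s. f u + g u = f1 u + g1 u"
    by eventually_elim simp
  with * show "\<exists>h. smooth h \<and> f s + g s = h s \<and> (\<forall>\<^sub>F u in at_right s. f u + g u = h u)"
    by (intro exI[of _ "\<lambda>u. f1 u + g1 u"]) (auto intro: smooth_add)
qed

lemma pws_mult:
  assumes "pws f" "pws g"
  shows "pws (\<lambda>s. f s * g s)"
  unfolding pws_def
proof (intro allI conjI)
  fix s
  obtain f1 g1 where *: "smooth f1" "\<forall>\<^sub>F u in at_left s. f u = f1 u"
    "smooth g1" "\<forall>\<^sub>F u in at_left s. g u = g1 u"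
    by (rule pws_leftE[OF assms(1)], rule pws_leftE[OF assms(2)])
  from *(2,4) have "\<forall>\<^sub>F u in at_left s. f u * g u = f1 u * g1 u"
    by eventually_elim simp
  with * show "\<exists>h. smooth h \<and> (\<forall>\<^sub>F u in at_left s. f u * g u = h u)"
    using smooth_mult by blast
  obtain f1 g1 where *: "smooth f1" "f s = f1 s" "\<forall>\<^sub>F u in at_right s. f u = f1 u"
    "smooth g1" "g s = g1 s" "\<forall>\<^sub>F u in at_right s. g u = g1 u"
    by (rule pws_rightE[OF assms(1)], rule pws_rightE[OF assms(2)])
  from *(3,6) have "\<forall>\<^sub>F u in at_right s. f u * g u = f1 u * g1 u"
    by eventually_elim simp
  with * show "\<exists>h. smooth h \<and> f s * g s = h s \<and> (\<forall>\<^sub>F u in at_right s. f u * g u = h u)"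
    by (intro exI[of _ "\<lambda>u. f1 u * g1 u"]) (auto intro: smooth_mult)
qed

lemma pws_const: "pws (\<lambda>_. c)"
  by (rule smooth_imp_pws[OF smooth_const])

lemma pws_indicator: "pws (indicator {a..<b})"
  unfolding pws_def
proof (intro allI conjI)
  fix s
  have "\<exists>c. \<forall>\<^sub>F u in at_left s. indicator {a..<b} u = (c :: real)"
  proof (cases "a < s \<and> s \<le> b")
    case True
    then have "\<forall>\<^sub>F u in at_left s. indicator {a..<b} u = (1 :: real)"
      unfolding eventually_at_left_field by (intro exI[of _ a]) auto
    then show ?thesis by blast
  next
    case False
    then have "\<forall>\<^sub>F u in at_left s. indicator {a..<b} u = (0 :: real)"
      unfolding eventually_at_left_field
      by (intro exI[of _ "if s \<le> a then s - 1 else b"]) auto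
    then show ?thesis by blast
  qed
  then show "\<exists>g. smooth g \<and> (\<forall>\<^sub>F u in at_left s. indicator {a..<b} u = g u)"
    using smooth_const by blast
  have "\<forall>\<^sub>F u in at_right s. indicator {a..<b} u = (indicator {a..<b} s :: real)"
  proof (cases "a \<le> s \<and> s < b")
    case True
    then show ?thesis
      unfolding eventually_at_right_field by (intro exI[of _ b]) auto
  next
    case False
    then show ?thesis
      unfolding eventually_at_right_field
      by (intro exI[of _ "if b \<le> s then s + 1 else a"]) auto
  qed
  then show "\<exists>g. smooth g \<and> indicator {a..<b} s = g s \<and> (\<forall>\<^sub>F u in at_right s. indicator {a..<b} u = g u)"
    using smooth_const by blast
qed

lemma pws_eventually_smooth_near:
  assumes "pws f"
  shows "\<forall>\<^sub>F u in at s. smooth_near f u"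
proof -
  obtain g where "smooth g" "\<forall>\<^sub>F u in at_left s. f u = g u"
    using assms by (rule pws_leftE)
  then have "\<forall>\<^sub>F u in at_left s. smooth_near f u"
    unfolding smooth_near_def by (auto intro: eventually_mono[OF eventually_at_left_nhds])
  moreover obtain g where "smooth g" "\<forall>\<^sub>F u in at_right s. f u = g u"
    using assms by (rule pws_rightE)
  then have "\<forall>\<^sub>F u in at_right s. smooth_near f u"
    unfolding smooth_near_def by (auto intro: eventually_mono[OF eventually_at_right_nhds])
  ultimately show ?thesis
    by (simp add: eventually_at_split)
qed

lemma pws_finite_breaks: "pws f \<Longrightarrow> finite ({a..b} \<inter> {u. \<not> smooth_near f u})"
  by (rule finite_exceptions) (rule pws_eventually_smooth_near)

text \<open>Smoothness inside the open interval says nothing about the behaviour at its ends. The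
  one-sided germs there extend f to the line: the right germ at a continues it to the left of a, the
  left germ at b to the right of b.\<close>

lemma pws_piece:
  assumes f: "pws f" and ab: "a < b" and good: "\<And>s. a < s \<Longrightarrow> s < b \<Longrightarrow> smooth_near f s"
  shows "\<exists>g. smooth g \<and> (\<forall>s\<in>{a..<b}. f s = g s)"
proof -
  obtain g1 where g1: "smooth g1" "f a = g1 a" "\<forall>\<^sub>F u in at_right a. f u = g1 u"
    using f by (rule pws_rightE)
  obtain g2 where g2: "smooth g2" "\<forall>\<^sub>F u in at_left b. f u = g2 u"
    using f by (rule pws_leftE)
  define h where "h s = (if s \<le> a then g1 s else if s < b then f s else g2 s)" for s
  have "smooth h"
  proof (rule smooth_locally)
    fix s
    consider "s < a" | "s = a" | "a < s" "s < b" | "s = b" | "s > b" by linarith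
    then show "\<exists>g. smooth g \<and> (\<forall>\<^sub>F u in nhds s. h u = g u)"
    proof cases
      case 1
      then have "\<forall>\<^sub>F u in nhds s. h u = g1 u"
        by (auto simp: eventually_nhds h_def intro!: exI[of _ "{..<a}"])
      with g1 show ?thesis by blast
    next
      case 2
      have "\<forall>\<^sub>F u in at_right a. a < u \<and> u < b"
        using ab by (auto simp: eventually_at_right_field)
      with g1(3) have "\<forall>\<^sub>F u in at_right a. h u = g1 u"
        by eventually_elim (simp add: h_def)
      moreover have "\<forall>\<^sub>F u in at_left a. h u = g1 u"
        by (auto simp: eventually_at_left_field h_def intro!: exI[of _ "a - 1"])
      ultimately have "\<forall>\<^sub>F u in nhds s. h u = g1 u"
        using 2 by (simp add: eventually_nhds_split h_def)
      with g1 show ?thesis by blast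
    next
      case 3
      from good[OF 3] obtain g where g: "smooth g" "\<forall>\<^sub>F u in nhds s. f u = g u"
        unfolding smooth_near_def by blast
      have "\<forall>\<^sub>F u in nhds s. u \<in> {a<..<b}"
        using 3 by (intro eventually_nhds_in_open) auto
      with g(2) have "\<forall>\<^sub>F u in nhds s. h u = g u"
        by eventually_elim (simp add: h_def)
      with g show ?thesis by blast
    next
      case 4
      have "\<forall>\<^sub>F u in at_left b. a < u \<and> u < b"
        using ab by (auto simp: eventually_at_left_field)
      with g2(2) have "\<forall>\<^sub>F u in at_left b. h u = g2 u"
        by eventually_elim (simp add: h_def)
      moreover have "\<forall>\<^sub>F u in at_right b. h u = g2 u"
        using ab by (auto simp: eventually_at_right_field h_def intro!: exI[of _ "b + 1"])
      ultimately have "\<forall>\<^sub>F u in nhds s. h u = g2 u"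
        using 4 ab by (simp add: eventually_nhds_split h_def)
      with g2 show ?thesis by blast
    next
      case 5
      then have "\<forall>\<^sub>F u in nhds s. h u = g2 u"
        using ab by (auto simp: eventually_nhds h_def intro!: exI[of _ "{b<..}"])
      with g2 show ?thesis by blast
    qed
  qed
  moreover have "f s = h s" if "s \<in> {a..<b}" for s
    using that g1(2) by (auto simp: h_def)
  ultimately show ?thesis by blast
qed

text \<open>With the integers in T, every point has a successor and a predecessor in T within
  distance 1, so that the minimum and the maximum range over finite nonempty sets. Iterating the two
  maps from 0 indexes the enumeration by the integers.\<close>

lemma locally_finite_enumeration:
  fixes T :: "real set"
  assumes fin: "\<And>a b. finite ({a..b} \<inter> T)" and ints: "\<int> \<subseteq> T"
  shows "\<exists>r :: int \<Rightarrow> real. strict_mono r \<and> filterlim r at_top at_top \<and> filterlim r at_bot at_bot \<and>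
    (\<forall>i s. r i < s \<longrightarrow> s < r (i + 1) \<longrightarrow> s \<notin> T)"
proof -
  define nxt where "nxt s = Min (T \<inter> {s<..of_int \<lfloor>s\<rfloor> + 1})" for s
  define prv where "prv s = Max (T \<inter> {of_int \<lceil>s\<rceil> - 1..<s})" for s
  have nxt: "nxt s \<in> T \<and> s < nxt s \<and> (\<forall>t. s < t \<longrightarrow> t < nxt s \<longrightarrow> t \<notin> T)" for s
  proof -
    have fn: "finite (T \<inter> {s<..of_int \<lfloor>s\<rfloor> + 1})"
      by (rule finite_subset[OF _ fin[of s "of_int \<lfloor>s\<rfloor> + 1"]]) auto
    have "of_int (\<lfloor>s\<rfloor> + 1) \<in> T"
      using ints Ints_of_int by (rule subsetD)
    then have ne: "of_int \<lfloor>s\<rfloor> + 1 \<in> T \<inter> {s<..of_int \<lfloor>s\<rfloor> + 1}"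
      by (simp add: of_int_add)
    then have "nxt s \<in> T \<inter> {s<..of_int \<lfloor>s\<rfloor> + 1}"
      unfolding nxt_def by (intro Min_in fn) auto
    moreover have "t \<notin> T" if "s < t" "t < nxt s" for t
    proof
      assume "t \<in> T"
      with that \<open>nxt s \<in> _\<close> have "t \<in> T \<inter> {s<..of_int \<lfloor>s\<rfloor> + 1}" by auto
      then have "nxt s \<le> t" unfolding nxt_def by (rule Min_le[OF fn])
      with that show False by simp
    qed
    ultimately show ?thesis by auto
  qed
  have prv: "prv s \<in> T \<and> prv s < s \<and> (\<forall>t. prv s < t \<longrightarrow> t < s \<longrightarrow> t \<notin> T)" for s
  proof -
    have fn: "finite (T \<inter> {of_int \<lceil>s\<rceil> - 1..<s})"
      by (rule finite_subset[OF _ fin[of "of_int \<lceil>s\<rceil> - 1" s]]) auto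
    have "of_int (\<lceil>s\<rceil> - 1) \<in> T"
      using ints Ints_of_int by (rule subsetD)
    then have ne: "of_int \<lceil>s\<rceil> - 1 \<in> T \<inter> {of_int \<lceil>s\<rceil> - 1..<s}"
      by (simp add: of_int_diff) linarith
    then have "prv s \<in> T \<inter> {of_int \<lceil>s\<rceil> - 1..<s}"
      unfolding prv_def by (intro Max_in fn) auto
    moreover have "t \<notin> T" if "prv s < t" "t < s" for t
    proof
      assume "t \<in> T"
      with that \<open>prv s \<in> _\<close> have "t \<in> T \<inter> {of_int \<lceil>s\<rceil> - 1..<s}" by auto
      then have "t \<le> prv s" unfolding prv_def by (rule Max_ge[OF fn])
      with that show False by simp
    qed
    ultimately show ?thesis by auto
  qed
  define r where "r i = (if i \<ge> 0 then (nxt ^^ nat i) 0 else (prv ^^ nat (- i)) 0)" for i :: int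
  have r: "r i \<in> T \<and> r i < r (i + 1) \<and> (\<forall>t. r i < t \<longrightarrow> t < r (i + 1) \<longrightarrow> t \<notin> T)" for i
  proof (cases "i \<ge> 0")
    case True
    then have "r (i + 1) = nxt (r i)"
      by (simp add: r_def nat_add_distrib)
    moreover have "r i \<in> T"
    proof (cases "nat i")
      case 0
      with True have "r i = of_int 0" by (simp add: r_def)
      then show ?thesis using ints by (metis Ints_of_int subsetD)
    next
      case (Suc k)
      with True nxt show ?thesis by (simp add: r_def)
    qed
    ultimately show ?thesis using nxt by simp
  next
    case False
    then have "nat (- i) = Suc (nat (- (i + 1)))" by simp
    then have "r i = prv (r (i + 1))"
      using False by (auto simp: r_def not_le)
    then show ?thesis using prv by simp
  qed
  have step: "r i < r (i + 1 + int k)" for i k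
  proof (induction k)
    case (Suc k)
    with r[of "i + 1 + int k"] show ?case by (simp add: algebra_simps)
  qed (simp add: r)
  have sm: "strict_mono r"
  proof (rule strict_monoI)
    fix i j :: int assume "i < j"
    with step[of i "nat (j - i - 1)"] show "r i < r j" by simp
  qed
  have inj: "inj_on r A" for A
    using sm by (simp add: strict_mono_on_imp_inj_on strict_mono_imp_inj_on inj_on_subset)
  \<comment> \<open>A bounded strictly increasing sequence would put infinitely many members of T
    into one compact interval.\<close>
  have top: "\<exists>i. c < r i" for c
  proof (rule ccontr)
    assume "\<nexists>i. c < r i"
    then have "r ` {0..} \<subseteq> {r 0..c} \<inter> T"
      using r sm by (auto simp: not_less strict_mono_less_eq)
    then have "finite (r ` {0..})"
      using finite_subset fin by blast
    then show False
      using finite_imageD[OF _ inj] infinite_Ici by blast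
  qed
  have bot: "\<exists>i. r i < c" for c
  proof (rule ccontr)
    assume "\<nexists>i. r i < c"
    then have "r ` {..0} \<subseteq> {c..r 0} \<inter> T"
      using r sm by (auto simp: not_less strict_mono_less_eq)
    then have "finite (r ` {..0})"
      using finite_subset fin by blast
    then show False
      using finite_imageD[OF _ inj] infinite_Iic by blast
  qed
  have "filterlim r at_top at_top"
    unfolding filterlim_at_top eventually_at_top_linorder
  proof
    fix c
    obtain i where "c < r i" using top by blast
    then show "\<exists>N. \<forall>n\<ge>N. c \<le> r n"
      using strict_mono_less_eq[OF sm, of i] by (intro exI[of _ i]) force
  qed
  moreover have "filterlim r at_bot at_bot"
    unfolding filterlim_at_bot eventually_at_bot_linorder
  proof
    fix c
    obtain i where "r i < c" using bot by blast
    then show "\<exists>N. \<forall>n\<le>N. r n \<le> c"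
      using strict_mono_less_eq[OF sm, of _ i] by (intro exI[of _ i]) force
  qed
  ultimately show ?thesis
    using sm r by (intro exI[of _ r] conjI) auto
qed

lemma pw_smooth_fun_iff_pws: "pw_smooth_fun f \<longleftrightarrow> pws f"
proof
  assume "pw_smooth_fun f"
  then obtain r :: "int \<Rightarrow> real" and g where r: "strict_mono r" "filterlim r at_top at_top"
    "filterlim r at_bot at_bot"
    and g: "\<And>i. smooth (g i)" "\<And>i s. s \<in> {r i..<r (i + 1)} \<Longrightarrow> f s = g i s"
    unfolding pw_smooth_fun_def by blast
  show "pws f"
    unfolding pws_def
  proof
    fix s
    obtain i0 where i0: "r i0 \<le> s"
      using r(3) unfolding filterlim_at_bot eventually_at_bot_linorder by blast
    obtain i1 where i1: "s + 1 \<le> r i1"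
      using r(2) unfolding filterlim_at_top eventually_at_top_linorder by blast
    \<comment> \<open>The piece containing s has the largest index i with r i \<le> s. The cut-off
      i0 and the bound i1 make the index set nonempty and finite.\<close>
    define I where "I = {i. i0 \<le> i \<and> r i \<le> s}"
    have "I \<subseteq> {i0..i1}"
    proof
      fix i assume "i \<in> I"
      then have "i0 \<le> i" "r i < r i1" using i1 by (auto simp: I_def)
      then show "i \<in> {i0..i1}" using r(1) by (simp add: strict_mono_less)
    qed
    then have finI: "finite I" by (rule finite_subset) simp
    have "i0 \<in> I" using i0 by (simp add: I_def)
    define i where "i = Max I"
    have "i \<in> I" using Max_in[OF finI] \<open>i0 \<in> I\<close> by (auto simp: i_def)
    have "i + 1 \<notin> I" using Max_ge[OF finI, of "i + 1"] by (auto simp: i_def)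
    with \<open>i \<in> I\<close> have s: "r i \<le> s" "s < r (i + 1)" by (auto simp: I_def)
    \<comment> \<open>At a break point the left germ comes from the preceding piece.\<close>
    have left: "\<forall>\<^sub>F u in at_left s. f u = g (if s = r i then i - 1 else i) u"
    proof (cases "s = r i")
      case True
      have "r (i - 1) < s" using r(1) True by (simp add: strict_mono_less)
      then show ?thesis
        using True g(2)[of _ "i - 1"]
        by (auto simp: eventually_at_left_field intro!: exI[of _ "r (i - 1)"])
    next
      case False
      then show ?thesis
        using s g(2)[of _ i] by (auto simp: eventually_at_left_field intro!: exI[of _ "r i"])
    qed
    have right: "\<forall>\<^sub>F u in at_right s. f u = g i u"
      using s g(2)[of _ i] by (auto simp: eventually_at_right_field intro!: exI[of _ "r (i + 1)"])
    show "(\<exists>g. smooth g \<and> (\<forall>\<^sub>F u in at_left s. f u = g u)) \<and>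
        (\<exists>g. smooth g \<and> f s = g s \<and> (\<forall>\<^sub>F u in at_right s. f u = g u))"
      using left right g(1) g(2)[of s i] s by auto
  qed
next
  assume f: "pws f"
  \<comment> \<open>The integers join the break points to meet the requirement of the enumeration;
    pieces may be cut further without harm.\<close>
  have fin: "finite ({a..b} \<inter> ({u. \<not> smooth_near f u} \<union> \<int>))" for a b :: real
  proof -
    have "\<int> \<inter> {a..b} \<subseteq> of_int ` {\<lfloor>a\<rfloor>..\<lceil>b\<rceil>}"
      by (auto elim!: Ints_cases intro!: imageI simp: floor_le_iff le_ceiling_iff)
    then have "finite (\<int> \<inter> {a..b})"
      by (rule finite_subset) simp
    then show ?thesis
      using pws_finite_breaks[OF f, of a b] by (simp add: Int_Un_distrib Int_commute)
  qed
  have ints: "\<int> \<subseteq> {u. \<not> smooth_near f u} \<union> \<int>"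
    by simp
  obtain r :: "int \<Rightarrow> real" where r: "strict_mono r" "filterlim r at_top at_top" "filterlim r at_bot at_bot"
    "\<forall>i s. r i < s \<longrightarrow> s < r (i + 1) \<longrightarrow> s \<notin> {u. \<not> smooth_near f u} \<union> \<int>"
    using locally_finite_enumeration[OF fin ints] by (elim exE conjE) (rule that)
  have "\<exists>g. smooth g \<and> (\<forall>s\<in>{r i..<r (i + 1)}. f s = g s)" for i
    using r by (intro pws_piece[OF f]) (auto simp: strict_mono_less)
  then obtain g where "\<And>i. smooth (g i) \<and> (\<forall>s\<in>{r i..<r (i + 1)}. f s = g i s)"
    by metis
  with r(1-3) show "pw_smooth_fun f"
    unfolding pw_smooth_fun_def by (intro exI[of _ r] exI[of _ g] conjI allI) simp_all
qed

section \<open>One-sided limits and right derivatives\<close>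

definition left_limit :: "(real \<Rightarrow> real) \<Rightarrow> real \<Rightarrow> real" where
  "left_limit f s = Lim (at_left s) f"

text \<open>At a break point \<open>deriv\<close> is of no use, whereas the one-sided quotient
  yields the right limit of the derivative. The result is again a right-continuous representative,
  hence the regular part of the distributional derivative with no exceptional points.\<close>

definition right_deriv :: "(real \<Rightarrow> real) \<Rightarrow> real \<Rightarrow> real" where
  "right_deriv f s = Lim (at_right s) (\<lambda>u. (f u - f s) / (u - s))"

lemma smooth_tendsto: "smooth g \<Longrightarrow> (g \<longlongrightarrow> g s) (at s within S)"
  by (metis isCont_def smooth_isCont subset_UNIV tendsto_within_subset)

lemma left_limit_eqI: "(f \<longlongrightarrow> l) (at_left s) \<Longrightarrow> left_limit f s = l"
  unfolding left_limit_def by (rule tendsto_Lim) simp_all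

lemma pws_tendsto_left:
  assumes "pws f"
  shows "(f \<longlongrightarrow> left_limit f s) (at_left s)"
proof -
  obtain g where g: "smooth g" "\<forall>\<^sub>F u in at_left s. f u = g u"
    using assms by (rule pws_leftE)
  then have "(f \<longlongrightarrow> g s) (at_left s)"
    using smooth_tendsto[OF g(1), of s] by (simp add: tendsto_cong)
  then show ?thesis
    using left_limit_eqI[of f "g s" s] by simp
qed

lemma pws_tendsto_right:
  assumes "pws f"
  shows "(f \<longlongrightarrow> f s) (at_right s)"
proof -
  obtain g where g: "smooth g" "f s = g s" "\<forall>\<^sub>F u in at_right s. f u = g u"
    using assms by (rule pws_rightE)
  then show ?thesis
    using smooth_tendsto[OF g(1), of s] by (simp add: tendsto_cong)
qed

lemma right_deriv_eqI:
  "(f has_real_derivative d) (at s within {s<..}) \<Longrightarrow> right_deriv f s = d"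
  unfolding right_deriv_def has_field_derivative_iff by (rule tendsto_Lim) simp_all

lemma has_right_derivative_cong:
  assumes "smooth g" "f s = g s" "\<forall>\<^sub>F u in at_right s. f u = g u"
  shows "(f has_real_derivative deriv g s) (at s within {s<..})"
proof -
  have "(g has_real_derivative deriv g s) (at s within {s<..})"
    by (rule has_field_derivative_at_within) (rule smooth_has_derivative[OF assms(1)])
  moreover have "\<forall>\<^sub>F u in at_right s. (f u - f s) / (u - s) = (g u - g s) / (u - s)"
    using assms(3) by eventually_elim (simp add: assms(2))
  ultimately show ?thesis
    unfolding has_field_derivative_iff by (subst tendsto_cong)
qed

lemma pws_has_right_deriv:
  assumes "pws f"
  shows "(f has_real_derivative right_deriv f s) (at s within {s<..})"
proof -
  obtain g where g: "smooth g" "f s = g s" "\<forall>\<^sub>F u in at_right s. f u = g u"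
    using assms by (rule pws_rightE)
  from has_right_derivative_cong[OF this] show ?thesis
    using right_deriv_eqI[of f "deriv g s" s] by simp
qed

lemma right_deriv_smooth_near:
  assumes "smooth g" "\<forall>\<^sub>F u in nhds s. f u = g u"
  shows "right_deriv f s = deriv g s" "(f has_real_derivative right_deriv f s) (at s)"
proof -
  show *: "right_deriv f s = deriv g s"
    using assms by (intro right_deriv_eqI has_right_derivative_cong) (auto simp: eventually_nhds_split)
  show "(f has_real_derivative right_deriv f s) (at s)"
    unfolding * using smooth_has_derivative[OF assms(1), of s] assms(2) DERIV_cong_ev[of s s f g] by simp
qed

lemma pws_right_deriv:
  assumes "pws f"
  shows "pws (right_deriv f)"
  unfolding pws_def
proof (intro allI conjI)
  fix s
  obtain g where g: "smooth g" "\<forall>\<^sub>F u in at_left s. f u = g u"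
    using assms by (rule pws_leftE)
  from eventually_at_left_nhds[OF g(2)] have "\<forall>\<^sub>F u in at_left s. right_deriv f u = deriv g u"
    by eventually_elim (rule right_deriv_smooth_near[OF g(1)])
  with g(1) show "\<exists>g. smooth g \<and> (\<forall>\<^sub>F u in at_left s. right_deriv f u = g u)"
    using smooth_deriv by blast
  obtain g where g: "smooth g" "f s = g s" "\<forall>\<^sub>F u in at_right s. f u = g u"
    using assms by (rule pws_rightE)
  from eventually_at_right_nhds[OF g(3)] have "\<forall>\<^sub>F u in at_right s. right_deriv f u = deriv g u"
    by eventually_elim (rule right_deriv_smooth_near[OF g(1)])
  with g show "\<exists>g. smooth g \<and> right_deriv f s = g s \<and> (\<forall>\<^sub>F u in at_right s. right_deriv f u = g u)"
    using smooth_deriv right_deriv_eqI[OF has_right_derivative_cong] by blast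
qed

lemma smooth_near_isCont: "smooth_near f s \<Longrightarrow> isCont f s"
  unfolding smooth_near_def using smooth_isCont isCont_cong by blast

lemma pws_borel_measurable:
  assumes "pws f"
  shows "f \<in> borel_measurable borel"
proof (rule borel_measurable_continuous_countable_exceptions)
  have "{u. \<not> smooth_near f u} = (\<Union>k::nat. {- real k..real k} \<inter> {u. \<not> smooth_near f u})"
  proof (intro equalityI subsetI)
    fix u assume u: "u \<in> {u. \<not> smooth_near f u}"
    obtain k :: nat where "\<bar>u\<bar> \<le> real k" using real_arch_simple by blast
    then have "- real k \<le> u" "u \<le> real k" by linarith+
    with u show "u \<in> (\<Union>k::nat. {- real k..real k} \<inter> {u. \<not> smooth_near f u})"
      by (intro UN_I[of k]) auto
  qed auto
  also have "countable \<dots>"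
    by (rule countable_UN) (auto intro!: countable_finite[OF pws_finite_breaks] assms simp del: finite_Int)
  finally show "countable {u. \<not> smooth_near f u}" .
  show "continuous_on (- {u. \<not> smooth_near f u}) f"
    by (auto intro!: continuous_at_imp_continuous_on smooth_near_isCont)
qed

text \<open>One-sided limits bound f near each point; Bolzano's bisection principle passes from
  small intervals to [a, b].\<close>

lemma pws_bounded:
  assumes "pws f" "a \<le> b"
  shows "\<exists>M. \<forall>u\<in>{a..b}. \<bar>f u\<bar> \<le> M"
  using assms(2)
proof (rule Bolzano)
  fix a b c :: real
  assume "\<exists>M. \<forall>u\<in>{a..b}. \<bar>f u\<bar> \<le> M" "\<exists>M. \<forall>u\<in>{b..c}. \<bar>f u\<bar> \<le> M"
  then obtain M1 M2 where "\<forall>u\<in>{a..b}. \<bar>f u\<bar> \<le> M1" "\<forall>u\<in>{b..c}. \<bar>f u\<bar> \<le> M2" by blast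
  then show "\<exists>M. \<forall>u\<in>{a..c}. \<bar>f u\<bar> \<le> M"
    by (intro exI[of _ "max M1 M2"]) (force simp: le_max_iff_disj)
next
  fix s :: real
  have "\<exists>M. \<forall>\<^sub>F u in at_left s. \<bar>f u\<bar> < M" "\<exists>M. \<forall>\<^sub>F u in at_right s. \<bar>f u\<bar> < M"
    using order_tendstoD(2)[OF tendsto_rabs[OF pws_tendsto_left[OF assms(1)]], of s "\<bar>left_limit f s\<bar> + 1"]
      order_tendstoD(2)[OF tendsto_rabs[OF pws_tendsto_right[OF assms(1)]], of s "\<bar>f s\<bar> + 1"]
    by auto
  then obtain M1 M2 where M: "\<forall>\<^sub>F u in at_left s. \<bar>f u\<bar> < M1" "\<forall>\<^sub>F u in at_right s. \<bar>f u\<bar> < M2"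
    by blast
  define M where "M = max \<bar>f s\<bar> (max M1 M2)"
  have "\<forall>\<^sub>F u in nhds s. \<bar>f u\<bar> \<le> M"
    unfolding eventually_nhds_split using M
    by (auto simp: M_def elim: eventually_mono)
  then obtain d where "d > 0" "\<And>u. dist u s < d \<Longrightarrow> \<bar>f u\<bar> \<le> M"
    unfolding eventually_nhds_metric by blast
  then show "\<exists>d>0. \<forall>a b. a \<le> s \<and> s \<le> b \<and> b - a < d \<longrightarrow> (\<exists>M. \<forall>u\<in>{a..b}. \<bar>f u\<bar> \<le> M)"
    by (intro exI[of _ d] conjI allI impI exI[of _ M]) (auto simp: dist_real_def)
qed

section \<open>Integration against test functions\<close>

lemma test_fun_supportE:
  obtains R where "R > 0" "\<And>s k. \<bar>s\<bar> \<ge> R \<Longrightarrow> (deriv ^^ k) (tf \<phi>) s = 0"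
proof -
  have "bounded {s. tf \<phi> s \<noteq> 0}"
    using tf[of \<phi>] by simp
  then obtain R where R: "\<And>s. tf \<phi> s \<noteq> 0 \<Longrightarrow> \<bar>s\<bar> \<le> R"
    by (auto simp: bounded_iff)
  \<comment> \<open>The margin 1 places s in the open complement of an interval containing the
    support, where all derivatives vanish as well.\<close>
  have "(deriv ^^ k) (tf \<phi>) s = 0" if "\<bar>s\<bar> \<ge> \<bar>R\<bar> + 1" for s k
  proof (rule deriv_funpow_eq_0[where U = "- {- \<bar>R\<bar>..\<bar>R\<bar>}"])
    show "tf \<phi> u = 0" if "u \<in> - {- \<bar>R\<bar>..\<bar>R\<bar>}" for u
    proof (rule ccontr)
      assume "tf \<phi> u \<noteq> 0"
      from R[OF this] that show False by auto
    qed
  qed (use that in auto)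
  then show thesis
    using that[of "\<bar>R\<bar> + 1"] by auto
qed

lemma pws_test_integrable:
  assumes "pws f"
  shows "integrable lborel (\<lambda>s. f s * tf \<phi> s)"
proof -
  obtain R where R: "R > 0" "\<And>s k. \<bar>s\<bar> \<ge> R \<Longrightarrow> (deriv ^^ k) (tf \<phi>) s = 0"
    by (rule test_fun_supportE[of \<phi>]) blast
  have p: "pws (\<lambda>s. f s * tf \<phi> s)"
    by (intro pws_mult assms smooth_imp_pws smooth_tf)
  obtain M where M: "\<forall>u\<in>{- R..R}. \<bar>f u * tf \<phi> u\<bar> \<le> M"
    using pws_bounded[OF p, of "- R" R] R(1) by auto
  show ?thesis
  proof (rule integrableI_bounded_set[where A = "{- R..R}" and B = M])
    show "(\<lambda>s. f s * tf \<phi> s) \<in> borel_measurable lborel"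
      using pws_borel_measurable[OF p] by simp
    show "AE s in lborel. s \<in> {- R..R} \<longrightarrow> norm (f s * tf \<phi> s) \<le> M"
      using M by simp
    show "AE s in lborel. s \<notin> {- R..R} \<longrightarrow> f s * tf \<phi> s = 0"
      using R(2)[where k = 0] by (auto intro!: AE_I2)
  qed (simp_all add: emeasure_lborel_Icc_eq)
qed

text \<open>The product of f and the test function jumps, so the fundamental theorem does not apply
  to it. Subtracting the jumps accumulated up to s yields a continuous F with the same derivative
  off a finite set; the test function vanishes at both ends, so the integral of that derivative is
  minus the sum of the jumps. K may be any finite set carrying all contributing jumps, so that
  \<open>rep_deriv\<close> can choose one that serves its impulses too.\<close>

lemma pws_integration_by_parts:
  assumes f: "pws f"
    and K: "finite K" "\<And>t. t \<notin> K \<Longrightarrow> (f t - left_limit f t) * tf \<phi> t = 0"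
  shows "- (\<integral>s. f s * tf (tf_deriv \<phi>) s \<partial>lborel) =
    (\<integral>s. right_deriv f s * tf \<phi> s \<partial>lborel) + (\<Sum>t\<in>K. (f t - left_limit f t) * tf \<phi> t)"
proof -
  obtain R where R: "R > 0" "\<And>s k. \<bar>s\<bar> \<ge> R \<Longrightarrow> (deriv ^^ k) (tf \<phi>) s = 0"
    by (rule test_fun_supportE[of \<phi>]) blast
  define J where "J t = (f t - left_limit f t) * tf \<phi> t" for t
  define h where "h s = f s * tf (tf_deriv \<phi>) s + right_deriv f s * tf \<phi> s" for s
  \<comment> \<open>The bounds enclose both the support of the test function and K. One unit further
    out the test function vanishes, all jumps are counted on the right and none on the left.\<close>
  define L where "L = Min (insert (- R) K)"
  define U where "U = Max (insert R K)"
  have LU: "L \<le> - R" "R \<le> U" "\<And>t. t \<in> K \<Longrightarrow> L \<le> t \<and> t \<le> U"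
    using K(1) by (auto simp: L_def U_def)
  define F where "F s = f s * tf \<phi> s - (\<Sum>t\<in>K. if t \<le> s then J t else 0)" for s
  have int: "integrable lborel (\<lambda>s. f s * tf (tf_deriv \<phi>) s)" "integrable lborel (\<lambda>s. right_deriv f s * tf \<phi> s)"
    by (intro pws_test_integrable f pws_right_deriv)+
  have cont: "isCont F s" for s
  proof -
    have step_right: "((\<lambda>u. if t \<le> u then J t else 0) \<longlongrightarrow> (if t \<le> s then J t else 0)) (at_right s)" for t
    proof (rule tendsto_eventually, cases "t \<le> s")
      case True
      then show "\<forall>\<^sub>F u in at_right s. (if t \<le> u then J t else 0) = (if t \<le> s then J t else 0)"
        by (auto simp: eventually_at_right_field intro!: exI[of _ "s + 1"])
    next
      case False
      then show "\<forall>\<^sub>F u in at_right s. (if t \<le> u then J t else 0) = (if t \<le> s then J t else 0)"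
        by (auto simp: eventually_at_right_field intro!: exI[of _ t])
    qed
    have right: "(F \<longlongrightarrow> F s) (at_right s)"
      unfolding F_def[abs_def]
      by (intro tendsto_diff tendsto_mult tendsto_sum step_right pws_tendsto_right[OF f]
          smooth_tendsto smooth_tf)
    have step_left: "((\<lambda>u. if t \<le> u then J t else 0) \<longlongrightarrow> (if t < s then J t else 0)) (at_left s)" for t
    proof (rule tendsto_eventually, cases "t < s")
      case True
      then show "\<forall>\<^sub>F u in at_left s. (if t \<le> u then J t else 0) = (if t < s then J t else 0)"
        by (auto simp: eventually_at_left_field intro!: exI[of _ t])
    next
      case False
      then show "\<forall>\<^sub>F u in at_left s. (if t \<le> u then J t else 0) = (if t < s then J t else 0)"
        by (auto simp: eventually_at_left_field intro!: exI[of _ "s - 1"])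
    qed
    have lim: "(F \<longlongrightarrow> left_limit f s * tf \<phi> s - (\<Sum>t\<in>K. if t < s then J t else 0)) (at_left s)"
      unfolding F_def[abs_def]
      by (intro tendsto_diff tendsto_mult tendsto_sum step_left pws_tendsto_left[OF f]
          smooth_tendsto smooth_tf)
    \<comment> \<open>Passing from the left limit to s switches on exactly the summand J s, which is
      zero for s outside K by the choice of K.\<close>
    have "(\<Sum>t\<in>K. if t \<le> s then J t else 0) = (\<Sum>t\<in>K. if t < s then J t else 0) + J s"
    proof -
      have "(\<Sum>t\<in>K. if t \<le> s then J t else 0) =
          (\<Sum>t\<in>K. (if t < s then J t else 0) + (if t = s then J s else 0))"
        by (rule sum.cong) auto
      also have "\<dots> = (\<Sum>t\<in>K. if t < s then J t else 0) + (if s \<in> K then J s else 0)"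
        using K(1) by (simp add: sum.distrib)
      finally show ?thesis
        using K(2)[of s] by (auto simp: J_def)
    qed
    moreover have "left_limit f s * tf \<phi> s = f s * tf \<phi> s - J s"
      by (simp add: J_def algebra_simps)
    ultimately have eq: "left_limit f s * tf \<phi> s - (\<Sum>t\<in>K. if t < s then J t else 0) = F s"
      by (simp add: F_def)
    have "(F \<longlongrightarrow> F s) (at_left s)"
      using lim unfolding eq .
    with right show ?thesis
      by (simp add: isCont_def filterlim_at_split)
  qed
  have der: "(F has_vector_derivative h s) (at s)" if s: "smooth_near f s" "s \<notin> K" for s
  proof -
    from s(1) obtain g where g: "smooth g" "\<forall>\<^sub>F u in nhds s. f u = g u"
      unfolding smooth_near_def by blast
    have df: "(f has_real_derivative right_deriv f s) (at s)"
      by (rule right_deriv_smooth_near[OF g])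
    have d\<phi>: "(tf \<phi> has_real_derivative tf (tf_deriv \<phi>) s) (at s)"
      unfolding tf_deriv.rep_eq by (rule smooth_has_derivative[OF smooth_tf])
    have d0: "((\<lambda>u. if t \<le> u then J t else 0) has_real_derivative 0) (at s)" if "t \<in> K" for t
    proof -
      have "\<exists>c. \<forall>\<^sub>F u in nhds s. (if t \<le> u then J t else 0) = c"
      proof (cases "t < s")
        case True
        then have "\<forall>\<^sub>F u in nhds s. (if t \<le> u then J t else 0) = J t"
          by (auto simp: eventually_nhds intro!: exI[of _ "{t<..}"])
        then show ?thesis by blast
      next
        case False
        then have "s < t" using s(2) that by (cases "s = t") auto
        then have "\<forall>\<^sub>F u in nhds s. (if t \<le> u then J t else 0) = 0"
          by (auto simp: eventually_nhds intro!: exI[of _ "{..<t}"])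
        then show ?thesis by blast
      qed
      then obtain c where "\<forall>\<^sub>F u in nhds s. (if t \<le> u then J t else 0) = c" by blast
      then show ?thesis
        using DERIV_cong_ev[of s s "\<lambda>u. if t \<le> u then J t else 0" "\<lambda>_. c" 0 0] by simp
    qed
    have "((\<lambda>u. \<Sum>t\<in>K. if t \<le> u then J t else 0) has_real_derivative (\<Sum>t\<in>K. 0)) (at s)"
      by (rule DERIV_sum) (rule d0)
    from DERIV_diff[OF DERIV_mult'[OF df d\<phi>] this]
    show ?thesis
      by (simp add: F_def[abs_def] h_def has_real_derivative_iff_has_vector_derivative[symmetric])
  qed
  have "(h has_integral (F (U + 1) - F (L - 1))) {L - 1..U + 1}"
  proof (rule fundamental_theorem_of_calculus_interior_strong)
    show "finite (({L - 1..U + 1} \<inter> {u. \<not> smooth_near f u}) \<union> K)"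
      using K(1) pws_finite_breaks[OF f] by simp
    show "L - 1 \<le> U + 1" using LU(1,2) R(1) by linarith
    show "continuous_on {L - 1..U + 1} F"
      by (intro continuous_at_imp_continuous_on ballI cont)
  qed (auto intro!: der)
  moreover have "F (U + 1) - F (L - 1) = - (\<Sum>t\<in>K. J t)"
  proof -
    have "tf \<phi> (U + 1) = 0" "tf \<phi> (L - 1) = 0"
      using R(2)[of "U + 1" 0] R(2)[of "L - 1" 0] LU(1,2) R(1) by auto
    moreover have "(\<Sum>t\<in>K. if t \<le> U + 1 then J t else 0) = (\<Sum>t\<in>K. J t)"
      by (rule sum.cong) (use LU(3) in force)+
    moreover have "(\<Sum>t\<in>K. if t \<le> L - 1 then J t else 0) = (\<Sum>t\<in>K. 0)"
      by (rule sum.cong) (use LU(3) in force)+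
    ultimately show ?thesis by (simp add: F_def)
  qed
  ultimately have "(h has_integral - (\<Sum>t\<in>K. J t)) {L - 1..U + 1}" by simp
  moreover have "h s = 0" if "s \<notin> {L - 1..U + 1}" for s
    using R(2)[of s 0] R(2)[of s 1] that LU(1,2) R(1) by (auto simp: h_def tf_deriv.rep_eq)
  ultimately have "(h has_integral - (\<Sum>t\<in>K. J t)) UNIV"
    by (subst has_integral_on_superset[where S = "{L - 1..U + 1}"]) auto
  moreover have "integrable lborel h"
    unfolding h_def by (intro Bochner_Integration.integrable_add int)
  ultimately have "(\<integral>s. h s \<partial>lborel) = - (\<Sum>t\<in>K. J t)"
    using integral_lborel has_integral_integrable_integral by metis
  then show ?thesis
    unfolding h_def J_def using int by simp
qed

text \<open>The fundamental lemma of the calculus of variations: where the continuous difference is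
  nonzero it keeps its sign on a small interval, and a bump supported there has a nonzero integral
  against it.\<close>

lemma continuous_eq_if_test_integrals_eq:
  fixes h1 h2 :: "real \<Rightarrow> real"
  assumes cont: "continuous_on {a<..<b} h1" "continuous_on {a<..<b} h2"
    and eq: "\<And>\<phi> c d. a < c \<Longrightarrow> d < b \<Longrightarrow> tf \<phi> = bump c d \<Longrightarrow>
      (\<integral>s. h1 s * tf \<phi> s \<partial>lborel) = (\<integral>s. h2 s * tf \<phi> s \<partial>lborel)"
    and s: "a < s" "s < b"
  shows "h1 s = h2 s"
proof (rule ccontr)
  assume ne: "h1 s \<noteq> h2 s"
  \<comment> \<open>The sign makes the difference positive at s and so covers both cases at
    once.\<close>
  define \<sigma> where "\<sigma> = sgn (h1 s - h2 s)"
  define h where "h u = \<sigma> * (h1 u - h2 u)" for u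
  have hs: "h s > 0" using ne by (simp add: h_def \<sigma>_def sgn_if)
  have ch: "continuous_on {a<..<b} h"
    unfolding h_def by (intro continuous_intros cont)
  then have "isCont h s"
    using s by (simp add: continuous_on_eq_continuous_at)
  then have "\<forall>\<^sub>F u in nhds s. h u > 0"
    using hs by (metis isCont_def order_tendstoD(1) tendsto_at_iff_tendsto_nhds)
  moreover have "\<forall>\<^sub>F u in nhds s. u \<in> {a<..<b}"
    using s by (intro eventually_nhds_in_open) auto
  ultimately have "\<forall>\<^sub>F u in nhds s. h u > 0 \<and> u \<in> {a<..<b}"
    by (rule eventually_conj)
  then obtain e where e: "e > 0" "\<And>u. dist u s < e \<Longrightarrow> h u > 0 \<and> u \<in> {a<..<b}"
    unfolding eventually_nhds_metric by blast
  \<comment> \<open>Halving the radius keeps the closed interval [c, d] inside the ball on which h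
    is positive.\<close>
  define c d where "c = s - e / 2" and "d = s + e / 2"
  have cd: "c < s" "s < d" "\<And>u. u \<in> {c..d} \<Longrightarrow> h u > 0 \<and> u \<in> {a<..<b}"
    using e by (auto simp: c_def d_def dist_real_def intro!: e(2))
  have acdb: "a < c" "d < b" using cd(3)[of c] cd(3)[of d] cd(1,2) by auto
  obtain \<phi> where \<phi>: "tf \<phi> = bump c d"
    using test_fun_ex[OF smooth_const[of 1], of c d] by auto
  have sub: "{c..d} \<subseteq> {a<..<b}" using acdb by auto
  have I: "set_integrable lborel {c..d} (\<lambda>u. k u * bump c d u)"
    "(\<integral>u. k u * bump c d u \<partial>lborel) = integral {c..d} (\<lambda>u. k u * bump c d u)"
    "(\<lambda>u. k u * bump c d u) integrable_on {c..d}"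
    if k: "continuous_on {a<..<b} k" for k
  proof -
    have "continuous_on {c..d} (\<lambda>u. k u * bump c d u)"
      by (intro continuous_on_mult continuous_on_subset[OF k sub] smooth_continuous_on smooth_bump)
    then show si: "set_integrable lborel {c..d} (\<lambda>u. k u * bump c d u)"
      and "(\<lambda>u. k u * bump c d u) integrable_on {c..d}"
      by (rule borel_integrable_atLeastAtMost' integrable_continuous_real)+
    have "(\<integral>u. k u * bump c d u \<partial>lborel) = (LINT u:{c..d}|lborel. k u * bump c d u)"
      unfolding set_lebesgue_integral_def
    proof (rule Bochner_Integration.integral_cong[OF refl])
      fix u
      show "k u * bump c d u = indicat_real {c..d} u *\<^sub>R (k u * bump c d u)"
      proof (cases "u \<in> {c..d}")
        case False
        then have "u \<notin> {c<..<d}" by auto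
        then show ?thesis using bump_zero[of u c d] by simp
      qed simp
    qed
    also have "\<dots> = integral {c..d} (\<lambda>u. k u * bump c d u)"
      by (rule set_borel_integral_eq_integral(2)[OF si])
    finally show "(\<integral>u. k u * bump c d u \<partial>lborel) = integral {c..d} (\<lambda>u. k u * bump c d u)" .
  qed
  have "integral {c..d} (\<lambda>u. h1 u * bump c d u) = integral {c..d} (\<lambda>u. h2 u * bump c d u)"
    using eq[OF acdb \<phi>] I(2)[OF cont(1)] I(2)[OF cont(2)] by (simp add: \<phi>)
  moreover have "integral {c..d} (\<lambda>u. h u * bump c d u) =
      \<sigma> * (integral {c..d} (\<lambda>u. h1 u * bump c d u) - integral {c..d} (\<lambda>u. h2 u * bump c d u))"
    using I(3)[OF cont(1)] I(3)[OF cont(2)]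
    by (simp add: h_def left_diff_distrib mult.assoc Henstock_Kurzweil_Integration.integral_diff)
  ultimately have "((\<lambda>u. h u * bump c d u) has_integral 0) (cbox c d)"
    using I(3)[OF ch] by (simp add: has_integral_integrable_integral)
  moreover have "continuous_on (cbox c d) (\<lambda>u. h u * bump c d u)"
    using continuous_on_mult[OF continuous_on_subset[OF ch sub] smooth_continuous_on[OF smooth_bump]]
    by simp
  moreover have "0 \<le> h u * bump c d u" if "u \<in> cbox c d" for u
    using cd(3)[of u] that bump_nonneg by (simp add: less_imp_le)
  ultimately have "h s * bump c d s = 0"
    using has_integral_0_cbox_imp_0[of c d "\<lambda>u. h u * bump c d u" s] cd(1,2) by auto
  with hs bump_pos[OF cd(1,2)] show False by simp
qed

section \<open>Piecewise-smooth distributions in coordinates\<close>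

text \<open>Junk value: the sum is 0 if infinitely many of the coefficients are nonzero.\<close>

definition dirac_sum :: "(nat \<Rightarrow> real) \<Rightarrow> real \<Rightarrow> distr" where
  "dirac_sum c t = (\<lambda>\<phi>. \<Sum>l | c l \<noteq> 0. c l * ((- 1) ^ l * (deriv ^^ l) (tf \<phi>) t))"

lemma dirac_sum_eq:
  assumes "\<forall>l\<ge>m. c l = 0"
  shows "dirac_sum c t \<phi> = (\<Sum>l<m. c l * ((- 1) ^ l * (deriv ^^ l) (tf \<phi>) t))"
  unfolding dirac_sum_def using assms
  by (intro sum.mono_neutral_left) (auto intro: leI)

lemma dirac_sum_0 [simp]: "dirac_sum (\<lambda>_. 0) t = (\<lambda>_. 0)"
  by (simp add: dirac_sum_def)

lemma dist_deriv_funpow_dirac: "(dist_deriv ^^ j) (dirac t) \<phi> = (- 1) ^ j * (deriv ^^ j) (tf \<phi>) t"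
proof (induction j arbitrary: \<phi>)
  case 0
  show ?case by (simp add: dirac_def)
next
  case (Suc j)
  have "(dist_deriv ^^ Suc j) (dirac t) \<phi> = - ((dist_deriv ^^ j) (dirac t) (tf_deriv \<phi>))"
    by (simp add: dist_deriv_def[of "(dist_deriv ^^ j) (dirac t)"])
  then show ?case
    by (simp add: Suc tf_deriv.rep_eq funpow_swap1)
qed

lemma dirac_comb_eq_dirac_sum: "dirac_comb m c t = dirac_sum (\<lambda>l. if l < m then c l else 0) t"
proof
  fix \<phi>
  have "dirac_sum (\<lambda>l. if l < m then c l else 0) t \<phi> =
      (\<Sum>l<m. (if l < m then c l else 0) * ((- 1) ^ l * (deriv ^^ l) (tf \<phi>) t))"
    by (rule dirac_sum_eq) simp
  then show "dirac_comb m c t \<phi> = dirac_sum (\<lambda>l. if l < m then c l else 0) t \<phi>"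
    by (simp add: dirac_comb_def dist_deriv_funpow_dirac)
qed

lemma dirac_sum_eq_dirac_comb:
  assumes "\<forall>l\<ge>m. c l = 0"
  shows "dirac_sum c t = dirac_comb m c t"
  by (rule ext) (simp add: dirac_sum_eq[OF assms] dirac_comb_def dist_deriv_funpow_dirac)

text \<open>Impulses do not accumulate, which is the filter form of a locally finite set of times,
  and at each time only finitely many orders occur. The bound on the order may depend on the
  time.\<close>

definition fin_impulses :: "(real \<Rightarrow> nat \<Rightarrow> real) \<Rightarrow> bool" where
  "fin_impulses c \<longleftrightarrow> (\<forall>s. \<forall>\<^sub>F t in at s. \<forall>l. c t l = 0) \<and> (\<forall>t. \<exists>m. \<forall>l\<ge>m. c t l = 0)"

text \<open>One rule serves linear combinations, restrictions and other pointwise operations: all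
  that matters is that zero coefficients produce zero.\<close>

lemma fin_impulses_combine:
  assumes "fin_impulses c" "fin_impulses d" and "\<And>t l. c t l = 0 \<Longrightarrow> d t l = 0 \<Longrightarrow> e t l = 0"
  shows "fin_impulses e"
  unfolding fin_impulses_def
proof (intro conjI allI)
  fix s
  have "\<forall>\<^sub>F t in at s. \<forall>l. c t l = 0" "\<forall>\<^sub>F t in at s. \<forall>l. d t l = 0"
    using assms(1,2) by (auto simp: fin_impulses_def)
  then show "\<forall>\<^sub>F t in at s. \<forall>l. e t l = 0"
    by eventually_elim (simp add: assms(3))
next
  fix t
  obtain m1 m2 where "\<forall>l\<ge>m1. c t l = 0" "\<forall>l\<ge>m2. d t l = 0"
    using assms(1,2) unfolding fin_impulses_def by blast
  then have "\<forall>l\<ge>max m1 m2. e t l = 0"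
    by (simp add: assms(3))
  then show "\<exists>m. \<forall>l\<ge>m. e t l = 0" ..
qed

text \<open>Only finitely many impulse times lie in the bounded support of a test function, so every
  infinite sum over times is a finite one.\<close>

lemma fin_impulses_supportE:
  assumes "fin_impulses c"
  obtains K where "finite K" "\<And>t. t \<notin> K \<Longrightarrow> dirac_sum (c t) t \<phi> = 0"
proof -
  obtain R where R: "R > 0" "\<And>s k. \<bar>s\<bar> \<ge> R \<Longrightarrow> (deriv ^^ k) (tf \<phi>) s = 0"
    by (rule test_fun_supportE[of \<phi>]) blast
  show thesis
  proof (rule that)
    show "finite ({- R..R} \<inter> {t. \<not> (\<forall>l. c t l = 0)})"
      using assms unfolding fin_impulses_def by (intro finite_exceptions) blast
    fix t assume "t \<notin> {- R..R} \<inter> {t. \<not> (\<forall>l. c t l = 0)}"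
    then have "R \<le> \<bar>t\<bar> \<or> (\<forall>l. c t l = 0)" by auto
    then show "dirac_sum (c t) t \<phi> = 0"
      using R(2)[of t] by (auto simp: dirac_sum_def)
  qed
qed

lemma infsum_finite_support:
  fixes h :: "'a \<Rightarrow> real"
  assumes "finite K" "\<And>t. t \<notin> K \<Longrightarrow> h t = 0"
  shows "infsum h UNIV = sum h K" "h summable_on UNIV"
proof -
  have "infsum h UNIV = infsum h K"
    by (rule infsum_cong_neutral) (auto simp: assms)
  then show "infsum h UNIV = sum h K"
    using assms(1) by simp
  have "h summable_on UNIV \<longleftrightarrow> h summable_on K"
    by (rule summable_on_cong_neutral) (auto simp: assms)
  then show "h summable_on UNIV"
    using assms(1) by simp
qed

lemma impulses_summable:
  assumes "fin_impulses c"
  shows "(\<lambda>t. dirac_sum (c t) t \<phi>) summable_on UNIV"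
proof -
  obtain K where "finite K" "\<And>t. t \<notin> K \<Longrightarrow> dirac_sum (c t) t \<phi> = 0"
    by (rule fin_impulses_supportE[OF assms, of \<phi>]) blast
  then show ?thesis by (rule infsum_finite_support(2))
qed

text \<open>Coordinates of a piecewise-smooth distribution: \<open>f\<close> is the right-continuous
  regular part and \<open>c t l\<close> the coefficient of the l-th derivative of the Dirac impulse
  at t. Recording zero coefficients at all other times replaces the set of impulse times and its
  family of impulses, which are not unique.\<close>

definition rep :: "distr \<Rightarrow> (real \<Rightarrow> real) \<Rightarrow> (real \<Rightarrow> nat \<Rightarrow> real) \<Rightarrow> bool" where
  "rep D f c \<longleftrightarrow> pws f \<and> fin_impulses c \<and>
     D = (\<lambda>\<phi>. (\<integral>s. f s * tf \<phi> s \<partial>lborel) + (\<Sum>\<^sub>\<infinity>t. dirac_sum (c t) t \<phi>))"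

lemma repD: "rep D f c \<Longrightarrow> pws f" "rep D f c \<Longrightarrow> fin_impulses c"
  by (simp_all add: rep_def)

lemma rep_unique_dist: "rep D f c \<Longrightarrow> rep D' f c \<Longrightarrow> D = D'"
  by (simp add: rep_def)

lemma dirac_sum_linear:
  assumes "\<exists>m. \<forall>l\<ge>m. c l = 0" "\<exists>m. \<forall>l\<ge>m. d l = 0"
  shows "dirac_sum (\<lambda>l. a * c l + b * d l) t \<phi> = a * dirac_sum c t \<phi> + b * dirac_sum d t \<phi>"
proof -
  obtain m1 m2 where m: "\<forall>l\<ge>m1. c l = 0" "\<forall>l\<ge>m2. d l = 0"
    using assms by blast
  define m where "m = max m1 m2"
  have "dirac_sum c t \<phi> = (\<Sum>l<m. c l * ((- 1) ^ l * (deriv ^^ l) (tf \<phi>) t))"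
    "dirac_sum d t \<phi> = (\<Sum>l<m. d l * ((- 1) ^ l * (deriv ^^ l) (tf \<phi>) t))"
    "dirac_sum (\<lambda>l. a * c l + b * d l) t \<phi> =
      (\<Sum>l<m. (a * c l + b * d l) * ((- 1) ^ l * (deriv ^^ l) (tf \<phi>) t))"
    by (rule dirac_sum_eq; use m in \<open>simp add: m_def\<close>)+
  then show ?thesis
    by (simp add: sum.distrib sum_distrib_left algebra_simps)
qed

lemma rep_linear:
  assumes D: "rep D f c" and D': "rep D' f' c'"
  shows "rep (\<lambda>\<phi>. a * D \<phi> + b * D' \<phi>) (\<lambda>s. a * f s + b * f' s) (\<lambda>t l. a * c t l + b * c' t l)"
  unfolding rep_def
proof (intro conjI ext)
  note f = repD[OF D] repD[OF D']
  show "pws (\<lambda>s. a * f s + b * f' s)"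
    by (intro pws_add pws_mult pws_const f)
  show "fin_impulses (\<lambda>t l. a * c t l + b * c' t l)"
    by (rule fin_impulses_combine[OF f(2,4)]) simp
  fix \<phi>
  have s: "(\<lambda>t. dirac_sum (c t) t \<phi>) summable_on UNIV" "(\<lambda>t. dirac_sum (c' t) t \<phi>) summable_on UNIV"
    by (intro impulses_summable f)+
  have "dirac_sum (\<lambda>l. a * c t l + b * c' t l) t \<phi> = a * dirac_sum (c t) t \<phi> + b * dirac_sum (c' t) t \<phi>" for t
    using f(2,4) by (intro dirac_sum_linear) (auto simp: fin_impulses_def)
  then have "(\<Sum>\<^sub>\<infinity>t. dirac_sum (\<lambda>l. a * c t l + b * c' t l) t \<phi>) =
      a * (\<Sum>\<^sub>\<infinity>t. dirac_sum (c t) t \<phi>) + b * (\<Sum>\<^sub>\<infinity>t. dirac_sum (c' t) t \<phi>)"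
    using s by (simp add: infsum_add summable_on_cmult_right infsum_cmult_right)
  moreover have "(\<integral>s. (a * f s + b * f' s) * tf \<phi> s \<partial>lborel) =
      a * (\<integral>s. f s * tf \<phi> s \<partial>lborel) + b * (\<integral>s. f' s * tf \<phi> s \<partial>lborel)"
    using pws_test_integrable[OF f(1), of \<phi>] pws_test_integrable[OF f(3), of \<phi>]
    by (simp add: distrib_right mult.assoc)
  ultimately show "a * D \<phi> + b * D' \<phi> = (\<integral>s. (a * f s + b * f' s) * tf \<phi> s \<partial>lborel) +
      (\<Sum>\<^sub>\<infinity>t. dirac_sum (\<lambda>l. a * c t l + b * c' t l) t \<phi>)"
    using D D' by (simp add: rep_def algebra_simps)
qed

lemma rep_0: "rep (\<lambda>_. 0) (\<lambda>_. 0) (\<lambda>_ _. 0)"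
  by (simp add: rep_def pws_const fin_impulses_def)

lemma rep_sum:
  assumes "\<And>j. j < (m :: nat) \<Longrightarrow> rep (D j) (f j) (c j)"
  shows "rep (\<lambda>\<phi>. \<Sum>j<m. a j * D j \<phi>) (\<lambda>s. \<Sum>j<m. a j * f j s) (\<lambda>t l. \<Sum>j<m. a j * c j t l)"
  using assms
proof (induction m)
  case 0
  show ?case using rep_0 by simp
next
  case (Suc m)
  then have "rep (\<lambda>\<phi>. \<Sum>j<m. a j * D j \<phi>) (\<lambda>s. \<Sum>j<m. a j * f j s) (\<lambda>t l. \<Sum>j<m. a j * c j t l)"
    by simp
  from rep_linear[OF this Suc.prems[of m], of 1 "a m"] show ?case by simp
qed

text \<open>To the right of any s lies an interval free of impulses on which f is smooth; bumps
  there force f to vanish, and right continuity reaches s itself. With f gone, a test function that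
  sees only the top order at t contradicts a nonzero coefficient.\<close>

lemma rep_0_unique:
  assumes "rep (\<lambda>_. 0) f c"
  shows "f = (\<lambda>_. 0)" "c = (\<lambda>_ _. 0)"
proof -
  note f = repD[OF assms]
  have eq: "(\<integral>s. f s * tf \<phi> s \<partial>lborel) + (\<Sum>\<^sub>\<infinity>t. dirac_sum (c t) t \<phi>) = 0" for \<phi>
    using assms unfolding rep_def by metis
  have f0: "f s = 0" for s
  proof -
    obtain g where g: "smooth g" "f s = g s" "\<forall>\<^sub>F u in at_right s. f u = g u"
      using f(1) by (rule pws_rightE)
    have "\<forall>\<^sub>F u in at_right s. \<forall>l. c u l = 0"
      using f(2) by (simp add: fin_impulses_def eventually_at_split)
    with g(3) have "\<forall>\<^sub>F u in at_right s. f u = g u \<and> (\<forall>l. c u l = 0)"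
      by (rule eventually_conj)
    then obtain b where b: "b > s" "\<And>u. s < u \<Longrightarrow> u < b \<Longrightarrow> f u = g u \<and> (\<forall>l. c u l = 0)"
      unfolding eventually_at_right_field by blast
    have z: "f u = 0" if u: "s < u" "u < b" for u
    proof (rule continuous_eq_if_test_integrals_eq[of s b f "\<lambda>_. 0"])
      show "continuous_on {s<..<b} f"
        using continuous_on_cong[of "{s<..<b}" "{s<..<b}" f g] b(2) smooth_continuous_on[OF g(1)] by auto
      fix \<phi> p q assume pq: "s < p" "q < b" and \<phi>: "tf \<phi> = bump p q"
      have "dirac_sum (c t) t \<phi> = 0" for t
      proof (cases "s < t \<and> t < b")
        case True
        then show ?thesis using b(2) by (simp add: dirac_sum_def)
      next
        case False
        have "(deriv ^^ l) (tf \<phi>) t = 0" for l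
          by (rule deriv_funpow_eq_0[where U = "- {p..q}"])
            (use False pq in \<open>auto simp: \<phi> bump_zero\<close>)
        then show ?thesis by (simp add: dirac_sum_def)
      qed
      with eq[of \<phi>] show "(\<integral>s. f s * tf \<phi> s \<partial>lborel) = (\<integral>s. 0 * tf \<phi> s \<partial>lborel)"
        by simp
    qed (use u in auto)
    have "\<forall>\<^sub>F u in at_right s. f u = 0"
      unfolding eventually_at_right_field using z b(1) by blast
    then have "(f \<longlongrightarrow> 0) (at_right s)"
      by (rule tendsto_eventually)
    then show "f s = 0"
      using tendsto_unique[OF _ pws_tendsto_right[OF f(1), of s]] by simp
  qed
  then show "f = (\<lambda>_. 0)" by blast
  have "c t l = 0" for t l
  proof (rule ccontr)
    assume "c t l \<noteq> 0"
    obtain m where m: "\<forall>l\<ge>m. c t l = 0"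
      using f(2) unfolding fin_impulses_def by blast
    then have "\<And>l. c t l \<noteq> 0 \<Longrightarrow> l < m"
      by (metis not_less)
    then have fin: "finite {l. c t l \<noteq> 0}"
      by (intro finite_subset[of "{l. c t l \<noteq> 0}" "{..<m}"]) auto
    \<comment> \<open>The highest order present at t: higher coefficients are zero and lower
      derivatives of the test function vanish, so only the term of order L remains.\<close>
    define L where "L = Max {l. c t l \<noteq> 0}"
    have L: "c t L \<noteq> 0" "\<And>l. c t l \<noteq> 0 \<Longrightarrow> l \<le> L"
      using Max_in[OF fin] Max_ge[OF fin] \<open>c t l \<noteq> 0\<close> unfolding L_def by auto
    have "\<forall>\<^sub>F u in at t. \<forall>l. c u l = 0"
      using f(2) by (simp add: fin_impulses_def)
    then obtain e where e: "e > 0" "\<And>u. u \<noteq> t \<Longrightarrow> dist u t < e \<Longrightarrow> \<forall>l. c u l = 0"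
      unfolding eventually_at by auto
    obtain \<phi> where \<phi>: "\<And>s. s \<notin> {t - e / 2<..<t + e / 2} \<Longrightarrow> tf \<phi> s = 0"
      "\<And>j. j < L \<Longrightarrow> (deriv ^^ j) (tf \<phi>) t = 0" "(deriv ^^ L) (tf \<phi>) t \<noteq> 0"
      using test_fun_order_ex[of "t - e / 2" t "t + e / 2" L] e(1) by auto
    have "dirac_sum (c u) u \<phi> = 0" if "u \<noteq> t" for u
    proof (cases "dist u t < e")
      case True
      then show ?thesis using e(2)[OF that] by (simp add: dirac_sum_def)
    next
      case False
      have "(deriv ^^ l) (tf \<phi>) u = 0" for l
        by (rule deriv_funpow_eq_0[where U = "- {t - e / 2..t + e / 2}"])
          (use False e(1) in \<open>auto simp: dist_real_def abs_if intro!: \<phi>(1) split: if_splits\<close>)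
      then show ?thesis by (simp add: dirac_sum_def)
    qed
    then have "(\<Sum>\<^sub>\<infinity>u. dirac_sum (c u) u \<phi>) = (\<Sum>u\<in>{t}. dirac_sum (c u) u \<phi>)"
      by (intro infsum_finite_support) auto
    with eq[of \<phi>] f0 have "dirac_sum (c t) t \<phi> = 0" by simp
    moreover have "dirac_sum (c t) t \<phi> = (\<Sum>l<Suc L. c t l * ((- 1) ^ l * (deriv ^^ l) (tf \<phi>) t))"
      using L(2) by (intro dirac_sum_eq) force
    ultimately show False
      using L(1) \<phi>(2,3) by simp
  qed
  then show "c = (\<lambda>_ _. 0)" by blast
qed

lemma rep_unique:
  assumes "rep D f c" "rep D f' c'"
  shows "f = f'" "c = c'"
proof -
  from rep_linear[OF assms, of 1 "- 1"]
  have "rep (\<lambda>_. 0) (\<lambda>s. f s - f' s) (\<lambda>t l. c t l - c' t l)" by simp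
  from rep_0_unique[OF this] show "f = f'" "c = c'"
    by (auto simp: fun_eq_iff)
qed

section \<open>Coordinates of decompositions, restrictions and derivatives\<close>

lemma pw_decomp_imp_rep:
  assumes "pw_decomp D f T Dt"
  shows "\<exists>c. rep D f c \<and> (\<forall>t. dirac_sum (c t) t = (if t \<in> T then Dt t else 0))"
proof -
  from assms have f: "pws f" and T: "\<And>a b. finite (T \<inter> {a..b})"
    and Dt: "\<And>t. t \<in> T \<Longrightarrow> \<exists>m c. Dt t = dirac_comb m c t"
    and D: "D = fun_dist f + (\<lambda>\<phi>. \<Sum>\<^sub>\<infinity>t\<in>T. Dt t \<phi>)"
    by (auto simp: pw_decomp_def pw_smooth_fun_iff_pws locally_finite_set_def dirac_span_def)
  from Dt obtain m c where mc: "\<And>t. t \<in> T \<Longrightarrow> Dt t = dirac_comb (m t) (c t) t"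
    by metis
  define c' where "c' t l = (if t \<in> T \<and> l < m t then c t l else 0)" for t l
  have c': "dirac_sum (c' t) t = (if t \<in> T then Dt t else 0)" for t
    by (auto simp: c'_def[abs_def] mc dirac_comb_eq_dirac_sum zero_fun_def)
  have "\<forall>\<^sub>F t in at s. t \<notin> T" for s
  proof -
    have "\<not> s islimpt (T \<inter> {s - 1..s + 1})"
      by (rule islimpt_finite[OF T])
    then have "\<forall>\<^sub>F t in at s. t \<notin> T \<inter> {s - 1..s + 1}"
      by (simp add: islimpt_iff_eventually)
    moreover have "\<forall>\<^sub>F t in at s. t \<in> {s - 1<..<s + 1}"
      by (rule eventually_at_in_open') auto
    ultimately show ?thesis
      by eventually_elim auto
  qed
  then have "\<forall>\<^sub>F t in at s. \<forall>l. c' t l = 0" for s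
    by (rule eventually_mono) (simp add: c'_def)
  moreover have "\<forall>l\<ge>m t. c' t l = 0" for t
    by (simp add: c'_def)
  ultimately have "fin_impulses c'"
    unfolding fin_impulses_def by blast
  moreover have "(\<Sum>\<^sub>\<infinity>t\<in>T. Dt t \<phi>) = (\<Sum>\<^sub>\<infinity>t. dirac_sum (c' t) t \<phi>)" for \<phi>
    by (rule infsum_cong_neutral) (auto simp: c' zero_fun_def)
  ultimately have "rep D f c'"
    by (simp add: rep_def f D fun_dist_def plus_fun_def)
  with c' show ?thesis by blast
qed

lemma rep_imp_pw_decomp:
  assumes "rep D f c"
  shows "pw_decomp D f {t. \<exists>l. c t l \<noteq> 0} (\<lambda>t. dirac_sum (c t) t)"
  unfolding pw_decomp_def
proof (intro conjI ballI)
  note f = repD[OF assms]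
  show "pw_smooth_fun f" using f by (simp add: pw_smooth_fun_iff_pws)
  show "locally_finite_set {t. \<exists>l. c t l \<noteq> 0}"
    using f(2) finite_exceptions[of "\<lambda>t. \<forall>l. c t l = 0"]
    by (auto simp: locally_finite_set_def fin_impulses_def Int_commute)
  fix t
  obtain m where m: "\<forall>l\<ge>m. c t l = 0"
    using f(2) unfolding fin_impulses_def by blast
  show "dirac_sum (c t) t \<in> dirac_span t"
    using dirac_sum_eq_dirac_comb[OF m] by (auto simp: dirac_span_def)
next
  have "(\<Sum>\<^sub>\<infinity>t | \<exists>l. c t l \<noteq> 0. dirac_sum (c t) t \<phi>) = (\<Sum>\<^sub>\<infinity>t. dirac_sum (c t) t \<phi>)" for \<phi>
    by (rule infsum_cong_neutral) (auto simp: dirac_sum_def)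
  then show "D = fun_dist f + (\<lambda>\<phi>. \<Sum>\<^sub>\<infinity>t | \<exists>l. c t l \<noteq> 0. dirac_sum (c t) t \<phi>)"
    using assms by (simp add: rep_def fun_dist_def plus_fun_def)
qed

lemma rep_in_pw_smooth_dists: "rep D f c \<Longrightarrow> D \<in> pw_smooth_dists"
  using rep_imp_pw_decomp unfolding pw_smooth_dists_def by blast

lemma pw_smooth_dists_rep: "D \<in> pw_smooth_dists \<Longrightarrow> \<exists>f c. rep D f c"
  using pw_decomp_imp_rep unfolding pw_smooth_dists_def by blast

lemma regular_part_rep:
  assumes "rep D f c"
  shows "regular_part D = f"
  unfolding regular_part_def
proof (rule the_equality)
  show "\<exists>T Dt. pw_decomp D f T Dt"
    using rep_imp_pw_decomp[OF assms] by blast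
  show "f' = f" if "\<exists>T Dt. pw_decomp D f' T Dt" for f'
    using that pw_decomp_imp_rep rep_unique(1)[OF _ assms] by blast
qed

lemma impulse_at_rep:
  assumes "rep D f c"
  shows "impulse_at D t = dirac_sum (c t) t"
  unfolding impulse_at_def
proof (rule the_equality)
  show "\<exists>f T Dt. pw_decomp D f T Dt \<and> dirac_sum (c t) t = (if t \<in> T then Dt t else 0)"
    by (intro exI conjI, rule rep_imp_pw_decomp[OF assms]) (auto simp: dirac_sum_def zero_fun_def)
  show "Q = dirac_sum (c t) t"
    if "\<exists>f T Dt. pw_decomp D f T Dt \<and> Q = (if t \<in> T then Dt t else 0)" for Q
  proof -
    from that obtain f' T Dt where *: "pw_decomp D f' T Dt" "Q = (if t \<in> T then Dt t else 0)" by blast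
    from pw_decomp_imp_rep[OF *(1)] obtain c' where
      "rep D f' c'" "dirac_sum (c' t) t = (if t \<in> T then Dt t else 0)" by blast
    with rep_unique(2)[OF _ assms] *(2) show ?thesis by metis
  qed
qed

text \<open>A missing left end a changes the regular part only on a null set, so its
  right-continuous representative is cut off by [a, b) either way. The impulses, in contrast, see
  exactly I.\<close>

lemma rep_restrict:
  assumes D: "rep D f c" and I: "I \<subseteq> {a..<b}" "{a<..<b} \<subseteq> I"
  shows "rep (dist_restrict I D) (\<lambda>s. indicator {a..<b} s * f s) (\<lambda>t l. if t \<in> I then c t l else 0)"
  unfolding rep_def
proof (intro conjI)
  note f = repD[OF D]
  show "pws (\<lambda>s. indicator {a..<b} s * f s)"
    by (intro pws_mult pws_indicator f)
  show "fin_impulses (\<lambda>t l. if t \<in> I then c t l else 0)"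
    by (rule fin_impulses_combine[OF f(2,2)]) simp
  have "(\<integral>s. indicator I s * f s * tf \<phi> s \<partial>lborel) = (\<integral>s. indicator {a..<b} s * f s * tf \<phi> s \<partial>lborel)" for \<phi>
  proof (rule integral_cong_AE)
    have fm: "f \<in> borel_measurable borel" "tf \<phi> \<in> borel_measurable borel"
      by (intro pws_borel_measurable f smooth_imp_pws smooth_tf)+
    have "I = {a<..<b} \<or> I = {a..<b}"
    proof (cases "a \<in> I")
      case True
      then have "I = {a..<b}" using I by (auto simp: subset_iff order_le_less)
      then show ?thesis ..
    next
      case False
      then have "I = {a<..<b}" using I by (force simp: subset_iff order_le_less)
      then show ?thesis ..
    qed
    then have "I \<in> sets borel" by auto
    with fm show "(\<lambda>s. indicator I s * f s * tf \<phi> s) \<in> borel_measurable lborel"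
      "(\<lambda>s. indicator {a..<b} s * f s * tf \<phi> s) \<in> borel_measurable lborel"
      by simp_all
    have "AE s in lborel. s \<noteq> a"
      by (rule AE_lborel_singleton)
    then show "AE s in lborel. indicator I s * f s * tf \<phi> s = indicator {a..<b} s * f s * tf \<phi> s"
    proof eventually_elim
      case (elim s)
      then have "s \<in> I \<longleftrightarrow> s \<in> {a..<b}"
        using I by (auto simp: subset_iff order_le_less)
      then show ?case by (simp add: indicator_def)
    qed
  qed
  moreover have "(\<Sum>\<^sub>\<infinity>t\<in>I. dirac_sum (c t) t \<phi>) =
      (\<Sum>\<^sub>\<infinity>t. dirac_sum (\<lambda>l. if t \<in> I then c t l else 0) t \<phi>)" for \<phi>
    by (rule infsum_cong_neutral) auto
  ultimately show "dist_restrict I D = (\<lambda>\<phi>. (\<integral>s. indicator {a..<b} s * f s * tf \<phi> s \<partial>lborel) +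
      (\<Sum>\<^sub>\<infinity>t. dirac_sum (\<lambda>l. if t \<in> I then c t l else 0) t \<phi>))"
    by (simp add: dist_restrict_def fun_dist_def plus_fun_def regular_part_rep[OF D] impulse_at_rep[OF D])
qed

lemma fin_impulses_jumps:
  assumes "pws f" "fin_impulses c"
  shows "fin_impulses (\<lambda>t l. case l of 0 \<Rightarrow> f t - left_limit f t | Suc l \<Rightarrow> c t l)"
  unfolding fin_impulses_def
proof (intro conjI allI)
  fix s
  have "\<forall>\<^sub>F t in at s. f t = left_limit f t"
    using pws_eventually_smooth_near[OF assms(1), of s]
  proof eventually_elim
    case (elim t)
    then have "(f \<longlongrightarrow> f t) (at_left t)"
      using smooth_near_isCont[of f t] by (auto simp: isCont_def filterlim_at_split)
    then show ?case using left_limit_eqI by simp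
  qed
  moreover have "\<forall>\<^sub>F t in at s. \<forall>l. c t l = 0"
    using assms(2) by (simp add: fin_impulses_def)
  ultimately show "\<forall>\<^sub>F t in at s. \<forall>l. (case l of 0 \<Rightarrow> f t - left_limit f t | Suc l \<Rightarrow> c t l) = 0"
    by eventually_elim (simp split: nat.split)
next
  fix t
  obtain m where "\<forall>l\<ge>m. c t l = 0"
    using assms(2) unfolding fin_impulses_def by blast
  then have "\<forall>l\<ge>Suc m. (case l of 0 \<Rightarrow> f t - left_limit f t | Suc l \<Rightarrow> c t l) = 0"
    by (simp split: nat.split)
  then show "\<exists>m. \<forall>l\<ge>m. (case l of 0 \<Rightarrow> f t - left_limit f t | Suc l \<Rightarrow> c t l) = 0" ..
qed

text \<open>Integration by parts produces the right derivative and the jumps, while passing the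
  derivative to the test function raises the order of every impulse by one. Hence the jump occupies
  order 0 and the old coefficients move up.\<close>

lemma rep_deriv:
  assumes D: "rep D f c"
  shows "rep (dist_deriv D) (right_deriv f)
    (\<lambda>t l. case l of 0 \<Rightarrow> f t - left_limit f t | Suc l \<Rightarrow> c t l)"
    (is "rep _ _ ?c")
  unfolding rep_def
proof (intro conjI ext)
  note f = repD[OF D]
  show "pws (right_deriv f)" by (rule pws_right_deriv[OF f(1)])
  show cfin: "fin_impulses ?c" by (rule fin_impulses_jumps[OF f])
  fix \<phi>
  define J where "J t = (f t - left_limit f t) * tf \<phi> t" for t
  have split: "dirac_sum (?c t) t \<phi> = J t - dirac_sum (c t) t (tf_deriv \<phi>)" for t
  proof -
    obtain m where m: "\<forall>l\<ge>m. c t l = 0"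
      using f(2) unfolding fin_impulses_def by blast
    then have "dirac_sum (?c t) t \<phi> = (\<Sum>l<Suc m. ?c t l * ((- 1) ^ l * (deriv ^^ l) (tf \<phi>) t))"
      by (intro dirac_sum_eq) (simp split: nat.split)
    also have "\<dots> = J t + (\<Sum>l<m. c t l * ((- 1) ^ Suc l * (deriv ^^ Suc l) (tf \<phi>) t))"
      by (subst sum.lessThan_Suc_shift) (simp add: J_def)
    also have "\<dots> = J t - dirac_sum (c t) t (tf_deriv \<phi>)"
      by (simp add: dirac_sum_eq[OF m] tf_deriv.rep_eq funpow_swap1 sum_negf)
    finally show ?thesis .
  qed
  obtain K1 where K1: "finite K1" "\<And>t. t \<notin> K1 \<Longrightarrow> dirac_sum (?c t) t \<phi> = 0"
    by (rule fin_impulses_supportE[OF cfin, of \<phi>]) blast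
  obtain K2 where K2: "finite K2" "\<And>t. t \<notin> K2 \<Longrightarrow> dirac_sum (c t) t (tf_deriv \<phi>) = 0"
    by (rule fin_impulses_supportE[OF f(2), of "tf_deriv \<phi>"]) blast
  \<comment> \<open>One finite set carries both impulse families. By \<open>split\<close> the jump
    contribution vanishes outside it too, which is what integration by parts asks for.\<close>
  define K where "K = K1 \<union> K2"
  have K: "finite K" "\<And>t. t \<notin> K \<Longrightarrow> dirac_sum (?c t) t \<phi> = 0"
    "\<And>t. t \<notin> K \<Longrightarrow> dirac_sum (c t) t (tf_deriv \<phi>) = 0" "\<And>t. t \<notin> K \<Longrightarrow> J t = 0"
    using K1 K2 split by (auto simp: K_def)
  have "(\<Sum>\<^sub>\<infinity>t. dirac_sum (?c t) t \<phi>) = (\<Sum>t\<in>K. dirac_sum (?c t) t \<phi>)"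
    by (rule infsum_finite_support(1)[OF K(1,2)])
  also have "\<dots> = (\<Sum>t\<in>K. J t) - (\<Sum>t\<in>K. dirac_sum (c t) t (tf_deriv \<phi>))"
    by (simp only: split sum_subtractf)
  also have "(\<Sum>t\<in>K. dirac_sum (c t) t (tf_deriv \<phi>)) = (\<Sum>\<^sub>\<infinity>t. dirac_sum (c t) t (tf_deriv \<phi>))"
    by (rule infsum_finite_support(1)[OF K(1,3), symmetric])
  finally have "(\<Sum>\<^sub>\<infinity>t. dirac_sum (?c t) t \<phi>) =
      (\<Sum>t\<in>K. J t) - (\<Sum>\<^sub>\<infinity>t. dirac_sum (c t) t (tf_deriv \<phi>))" .
  moreover
  have "- (\<integral>s. f s * tf (tf_deriv \<phi>) s \<partial>lborel) =
      (\<integral>s. right_deriv f s * tf \<phi> s \<partial>lborel) + (\<Sum>t\<in>K. J t)"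
    unfolding J_def using K(4) by (intro pws_integration_by_parts f K(1)) (simp add: J_def)
  moreover have "dist_deriv D \<phi> = - ((\<integral>s. f s * tf (tf_deriv \<phi>) s \<partial>lborel) +
      (\<Sum>\<^sub>\<infinity>t. dirac_sum (c t) t (tf_deriv \<phi>)))"
    using D by (simp add: dist_deriv_def rep_def)
  ultimately show "dist_deriv D \<phi> = (\<integral>s. right_deriv f s * tf \<phi> s \<partial>lborel) + (\<Sum>\<^sub>\<infinity>t. dirac_sum (?c t) t \<phi>)"
    by simp
qed

section \<open>Linear algebra\<close>

lemma mult_mat_vec_nth:
  assumes "A \<in> carrier_mat m n" "v \<in> carrier_vec n" "i < m"
  shows "(A *\<^sub>v v) $ i = (\<Sum>k<n. A $$ (i, k) * v $ k)"
  using assms by (simp add: scalar_prod_def lessThan_atLeast0)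

lemma mult_mat_nth:
  assumes "A \<in> carrier_mat m n" "B \<in> carrier_mat n l" "i < m" "j < l"
  shows "(A * B) $$ (i, j) = (\<Sum>k<n. A $$ (i, k) * B $$ (k, j))"
  using assms by (simp add: scalar_prod_def lessThan_atLeast0)

lemma zero_mat_mult_vec: "v \<in> carrier_vec n \<Longrightarrow> 0\<^sub>m m n *\<^sub>v v = 0\<^sub>v m"
  by (rule eq_vecI) auto

lemma mult_mat_zero_vec: "A \<in> carrier_mat m n \<Longrightarrow> A *\<^sub>v 0\<^sub>v n = 0\<^sub>v m"
  by (rule eq_vecI) auto

lemma mult_mat_uminus_vec:
  fixes A :: "real mat"
  shows "A \<in> carrier_mat m n \<Longrightarrow> v \<in> carrier_vec n \<Longrightarrow> A *\<^sub>v (- v) = - (A *\<^sub>v v)"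
  by (rule eq_vecI) auto

lemma pow_mat_Suc_left:
  assumes "A \<in> carrier_mat n n"
  shows "A ^\<^sub>m Suc k = A * A ^\<^sub>m k"
proof (induction k)
  case 0
  show ?case using assms by simp
next
  case (Suc k)
  have "A ^\<^sub>m Suc (Suc k) = (A * A ^\<^sub>m k) * A"
    using Suc by simp
  also have "\<dots> = A * A ^\<^sub>m Suc k"
    using assms by (simp add: assoc_mult_mat[of A n n _ n _ n])
  finally show ?case .
qed

lemma pow_mat_add:
  assumes "A \<in> carrier_mat n n"
  shows "A ^\<^sub>m (k + l) = A ^\<^sub>m k * A ^\<^sub>m l"
proof (induction l)
  case 0
  show ?case using assms right_mult_one_mat[of "A ^\<^sub>m k" n n] by simp
next
  case (Suc l)
  then show ?case using assms by (simp add: assoc_mult_mat[of _ n n _ n _ n])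
qed

text \<open>An n by (n + 1) system has a nontrivial solution because a zero row makes its matrix
  square and singular.\<close>

lemma vectors_dependent:
  fixes w :: "nat \<Rightarrow> nat \<Rightarrow> real"
  shows "\<exists>a. (\<exists>j\<le>n. a j \<noteq> 0) \<and> (\<forall>i<n. (\<Sum>j\<le>n. a j * w j i) = 0)"
proof -
  define c where "c i = vec (Suc n) (\<lambda>j. w j i)" for i
  define Q where "Q = mat\<^sub>r (Suc n) (Suc n) (\<lambda>i. if i = n then 0\<^sub>v (Suc n) else c i)"
  have Q: "Q \<in> carrier_mat (Suc n) (Suc n)"
    by (simp add: Q_def)
  have "det Q = 0"
    unfolding Q_def by (rule det_row_0) (auto simp: c_def)
  then obtain v where v: "v \<in> carrier_vec (Suc n)" "v \<noteq> 0\<^sub>v (Suc n)" "Q *\<^sub>v v = 0\<^sub>v (Suc n)"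
    using det_0_iff_vec_prod_zero_field[OF Q] by blast
  have "\<exists>j\<le>n. v $ j \<noteq> 0"
  proof (rule ccontr)
    assume "\<not> (\<exists>j\<le>n. v $ j \<noteq> 0)"
    then have "v = 0\<^sub>v (Suc n)" using v(1) by (intro eq_vecI) auto
    with v(2) show False ..
  qed
  moreover have "(\<Sum>j\<le>n. v $ j * w j i) = 0" if "i < n" for i
  proof -
    have "0 = (Q *\<^sub>v v) $ i" using v(3) that by simp
    also have "\<dots> = (\<Sum>j<Suc n. Q $$ (i, j) * v $ j)"
      using that by (intro mult_mat_vec_nth[OF Q v(1)]) simp
    also have "\<dots> = (\<Sum>j\<le>n. v $ j * w j i)"
      unfolding lessThan_Suc_atMost using that by (intro sum.cong) (auto simp: Q_def c_def)
    finally show ?thesis by simp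
  qed
  ultimately show ?thesis by (intro exI[of _ "\<lambda>j. v $ j"]) blast
qed

text \<open>In place of the Cayley-Hamilton theorem: every observed orbit of a matrix satisfies a
  linear recurrence of order at most \<open>n\<close>.\<close>

lemma orbit_recurrence:
  fixes A :: "real mat"
  assumes A: "A \<in> carrier_mat n n" and v: "v \<in> carrier_vec n"
  shows "\<exists>a :: nat \<Rightarrow> real. (\<exists>i\<le>n. a i \<noteq> 0) \<and> (\<forall>C m r k. C \<in> carrier_mat m n \<longrightarrow> r < m \<longrightarrow>
    (\<Sum>i\<le>n. a i * (C *\<^sub>v (A ^\<^sub>m (k + i) *\<^sub>v v)) $ r) = 0)"
proof -
  obtain a where a: "\<exists>i\<le>n. a i \<noteq> 0" "\<forall>c<n. (\<Sum>i\<le>n. a i * (A ^\<^sub>m i *\<^sub>v v) $ c) = 0"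
    using vectors_dependent[of n "\<lambda>i c. (A ^\<^sub>m i *\<^sub>v v) $ c"] by blast
  show ?thesis
  proof (intro exI[of _ a] conjI allI impI a(1))
    fix C :: "real mat" and m r k
    assume C: "C \<in> carrier_mat m n" and r: "r < m"
    define B where "B = C * A ^\<^sub>m k"
    have B: "B \<in> carrier_mat m n" using C A by (simp add: B_def)
    note cA = pow_carrier_mat[OF A]
    have "C *\<^sub>v (A ^\<^sub>m (k + i) *\<^sub>v v) = B *\<^sub>v (A ^\<^sub>m i *\<^sub>v v)" for i
      unfolding B_def pow_mat_add[OF A] assoc_mult_mat_vec[OF cA cA v]
      by (rule assoc_mult_mat_vec[OF C cA mult_mat_vec_carrier[OF cA v], symmetric])
    then have "(\<Sum>i\<le>n. a i * (C *\<^sub>v (A ^\<^sub>m (k + i) *\<^sub>v v)) $ r) =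
        (\<Sum>i\<le>n. a i * (\<Sum>c<n. B $$ (r, c) * (A ^\<^sub>m i *\<^sub>v v) $ c))"
      using mult_mat_vec_nth[OF B mult_mat_vec_carrier[OF pow_carrier_mat[OF A] v] r] by simp
    also have "\<dots> = (\<Sum>c<n. B $$ (r, c) * (\<Sum>i\<le>n. a i * (A ^\<^sub>m i *\<^sub>v v) $ c))"
      unfolding sum_distrib_left by (subst sum.swap) (simp add: mult.left_commute)
    also have "\<dots> = 0" using a(2) by simp
    finally show "(\<Sum>i\<le>n. a i * (C *\<^sub>v (A ^\<^sub>m (k + i) *\<^sub>v v)) $ r) = 0" .
  qed
qed

text \<open>The recurrence is solved for its highest term: the last nonzero coefficient, of index M
  \<le> n, expresses the output of power j through outputs of smaller powers, so vanishing below n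
  propagates upward.\<close>

lemma observed_orbit_zero:
  fixes A :: "real mat"
  assumes A: "A \<in> carrier_mat n n" and v: "v \<in> carrier_vec n" and C: "C \<in> carrier_mat m n"
    and low: "\<And>j. j < n \<Longrightarrow> C *\<^sub>v (A ^\<^sub>m j *\<^sub>v v) = 0\<^sub>v m"
  shows "C *\<^sub>v (A ^\<^sub>m j *\<^sub>v v) = 0\<^sub>v m"
proof (induction j rule: less_induct)
  case (less j)
  obtain a :: "nat \<Rightarrow> real" where aC: "(\<exists>i\<le>n. a i \<noteq> 0) \<and> (\<forall>C m r k. C \<in> carrier_mat m n \<longrightarrow> r < m \<longrightarrow>
    (\<Sum>i\<le>n. a i * (C *\<^sub>v (A ^\<^sub>m (k + i) *\<^sub>v v)) $ r) = 0)"
    using orbit_recurrence[OF A v] by (rule exE)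
  note a = conjunct1[OF aC] conjunct2[OF aC]
  define M where "M = Max {i. i \<le> n \<and> a i \<noteq> 0}"
  have fin: "finite {i. i \<le> n \<and> a i \<noteq> 0}" by simp
  have M: "M \<le> n" "a M \<noteq> 0" "\<And>i. i \<le> n \<Longrightarrow> M < i \<Longrightarrow> a i = 0"
    using Max_in[OF fin] Max_ge[OF fin] a(1) unfolding M_def[symmetric] by (auto simp: not_le[symmetric])
  show ?case
  proof (cases "j < n")
    case False
    have "(C *\<^sub>v (A ^\<^sub>m j *\<^sub>v v)) $ r = 0" if r: "r < m" for r
    proof -
      have "0 = (\<Sum>i\<le>n. a i * (C *\<^sub>v (A ^\<^sub>m ((j - M) + i) *\<^sub>v v)) $ r)"
        using a(2)[rule_format, OF C r] by simp
      also have "\<dots> = (\<Sum>i\<le>n. if i = M then a M * (C *\<^sub>v (A ^\<^sub>m j *\<^sub>v v)) $ r else 0)"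
      proof (rule sum.cong[OF refl])
        fix i assume "i \<in> {..n}"
        then show "a i * (C *\<^sub>v (A ^\<^sub>m ((j - M) + i) *\<^sub>v v)) $ r =
            (if i = M then a M * (C *\<^sub>v (A ^\<^sub>m j *\<^sub>v v)) $ r else 0)"
          using M False less[of "(j - M) + i"] r by (cases i M rule: linorder_cases) auto
      qed
      also have "\<dots> = a M * (C *\<^sub>v (A ^\<^sub>m j *\<^sub>v v)) $ r"
        using M(1) by simp
      finally show ?thesis using M(2) by simp
    qed
    then show ?thesis using C by (intro eq_vecI) auto
  qed (rule low)
qed

text \<open>The recurrence is solved for its lowest term: the first nonzero coefficient expresses
  power i through higher powers, so vanishing beyond the exponent L propagates downward, as long as
  i is at least the index M \<le> n of that coefficient.\<close>

lemma nilpotent_orbit_zero: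
  fixes A :: "real mat"
  assumes A: "A \<in> carrier_mat n n" and v: "v \<in> carrier_vec n"
    and nil: "A ^\<^sub>m L = 0\<^sub>m n n" and j: "n \<le> j"
  shows "A ^\<^sub>m j *\<^sub>v v = 0\<^sub>v n"
proof -
  obtain a :: "nat \<Rightarrow> real" where aC: "(\<exists>i\<le>n. a i \<noteq> 0) \<and> (\<forall>C m r k. C \<in> carrier_mat m n \<longrightarrow> r < m \<longrightarrow>
    (\<Sum>i\<le>n. a i * (C *\<^sub>v (A ^\<^sub>m (k + i) *\<^sub>v v)) $ r) = 0)"
    using orbit_recurrence[OF A v] by (rule exE)
  note a = conjunct1[OF aC] conjunct2[OF aC]
  define M where "M = (LEAST i. a i \<noteq> 0)"
  have M: "a M \<noteq> 0" "\<And>i. i < M \<Longrightarrow> a i = 0" "M \<le> n"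
    using a(1) LeastI[of "\<lambda>i. a i \<noteq> 0"] not_less_Least[of _ "\<lambda>i. a i \<noteq> 0"]
      Least_le[of "\<lambda>i. a i \<noteq> 0"] unfolding M_def[symmetric] by (auto intro: order_trans)
  have large: "A ^\<^sub>m i *\<^sub>v v = 0\<^sub>v n" if "L \<le> i" for i
  proof -
    have "A ^\<^sub>m i = A ^\<^sub>m L * A ^\<^sub>m (i - L)"
      using pow_mat_add[OF A, of L "i - L"] that by simp
    also have "\<dots> *\<^sub>v v = 0\<^sub>m n n *\<^sub>v (A ^\<^sub>m (i - L) *\<^sub>v v)"
      unfolding nil[symmetric] by (rule assoc_mult_mat_vec[OF pow_carrier_mat[OF A] pow_carrier_mat[OF A] v])
    also have "\<dots> = 0\<^sub>v n"
      by (rule zero_mat_mult_vec[OF mult_mat_vec_carrier[OF pow_carrier_mat[OF A] v]])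
    finally show ?thesis .
  qed
  have "n \<le> i \<Longrightarrow> A ^\<^sub>m i *\<^sub>v v = 0\<^sub>v n" for i
  proof (induction "L - i" arbitrary: i rule: less_induct)
    case less
    show ?case
    proof (cases "L \<le> i")
      case False
      have IH: "A ^\<^sub>m i' *\<^sub>v v = 0\<^sub>v n" if "i < i'" for i'
        using less(1)[of i'] less(2) that False by linarith
      have "(A ^\<^sub>m i *\<^sub>v v) $ r = 0" if r: "r < n" for r
      proof -
        have one: "1\<^sub>m n *\<^sub>v (A ^\<^sub>m l *\<^sub>v v) = A ^\<^sub>m l *\<^sub>v v" for l
          by (rule one_mult_mat_vec[OF mult_mat_vec_carrier[OF pow_carrier_mat[OF A] v]])
        have "0 = (\<Sum>l\<le>n. a l * (A ^\<^sub>m ((i - M) + l) *\<^sub>v v) $ r)"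
          using a(2)[rule_format, OF one_carrier_mat r] by (simp only: one)
        also have "\<dots> = (\<Sum>l\<le>n. if l = M then a M * (A ^\<^sub>m i *\<^sub>v v) $ r else 0)"
        proof (rule sum.cong[OF refl])
          fix l assume "l \<in> {..n}"
          then show "a l * (A ^\<^sub>m ((i - M) + l) *\<^sub>v v) $ r = (if l = M then a M * (A ^\<^sub>m i *\<^sub>v v) $ r else 0)"
            using M less(2) IH[of "(i - M) + l"] r by (cases l M rule: linorder_cases) auto
        qed
        also have "\<dots> = a M * (A ^\<^sub>m i *\<^sub>v v) $ r"
          using M(3) by simp
        finally show ?thesis using M(1) by simp
      qed
      then show ?thesis using A by (intro eq_vecI) auto
    qed (rule large)
  qed
  with j show ?thesis by blast
qed

subsection \<open>Orthogonal complements\<close>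

lemma orthonormal_basis_matD:
  assumes "orthonormal_basis_mat n Z V"
  shows "Z \<in> carrier_mat n (dim_col Z)" "transpose_mat Z * Z = 1\<^sub>m (dim_col Z)" "mat_image Z = V"
  using assms by (auto simp: orthonormal_basis_mat_def)

lemma orthonormal_basis_residual:
  assumes Z: "orthonormal_basis_mat n Z V" and e: "e \<in> carrier_vec n"
  shows "e - Z *\<^sub>v (transpose_mat Z *\<^sub>v e) \<in> orth_compl n V"
proof -
  define d where "d = dim_col Z"
  note Z = orthonormal_basis_matD[OF Z, folded d_def]
  have Zt: "transpose_mat Z \<in> carrier_mat d n" using Z(1) by simp
  let ?r = "e - Z *\<^sub>v (transpose_mat Z *\<^sub>v e)"
  have r: "?r \<in> carrier_vec n" using Z(1) Zt e by simp
  have "transpose_mat Z *\<^sub>v ?r = transpose_mat Z *\<^sub>v e - (transpose_mat Z * Z) *\<^sub>v (transpose_mat Z *\<^sub>v e)"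
    using Z(1) Zt e by (simp add: mult_minus_distrib_mat_vec[OF Zt] assoc_mult_mat_vec[OF Zt Z(1)])
  also have "\<dots> = 0\<^sub>v d" using Z(2) Zt e by simp
  finally have 0: "transpose_mat Z *\<^sub>v ?r = 0\<^sub>v d" .
  have "?r \<bullet> w = 0" if "w \<in> V" for w
  proof -
    from that Z(3) obtain c where c: "c \<in> carrier_vec d" "w = Z *\<^sub>v c"
      by (auto simp: mat_image_def d_def)
    have "?r \<bullet> w = (transpose_mat Z *\<^sub>v ?r) \<bullet> c"
      unfolding c(2) by (rule transpose_vec_mult_scalar[OF Z(1) c(1) r, symmetric])
    with 0 c show ?thesis by simp
  qed
  with r show ?thesis by (simp add: orth_compl_def)
qed

text \<open>Dimensions are avoided: if V is the complement of some R, then R lies in the complement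
  of V, and taking complements reverses this inclusion. This is why the unobservable spaces below
  are written as complements.\<close>

lemma orth_compl_orth_compl:
  assumes "V = orth_compl n R" "R \<subseteq> carrier_vec n"
  shows "orth_compl n (orth_compl n V) \<subseteq> V"
proof
  fix v assume v: "v \<in> orth_compl n (orth_compl n V)"
  have "w \<bullet> u = 0" if "w \<in> R" "u \<in> V" for w u
    using that assms comm_scalar_prod[of w n u] by (auto simp: orth_compl_def)
  then have "R \<subseteq> orth_compl n V"
    using assms(2) by (auto simp: orth_compl_def)
  with v show "v \<in> V"
    unfolding assms(1) by (auto simp: orth_compl_def)
qed

lemma orth_compl_Un: "orth_compl n (R1 \<union> R2) = orth_compl n R1 \<inter> orth_compl n R2"
  by (auto simp: orth_compl_def)

text \<open>The adjoint identity shows that the preimage of a complement is again a complement. Such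
  presentations therefore survive the backward recursion of the unobservable spaces.\<close>

lemma orth_compl_image_transpose:
  assumes B: "B \<in> carrier_mat m n" and R: "R \<subseteq> carrier_vec m"
  shows "{v \<in> carrier_vec n. B *\<^sub>v v \<in> orth_compl m R} = orth_compl n ((\<lambda>w. transpose_mat B *\<^sub>v w) ` R)"
proof -
  have "v \<bullet> (transpose_mat B *\<^sub>v w) = (B *\<^sub>v v) \<bullet> w" if "v \<in> carrier_vec n" "w \<in> R" for v w
  proof -
    have w: "w \<in> carrier_vec m" using that R by blast
    have "v \<bullet> (transpose_mat B *\<^sub>v w) = (transpose_mat B *\<^sub>v w) \<bullet> v"
      using B w that by (intro comm_scalar_prod[of _ n]) auto
    also have "\<dots> = w \<bullet> (B *\<^sub>v v)"
      by (rule transpose_vec_mult_scalar[OF B that(1) w])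
    also have "\<dots> = (B *\<^sub>v v) \<bullet> w"
      using B w that by (intro comm_scalar_prod[of _ m]) auto
    finally show ?thesis .
  qed
  then show ?thesis
    using B by (auto simp: orth_compl_def)
qed

lemma scalar_prod_self_nonneg: "(v :: real vec) \<bullet> v \<ge> 0"
  by (simp add: scalar_prod_def sum_nonneg)

lemma scalar_prod_self_eq_0:
  fixes v :: "real vec"
  assumes "v \<in> carrier_vec n" "v \<bullet> v = 0"
  shows "v = 0\<^sub>v n"
proof (rule eq_vecI)
  fix i assume i: "i < dim_vec (0\<^sub>v n)"
  have "\<forall>i\<in>{0..<dim_vec v}. v $ i * v $ i = 0"
    using assms(2) unfolding scalar_prod_def by (subst (asm) sum_nonneg_eq_0_iff) auto
  with i assms(1) show "v $ i = 0\<^sub>v n $ i" by auto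
qed (use assms in auto)

text \<open>Pythagoras: with orthonormal columns, Z times its transpose is the orthogonal projection
  onto V, and removing a projection cannot increase the length.\<close>

lemma orthonormal_basis_residual_vnorm:
  assumes Z: "orthonormal_basis_mat n Z V" and e: "e \<in> carrier_vec n"
  shows "vnorm (e - Z *\<^sub>v (transpose_mat Z *\<^sub>v e)) \<le> vnorm e"
proof -
  define p where "p = Z *\<^sub>v (transpose_mat Z *\<^sub>v e)"
  define m where "m = dim_col Z"
  note zc = orthonormal_basis_matD[OF Z, folded m_def]
  have Zt: "transpose_mat Z \<in> carrier_mat m n" using zc(1) by simp
  have p: "p \<in> carrier_vec n" using zc(1) e Zt by (simp add: p_def)
  have "p \<in> V" unfolding p_def zc(3)[symmetric] mat_image_def m_def[symmetric]
    using Zt e by (intro imageI) simp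
  with orthonormal_basis_residual[OF Z e] have 0: "(e - p) \<bullet> p = 0"
    by (simp add: orth_compl_def p_def)
  define d where "d = e - p"
  have d: "d \<in> carrier_vec n" using e p by (simp add: d_def)
  have ed: "e = d + p" using e p by (intro eq_vecI) (auto simp: d_def)
  have dp: "d \<bullet> p = 0" "p \<bullet> d = 0" using 0 d p by (simp_all add: d_def comm_scalar_prod[of p n])
  have "e \<bullet> e = d \<bullet> d + p \<bullet> p"
    unfolding ed using d p dp
    by (simp add: add_scalar_prod_distrib[of _ n] scalar_prod_add_distrib[of _ n])
  then show ?thesis
    using scalar_prod_self_nonneg[of p] by (simp add: vnorm_def d_def p_def)
qed

subsection \<open>Matrix exponential\<close>

text \<open>Time is a separate argument, so that each entry is a power series in t and can be
  differentiated termwise.\<close>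

definition mexp :: "real mat \<Rightarrow> real \<Rightarrow> real mat" where
  "mexp A t = mat_exp (t \<cdot>\<^sub>m A)"

lemma smult_pow_mat:
  fixes A :: "real mat"
  assumes "A \<in> carrier_mat n n"
  shows "(t \<cdot>\<^sub>m A) ^\<^sub>m l = t ^ l \<cdot>\<^sub>m A ^\<^sub>m l"
proof (induction l)
  case 0
  show ?case by (rule eq_matI) auto
next
  case (Suc l)
  have "(t ^ l \<cdot>\<^sub>m A ^\<^sub>m l) * (t \<cdot>\<^sub>m A) = (t ^ l * t) \<cdot>\<^sub>m (A ^\<^sub>m l * A)"
    using assms by (intro eq_matI) (auto simp: mult_smult_assoc_mat[of _ n n _ n] mult_smult_distrib[of _ n n _ n])
  with Suc show ?case by (simp add: mult.commute)
qed

lemma mexp_carrier: "A \<in> carrier_mat n n \<Longrightarrow> mexp A t \<in> carrier_mat n n"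
  by (simp add: mexp_def mat_exp_def)

lemma mexp_nth:
  assumes "A \<in> carrier_mat n n" "i < n" "j < n"
  shows "mexp A t $$ (i, j) = (\<Sum>l. (A ^\<^sub>m l) $$ (i, j) / fact l * t ^ l)"
  using assms by (simp add: mexp_def mat_exp_def smult_pow_mat mult.commute)

lemma pow_mat_nth_bound:
  fixes A :: "real mat"
  assumes A: "A \<in> carrier_mat n n"
  shows "\<exists>K. \<forall>l i j. i < n \<longrightarrow> j < n \<longrightarrow> \<bar>(A ^\<^sub>m l) $$ (i, j)\<bar> \<le> K ^ l"
proof -
  define M where "M = (\<Sum>k<n. \<Sum>j<n. \<bar>A $$ (k, j)\<bar>)"
  have M: "\<bar>A $$ (k, j)\<bar> \<le> M" if "k < n" "j < n" for k j
  proof -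
    have "\<bar>A $$ (k, j)\<bar> \<le> (\<Sum>j<n. \<bar>A $$ (k, j)\<bar>)"
      using that by (intro member_le_sum) auto
    also have "\<dots> \<le> M"
      unfolding M_def using that by (intro member_le_sum[of k _ "\<lambda>k. \<Sum>j<n. \<bar>A $$ (k, j)\<bar>"]) (auto intro: sum_nonneg)
    finally show ?thesis .
  qed
  show ?thesis
  \<comment> \<open>M bounds every entry, and each further factor A sums n products, whence n * M
    per power.\<close>
  proof (intro exI[of _ "real n * M"] allI impI)
    fix l i j :: nat assume "i < n" "j < n"
    then show "\<bar>(A ^\<^sub>m l) $$ (i, j)\<bar> \<le> (real n * M) ^ l"
    proof (induction l arbitrary: j)
      case 0
      then show ?case using A by simp
    next
      case (Suc l)
      have "\<bar>(A ^\<^sub>m Suc l) $$ (i, j)\<bar> = \<bar>\<Sum>k<n. (A ^\<^sub>m l) $$ (i, k) * A $$ (k, j)\<bar>"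
        unfolding pow_mat.simps by (subst mult_mat_nth[OF pow_carrier_mat[OF A] A]) (use Suc.prems in simp_all)
      also have "\<dots> \<le> (\<Sum>k<n. \<bar>(A ^\<^sub>m l) $$ (i, k) * A $$ (k, j)\<bar>)"
        by (rule sum_abs)
      also have "\<dots> \<le> (\<Sum>k<n. (real n * M) ^ l * M)"
      proof (rule sum_mono)
        fix k assume "k \<in> {..<n}"
        then have "\<bar>(A ^\<^sub>m l) $$ (i, k)\<bar> \<le> (real n * M) ^ l" "\<bar>A $$ (k, j)\<bar> \<le> M"
          using Suc M by auto
        then show "\<bar>(A ^\<^sub>m l) $$ (i, k) * A $$ (k, j)\<bar> \<le> (real n * M) ^ l * M"
          unfolding abs_mult by (intro mult_mono) auto
      qed
      also have "\<dots> = (real n * M) ^ Suc l" by simp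
      finally show ?case .
    qed
  qed
qed

lemma mexp_summable:
  fixes A :: "real mat"
  assumes A: "A \<in> carrier_mat n n" "i < n" "j < n"
  shows "summable (\<lambda>l. (A ^\<^sub>m l) $$ (i, j) / fact l * t ^ l)"
proof -
  obtain K where K: "\<forall>l i j. i < n \<longrightarrow> j < n \<longrightarrow> \<bar>(A ^\<^sub>m l) $$ (i, j)\<bar> \<le> K ^ l"
    using pow_mat_nth_bound[OF A(1)] by (elim exE) (rule that)
  show ?thesis
  proof (rule summable_comparison_test'[OF summable_exp[of "K * \<bar>t\<bar>"], of 0])
    fix l
    have "\<bar>(A ^\<^sub>m l) $$ (i, j)\<bar> / fact l * \<bar>t\<bar> ^ l \<le> K ^ l / fact l * \<bar>t\<bar> ^ l"
      by (intro mult_right_mono divide_right_mono K[rule_format] A) auto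
    then show "norm ((A ^\<^sub>m l) $$ (i, j) / fact l * t ^ l) \<le> inverse (fact l) * (K * \<bar>t\<bar>) ^ l"
      by (simp add: abs_mult power_abs power_mult_distrib field_simps)
  qed
qed

lemma mexp_has_derivative_suminf:
  assumes A: "A \<in> carrier_mat n n" "i < n" "j < n"
  shows "((\<lambda>t. mexp A t $$ (i, j)) has_real_derivative
    (\<Sum>l. (A ^\<^sub>m Suc l) $$ (i, j) / fact l * t ^ l)) (at t)"
proof -
  have "diffs (\<lambda>l. (A ^\<^sub>m l) $$ (i, j) / fact l) = (\<lambda>l. (A ^\<^sub>m Suc l) $$ (i, j) / fact l)"
    by (rule ext) (simp add: diffs_def field_simps del: pow_mat.simps of_nat_Suc)
  with termdiffs_strong_converges_everywhere[of "\<lambda>l. (A ^\<^sub>m l) $$ (i, j) / fact l" t, OF mexp_summable[OF A]]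
  show ?thesis
    by (simp add: mexp_nth[OF A] del: pow_mat.simps)
qed

text \<open>Splitting off a factor A on either side of the power gives the two forms. With both at
  hand the inverse formula is a plain product rule, without a separate proof that A commutes with
  its exponential.\<close>

lemma mexp_has_derivative:
  assumes A: "A \<in> carrier_mat n n" "i < n" "j < n"
  shows "((\<lambda>t. mexp A t $$ (i, j)) has_real_derivative (A * mexp A t) $$ (i, j)) (at t)"
    and "((\<lambda>t. mexp A t $$ (i, j)) has_real_derivative (mexp A t * A) $$ (i, j)) (at t)"
proof -
  have "(A ^\<^sub>m Suc l) $$ (i, j) = (\<Sum>k<n. A $$ (i, k) * (A ^\<^sub>m l) $$ (k, j))" for l
    unfolding pow_mat_Suc_left[OF A(1)] by (rule mult_mat_nth[OF A(1) pow_carrier_mat[OF A(1)] A(2,3)])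
  then have "(\<lambda>l. (A ^\<^sub>m Suc l) $$ (i, j) / fact l * t ^ l) =
      (\<lambda>l. \<Sum>k<n. A $$ (i, k) * ((A ^\<^sub>m l) $$ (k, j) / fact l * t ^ l))"
    by (simp add: sum_divide_distrib sum_distrib_right mult.assoc del: pow_mat.simps)
  then have "(\<Sum>l. (A ^\<^sub>m Suc l) $$ (i, j) / fact l * t ^ l) =
      (\<Sum>k<n. \<Sum>l. A $$ (i, k) * ((A ^\<^sub>m l) $$ (k, j) / fact l * t ^ l))"
    using A by (simp only:, intro suminf_sum summable_mult mexp_summable) auto
  also have "\<dots> = (\<Sum>k<n. A $$ (i, k) * mexp A t $$ (k, j))"
  proof (rule sum.cong[OF refl])
    fix k assume "k \<in> {..<n}"
    then have k: "k < n" by simp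
    show "(\<Sum>l. A $$ (i, k) * ((A ^\<^sub>m l) $$ (k, j) / fact l * t ^ l)) = A $$ (i, k) * mexp A t $$ (k, j)"
      unfolding mexp_nth[OF A(1) k A(3)] by (rule suminf_mult[OF mexp_summable[OF A(1) k A(3)]])
  qed
  also have "\<dots> = (A * mexp A t) $$ (i, j)"
    by (rule mult_mat_nth[OF A(1) mexp_carrier[OF A(1)] A(2,3), symmetric])
  finally have eq: "(\<Sum>l. (A ^\<^sub>m Suc l) $$ (i, j) / fact l * t ^ l) = (A * mexp A t) $$ (i, j)" .
  show "((\<lambda>t. mexp A t $$ (i, j)) has_real_derivative (A * mexp A t) $$ (i, j)) (at t)"
    using mexp_has_derivative_suminf[OF A, of t] unfolding eq .
  have "(A ^\<^sub>m Suc l) $$ (i, j) = (\<Sum>k<n. A $$ (k, j) * (A ^\<^sub>m l) $$ (i, k))" for l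
    unfolding pow_mat.simps mult_mat_nth[OF pow_carrier_mat[OF A(1)] A] by (simp add: mult.commute)
  then have "(\<lambda>l. (A ^\<^sub>m Suc l) $$ (i, j) / fact l * t ^ l) =
      (\<lambda>l. \<Sum>k<n. A $$ (k, j) * ((A ^\<^sub>m l) $$ (i, k) / fact l * t ^ l))"
    by (simp add: sum_divide_distrib sum_distrib_right mult.assoc del: pow_mat.simps)
  then have "(\<Sum>l. (A ^\<^sub>m Suc l) $$ (i, j) / fact l * t ^ l) =
      (\<Sum>k<n. \<Sum>l. A $$ (k, j) * ((A ^\<^sub>m l) $$ (i, k) / fact l * t ^ l))"
    using A by (simp only:, intro suminf_sum summable_mult mexp_summable) auto
  also have "\<dots> = (\<Sum>k<n. A $$ (k, j) * mexp A t $$ (i, k))"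
  proof (rule sum.cong[OF refl])
    fix k assume "k \<in> {..<n}"
    then have k: "k < n" by simp
    show "(\<Sum>l. A $$ (k, j) * ((A ^\<^sub>m l) $$ (i, k) / fact l * t ^ l)) = A $$ (k, j) * mexp A t $$ (i, k)"
      unfolding mexp_nth[OF A(1,2) k] by (rule suminf_mult[OF mexp_summable[OF A(1,2) k]])
  qed
  also have "\<dots> = (mexp A t * A) $$ (i, j)"
    unfolding mult_mat_nth[OF mexp_carrier[OF A(1)] A] by (simp add: mult.commute)
  finally have eq: "(\<Sum>l. (A ^\<^sub>m Suc l) $$ (i, j) / fact l * t ^ l) = (mexp A t * A) $$ (i, j)" .
  show "((\<lambda>t. mexp A t $$ (i, j)) has_real_derivative (mexp A t * A) $$ (i, j)) (at t)"
    using mexp_has_derivative_suminf[OF A, of t] unfolding eq .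
qed

lemma mexp_0:
  assumes A: "A \<in> carrier_mat n n"
  shows "mexp A 0 = 1\<^sub>m n"
proof (rule eq_matI)
  fix i j assume "i < dim_row (1\<^sub>m n)" "j < dim_col (1\<^sub>m n)"
  then have ij: "i < n" "j < n" by auto
  have "mexp A 0 $$ (i, j) = (A ^\<^sub>m 0) $$ (i, j) / fact 0"
    unfolding mexp_nth[OF A ij] by (rule powser_zero)
  then show "mexp A 0 $$ (i, j) = 1\<^sub>m n $$ (i, j)" using A ij by simp
qed (use mexp_carrier[OF A] in auto)

lemma mexp_minus_mult:
  assumes A: "A \<in> carrier_mat n n"
  shows "mexp A (- t) * mexp A t = 1\<^sub>m n"
proof (rule eq_matI)
  note cE = mexp_carrier[OF A]
  fix i j assume "i < dim_row (1\<^sub>m n)" "j < dim_col (1\<^sub>m n)"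
  then have ij: "i < n" "j < n" by auto
  define h where "h t = (mexp A (- t) * mexp A t) $$ (i, j)" for t
  have h: "h = (\<lambda>t. \<Sum>k<n. mexp A (- t) $$ (i, k) * mexp A t $$ (k, j))"
    using ij by (simp add: h_def mult_mat_nth[OF cE cE] fun_eq_iff)
  have "(h has_real_derivative 0) (at t)" for t
  proof -
    have "(h has_real_derivative (\<Sum>k<n. mexp A (- t) $$ (i, k) * (A * mexp A t) $$ (k, j) +
        - (mexp A (- t) * A) $$ (i, k) * mexp A t $$ (k, j))) (at t)"
      unfolding h
    proof (intro DERIV_sum DERIV_mult')
      fix k assume "k \<in> {..<n}"
      then have k: "k < n" by simp
      show "((\<lambda>t. mexp A t $$ (k, j)) has_real_derivative (A * mexp A t) $$ (k, j)) (at t)"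
        by (rule mexp_has_derivative(1)[OF A k ij(2)])
      have "((\<lambda>t. mexp A (- t) $$ (i, k)) has_real_derivative (mexp A (- t) * A) $$ (i, k) * - 1) (at t)"
        by (rule DERIV_chain2[where f = "\<lambda>t. mexp A t $$ (i, k)", OF mexp_has_derivative(2)[OF A ij(1) k]])
          (auto intro!: derivative_eq_intros)
      then show "((\<lambda>t. mexp A (- t) $$ (i, k)) has_real_derivative - (mexp A (- t) * A) $$ (i, k)) (at t)"
        by simp
    qed
    also have "(\<Sum>k<n. mexp A (- t) $$ (i, k) * (A * mexp A t) $$ (k, j) +
        - (mexp A (- t) * A) $$ (i, k) * mexp A t $$ (k, j)) =
        (mexp A (- t) * (A * mexp A t)) $$ (i, j) - ((mexp A (- t) * A) * mexp A t) $$ (i, j)"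
      unfolding mult_mat_nth[OF cE mult_carrier_mat[OF A cE] ij] mult_mat_nth[OF mult_carrier_mat[OF cE A] cE ij]
      by (simp add: sum_subtractf del: index_mult_mat)
    also have "\<dots> = 0"
      using A cE by (simp add: assoc_mult_mat[of _ n n _ n _ n])
    finally show ?thesis .
  qed
  then have "h t = h 0" by (intro DERIV_isconst_all) blast
  also have "h 0 = 1\<^sub>m n $$ (i, j)"
    using A by (simp add: h_def mexp_0)
  finally show "(mexp A (- t) * mexp A t) $$ (i, j) = 1\<^sub>m n $$ (i, j)"
    by (simp add: h_def)
qed (use mexp_carrier[OF A] in auto)

lemma mexp_mult_minus:
  "A \<in> carrier_mat n n \<Longrightarrow> mexp A t * mexp A (- t) = 1\<^sub>m n"
  using mexp_minus_mult[of A n "- t"] by simp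

lemma mult_mat_vec_has_derivative:
  assumes "A \<in> carrier_mat m n" "\<And>u. f u \<in> carrier_vec n" "f' \<in> carrier_vec n"
    and "\<And>k. k < n \<Longrightarrow> ((\<lambda>u. f u $ k) has_real_derivative f' $ k) (at s within S)" and "i < m"
  shows "((\<lambda>u. (A *\<^sub>v f u) $ i) has_real_derivative (A *\<^sub>v f') $ i) (at s within S)"
proof -
  have "((\<lambda>u. \<Sum>k<n. A $$ (i, k) * f u $ k) has_real_derivative (\<Sum>k<n. A $$ (i, k) * f' $ k))
      (at s within S)"
    by (intro DERIV_sum DERIV_cmult) (simp add: assms(4))
  then show ?thesis
    by (simp add: mult_mat_vec_nth[OF assms(1,2,5)] mult_mat_vec_nth[OF assms(1,3,5)])
qed

lemma mexp_mult_vec_has_derivative: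
  assumes A: "A \<in> carrier_mat n n" and v: "v \<in> carrier_vec n" and i: "i < n"
  shows "((\<lambda>s. (mexp A (s - a) *\<^sub>v v) $ i) has_real_derivative (A *\<^sub>v (mexp A (s - a) *\<^sub>v v)) $ i) (at s)"
proof -
  note cE = mexp_carrier[OF A]
  have "((\<lambda>s. \<Sum>k<n. mexp A (s - a) $$ (i, k) * v $ k) has_real_derivative
      (\<Sum>k<n. (A * mexp A (s - a)) $$ (i, k) * v $ k)) (at s)"
  proof (intro DERIV_sum DERIV_cmult_right)
    fix k assume "k \<in> {..<n}"
    then have k: "k < n" by simp
    have "((\<lambda>s. mexp A (s - a) $$ (i, k)) has_real_derivative (A * mexp A (s - a)) $$ (i, k) * 1) (at s)"
      by (rule DERIV_chain2[where f = "\<lambda>t. mexp A t $$ (i, k)", OF mexp_has_derivative(1)[OF A i k]])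
        (auto intro!: derivative_eq_intros)
    then show "((\<lambda>s. mexp A (s - a) $$ (i, k)) has_real_derivative (A * mexp A (s - a)) $$ (i, k)) (at s)"
      by simp
  qed
  also have "(\<Sum>k<n. (A * mexp A (s - a)) $$ (i, k) * v $ k) = ((A * mexp A (s - a)) *\<^sub>v v) $ i"
    using A cE v i by (intro mult_mat_vec_nth[symmetric]) auto
  also have "(A * mexp A (s - a)) *\<^sub>v v = A *\<^sub>v (mexp A (s - a) *\<^sub>v v)"
    by (rule assoc_mult_mat_vec[OF A cE v])
  finally show ?thesis
    by (simp add: mult_mat_vec_nth[OF cE v i])
qed

lemma linear_ode_unique:
  assumes A: "A \<in> carrier_mat n n" and f: "\<And>s. f s \<in> carrier_vec n" and ab: "a \<le> b"
    and fin: "finite K"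
    and cont: "\<And>i. i < n \<Longrightarrow> continuous_on {a..b} (\<lambda>s. f s $ i)"
    and der: "\<And>s i. a < s \<Longrightarrow> s < b \<Longrightarrow> s \<notin> K \<Longrightarrow> i < n \<Longrightarrow>
      ((\<lambda>s. f s $ i) has_real_derivative (A *\<^sub>v f s) $ i) (at s)"
  shows "f b = mexp A (b - a) *\<^sub>v f a"
proof -
  note cE = mexp_carrier[OF A]
  have dE: "((\<lambda>s. mexp A (a - s) $$ (i, k)) has_real_derivative - (mexp A (a - s) * A) $$ (i, k)) (at s)"
    if "i < n" "k < n" for i k s
  proof -
    have "((\<lambda>s. mexp A (a - s) $$ (i, k)) has_real_derivative (mexp A (a - s) * A) $$ (i, k) * - 1) (at s)"
      by (rule DERIV_chain2[where f = "\<lambda>t. mexp A t $$ (i, k)", OF mexp_has_derivative(2)[OF A that]])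
        (auto intro!: derivative_eq_intros)
    then show ?thesis by simp
  qed
  have comp: "(mexp A (a - b) *\<^sub>v f b) $ i = f a $ i" if i: "i < n" for i
  proof -
    define h where "h s = (\<Sum>k<n. mexp A (a - s) $$ (i, k) * f s $ k)" for s
    have hv: "h s = (mexp A (a - s) *\<^sub>v f s) $ i" for s
      unfolding h_def using mult_mat_vec_nth[OF cE f i] by simp
    have "((\<lambda>_. 0) has_integral (h b - h a)) {a..b}"
    proof (rule fundamental_theorem_of_calculus_interior_strong[OF fin ab])
      show "continuous_on {a..b} h"
        unfolding h_def
        by (intro continuous_on_sum continuous_on_mult cont)
          (auto intro!: continuous_at_imp_continuous_on DERIV_isCont[OF dE] i)
      fix s assume s: "s \<in> {a<..<b} - K"
      have "(h has_real_derivative (\<Sum>k<n. mexp A (a - s) $$ (i, k) * (A *\<^sub>v f s) $ k +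
          - (mexp A (a - s) * A) $$ (i, k) * f s $ k)) (at s)"
        unfolding h_def by (intro DERIV_sum DERIV_mult' dE der) (use s i in auto)
      also have "(\<Sum>k<n. mexp A (a - s) $$ (i, k) * (A *\<^sub>v f s) $ k +
          - (mexp A (a - s) * A) $$ (i, k) * f s $ k) =
          (mexp A (a - s) *\<^sub>v (A *\<^sub>v f s)) $ i - ((mexp A (a - s) * A) *\<^sub>v f s) $ i"
        using mult_mat_vec_nth[OF cE mult_mat_vec_carrier[OF A f] i, of "a - s" s]
          mult_mat_vec_nth[OF mult_carrier_mat[OF cE A] f i, of "a - s" s]
        by (simp add: sum_subtractf del: assoc_mult_mat_vec index_mult_mat_vec index_mult_mat)
      also have "\<dots> = 0"
        using assoc_mult_mat_vec[OF cE A f] by simp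
      finally show "(h has_vector_derivative 0) (at s)"
        by (simp add: has_real_derivative_iff_has_vector_derivative)
    qed
    then have "h b - h a = 0"
      using has_integral_0_eq by blast
    then show ?thesis
      using f[of a] A i by (simp add: hv mexp_0)
  qed
  have "mexp A (a - b) *\<^sub>v f b = f a"
    using comp f[of a] cE[of "a - b"] by (intro eq_vecI) auto
  then have "mexp A (b - a) *\<^sub>v f a = (mexp A (b - a) * mexp A (- (b - a))) *\<^sub>v f b"
    using assoc_mult_mat_vec[OF cE cE f, of "b - a" "a - b" b] by simp
  also have "\<dots> = f b"
    using f[of b] by (simp only: mexp_mult_minus[OF A] one_mult_mat_vec)
  finally show ?thesis by simp
qed

subsection \<open>The algebra of a mode\<close>

text \<open>\<open>X\<close> is \<open>T * S\<close>: multiplying the DAE by \<open>X\<close> separates its differential and algebraic parts.\<close>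

definition mode_algebra :: "nat \<Rightarrow> real mat \<Rightarrow> real mat \<Rightarrow> real mat \<Rightarrow> real mat \<Rightarrow> real mat \<Rightarrow>
    real mat \<Rightarrow> real mat \<Rightarrow> bool" where
  "mode_algebra n E A P Ad Ei X Y \<longleftrightarrow>
     E \<in> carrier_mat n n \<and> A \<in> carrier_mat n n \<and> P \<in> carrier_mat n n \<and> Ad \<in> carrier_mat n n \<and>
     Ei \<in> carrier_mat n n \<and> X \<in> carrier_mat n n \<and> Y \<in> carrier_mat n n \<and>
     X * E = P + Ei \<and> X * A = Ad + (1\<^sub>m n - P) \<and> Y * X = 1\<^sub>m n \<and>
     P * P = P \<and> P * Ad = Ad \<and> Ad * P = Ad \<and> P * Ei = 0\<^sub>m n n \<and> Ei * P = 0\<^sub>m n n \<and>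
     (\<exists>L. Ei ^\<^sub>m L = 0\<^sub>m n n)"

text \<open>\<open>mat_inv\<close> is a definite description, so existence alone is not enough:
  two-sided inverses are unique by associativity.\<close>

lemma mat_inv:
  assumes T: "T \<in> carrier_mat n n" "invertible_mat T"
  shows "mat_inv T \<in> carrier_mat n n" "T * mat_inv T = 1\<^sub>m n" "mat_inv T * T = 1\<^sub>m n"
proof -
  obtain R where R: "inverts_mat T R" "inverts_mat R T"
    using T(2) by (auto simp: invertible_mat_def)
  have cR: "R' \<in> carrier_mat n n" if "inverts_mat T R'" "inverts_mat R' T" for R'
  proof -
    have "dim_col (T * R') = n" "dim_col (R' * T) = dim_row R'"
      using that T(1) by (simp_all only: inverts_mat_def index_one_mat carrier_matD)
    then show ?thesis using T(1) by auto
  qed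
  have "mat_inv T = R"
    unfolding mat_inv_def
  proof (rule the_equality)
    show "inverts_mat T R \<and> inverts_mat R T" using R ..
    fix R' assume R': "inverts_mat T R' \<and> inverts_mat R' T"
    have c: "R \<in> carrier_mat n n" "R' \<in> carrier_mat n n"
      using cR R R' by auto
    have "R' = R' * (T * R)"
      using R(1) c T(1) by (simp add: inverts_mat_def)
    also have "\<dots> = (R' * T) * R"
      by (rule assoc_mult_mat[symmetric, OF c(2) T(1) c(1)])
    also have "\<dots> = R"
      using R' c by (simp add: inverts_mat_def)
    finally show "R' = R" .
  qed
  then show "mat_inv T \<in> carrier_mat n n" "T * mat_inv T = 1\<^sub>m n" "mat_inv T * T = 1\<^sub>m n"
    using R cR[OF R] T(1) by (auto simp: inverts_mat_def)
qed

lemma conjugate_mult: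
  assumes "T \<in> carrier_mat n n" "R \<in> carrier_mat n n" "R * T = 1\<^sub>m n"
    "U \<in> carrier_mat n n" "V \<in> carrier_mat n n"
  shows "(T * U * R) * (T * V * R) = T * (U * V) * (R :: real mat)"
proof -
  note c = mult_carrier_mat[of _ n n _ n] and a = assoc_mult_mat[of _ n n _ n _ n]
  have "R * (T * V * R) = R * (T * (V * R))"
    using assms by (simp add: a)
  also have "\<dots> = (R * T) * (V * R)"
    by (rule a[symmetric]) (intro c assms)+
  also have "\<dots> = V * R"
    unfolding assms(3) by (rule left_mult_one_mat[of _ n n]) (intro c assms)+
  finally have 1: "R * (T * V * R) = V * R" .
  have "(T * U * R) * (T * V * R) = T * U * (R * (T * V * R))"
    by (rule a) (intro c assms)+
  also have "\<dots> = T * (U * V) * R"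
    unfolding 1 using assms by (simp add: a c)
  finally show ?thesis .
qed

text \<open>All three matrices are conjugates by T of block-diagonal ones, so their products reduce
  to products of blocks; X = T S carries E and A to sums of such conjugates.\<close>

lemma mode_matrices_algebra:
  assumes "mode_matrices n E A P Ad Ei" "E \<in> carrier_mat n n" "A \<in> carrier_mat n n"
  shows "\<exists>X Y. mode_algebra n E A P Ad Ei X Y"
proof -
  from assms(1) obtain S T r J N where
    S: "S \<in> carrier_mat n n" "invertible_mat S" and T: "T \<in> carrier_mat n n" "invertible_mat T"
    and r: "r \<le> n" and J: "J \<in> carrier_mat r r" and N: "N \<in> carrier_mat (n - r) (n - r)" "nilpotent_mat N"
    and SET: "S * E * T = four_block_mat (1\<^sub>m r) (0\<^sub>m r (n - r)) (0\<^sub>m (n - r) r) N"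
    and SAT: "S * A * T = four_block_mat J (0\<^sub>m r (n - r)) (0\<^sub>m (n - r) r) (1\<^sub>m (n - r))"
    and P: "P = T * four_block_mat (1\<^sub>m r) (0\<^sub>m r (n - r)) (0\<^sub>m (n - r) r) (0\<^sub>m (n - r) (n - r)) * mat_inv T"
    and Ad: "Ad = T * four_block_mat J (0\<^sub>m r (n - r)) (0\<^sub>m (n - r) r) (0\<^sub>m (n - r) (n - r)) * mat_inv T"
    and Ei: "Ei = T * four_block_mat (0\<^sub>m r r) (0\<^sub>m r (n - r)) (0\<^sub>m (n - r) r) N * mat_inv T"
    unfolding mode_matrices_def quasi_weierstrass_def Let_def by blast
  define m where "m = n - r"
  define R where "R = mat_inv T"
  define blk where "blk U V = four_block_mat U (0\<^sub>m r m) (0\<^sub>m m r) V" for U V :: "real mat"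
  have n: "n = r + m" using r by (simp add: m_def)
  have cblk: "blk U V \<in> carrier_mat n n" if "U \<in> carrier_mat r r" "V \<in> carrier_mat m m" for U V
    using that unfolding blk_def n by (rule four_block_carrier_mat)
  have mblk: "blk U V * blk U' V' = blk (U * U') (V * V')"
    if "U \<in> carrier_mat r r" "V \<in> carrier_mat m m" "U' \<in> carrier_mat r r" "V' \<in> carrier_mat m m" for U V U' V'
    unfolding blk_def by (subst mult_four_block_mat[of _ r r _ m _ m _ _ r _ m]) (use that in auto)
  have ablk: "blk U V + blk U' V' = blk (U + U') (V + V')"
    if "U \<in> carrier_mat r r" "V \<in> carrier_mat m m" "U' \<in> carrier_mat r r" "V' \<in> carrier_mat m m" for U V U' V'
    unfolding blk_def by (subst add_four_block_mat[of _ r r _ m _ m]) (use that in auto)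
  have one: "blk (1\<^sub>m r) (1\<^sub>m m) = 1\<^sub>m n" "blk (0\<^sub>m r r) (0\<^sub>m m m) = 0\<^sub>m n n"
    unfolding blk_def n by simp_all
  note R = mat_inv[OF T, folded R_def]
  have N': "N \<in> carrier_mat m m" using N by (simp add: m_def)
  have PAE: "P = T * blk (1\<^sub>m r) (0\<^sub>m m m) * R" "Ad = T * blk J (0\<^sub>m m m) * R" "Ei = T * blk (0\<^sub>m r r) N * R"
    unfolding P Ad Ei R_def blk_def m_def by simp_all
  have cb: "blk (1\<^sub>m r) (0\<^sub>m m m) \<in> carrier_mat n n" "blk J (0\<^sub>m m m) \<in> carrier_mat n n"
    "blk (0\<^sub>m r r) N \<in> carrier_mat n n" "blk (0\<^sub>m r r) (1\<^sub>m m) \<in> carrier_mat n n"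
    by (intro cblk; use J N' in simp)+
  have conj_c: "T * U * R \<in> carrier_mat n n" if "U \<in> carrier_mat n n" for U
    using that T R by simp
  have conj_add: "T * U * R + T * V * R = T * (U + V) * R" if "U \<in> carrier_mat n n" "V \<in> carrier_mat n n" for U V
    using that T R by (simp add: mult_add_distrib_mat[of T n n _ n] add_mult_distrib_mat[of _ n n _ _ n])
  have conj_one: "T * 1\<^sub>m n * R = 1\<^sub>m n" using T R by simp
  have conj_zero: "T * 0\<^sub>m n n * R = 0\<^sub>m n n" using T R by simp
  define X where "X = T * S"
  define Y where "Y = mat_inv S * R"
  note Si = mat_inv[OF S]
  have X: "X * B = T * (S * B * T) * R" if "B \<in> carrier_mat n n" for B
  proof -
    have "T * (S * B * T) * R = T * (S * (B * (T * R)))"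
      using T R S that by (simp add: assoc_mult_mat[of _ n n _ n _ n] mult_carrier_mat[of _ n n _ n] del: R(2))
    also have "\<dots> = X * B"
      using T R S that by (simp add: X_def assoc_mult_mat[of _ n n _ n _ n])
    finally show ?thesis ..
  qed
  have "X * E = T * blk (1\<^sub>m r) N * R"
    unfolding X[OF assms(2)] SET blk_def m_def ..
  also have "blk (1\<^sub>m r) N = blk (1\<^sub>m r) (0\<^sub>m m m) + blk (0\<^sub>m r r) N"
    using N' by (subst ablk) auto
  finally have XE: "X * E = P + Ei"
    unfolding PAE conj_add[OF cb(1,3)] .
  have "1\<^sub>m n = P + T * blk (0\<^sub>m r r) (1\<^sub>m m) * R"
    unfolding PAE conj_add[OF cb(1,4)] by (subst ablk) (simp_all add: one conj_one)
  then have Q: "T * blk (0\<^sub>m r r) (1\<^sub>m m) * R = 1\<^sub>m n - P"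
    using conj_c[OF cb(4)] conj_c[OF cb(1)] by (auto simp: PAE intro!: eq_matI)
  have "X * A = T * blk J (1\<^sub>m m) * R"
    unfolding X[OF assms(3)] SAT blk_def m_def ..
  also have "blk J (1\<^sub>m m) = blk J (0\<^sub>m m m) + blk (0\<^sub>m r r) (1\<^sub>m m)"
    using J by (subst ablk) auto
  finally have XA: "X * A = Ad + (1\<^sub>m n - P)"
    unfolding Q[symmetric] PAE(2) conj_add[OF cb(2,4)] .
  have "Y * X = mat_inv S * ((R * T) * S)"
    using T R(1) S Si(1) unfolding X_def Y_def
    by (simp add: assoc_mult_mat[of _ n n _ n _ n] mult_carrier_mat[of _ n n _ n])
  then have YX: "Y * X = 1\<^sub>m n"
    using R(3) S Si by simp
  obtain L where L: "N ^\<^sub>m L = 0\<^sub>m m m"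
    using N N' unfolding nilpotent_mat_def by auto
  \<comment> \<open>Only positive powers have this block form, since the zeroth power has an
    identity in the upper left block as well.\<close>
  have pow: "Ei ^\<^sub>m Suc k = T * blk (0\<^sub>m r r) (N ^\<^sub>m Suc k) * R" for k
  proof (induction k)
    case 0
    show ?case using N' conj_c[OF cb(3)] by (simp add: PAE(3))
  next
    case (Suc k)
    have "Ei ^\<^sub>m Suc (Suc k) = (T * blk (0\<^sub>m r r) (N ^\<^sub>m Suc k) * R) * (T * blk (0\<^sub>m r r) N * R)"
      using Suc by (simp add: PAE(3))
    also have "\<dots> = T * (blk (0\<^sub>m r r) (N ^\<^sub>m Suc k) * blk (0\<^sub>m r r) N) * R"
      using N' by (intro conjugate_mult[OF T(1) R(1,3)] cblk) (auto simp del: pow_mat.simps)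
    also have "blk (0\<^sub>m r r) (N ^\<^sub>m Suc k) * blk (0\<^sub>m r r) N = blk (0\<^sub>m r r) (N ^\<^sub>m Suc (Suc k))"
      using N' by (subst mblk) (auto simp del: pow_mat.simps(2) simp: pow_mat.simps(2)[of N "Suc k"])
    finally show ?case .
  qed
  have cm: "(T * blk U V * R) * (T * blk U' V' * R) = T * blk (U * U') (V * V') * R"
    if "U \<in> carrier_mat r r" "V \<in> carrier_mat m m" "U' \<in> carrier_mat r r" "V' \<in> carrier_mat m m"
    for U V U' V'
    unfolding mblk[OF that, symmetric] by (intro conjugate_mult[OF T(1) R(1,3)] cblk that)
  have "Ei ^\<^sub>m Suc L = 0\<^sub>m n n"
    unfolding pow using L N' by (simp add: one conj_zero)
  moreover note assms(2,3) XE XA YX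
  moreover have "P \<in> carrier_mat n n" "Ad \<in> carrier_mat n n" "Ei \<in> carrier_mat n n"
    unfolding PAE by (intro conj_c cb)+
  moreover have "X \<in> carrier_mat n n" "Y \<in> carrier_mat n n"
    using T R S Si by (auto simp: X_def Y_def)
  moreover have "P * P = P"
    unfolding PAE by (subst cm) simp_all
  moreover have "P * Ad = Ad" "Ad * P = Ad"
    unfolding PAE using J by (subst cm; simp)+
  moreover have "P * Ei = 0\<^sub>m n n" "Ei * P = 0\<^sub>m n n"
    unfolding PAE using N' by (subst cm; simp add: one conj_zero)+
  ultimately show ?thesis
    unfolding mode_algebra_def by blast
qed

section \<open>Vectors of distributions in coordinates\<close>

definition vrep :: "nat \<Rightarrow> distr vec \<Rightarrow> (real \<Rightarrow> real vec) \<Rightarrow> (real \<Rightarrow> nat \<Rightarrow> real vec) \<Rightarrow> bool" where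
  "vrep n x f c \<longleftrightarrow> x \<in> carrier_vec n \<and> (\<forall>s. f s \<in> carrier_vec n) \<and> (\<forall>t l. c t l \<in> carrier_vec n) \<and>
     (\<forall>i<n. rep (x $ i) (\<lambda>s. f s $ i) (\<lambda>t l. c t l $ i))"

definition vleft :: "nat \<Rightarrow> (real \<Rightarrow> real vec) \<Rightarrow> real \<Rightarrow> real vec" where
  "vleft n f t = vec n (\<lambda>i. left_limit (\<lambda>s. f s $ i) t)"

definition vright_deriv :: "nat \<Rightarrow> (real \<Rightarrow> real vec) \<Rightarrow> real \<Rightarrow> real vec" where
  "vright_deriv n f t = vec n (\<lambda>i. right_deriv (\<lambda>s. f s $ i) t)"

lemma vleft_carrier [simp]: "vleft n f t \<in> carrier_vec n"
  by (simp add: vleft_def)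

lemma vright_deriv_carrier [simp]: "vright_deriv n f t \<in> carrier_vec n"
  by (simp add: vright_deriv_def)

lemma vrepD:
  assumes "vrep n x f c"
  shows "x \<in> carrier_vec n" "f s \<in> carrier_vec n" "c t l \<in> carrier_vec n"
    "i < n \<Longrightarrow> rep (x $ i) (\<lambda>s. f s $ i) (\<lambda>t l. c t l $ i)"
    "i < n \<Longrightarrow> pws (\<lambda>s. f s $ i)"
  using assms repD(1) unfolding vrep_def by blast+

lemma pw_smooth_vecs_vrep:
  assumes "x \<in> pw_smooth_vecs n"
  shows "\<exists>f c. vrep n x f c"
proof -
  have "\<exists>f c. rep (x $ i) f c" if "i < n" for i
    using assms that pw_smooth_dists_rep[of "x $ i"] by (simp add: pw_smooth_vecs_def)
  then obtain f c where fc: "\<And>i. i < n \<Longrightarrow> rep (x $ i) (f i) (c i)"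
    by metis
  have "vrep n x (\<lambda>s. vec n (\<lambda>i. f i s)) (\<lambda>t l. vec n (\<lambda>i. c i t l))"
    using assms fc by (simp add: vrep_def pw_smooth_vecs_def)
  then show ?thesis by blast
qed

lemma vrep_pw_smooth_vecs: "vrep n x f c \<Longrightarrow> x \<in> pw_smooth_vecs n"
  by (auto simp: vrep_def pw_smooth_vecs_def intro: rep_in_pw_smooth_dists)

lemma vrep_unique:
  assumes "vrep n x f c" "vrep n x f' c'"
  shows "f = f'" "c = c'"
proof -
  note u = rep_unique[OF vrepD(4)[OF assms(1)] vrepD(4)[OF assms(2)]]
  show "f = f'"
  proof (intro ext eq_vecI)
    fix s i assume "i < dim_vec (f' s)"
    then have i: "i < n" using carrier_vecD[OF vrepD(2)[OF assms(2), of s]] by simp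
    show "f s $ i = f' s $ i"
      using fun_cong[OF u(1)[OF i i], of s] .
  qed (simp add: carrier_vecD[OF vrepD(2)[OF assms(1)]] carrier_vecD[OF vrepD(2)[OF assms(2)]])
  show "c = c'"
  proof (intro ext eq_vecI)
    fix t l i assume "i < dim_vec (c' t l)"
    then have i: "i < n" using carrier_vecD[OF vrepD(3)[OF assms(2), of t l]] by simp
    show "c t l $ i = c' t l $ i"
      using fun_cong[OF fun_cong[OF u(2)[OF i i], of t], of l] .
  qed (simp add: carrier_vecD[OF vrepD(3)[OF assms(1)]] carrier_vecD[OF vrepD(3)[OF assms(2)]])
qed

lemma vrep_ext:
  assumes "vrep n x f c" "vrep n x' f c"
  shows "x = x'"
proof (rule eq_vecI)
  show "dim_vec x = dim_vec x'"
    using carrier_vecD[OF vrepD(1)[OF assms(1)]] carrier_vecD[OF vrepD(1)[OF assms(2)]] by simp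
  fix i assume "i < dim_vec x'"
  then have i: "i < n" using carrier_vecD[OF vrepD(1)[OF assms(2)]] by simp
  show "x $ i = x' $ i"
    by (rule rep_unique_dist[OF vrepD(4)[OF assms(1) i] vrepD(4)[OF assms(2) i]])
qed

lemma vrep_mat_dist:
  assumes A: "A \<in> carrier_mat m n" and x: "vrep n x f c"
  shows "vrep m (mat_dist A x) (\<lambda>s. A *\<^sub>v f s) (\<lambda>t l. A *\<^sub>v c t l)"
  unfolding vrep_def
proof (intro conjI allI impI)
  fix i assume i: "i < m"
  have "rep (\<lambda>\<phi>. \<Sum>j<n. A $$ (i, j) * (x $ j) \<phi>) (\<lambda>s. \<Sum>j<n. A $$ (i, j) * f s $ j)
      (\<lambda>t l. \<Sum>j<n. A $$ (i, j) * c t l $ j)"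
    by (rule rep_sum) (rule vrepD(4)[OF x])
  moreover have "mat_dist A x $ i = (\<lambda>\<phi>. \<Sum>j<n. A $$ (i, j) * (x $ j) \<phi>)"
    using A i by (simp add: mat_dist_def)
  ultimately show "rep (mat_dist A x $ i) (\<lambda>s. (A *\<^sub>v f s) $ i) (\<lambda>t l. (A *\<^sub>v c t l) $ i)"
    unfolding mult_mat_vec_nth[OF A vrepD(2)[OF x] i] mult_mat_vec_nth[OF A vrepD(3)[OF x] i] by simp
next
  show "mat_dist A x \<in> carrier_vec m"
    using A by (intro carrier_vecI) (simp add: mat_dist_def)
  show "A *\<^sub>v f s \<in> carrier_vec m" "A *\<^sub>v c t l \<in> carrier_vec m" for s t l
    by (intro mult_mat_vec_carrier[OF A] vrepD(2,3)[OF x])+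
qed

lemma vrep_add:
  assumes x: "vrep n x f c" and y: "vrep n y g d"
  shows "vrep n (x + y) (\<lambda>s. f s + g s) (\<lambda>t l. c t l + d t l)"
  unfolding vrep_def
proof (intro conjI allI impI)
  fix i assume i: "i < n"
  have "(x + y) $ i = (\<lambda>\<phi>. 1 * (x $ i) \<phi> + 1 * (y $ i) \<phi>)"
    using vrepD(1)[OF y] i by (simp add: plus_fun_def)
  with rep_linear[OF vrepD(4)[OF x i] vrepD(4)[OF y i], of 1 1]
  show "rep ((x + y) $ i) (\<lambda>s. (f s + g s) $ i) (\<lambda>t l. (c t l + d t l) $ i)"
    using carrier_vecD[OF vrepD(2)[OF y]] carrier_vecD[OF vrepD(3)[OF y]] i by simp
qed (use vrepD(1-3)[OF x] vrepD(1-3)[OF y] in simp_all)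

lemma vrep_diff:
  assumes x: "vrep n x f c" and y: "vrep n y g d"
  shows "vrep n (x - y) (\<lambda>s. f s - g s) (\<lambda>t l. c t l - d t l)"
  unfolding vrep_def
proof (intro conjI allI impI)
  fix i assume i: "i < n"
  have "(x - y) $ i = (\<lambda>\<phi>. 1 * (x $ i) \<phi> + (- 1) * (y $ i) \<phi>)"
    using vrepD(1)[OF y] i by (simp add: fun_diff_def)
  with rep_linear[OF vrepD(4)[OF x i] vrepD(4)[OF y i], of 1 "- 1"]
  show "rep ((x - y) $ i) (\<lambda>s. (f s - g s) $ i) (\<lambda>t l. (c t l - d t l) $ i)"
    using carrier_vecD[OF vrepD(2)[OF y]] carrier_vecD[OF vrepD(3)[OF y]] i by simp
qed (use vrepD(1-3)[OF x] vrepD(1-3)[OF y] in simp_all)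

lemma vrep_0: "vrep n (0\<^sub>v n) (\<lambda>_. 0\<^sub>v n) (\<lambda>_ _. 0\<^sub>v n)"
  using rep_0 by (simp add: vrep_def zero_fun_def)

lemma vrep_deriv:
  assumes x: "vrep n x f c"
  shows "vrep n (vec_deriv x) (vright_deriv n f)
    (\<lambda>t l. case l of 0 \<Rightarrow> f t - vleft n f t | Suc l \<Rightarrow> c t l)"
  unfolding vrep_def
proof (intro conjI allI impI)
  show "(case l of 0 \<Rightarrow> f t - vleft n f t | Suc l \<Rightarrow> c t l) \<in> carrier_vec n" for t l
    using vrepD(2,3)[OF x] by (simp split: nat.split)
  fix i assume i: "i < n"
  have "(\<lambda>t l. (case l of 0 \<Rightarrow> f t - vleft n f t | Suc l \<Rightarrow> c t l) $ i) =
      (\<lambda>t l. case l of 0 \<Rightarrow> f t $ i - left_limit (\<lambda>s. f s $ i) t | Suc l \<Rightarrow> c t l $ i)"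
    using i by (intro ext) (simp add: vleft_def split: nat.split)
  moreover have "(\<lambda>s. vright_deriv n f s $ i) = right_deriv (\<lambda>s. f s $ i)"
    using i by (intro ext) (simp add: vright_deriv_def)
  ultimately show "rep (vec_deriv x $ i) (\<lambda>s. vright_deriv n f s $ i)
      (\<lambda>t l. (case l of 0 \<Rightarrow> f t - vleft n f t | Suc l \<Rightarrow> c t l) $ i)"
    using rep_deriv[OF vrepD(4)[OF x i]] i vrepD(1)[OF x] by (simp add: vec_deriv_def)
qed (use vrepD(1)[OF x] in \<open>simp_all add: vec_deriv_def\<close>)

lemma vec_deriv_diff: "dim_vec x = dim_vec y \<Longrightarrow> vec_deriv (x - y) = vec_deriv x - vec_deriv y"
  by (rule eq_vecI) (auto simp: vec_deriv_def dist_deriv_def fun_diff_def)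

lemma vrep_restrict:
  assumes x: "vrep n x f c" and I: "I \<subseteq> {a..<b}" "{a<..<b} \<subseteq> I"
  shows "vrep n (vec_restrict I x) (\<lambda>s. if s \<in> {a..<b} then f s else 0\<^sub>v n)
    (\<lambda>t l. if t \<in> I then c t l else 0\<^sub>v n)"
  unfolding vrep_def
proof (intro conjI allI impI)
  fix i assume i: "i < n"
  have "(\<lambda>s. (if s \<in> {a..<b} then f s else 0\<^sub>v n) $ i) = (\<lambda>s. indicator {a..<b} s * f s $ i)"
    using i by (intro ext) (simp add: indicator_def)
  moreover have "(\<lambda>t l. (if t \<in> I then c t l else 0\<^sub>v n) $ i) = (\<lambda>t l. if t \<in> I then c t l $ i else 0)"
    using i by (intro ext) simp
  ultimately show "rep (vec_restrict I x $ i) (\<lambda>s. (if s \<in> {a..<b} then f s else 0\<^sub>v n) $ i)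
      (\<lambda>t l. (if t \<in> I then c t l else 0\<^sub>v n) $ i)"
    using rep_restrict[OF vrepD(4)[OF x i] I] i vrepD(1)[OF x] by (simp add: vec_restrict_def)
qed (use vrepD(1-3)[OF x] in \<open>simp_all add: vec_restrict_def\<close>)

text \<open>This is the passage from distributions to pointwise equations. Coordinates are unique
  and regular parts right-continuous, so equality holds at every point of [a, b) and not just almost
  everywhere; impulses at the left end are included.\<close>

lemma vec_restrict_eq_iff:
  assumes x: "vrep n x f c" and y: "vrep n y g d"
  shows "vec_restrict {a..<b} x = vec_restrict {a..<b} y \<longleftrightarrow>
    (\<forall>s\<in>{a..<b}. f s = g s \<and> (\<forall>l. c s l = d s l))"
proof -
  have I: "{a..<b} \<subseteq> {a..<b}" "{a<..<b} \<subseteq> {a..<b}" by auto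
  note rx = vrep_restrict[OF x I] and ry = vrep_restrict[OF y I]
  show ?thesis
  proof
    assume eq: "vec_restrict {a..<b} x = vec_restrict {a..<b} y"
    note u = vrep_unique[OF rx ry[folded eq]]
    show "\<forall>s\<in>{a..<b}. f s = g s \<and> (\<forall>l. c s l = d s l)"
    proof (intro ballI conjI allI)
      fix s l assume s: "s \<in> {a..<b}"
      from fun_cong[OF u(1), of s] s show "f s = g s" by simp
      from fun_cong[OF fun_cong[OF u(2)], of s l] s show "c s l = d s l" by simp
    qed
  next
    assume *: "\<forall>s\<in>{a..<b}. f s = g s \<and> (\<forall>l. c s l = d s l)"
    have eqs: "(\<lambda>s. if s \<in> {a..<b} then f s else 0\<^sub>v n) = (\<lambda>s. if s \<in> {a..<b} then g s else 0\<^sub>v n)"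
      "(\<lambda>t l. if t \<in> {a..<b} then c t l else 0\<^sub>v n) = (\<lambda>t l. if t \<in> {a..<b} then d t l else 0\<^sub>v n)"
      using * by (auto simp: fun_eq_iff)
    show "vec_restrict {a..<b} x = vec_restrict {a..<b} y"
      by (rule vrep_ext[OF rx ry[folded eqs]])
  qed
qed

lemma left_value_vrep:
  assumes "vrep n x f c"
  shows "left_value x t = vleft n f t"
  using vrepD(1)[OF assms] regular_part_rep[OF vrepD(4)[OF assms]]
  by (intro eq_vecI) (auto simp: left_value_def vleft_def left_limit_def)

lemma right_value_vrep:
  assumes "vrep n x f c"
  shows "right_value x t = f t"
proof (rule eq_vecI)
  show "dim_vec (right_value x t) = dim_vec (f t)"
    using vrepD(1)[OF assms] vrepD(2)[OF assms, of t] by (simp add: right_value_def)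
  fix i assume "i < dim_vec (f t)"
  then have i: "i < n" using vrepD(2)[OF assms, of t] by simp
  have "Lim (at_right t) (\<lambda>s. f s $ i) = f t $ i"
    using pws_tendsto_right[OF vrepD(5)[OF assms i], of t] by (intro tendsto_Lim) auto
  then show "right_value x t $ i = f t $ i"
    using i vrepD(1)[OF assms] regular_part_rep[OF vrepD(4)[OF assms i]] by (simp add: right_value_def)
qed

lemma vleft_diff:
  assumes "vrep n x f c" "vrep n y g d"
  shows "vleft n (\<lambda>s. f s - g s) t = vleft n f t - vleft n g t"
proof (rule eq_vecI)
  fix i assume "i < dim_vec (vleft n f t - vleft n g t)"
  then have i: "i < n" by (simp add: vleft_def)
  have "((\<lambda>s. f s $ i - g s $ i) \<longlongrightarrow> left_limit (\<lambda>s. f s $ i) t - left_limit (\<lambda>s. g s $ i) t) (at_left t)"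
    by (intro tendsto_diff pws_tendsto_left vrepD(5)[OF assms(1) i] vrepD(5)[OF assms(2) i])
  from left_limit_eqI[OF this] show "vleft n (\<lambda>s. f s - g s) t $ i = (vleft n f t - vleft n g t) $ i"
    using i carrier_vecD[OF vrepD(2)[OF assms(2)]] by (simp add: vleft_def)
qed (simp add: vleft_def)

text \<open>The homogeneous DAE on \<open>[a, b)\<close> in coordinates: its regular part, and the coefficients of
  \<open>\<delta>\<close> and of the derivatives of \<open>\<delta>\<close>.\<close>

definition homogeneous_piece :: "nat \<Rightarrow> real mat \<Rightarrow> real mat \<Rightarrow> real \<Rightarrow> real \<Rightarrow>
    (real \<Rightarrow> real vec) \<Rightarrow> (real \<Rightarrow> nat \<Rightarrow> real vec) \<Rightarrow> bool" where
  "homogeneous_piece n E A a b f c \<longleftrightarrow> (\<forall>s\<in>{a..<b}. E *\<^sub>v vright_deriv n f s = A *\<^sub>v f s \<and>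
     E *\<^sub>v (f s - vleft n f s) = A *\<^sub>v c s 0 \<and> (\<forall>l. E *\<^sub>v c s l = A *\<^sub>v c s (Suc l)))"

lemma homogeneous_piece_iff:
  assumes E: "E \<in> carrier_mat n n" and A: "A \<in> carrier_mat n n" and x: "vrep n x f c"
  shows "vec_restrict {a..<b} (mat_dist E (vec_deriv x)) = vec_restrict {a..<b} (mat_dist A x) \<longleftrightarrow>
    homogeneous_piece n E A a b f c"
proof -
  have all: "(\<forall>l. Q l) \<longleftrightarrow> Q 0 \<and> (\<forall>l. Q (Suc l))" for Q :: "nat \<Rightarrow> bool"
    by (metis not0_implies_Suc)
  have "(\<forall>l. E *\<^sub>v (case l of 0 \<Rightarrow> f s - vleft n f s | Suc l \<Rightarrow> c s l) = A *\<^sub>v c s l) \<longleftrightarrow>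
    E *\<^sub>v (f s - vleft n f s) = A *\<^sub>v c s 0 \<and> (\<forall>l. E *\<^sub>v c s l = A *\<^sub>v c s (Suc l))" for s
    by (subst all) simp
  then show ?thesis
    unfolding homogeneous_piece_def
      vec_restrict_eq_iff[OF vrep_mat_dist[OF E vrep_deriv[OF x]] vrep_mat_dist[OF A x]] by simp
qed

text \<open>In coordinates the common input contributes the same vector to both equations at each
  time and each order, and cancels.\<close>

lemma dae_difference:
  assumes E: "E \<in> carrier_mat n n" and A: "A \<in> carrier_mat n n" and B: "B \<in> carrier_mat n nu"
    and C: "C \<in> carrier_mat ny n" and D: "D \<in> carrier_mat ny nu"
    and x: "vrep n x f c" and xh: "vrep n xh fh ch" and u: "vrep nu u g d"
    and y: "vrep ny y r v" and yh: "vrep ny yh rh vh"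
    and eq: "vec_restrict {a..<b} (mat_dist E (vec_deriv x)) = vec_restrict {a..<b} (mat_dist A x + mat_dist B u)"
      "vec_restrict {a..<b} (mat_dist E (vec_deriv xh)) = vec_restrict {a..<b} (mat_dist A xh + mat_dist B u)"
    and out: "vec_restrict {a..<b} y = vec_restrict {a..<b} (mat_dist C x + mat_dist D u)"
      "vec_restrict {a..<b} yh = vec_restrict {a..<b} (mat_dist C xh + mat_dist D u)"
  shows "homogeneous_piece n E A a b (\<lambda>s. fh s - f s) (\<lambda>t l. ch t l - c t l)"
    and "vec_restrict {a..<b} (yh - y) = vec_restrict {a..<b} (mat_dist C (xh - x))"
proof -
  have sub: "(p + w) - (p' + w) = p - p'" if "p \<in> carrier_vec m" "p' \<in> carrier_vec m" "w \<in> carrier_vec m"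
    for p p' w :: "real vec" and m
    using that by (intro eq_vecI) auto
  note dx = vrep_deriv[OF x] and dxh = vrep_deriv[OF xh]
  note e = vrep_diff[OF xh x]
  have dim: "dim_vec xh = dim_vec x"
    using vrepD(1)[OF x] vrepD(1)[OF xh] by simp
  note p1 = eq(1)[unfolded vec_restrict_eq_iff[OF vrep_mat_dist[OF E dx] vrep_add[OF vrep_mat_dist[OF A x] vrep_mat_dist[OF B u]]]]
  note p2 = eq(2)[unfolded vec_restrict_eq_iff[OF vrep_mat_dist[OF E dxh] vrep_add[OF vrep_mat_dist[OF A xh] vrep_mat_dist[OF B u]]]]
  have "vec_restrict {a..<b} (mat_dist E (vec_deriv (xh - x))) = vec_restrict {a..<b} (mat_dist A (xh - x))"
    unfolding vec_deriv_diff[OF dim] vec_restrict_eq_iff[OF vrep_mat_dist[OF E vrep_diff[OF dxh dx]] vrep_mat_dist[OF A e]]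
  proof (intro ballI conjI allI)
    fix s l assume s: "s \<in> {a..<b}"
    show "E *\<^sub>v (vright_deriv n fh s - vright_deriv n f s) = A *\<^sub>v (fh s - f s)"
      unfolding mult_minus_distrib_mat_vec[OF E vrepD(2)[OF dxh] vrepD(2)[OF dx]]
        mult_minus_distrib_mat_vec[OF A vrepD(2)[OF xh] vrepD(2)[OF x]]
        p1[rule_format, OF s, THEN conjunct1] p2[rule_format, OF s, THEN conjunct1]
      by (rule sub[where m = n]) (intro mult_mat_vec_carrier[OF A] mult_mat_vec_carrier[OF B] vrepD(2)[OF x] vrepD(2)[OF xh] vrepD(2)[OF u])+
    show "E *\<^sub>v ((case l of 0 \<Rightarrow> fh s - vleft n fh s | Suc l \<Rightarrow> ch s l) -
        (case l of 0 \<Rightarrow> f s - vleft n f s | Suc l \<Rightarrow> c s l)) = A *\<^sub>v (ch s l - c s l)"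
      unfolding mult_minus_distrib_mat_vec[OF E vrepD(3)[OF dxh] vrepD(3)[OF dx]]
        mult_minus_distrib_mat_vec[OF A vrepD(3)[OF xh] vrepD(3)[OF x]]
        p1[rule_format, OF s, THEN conjunct2, rule_format] p2[rule_format, OF s, THEN conjunct2, rule_format]
      by (rule sub[where m = n]) (intro mult_mat_vec_carrier[OF A] mult_mat_vec_carrier[OF B] vrepD(3)[OF x] vrepD(3)[OF xh] vrepD(3)[OF u])+
  qed
  then show "homogeneous_piece n E A a b (\<lambda>s. fh s - f s) (\<lambda>t l. ch t l - c t l)"
    using homogeneous_piece_iff[OF E A e] by blast
  note o1 = out(1)[unfolded vec_restrict_eq_iff[OF y vrep_add[OF vrep_mat_dist[OF C x] vrep_mat_dist[OF D u]]]]
  note o2 = out(2)[unfolded vec_restrict_eq_iff[OF yh vrep_add[OF vrep_mat_dist[OF C xh] vrep_mat_dist[OF D u]]]]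
  show "vec_restrict {a..<b} (yh - y) = vec_restrict {a..<b} (mat_dist C (xh - x))"
    unfolding vec_restrict_eq_iff[OF vrep_diff[OF yh y] vrep_mat_dist[OF C e]]
  proof (intro ballI conjI allI)
    fix s l assume s: "s \<in> {a..<b}"
    show "rh s - r s = C *\<^sub>v (fh s - f s)"
      unfolding mult_minus_distrib_mat_vec[OF C vrepD(2)[OF xh] vrepD(2)[OF x]]
        o1[rule_format, OF s, THEN conjunct1] o2[rule_format, OF s, THEN conjunct1]
      by (rule sub[where m = ny]) (intro mult_mat_vec_carrier[OF C] mult_mat_vec_carrier[OF D] vrepD(2)[OF x] vrepD(2)[OF xh] vrepD(2)[OF u])+
    show "vh s l - v s l = C *\<^sub>v (ch s l - c s l)"
      unfolding mult_minus_distrib_mat_vec[OF C vrepD(3)[OF xh] vrepD(3)[OF x]]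
        o1[rule_format, OF s, THEN conjunct2, rule_format] o2[rule_format, OF s, THEN conjunct2, rule_format]
      by (rule sub[where m = ny]) (intro mult_mat_vec_carrier[OF C] mult_mat_vec_carrier[OF D] vrepD(3)[OF x] vrepD(3)[OF xh] vrepD(3)[OF u])+
  qed
qed

section \<open>Solutions on one interval\<close>

locale mode =
  fixes n E A P Ad Ei X Y
  assumes algebra: "mode_algebra n E A P Ad Ei X Y"
begin

lemma carrier:
  "E \<in> carrier_mat n n" "A \<in> carrier_mat n n" "P \<in> carrier_mat n n" "Ad \<in> carrier_mat n n"
  "Ei \<in> carrier_mat n n" "X \<in> carrier_mat n n" "Y \<in> carrier_mat n n"
  using algebra by (auto simp: mode_algebra_def)

lemma nilpotent: "\<exists>L. Ei ^\<^sub>m L = 0\<^sub>m n n"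
  using algebra by (auto simp: mode_algebra_def)

lemma mult_vec:
  assumes v: "v \<in> carrier_vec n"
  shows "P *\<^sub>v (P *\<^sub>v v) = P *\<^sub>v v" "P *\<^sub>v (Ad *\<^sub>v v) = Ad *\<^sub>v v" "Ad *\<^sub>v (P *\<^sub>v v) = Ad *\<^sub>v v"
    "P *\<^sub>v (Ei *\<^sub>v v) = 0\<^sub>v n" "Ei *\<^sub>v (P *\<^sub>v v) = 0\<^sub>v n"
proof -
  have eq: "P * P = P" "P * Ad = Ad" "Ad * P = Ad" "P * Ei = 0\<^sub>m n n" "Ei * P = 0\<^sub>m n n"
    using algebra by (auto simp: mode_algebra_def)
  have a: "U *\<^sub>v (V *\<^sub>v v) = (U * V) *\<^sub>v v" if "U \<in> carrier_mat n n" "V \<in> carrier_mat n n" for U V :: "real mat"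
    using assoc_mult_mat_vec[OF that v] by simp
  show "P *\<^sub>v (P *\<^sub>v v) = P *\<^sub>v v" "P *\<^sub>v (Ad *\<^sub>v v) = Ad *\<^sub>v v" "Ad *\<^sub>v (P *\<^sub>v v) = Ad *\<^sub>v v"
    unfolding a[OF carrier(3,3)] a[OF carrier(3,4)] a[OF carrier(4,3)] eq by (rule refl)+
  show "P *\<^sub>v (Ei *\<^sub>v v) = 0\<^sub>v n" "Ei *\<^sub>v (P *\<^sub>v v) = 0\<^sub>v n"
    unfolding a[OF carrier(3,5)] a[OF carrier(5,3)] eq by (rule zero_mat_mult_vec[OF v])+
qed

lemma mult_vec_carrier:
  assumes "v \<in> carrier_vec n"
  shows "P *\<^sub>v v \<in> carrier_vec n" "Ad *\<^sub>v v \<in> carrier_vec n" "Ei *\<^sub>v v \<in> carrier_vec n"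
    "Ei ^\<^sub>m k *\<^sub>v v \<in> carrier_vec n" "mexp Ad t *\<^sub>v v \<in> carrier_vec n"
  by (intro mult_mat_vec_carrier[OF carrier(3) assms] mult_mat_vec_carrier[OF carrier(4) assms]
      mult_mat_vec_carrier[OF carrier(5) assms] mult_mat_vec_carrier[OF pow_carrier_mat[OF carrier(5)] assms]
      mult_mat_vec_carrier[OF mexp_carrier[OF carrier(4)] assms])+

lemma X_mult:
  assumes v: "v \<in> carrier_vec n"
  shows "X *\<^sub>v (E *\<^sub>v v) = P *\<^sub>v v + Ei *\<^sub>v v" "X *\<^sub>v (A *\<^sub>v v) = Ad *\<^sub>v v + (v - P *\<^sub>v v)"
proof -
  have eq: "X * E = P + Ei" "X * A = Ad + (1\<^sub>m n - P)"
    using algebra by (auto simp: mode_algebra_def)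
  show "X *\<^sub>v (E *\<^sub>v v) = P *\<^sub>v v + Ei *\<^sub>v v"
    unfolding assoc_mult_mat_vec[OF carrier(6,1) v, symmetric] eq
    by (rule add_mult_distrib_mat_vec[OF carrier(3,5) v])
  show "X *\<^sub>v (A *\<^sub>v v) = Ad *\<^sub>v v + (v - P *\<^sub>v v)"
    unfolding assoc_mult_mat_vec[OF carrier(6,2) v, symmetric] eq
      add_mult_distrib_mat_vec[OF carrier(4) minus_carrier_mat[OF carrier(3)] v]
      minus_mult_distrib_mat_vec[OF one_carrier_mat carrier(3) v] one_mult_mat_vec[OF v] ..
qed

text \<open>Multiplication by X turns the equation into P v + Ei v = Ad w + (w - P w). P annihilates
  the terms Ei v and w - P w and fixes the other two, so applying it isolates the differential part;
  subtraction leaves the algebraic one.\<close>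

lemma split:
  assumes v: "v \<in> carrier_vec n" and w: "w \<in> carrier_vec n" and eq: "E *\<^sub>v v = A *\<^sub>v w"
  shows "P *\<^sub>v v = Ad *\<^sub>v w" "Ei *\<^sub>v v = w - P *\<^sub>v w"
proof -
  note c = mult_vec_carrier[OF v] mult_vec_carrier[OF w]
  have e: "P *\<^sub>v v + Ei *\<^sub>v v = Ad *\<^sub>v w + (w - P *\<^sub>v w)"
    using X_mult(1)[OF v] X_mult(2)[OF w] eq by simp
  have "P *\<^sub>v (P *\<^sub>v v + Ei *\<^sub>v v) = P *\<^sub>v v"
    using c by (simp add: mult_add_distrib_mat_vec[OF carrier(3)] mult_vec v)
  moreover have "P *\<^sub>v (Ad *\<^sub>v w + (w - P *\<^sub>v w)) = Ad *\<^sub>v w"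
    using c w by (simp add: mult_add_distrib_mat_vec[OF carrier(3)] mult_minus_distrib_mat_vec[OF carrier(3)] mult_vec)
  ultimately show 1: "P *\<^sub>v v = Ad *\<^sub>v w"
    using e by simp
  show "Ei *\<^sub>v v = w - P *\<^sub>v w"
  proof (rule eq_vecI)
    fix i assume "i < dim_vec (w - P *\<^sub>v w)"
    then have i: "i < n" using carrier(3) by simp
    have "(P *\<^sub>v v + Ei *\<^sub>v v) $ i = (Ad *\<^sub>v w + (w - P *\<^sub>v w)) $ i"
      using e by simp
    then show "(Ei *\<^sub>v v) $ i = (w - P *\<^sub>v w) $ i"
      unfolding 1 using c w i carrier by (simp del: index_mult_mat_vec)
  qed (use carrier in simp)
qed

text \<open>The converse of \<open>split\<close>: X has the left inverse Y, so the two parts recover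
  the original equation.\<close>

lemma join:
  assumes v: "v \<in> carrier_vec n" and w: "w \<in> carrier_vec n"
    and eq: "P *\<^sub>v v = Ad *\<^sub>v w" "Ei *\<^sub>v v = w - P *\<^sub>v w"
  shows "E *\<^sub>v v = A *\<^sub>v w"
proof -
  have YX: "Y *\<^sub>v (X *\<^sub>v y) = y" if "y \<in> carrier_vec n" for y
    using assoc_mult_mat_vec[OF carrier(7,6) that] algebra that by (simp add: mode_algebra_def)
  have "X *\<^sub>v (E *\<^sub>v v) = X *\<^sub>v (A *\<^sub>v w)"
    unfolding X_mult(1)[OF v] X_mult(2)[OF w] eq ..
  then have "Y *\<^sub>v (X *\<^sub>v (E *\<^sub>v v)) = Y *\<^sub>v (X *\<^sub>v (A *\<^sub>v w))" by simp
  then show ?thesis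
    by (simp only: YX[OF mult_mat_vec_carrier[OF carrier(1) v]] YX[OF mult_mat_vec_carrier[OF carrier(2) w]])
qed

lemma Ei_pow_Suc:
  assumes v: "v \<in> carrier_vec n"
  shows "Ei ^\<^sub>m Suc j *\<^sub>v v = Ei ^\<^sub>m j *\<^sub>v (Ei *\<^sub>v v)" "Ei ^\<^sub>m Suc j *\<^sub>v v = Ei *\<^sub>v (Ei ^\<^sub>m j *\<^sub>v v)"
  unfolding pow_mat.simps assoc_mult_mat_vec[OF pow_carrier_mat[OF carrier(5)] carrier(5) v]
proof -
  show "Ei ^\<^sub>m j *\<^sub>v (Ei *\<^sub>v v) = Ei *\<^sub>v (Ei ^\<^sub>m j *\<^sub>v v)"
    unfolding assoc_mult_mat_vec[OF pow_carrier_mat[OF carrier(5)] carrier(5) v, symmetric]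
      assoc_mult_mat_vec[OF carrier(5) pow_carrier_mat[OF carrier(5)] v, symmetric]
      pow_mat_Suc_left[OF carrier(5), symmetric] by simp
qed (rule refl)

lemma Ei_pow_P: "v \<in> carrier_vec n \<Longrightarrow> Ei ^\<^sub>m Suc j *\<^sub>v (P *\<^sub>v v) = 0\<^sub>v n"
  by (simp only: Ei_pow_Suc(1) mult_vec_carrier mult_vec mult_mat_zero_vec[OF pow_carrier_mat[OF carrier(5)]])

lemma P_Ei_pow: "v \<in> carrier_vec n \<Longrightarrow> P *\<^sub>v (Ei ^\<^sub>m Suc j *\<^sub>v v) = 0\<^sub>v n"
  by (simp only: Ei_pow_Suc(2) mult_vec_carrier mult_vec)

lemma Ei_pow_large: "v \<in> carrier_vec n \<Longrightarrow> n \<le> j \<Longrightarrow> Ei ^\<^sub>m j *\<^sub>v v = 0\<^sub>v n"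
  using nilpotent nilpotent_orbit_zero[OF carrier(5)] by blast

text \<open>The difference between the flow and its projection is constant in time, because P Ad =
  Ad, and zero at time 0.\<close>

lemma P_flow:
  assumes w: "w \<in> carrier_vec n"
  shows "P *\<^sub>v (mexp Ad t *\<^sub>v (P *\<^sub>v w)) = mexp Ad t *\<^sub>v (P *\<^sub>v w)"
proof (rule eq_vecI)
  note Pw = mult_vec_carrier(1)[OF w]
  fix i assume "i < dim_vec (mexp Ad t *\<^sub>v (P *\<^sub>v w))"
  then have i: "i < n" using mexp_carrier[OF carrier(4), of t] by simp
  define e where "e t = mexp Ad t *\<^sub>v (P *\<^sub>v w)" for t
  have e: "e t \<in> carrier_vec n" for t
    unfolding e_def by (rule mult_vec_carrier(5)[OF Pw])
  have de: "((\<lambda>t. e t $ k) has_real_derivative (Ad *\<^sub>v e t) $ k) (at t)" if "k < n" for k t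
    using mexp_mult_vec_has_derivative[OF carrier(4) Pw that, of 0 t] by (simp add: e_def)
  have "((\<lambda>t. (P *\<^sub>v e t) $ i - e t $ i) has_real_derivative (P *\<^sub>v (Ad *\<^sub>v e t)) $ i - (Ad *\<^sub>v e t) $ i) (at t)" for t
    by (intro DERIV_diff mult_mat_vec_has_derivative[OF carrier(3)] de i e mult_vec_carrier)
  then have "((\<lambda>t. (P *\<^sub>v e t) $ i - e t $ i) has_real_derivative 0) (at t)" for t
    by (simp only: mult_vec(2)[OF e] diff_self)
  then have "(P *\<^sub>v e t) $ i - e t $ i = (P *\<^sub>v e 0) $ i - e 0 $ i"
    by (intro DERIV_isconst_all) blast
  also have "e 0 = P *\<^sub>v w"
    unfolding e_def mexp_0[OF carrier(4)] by (rule one_mult_mat_vec[OF Pw])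
  finally show "(P *\<^sub>v (mexp Ad t *\<^sub>v (P *\<^sub>v w))) $ i = (mexp Ad t *\<^sub>v (P *\<^sub>v w)) $ i"
    by (simp only: mult_vec(1)[OF w] e_def)
qed (use carrier mexp_carrier[OF carrier(4), of t] in simp)

end

lemma vec_sub_eq_0D:
  assumes "u \<in> carrier_vec n" "v \<in> carrier_vec n" "u - v = 0\<^sub>v n"
  shows "u = (v :: real vec)"
proof (rule eq_vecI)
  fix i assume "i < dim_vec v"
  then show "u $ i = v $ i"
    using arg_cong[OF assms(3), of "\<lambda>x. x $ i"] assms(1,2) by simp
qed (use assms in simp)

text \<open>An algebraic constraint valid on [s, b) may be differentiated from the right at s.
  Repeated differentiation of this kind drives \<open>consistent\<close>.\<close>

lemma vright_deriv_kernel: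
  assumes x: "vrep n x f c" and M: "M \<in> carrier_mat n n" and s: "s < b"
    and zero: "\<And>u. s \<le> u \<Longrightarrow> u < b \<Longrightarrow> M *\<^sub>v f u = 0\<^sub>v n"
  shows "M *\<^sub>v vright_deriv n f s = 0\<^sub>v n"
proof (rule eq_vecI)
  fix i assume "i < dim_vec (0\<^sub>v n)"
  then have i: "i < n" by simp
  have "((\<lambda>u. (M *\<^sub>v f u) $ i) has_real_derivative (M *\<^sub>v vright_deriv n f s) $ i) (at s within {s<..})"
    by (rule mult_mat_vec_has_derivative[OF M vrepD(2)[OF x] vright_deriv_carrier _ i])
      (simp add: vright_deriv_def pws_has_right_deriv[OF vrepD(5)[OF x]])
  moreover have "((\<lambda>u. (M *\<^sub>v f u) $ i) has_real_derivative deriv (\<lambda>_. 0) s) (at s within {s<..})"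
  proof (rule has_right_derivative_cong)
    show "\<forall>\<^sub>F u in at_right s. (M *\<^sub>v f u) $ i = 0"
      unfolding eventually_at_right_field using s zero i by (intro exI[of _ b]) auto
  qed (use zero[of s] s i in simp_all)
  ultimately have "(M *\<^sub>v vright_deriv n f s) $ i = deriv (\<lambda>_. 0) s"
    using right_deriv_eqI by metis
  with i show "(M *\<^sub>v vright_deriv n f s) $ i = 0\<^sub>v n $ i" by simp
qed (use M in simp)

lemma vrep_impulses_finite:
  assumes x: "vrep n x f c"
  shows "\<exists>m. \<forall>l\<ge>m. c t l = 0\<^sub>v n"
proof -
  have "\<exists>m. \<forall>l\<ge>m. c t l $ i = 0" if "i < n" for i
    using repD(2)[OF vrepD(4)[OF x that]] unfolding fin_impulses_def by blast
  then obtain m where m: "\<And>i. i < n \<Longrightarrow> \<forall>l\<ge>m i. c t l $ i = 0" by metis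
  have "c t l = 0\<^sub>v n" if "(\<Sum>i<n. m i) \<le> l" for l
  proof (rule eq_vecI)
    fix i assume "i < dim_vec (0\<^sub>v n)"
    then have i: "i < n" by simp
    then have "m i \<le> (\<Sum>i<n. m i)" by (intro member_le_sum) auto
    with m[OF i] that i show "c t l $ i = 0\<^sub>v n $ i" by simp
  qed (use vrepD(3)[OF x] in simp)
  then show ?thesis by blast
qed

lemma vleft_tendsto:
  assumes x: "vrep n x f c" and i: "i < n"
  shows "((\<lambda>s. f s $ i) \<longlongrightarrow> vleft n f t $ i) (at_left t)"
  using pws_tendsto_left[OF vrepD(5)[OF x i], of t] i by (simp add: vleft_def)

lemma mult_mat_vec_tendsto:
  fixes A :: "real mat"
  assumes A: "A \<in> carrier_mat m n" and f: "\<And>s. f s \<in> carrier_vec n" and w: "w \<in> carrier_vec n"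
    and lim: "\<And>k. k < n \<Longrightarrow> ((\<lambda>s. f s $ k) \<longlongrightarrow> w $ k) F" and i: "i < m"
  shows "((\<lambda>s. (A *\<^sub>v f s) $ i) \<longlongrightarrow> (A *\<^sub>v w) $ i) F"
  unfolding mult_mat_vec_nth[OF A f i] mult_mat_vec_nth[OF A w i]
  by (intro tendsto_sum tendsto_mult tendsto_const lim) simp

section \<open>Structure of a homogeneous solution on one interval\<close>

locale mode_solution = mode +
  fixes x f c and a b :: real
  assumes x: "vrep n x f c" and hom: "homogeneous_piece n E A a b f c" and ab: "a < b"
begin

abbreviation "r \<equiv> vright_deriv n f"
abbreviation "left \<equiv> vleft n f a"

lemma f_carrier [simp]: "f s \<in> carrier_vec n"
  by (rule vrepD(2)[OF x])

lemma c_carrier [simp]: "c s l \<in> carrier_vec n"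
  by (rule vrepD(3)[OF x])

lemma regular_part_eqs:
  assumes "a \<le> s" "s < b"
  shows "P *\<^sub>v r s = Ad *\<^sub>v f s" "Ei *\<^sub>v r s = f s - P *\<^sub>v f s"
  using hom assms split[of "r s" "f s"] by (auto simp: homogeneous_piece_def)

text \<open>The part h = f - P f equals Ei r with r the right derivative of f. If Ei^(j+1)
  annihilates h on the interval, it annihilates f, because Ei P = 0, and hence r; thus Ei^j
  annihilates h. Nilpotency starts this descent, which ends at h = 0.\<close>

lemma consistent:
  assumes s: "a \<le> s" "s < b"
  shows "P *\<^sub>v f s = f s"
proof -
  define h where "h s = f s - P *\<^sub>v f s" for s
  have hc: "h s \<in> carrier_vec n" for s
    unfolding h_def by (intro minus_carrier_vec mult_vec_carrier f_carrier)
  have fh: "f s = h s + P *\<^sub>v f s" for s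
    unfolding h_def using f_carrier[of s] mult_vec_carrier(1)[OF f_carrier[of s]] carrier(3) by (intro eq_vecI) auto
  obtain L where L: "Ei ^\<^sub>m L = 0\<^sub>m n n" using nilpotent by blast
  have "k \<le> L \<Longrightarrow> \<forall>s. a \<le> s \<longrightarrow> s < b \<longrightarrow> Ei ^\<^sub>m (L - k) *\<^sub>v h s = 0\<^sub>v n" for k
  proof (induction k)
    case 0
    show ?case using zero_mat_mult_vec[OF hc] by (simp add: L)
  next
    case (Suc k)
    define j where "j = L - Suc k"
    have Sj: "L - k = Suc j" using Suc.prems by (simp add: j_def)
    have z: "Ei ^\<^sub>m Suc j *\<^sub>v f u = 0\<^sub>v n" if "a \<le> u" "u < b" for u
    proof -
      have "Ei ^\<^sub>m Suc j *\<^sub>v f u = Ei ^\<^sub>m Suc j *\<^sub>v (h u + P *\<^sub>v f u)"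
        using fh[of u] by simp
      also have "\<dots> = Ei ^\<^sub>m Suc j *\<^sub>v h u + Ei ^\<^sub>m Suc j *\<^sub>v (P *\<^sub>v f u)"
        by (rule mult_add_distrib_mat_vec[OF pow_carrier_mat[OF carrier(5)] hc mult_vec_carrier(1)[OF f_carrier]])
      also have "\<dots> = 0\<^sub>v n"
        unfolding Ei_pow_P[OF f_carrier] using Suc that unfolding Sj by simp
      finally show ?thesis .
    qed
    have "Ei ^\<^sub>m j *\<^sub>v h s = 0\<^sub>v n" if s: "a \<le> s" "s < b" for s
    proof -
      have "Ei ^\<^sub>m j *\<^sub>v h s = Ei ^\<^sub>m Suc j *\<^sub>v r s"
        unfolding h_def regular_part_eqs(2)[OF s, symmetric] by (rule Ei_pow_Suc(1)[symmetric]) simp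
      also have "\<dots> = 0\<^sub>v n"
        by (rule vright_deriv_kernel[OF x pow_carrier_mat[OF carrier(5)] s(2)]) (use z s in auto)
      finally show ?thesis .
    qed
    then show ?case unfolding j_def by blast
  qed
  from this[of L] s have "Ei ^\<^sub>m 0 *\<^sub>v h s = 0\<^sub>v n" by simp
  then have "h s = 0\<^sub>v n" using hc[of s] carrier(5) by simp
  then have "f s = P *\<^sub>v f s"
    unfolding h_def by (rule vec_sub_eq_0D[OF f_carrier mult_vec_carrier(1)[OF f_carrier]])
  then show ?thesis by simp
qed

text \<open>\<open>regular_part_eqs\<close> determines only P r; since f stays in the image of P, so
  does its right derivative.\<close>

lemma flow_equation:
  assumes s: "a \<le> s" "s < b"
  shows "r s = Ad *\<^sub>v f s"
proof -
  have M: "1\<^sub>m n - P \<in> carrier_mat n n" by (rule minus_carrier_mat[OF carrier(3)])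
  have eq: "(1\<^sub>m n - P) *\<^sub>v v = v - P *\<^sub>v v" if "v \<in> carrier_vec n" for v
    using minus_mult_distrib_mat_vec[OF one_carrier_mat carrier(3) that] that by simp
  have "(1\<^sub>m n - P) *\<^sub>v r s = 0\<^sub>v n"
  proof (rule vright_deriv_kernel[OF x M s(2)])
    fix u assume u: "s \<le> u" "u < b"
    have "P *\<^sub>v f u = f u" by (rule consistent) (use u s in auto)
    then show "(1\<^sub>m n - P) *\<^sub>v f u = 0\<^sub>v n" using f_carrier[of u] by (simp add: eq)
  qed
  then have "r s - P *\<^sub>v r s = 0\<^sub>v n"
    by (simp add: eq)
  then have "r s = P *\<^sub>v r s"
    by (rule vec_sub_eq_0D[rotated 2]) (simp_all add: mult_vec_carrier)
  with regular_part_eqs(1)[OF s] show ?thesis by simp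
qed

text \<open>The equations link each coefficient to the next, and only finitely many are nonzero. The
  P-parts therefore vanish from the top order downward, while the nilpotent parts determine each
  coefficient from the preceding one, starting with the jump.\<close>

lemma impulses:
  assumes s: "a \<le> s" "s < b"
  shows "P *\<^sub>v (f s - vleft n f s) = 0\<^sub>v n" "c s l = Ei ^\<^sub>m Suc l *\<^sub>v (f s - vleft n f s)"
proof -
  define j where "j = f s - vleft n f s"
  have jc: "j \<in> carrier_vec n" by (simp add: j_def)
  have eqs: "E *\<^sub>v j = A *\<^sub>v c s 0" "E *\<^sub>v c s l = A *\<^sub>v c s (Suc l)" for l
    using hom s by (auto simp: homogeneous_piece_def j_def)
  note s0 = split[OF jc c_carrier eqs(1)] and sS = split[OF c_carrier c_carrier eqs(2)]
  obtain m where m: "\<forall>l\<ge>m. c s l = 0\<^sub>v n"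
    using vrep_impulses_finite[OF x] by blast
  have Pc: "P *\<^sub>v c s l = 0\<^sub>v n" for l
  proof (induction "m - l" arbitrary: l)
    case 0
    then show ?case using m mult_mat_zero_vec[OF carrier(3)] by simp
  next
    case (Suc k)
    then have IH: "P *\<^sub>v c s (Suc l) = 0\<^sub>v n" by simp
    have "P *\<^sub>v c s l = Ad *\<^sub>v (P *\<^sub>v c s (Suc l))"
      by (simp only: sS(1)[of l] mult_vec(3)[OF c_carrier])
    then show ?case unfolding IH by (simp only: mult_mat_zero_vec[OF carrier(4)])
  qed
  have "P *\<^sub>v j = Ad *\<^sub>v (P *\<^sub>v c s 0)"
    unfolding s0(1) mult_vec(3)[OF c_carrier] ..
  then show "P *\<^sub>v (f s - vleft n f s) = 0\<^sub>v n"
    unfolding Pc j_def by (simp only: mult_mat_zero_vec[OF carrier(4)])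
  have sub0: "v - 0\<^sub>v n = v" if "v \<in> carrier_vec n" for v :: "real vec"
    using that by (intro eq_vecI) auto
  have "c s l = Ei ^\<^sub>m Suc l *\<^sub>v j"
  proof (induction l)
    case 0
    have "Ei *\<^sub>v j = c s 0"
      using s0(2) unfolding Pc sub0[OF c_carrier] .
    moreover have "Ei ^\<^sub>m Suc 0 = Ei" using carrier(5) by simp
    ultimately show ?case by simp
  next
    case (Suc l)
    have "Ei *\<^sub>v c s l = c s (Suc l)"
      using sS(2)[of l] unfolding Pc sub0[OF c_carrier] .
    then show ?case unfolding Ei_pow_Suc(2)[OF jc, of "Suc l"] Suc[symmetric] by simp
  qed
  then show "c s l = Ei ^\<^sub>m Suc l *\<^sub>v (f s - vleft n f s)"
    unfolding j_def .
qed

text \<open>Inside the interval the left limit is consistent as well, so the jump lies in the image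
  of P; by \<open>impulses\<close>, P also annihilates it.\<close>

lemma no_jump:
  assumes s: "a < s" "s < b"
  shows "vleft n f s = f s" "c s l = 0\<^sub>v n"
proof -
  have P: "P *\<^sub>v vleft n f s = vleft n f s"
  proof (rule eq_vecI)
    fix i assume "i < dim_vec (vleft n f s)"
    then have i: "i < n" by (simp add: vleft_def)
    have "((\<lambda>u. (P *\<^sub>v f u) $ i) \<longlongrightarrow> (P *\<^sub>v vleft n f s) $ i) (at_left s)"
      by (rule mult_mat_vec_tendsto[OF carrier(3) f_carrier vleft_carrier vleft_tendsto[OF x] i])
    moreover have "\<forall>\<^sub>F u in at_left s. (P *\<^sub>v f u) $ i = f u $ i"
      unfolding eventually_at_left_field using s by (intro exI[of _ a]) (auto simp: consistent)
    ultimately have "((\<lambda>u. f u $ i) \<longlongrightarrow> (P *\<^sub>v vleft n f s) $ i) (at_left s)"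
      by (simp only: tendsto_cong)
    then show "(P *\<^sub>v vleft n f s) $ i = vleft n f s $ i"
      using tendsto_unique[OF _ _ vleft_tendsto[OF x i]] by simp
  qed (simp add: vleft_def carrier_matD[OF carrier(3)])
  have s': "a \<le> s" using s by simp
  have "f s - vleft n f s = P *\<^sub>v (f s - vleft n f s)"
    unfolding mult_minus_distrib_mat_vec[OF carrier(3) f_carrier vleft_carrier] P consistent[OF s' s(2)] ..
  then have j: "f s - vleft n f s = 0\<^sub>v n"
    using impulses(1)[OF s' s(2)] by simp
  then show "vleft n f s = f s"
    using vec_sub_eq_0D[OF f_carrier vleft_carrier j] by simp
  show "c s l = 0\<^sub>v n"
    unfolding impulses(2)[OF s' s(2)] j by (rule mult_mat_zero_vec[OF pow_carrier_mat[OF carrier(5)]])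
qed

lemma initial_value: "f a = P *\<^sub>v left"
proof -
  have "P *\<^sub>v f a - P *\<^sub>v left = 0\<^sub>v n"
    using impulses(1)[of a] ab mult_minus_distrib_mat_vec[OF carrier(3) f_carrier vleft_carrier] by simp
  then have "P *\<^sub>v f a = P *\<^sub>v left"
    by (rule vec_sub_eq_0D[rotated 2]) (intro mult_vec_carrier f_carrier vleft_carrier)+
  with consistent[of a] ab show ?thesis by simp
qed

text \<open>The jump at a contains the new value f a, but that lies in the image of P, which Ei
  annihilates. Only the incoming left limit is visible in the impulses.\<close>

lemma initial_impulses: "c a l = - (Ei ^\<^sub>m Suc l *\<^sub>v left)"
proof -
  note cE = pow_carrier_mat[OF carrier(5)]
  have "c a l = Ei ^\<^sub>m Suc l *\<^sub>v f a - Ei ^\<^sub>m Suc l *\<^sub>v left"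
    by (simp only: impulses(2)[OF order_refl ab] mult_minus_distrib_mat_vec[OF cE f_carrier vleft_carrier])
  also have "Ei ^\<^sub>m Suc l *\<^sub>v f a = 0\<^sub>v n"
    unfolding initial_value by (rule Ei_pow_P[OF vleft_carrier])
  also have "0\<^sub>v n - Ei ^\<^sub>m Suc l *\<^sub>v left = - (Ei ^\<^sub>m Suc l *\<^sub>v left)"
    using mult_vec_carrier(4)[OF vleft_carrier, of "Suc l" f a] by (intro eq_vecI) auto
  finally show ?thesis .
qed

lemma flow:
  assumes s: "a \<le> s" "s < b"
  shows "f s = mexp Ad (s - a) *\<^sub>v (P *\<^sub>v left)"
proof -
  \<comment> \<open>Nothing so far excludes kinks of f inside the interval. They are finitely many,
    and \<open>no_jump\<close> provides continuity there, which is what the uniqueness theorem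
    needs.\<close>
  define K where "K = (\<Union>i<n. {a..s} \<inter> {u. \<not> smooth_near (\<lambda>u. f u $ i) u})"
  have "f s = mexp Ad (s - a) *\<^sub>v f a"
  proof (rule linear_ode_unique[OF carrier(4) f_carrier s(1)])
    show "finite K"
      unfolding K_def by (intro finite_UN_I finite_lessThan pws_finite_breaks vrepD(5)[OF x]) simp
    show "((\<lambda>u. f u $ i) has_real_derivative (Ad *\<^sub>v f u) $ i) (at u)"
      if u: "a < u" "u < s" "u \<notin> K" and i: "i < n" for u i
    proof -
      have "smooth_near (\<lambda>u. f u $ i) u" using u i by (auto simp: K_def)
      then obtain g where g: "smooth g" "\<forall>\<^sub>F v in nhds u. f v $ i = g v"
        unfolding smooth_near_def by blast
      have "r u $ i = right_deriv (\<lambda>u. f u $ i) u" using i by (simp add: vright_deriv_def)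
      with right_deriv_smooth_near(2)[OF g] show ?thesis
        using flow_equation[of u] u s by simp
    qed
    show "continuous_on {a..s} (\<lambda>u. f u $ i)" if i: "i < n" for i
      unfolding continuous_on_def
    proof
      fix u assume u: "u \<in> {a..s}"
      note right = pws_tendsto_right[OF vrepD(5)[OF x i], of u]
      show "((\<lambda>u. f u $ i) \<longlongrightarrow> f u $ i) (at u within {a..s})"
      proof (cases "u = a")
        case True
        have "((\<lambda>u. f u $ i) \<longlongrightarrow> f u $ i) (at u within {u..})"
          using right by (simp add: at_within_Ici_at_right)
        then show ?thesis
          by (rule tendsto_within_subset) (use True in auto)
      next
        case False
        then have "vleft n f u = f u" using u s by (intro no_jump) auto
        with vleft_tendsto[OF x i, of u] right have "((\<lambda>u. f u $ i) \<longlongrightarrow> f u $ i) (at u)"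
          by (simp add: filterlim_at_split)
        then show ?thesis by (rule tendsto_within_subset) simp
      qed
    qed
  qed
  then show ?thesis unfolding initial_value .
qed

lemma final_value: "vleft n f b = mexp Ad (b - a) *\<^sub>v (P *\<^sub>v left)"
proof (rule eq_vecI)
  have Pl: "P *\<^sub>v left \<in> carrier_vec n" by (intro mult_vec_carrier vleft_carrier)
  fix i assume "i < dim_vec (mexp Ad (b - a) *\<^sub>v (P *\<^sub>v left))"
  then have i: "i < n" using mexp_carrier[OF carrier(4), of "b - a"] by simp
  have "((\<lambda>s. (mexp Ad (s - a) *\<^sub>v (P *\<^sub>v left)) $ i) \<longlongrightarrow> (mexp Ad (b - a) *\<^sub>v (P *\<^sub>v left)) $ i) (at b)"
    using DERIV_isCont[OF mexp_mult_vec_has_derivative[OF carrier(4) Pl i, of a b]] by (simp add: isCont_def)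
  then have "((\<lambda>s. (mexp Ad (s - a) *\<^sub>v (P *\<^sub>v left)) $ i) \<longlongrightarrow> (mexp Ad (b - a) *\<^sub>v (P *\<^sub>v left)) $ i) (at_left b)"
    by (rule tendsto_within_subset) simp
  moreover have "\<forall>\<^sub>F s in at_left b. f s $ i = (mexp Ad (s - a) *\<^sub>v (P *\<^sub>v left)) $ i"
    unfolding eventually_at_left_field using ab flow by (intro exI[of _ a]) auto
  ultimately have "((\<lambda>s. f s $ i) \<longlongrightarrow> (mexp Ad (b - a) *\<^sub>v (P *\<^sub>v left)) $ i) (at_left b)"
    by (simp only: tendsto_cong)
  then show "vleft n f b $ i = (mexp Ad (b - a) *\<^sub>v (P *\<^sub>v left)) $ i"
    using tendsto_unique[OF _ vleft_tendsto[OF x i]] by simp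
qed (use mexp_carrier[OF carrier(4), of "b - a"] in \<open>simp add: vleft_def\<close>)

end

context mode
begin

text \<open>The converse of the description in \<open>mode_solution\<close>: the flow of P w
  together with the impulses forced by w solves the DAE with left limit w. It serves to verify the
  auxiliary solution that starts in the unobservable space.\<close>

lemma flow_homogeneous:
  assumes x: "vrep n x f c" and ab: "a < b" and w: "w \<in> carrier_vec n" and left: "vleft n f a = w"
    and f: "\<And>s. a \<le> s \<Longrightarrow> s < b \<Longrightarrow> f s = mexp Ad (s - a) *\<^sub>v (P *\<^sub>v w)"
    and c: "\<And>l. c a l = - (Ei ^\<^sub>m Suc l *\<^sub>v w)" "\<And>s l. a < s \<Longrightarrow> s < b \<Longrightarrow> c s l = 0\<^sub>v n"
  shows "homogeneous_piece n E A a b f c"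
  unfolding homogeneous_piece_def
proof (intro ballI conjI allI)
  have Pw: "P *\<^sub>v w \<in> carrier_vec n" by (rule mult_vec_carrier(1)[OF w])
  have fc: "f s \<in> carrier_vec n" for s by (rule vrepD(2)[OF x])
  have zero: "E *\<^sub>v 0\<^sub>v n = A *\<^sub>v 0\<^sub>v n"
    by (simp only: mult_mat_zero_vec[OF carrier(1)] mult_mat_zero_vec[OF carrier(2)])
  have self: "v - v = 0\<^sub>v n" if "v \<in> carrier_vec n" for v :: "real vec"
    using that by simp
  fix s assume "s \<in> {a..<b}"
  then have s: "a \<le> s" "s < b" by auto
  have Pf: "P *\<^sub>v f s = f s"
    unfolding f[OF s] by (rule P_flow[OF w])
  have "vright_deriv n f s = Ad *\<^sub>v f s"
  proof (rule eq_vecI)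
    fix i assume "i < dim_vec (Ad *\<^sub>v f s)"
    then have i: "i < n" using carrier(4) by simp
    have "((\<lambda>u. (mexp Ad (u - a) *\<^sub>v (P *\<^sub>v w)) $ i) has_real_derivative (Ad *\<^sub>v f s) $ i) (at s within {s<..})"
      unfolding f[OF s] by (rule has_field_derivative_at_within) (rule mexp_mult_vec_has_derivative[OF carrier(4) Pw i])
    moreover have "\<forall>\<^sub>F u in at_right s. (f u $ i - f s $ i) / (u - s) =
        ((mexp Ad (u - a) *\<^sub>v (P *\<^sub>v w)) $ i - (mexp Ad (s - a) *\<^sub>v (P *\<^sub>v w)) $ i) / (u - s)"
      unfolding eventually_at_right_field using s f by (intro exI[of _ b]) auto
    ultimately have "((\<lambda>u. f u $ i) has_real_derivative (Ad *\<^sub>v f s) $ i) (at s within {s<..})"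
      unfolding has_field_derivative_iff by (simp only: tendsto_cong)
    from right_deriv_eqI[OF this] show "vright_deriv n f s $ i = (Ad *\<^sub>v f s) $ i"
      using i by (simp add: vright_deriv_def)
  qed (use carrier(4) in \<open>simp add: vright_deriv_def\<close>)
  moreover have "E *\<^sub>v (Ad *\<^sub>v f s) = A *\<^sub>v f s"
  proof (rule join)
    show "P *\<^sub>v (Ad *\<^sub>v f s) = Ad *\<^sub>v f s" by (rule mult_vec(2)[OF fc])
    have "Ei *\<^sub>v (Ad *\<^sub>v f s) = Ei *\<^sub>v (P *\<^sub>v (Ad *\<^sub>v f s))"
      by (simp only: mult_vec(2)[OF fc])
    also have "\<dots> = 0\<^sub>v n" by (rule mult_vec(5)[OF mult_vec_carrier(2)[OF fc]])
    finally show "Ei *\<^sub>v (Ad *\<^sub>v f s) = f s - P *\<^sub>v f s"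
      unfolding Pf self[OF fc] .
  qed (intro mult_vec_carrier fc)+
  ultimately show "E *\<^sub>v vright_deriv n f s = A *\<^sub>v f s" by simp
  note neg = mult_mat_uminus_vec
  have negz: "- (0\<^sub>v n) = (0\<^sub>v n :: real vec)" by (rule eq_vecI) auto
  note ec = mult_vec_carrier(4)[OF w]
  show "E *\<^sub>v (f s - vleft n f s) = A *\<^sub>v c s 0"
  proof (cases "s = a")
    case True
    have fa: "f a = P *\<^sub>v w"
      using f[of a] ab one_mult_mat_vec[OF Pw] by (simp add: mexp_0[OF carrier(4)])
    \<comment> \<open>At the left end the jump is P w - w. P annihilates it, and Ei maps it to - Ei
      w, the coefficient of order 0.\<close>
    have "E *\<^sub>v (P *\<^sub>v w - w) = A *\<^sub>v (- (Ei ^\<^sub>m Suc 0 *\<^sub>v w))"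
    proof (rule join)
      have "P *\<^sub>v (P *\<^sub>v w - w) = 0\<^sub>v n"
        unfolding mult_minus_distrib_mat_vec[OF carrier(3) Pw w] mult_vec(1)[OF w] by (rule self[OF Pw])
      also have "0\<^sub>v n = Ad *\<^sub>v (P *\<^sub>v (- (Ei ^\<^sub>m Suc 0 *\<^sub>v w)))"
        by (simp only: neg[OF carrier(3) ec] P_Ei_pow[OF w] negz mult_mat_zero_vec[OF carrier(4)])
      also have "\<dots> = Ad *\<^sub>v (- (Ei ^\<^sub>m Suc 0 *\<^sub>v w))"
        by (intro mult_vec(3) uminus_carrier_vec[THEN iffD2] ec)
      finally show "P *\<^sub>v (P *\<^sub>v w - w) = Ad *\<^sub>v (- (Ei ^\<^sub>m Suc 0 *\<^sub>v w))" .
      have "Ei ^\<^sub>m Suc 0 = Ei" using carrier(5) by simp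
      then show "Ei *\<^sub>v (P *\<^sub>v w - w) = - (Ei ^\<^sub>m Suc 0 *\<^sub>v w) - P *\<^sub>v (- (Ei ^\<^sub>m Suc 0 *\<^sub>v w))"
        unfolding mult_minus_distrib_mat_vec[OF carrier(5) Pw w] mult_vec(5)[OF w]
          neg[OF carrier(3) ec] P_Ei_pow[OF w] negz
        using ec[of "Suc 0"] by (intro eq_vecI) auto
    qed (intro minus_carrier_vec Pw w uminus_carrier_vec[THEN iffD2] ec)+
    then show ?thesis
      unfolding True fa left c(1) .
  next
    case False
    then have as: "a < s" using s by simp
    have "vleft n f s = f s"
    proof (rule eq_vecI)
      fix i assume "i < dim_vec (f s)"
      then have i: "i < n" using fc[of s] by simp
      have "((\<lambda>u. (mexp Ad (u - a) *\<^sub>v (P *\<^sub>v w)) $ i) \<longlongrightarrow> f s $ i) (at s)"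
        using DERIV_isCont[OF mexp_mult_vec_has_derivative[OF carrier(4) Pw i, of a s]] f[OF s]
        by (simp add: isCont_def)
      then have "((\<lambda>u. (mexp Ad (u - a) *\<^sub>v (P *\<^sub>v w)) $ i) \<longlongrightarrow> f s $ i) (at_left s)"
        by (rule tendsto_within_subset) simp
      moreover have "\<forall>\<^sub>F u in at_left s. f u $ i = (mexp Ad (u - a) *\<^sub>v (P *\<^sub>v w)) $ i"
        unfolding eventually_at_left_field using as s f by (intro exI[of _ a]) auto
      ultimately have "((\<lambda>u. f u $ i) \<longlongrightarrow> f s $ i) (at_left s)"
        by (simp only: tendsto_cong)
      then show "vleft n f s $ i = f s $ i"
        using left_limit_eqI i by (simp add: vleft_def)
    qed (use fc[of s] in \<open>simp add: vleft_def\<close>)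
    then show ?thesis
      unfolding c(2)[OF as s(2)] by (simp only: self[OF fc] zero)
  qed
  fix l
  show "E *\<^sub>v c s l = A *\<^sub>v c s (Suc l)"
  proof (cases "s = a")
    case True
    show ?thesis
      unfolding True c(1)
    proof (rule join)
      show "P *\<^sub>v (- (Ei ^\<^sub>m Suc l *\<^sub>v w)) = Ad *\<^sub>v (- (Ei ^\<^sub>m Suc (Suc l) *\<^sub>v w))"
      proof -
        have "Ad *\<^sub>v (- (Ei ^\<^sub>m Suc (Suc l) *\<^sub>v w)) = Ad *\<^sub>v (P *\<^sub>v (- (Ei ^\<^sub>m Suc (Suc l) *\<^sub>v w)))"
          by (intro mult_vec(3)[symmetric] uminus_carrier_vec[THEN iffD2] ec)
        then show ?thesis
          by (simp only: neg[OF carrier(3) ec] P_Ei_pow[OF w] negz mult_mat_zero_vec[OF carrier(4)])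
      qed
      show "Ei *\<^sub>v (- (Ei ^\<^sub>m Suc l *\<^sub>v w)) =
          - (Ei ^\<^sub>m Suc (Suc l) *\<^sub>v w) - P *\<^sub>v (- (Ei ^\<^sub>m Suc (Suc l) *\<^sub>v w))"
        unfolding neg[OF carrier(3) ec] neg[OF carrier(5) ec] P_Ei_pow[OF w] negz
          Ei_pow_Suc(2)[OF w, of "Suc l", symmetric]
        using ec[of "Suc (Suc l)"] by (intro eq_vecI) auto
    qed (intro uminus_carrier_vec[THEN iffD2] ec)+
  next
    case False
    then have "a < s" using s by simp
    with c(2) s(2) zero show ?thesis by simp
  qed
qed

end

section \<open>Local observations\<close>

lemma stacked_index_less: "j < m \<Longrightarrow> i < k \<Longrightarrow> j * k + i < m * (k :: nat)"
  using mult_le_mono1[of "Suc j" m k] by simp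

lemma hcat_carrier:
  "X1 \<in> carrier_mat n k \<Longrightarrow> X2 \<in> carrier_mat n l \<Longrightarrow> hcat X1 X2 \<in> carrier_mat n (k + l)"
  by (auto simp: hcat_def)

lemma hcat_transpose_mult_vec:
  assumes X1: "X1 \<in> carrier_mat n k" and X2: "X2 \<in> carrier_mat n l"
  shows "transpose_mat (hcat X1 X2) *\<^sub>v v = (transpose_mat X1 *\<^sub>v v) @\<^sub>v (transpose_mat X2 *\<^sub>v v)"
proof (rule eq_vecI)
  note h = hcat_carrier[OF X1 X2]
  show "dim_vec (transpose_mat (hcat X1 X2) *\<^sub>v v) = dim_vec ((transpose_mat X1 *\<^sub>v v) @\<^sub>v (transpose_mat X2 *\<^sub>v v))"
    using h X1 X2 by simp
  fix i assume "i < dim_vec ((transpose_mat X1 *\<^sub>v v) @\<^sub>v (transpose_mat X2 *\<^sub>v v))"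
  then have i: "i < k + l" using X1 X2 by simp
  have len: "length (cols X1) = k" "length (cols X2) = l" using X1 X2 by auto
  have "col (hcat X1 X2) i = (cols X1 @ cols X2) ! i"
    unfolding hcat_def using i X1 X2 len
    by (intro col_mat_of_cols) (auto simp: nth_append)
  also have "\<dots> = (if i < k then col X1 i else col X2 (i - k))"
    using i X1 X2 len by (auto simp: nth_append)
  finally show "(transpose_mat (hcat X1 X2) *\<^sub>v v) $ i =
      ((transpose_mat X1 *\<^sub>v v) @\<^sub>v (transpose_mat X2 *\<^sub>v v)) $ i"
    using i h X1 X2 by auto
qed

lemma transpose_mult_vec:
  fixes A :: "real mat"
  assumes "A \<in> carrier_mat m n" "B \<in> carrier_mat n k" "v \<in> carrier_vec m"
  shows "transpose_mat (A * B) *\<^sub>v v = transpose_mat B *\<^sub>v (transpose_mat A *\<^sub>v v)"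
  unfolding transpose_mult[OF assms(1,2)]
  using assms by (intro assoc_mult_mat_vec[of _ k n _ m]) auto

text \<open>A single impulse is itself a piecewise-smooth distribution, so uniqueness of coordinates
  applies to it.\<close>

lemma dirac_sum_inject:
  assumes eq: "dirac_sum p t = dirac_sum q t" and fin: "\<exists>m. \<forall>l\<ge>m. p l = 0" "\<exists>m. \<forall>l\<ge>m. q l = 0"
  shows "p = q"
proof -
  have r: "rep (dirac_sum p t) (\<lambda>_. 0) (\<lambda>s. if s = t then p else (\<lambda>_. 0))"
    if fp: "\<exists>m. \<forall>l\<ge>m. p l = 0" for p
    unfolding rep_def
  proof (intro conjI ext)
    have "\<forall>\<^sub>F u in at s. u \<noteq> t" for s
      by (cases "s = t") (auto simp: eventually_neq_at_within eventually_at_filter intro: t1_space_nhds)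
    then have "\<forall>\<^sub>F u in at s. \<forall>l. (if u = t then p else (\<lambda>_. 0)) l = 0" for s
      by (rule eventually_mono) simp
    then show "fin_impulses (\<lambda>s. if s = t then p else (\<lambda>_. 0))"
      using fp by (simp add: fin_impulses_def)
    fix \<phi>
    have "(\<Sum>\<^sub>\<infinity>s. dirac_sum (if s = t then p else (\<lambda>_. 0)) s \<phi>) =
        (\<Sum>s\<in>{t}. dirac_sum (if s = t then p else (\<lambda>_. 0)) s \<phi>)"
      by (rule infsum_finite_support(1)) auto
    then show "dirac_sum p t \<phi> = (\<integral>s. 0 * tf \<phi> s \<partial>lborel) +
        (\<Sum>\<^sub>\<infinity>s. dirac_sum (if s = t then p else (\<lambda>_. 0)) s \<phi>)" by simp
  qed (rule pws_const)
  have "(\<lambda>s. if s = t then p else (\<lambda>_. 0)) = (\<lambda>s. if s = t then q else (\<lambda>_. 0))"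
    using rep_unique(2)[OF r[OF fin(1)] r[OF fin(2), folded eq]] .
  from fun_cong[OF this, of t] show ?thesis by simp
qed

section \<open>The reduced observable system of a mode\<close>

locale observed_mode = mode +
  fixes ny d :: nat and C Zd :: "real mat"
  assumes C: "C \<in> carrier_mat ny n" and Zd_dim: "Zd \<in> carrier_mat n d"
    and Zd: "orthonormal_basis_mat n Zd (mat_image (transpose_mat (O_diff n ny C P Ad)))"
begin

abbreviation "Zt \<equiv> transpose_mat Zd"
abbreviation "Sd \<equiv> transpose_mat Zd * Ad * Zd"
abbreviation "Rd \<equiv> C * P * Zd"

lemma Zd_carrier: "Zd \<in> carrier_mat n d" "Zt \<in> carrier_mat d n"
  using Zd_dim by simp_all

lemma CP_carrier: "C * P \<in> carrier_mat ny n"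
  by (rule mult_carrier_mat[OF C carrier(3)])

lemma Sd_carrier: "Sd \<in> carrier_mat d d"
  by (rule mult_carrier_mat[OF mult_carrier_mat[OF Zd_carrier(2) carrier(4)] Zd_carrier(1)])

lemma Rd_carrier: "Rd \<in> carrier_mat ny d"
  by (rule mult_carrier_mat[OF CP_carrier Zd_carrier(1)])

lemma Zt_Zd: "w \<in> carrier_vec d \<Longrightarrow> Zt *\<^sub>v (Zd *\<^sub>v w) = w"
  using assoc_mult_mat_vec[OF Zd_carrier(2,1), of w] orthonormal_basis_matD(2)[OF Zd] carrier_matD(2)[OF Zd_dim]
  by simp

lemma O_diff_mult_vec_nth:
  assumes v: "v \<in> carrier_vec n" and j: "j < n" and i: "i < ny"
  shows "(O_diff n ny C P Ad *\<^sub>v v) $ (j * ny + i) = ((C * P) *\<^sub>v (Ad ^\<^sub>m j *\<^sub>v v)) $ i"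
proof -
  have k: "j * ny + i < n * ny"
    using j i by (rule stacked_index_less)
  have M: "C * P * Ad ^\<^sub>m j \<in> carrier_mat ny n"
    by (rule mult_carrier_mat[OF CP_carrier pow_carrier_mat[OF carrier(4)]])
  have "(O_diff n ny C P Ad *\<^sub>v v) $ (j * ny + i) = (\<Sum>l<n. O_diff n ny C P Ad $$ (j * ny + i, l) * v $ l)"
    by (rule mult_mat_vec_nth[OF _ v k]) (simp add: O_diff_def)
  also have "\<dots> = (\<Sum>l<n. (C * P * Ad ^\<^sub>m j) $$ (i, l) * v $ l)"
    using k i by (intro sum.cong) (simp_all add: O_diff_def del: index_mult_mat)
  also have "\<dots> = ((C * P * Ad ^\<^sub>m j) *\<^sub>v v) $ i"
    by (rule mult_mat_vec_nth[OF M v i, symmetric])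
  also have "(C * P * Ad ^\<^sub>m j) *\<^sub>v v = (C * P) *\<^sub>v (Ad ^\<^sub>m j *\<^sub>v v)"
    by (rule assoc_mult_mat_vec[OF CP_carrier pow_carrier_mat[OF carrier(4)] v])
  finally show ?thesis .
qed

lemma O_diff_kernel_iff:
  assumes v: "v \<in> carrier_vec n"
  shows "O_diff n ny C P Ad *\<^sub>v v = 0\<^sub>v (n * ny) \<longleftrightarrow> (\<forall>j<n. (C * P) *\<^sub>v (Ad ^\<^sub>m j *\<^sub>v v) = 0\<^sub>v ny)"
proof
  assume eq: "O_diff n ny C P Ad *\<^sub>v v = 0\<^sub>v (n * ny)"
  show "\<forall>j<n. (C * P) *\<^sub>v (Ad ^\<^sub>m j *\<^sub>v v) = 0\<^sub>v ny"
  proof (intro allI impI eq_vecI)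
    fix j i assume j: "j < n" and "i < dim_vec (0\<^sub>v ny)"
    then have i: "i < ny" by simp
    have "j * ny + i < n * ny" using j i by (rule stacked_index_less)
    then show "((C * P) *\<^sub>v (Ad ^\<^sub>m j *\<^sub>v v)) $ i = 0\<^sub>v ny $ i"
      using O_diff_mult_vec_nth[OF v j i] i unfolding eq by simp
  qed (use C in simp)
next
  assume z: "\<forall>j<n. (C * P) *\<^sub>v (Ad ^\<^sub>m j *\<^sub>v v) = 0\<^sub>v ny"
  show "O_diff n ny C P Ad *\<^sub>v v = 0\<^sub>v (n * ny)"
  proof (rule eq_vecI)
    fix k assume "k < dim_vec (0\<^sub>v (n * ny))"
    then have k: "k < n * ny" by simp
    then have "ny > 0" by (cases ny) auto
    have "k div ny < n" "k mod ny < ny"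
      using k \<open>ny > 0\<close> by (auto simp: less_mult_imp_div_less)
    from O_diff_mult_vec_nth[OF v this] z this k show "(O_diff n ny C P Ad *\<^sub>v v) $ k = 0\<^sub>v (n * ny) $ k"
      by simp
  qed (simp add: O_diff_def)
qed

text \<open>The columns of \<open>Zd\<close> span the image of the transposed observability matrix,
  so both kernels are the complement of one space; pairing each product with itself proves this
  without dimensions. \<open>Zt\<close> thus reads off the state modulo what the output cannot
  see.\<close>

lemma kernel_iff:
  assumes u: "u \<in> carrier_vec n"
  shows "Zt *\<^sub>v u = 0\<^sub>v d \<longleftrightarrow> (\<forall>j<n. (C * P) *\<^sub>v (Ad ^\<^sub>m j *\<^sub>v u) = 0\<^sub>v ny)"
proof -
  let ?O = "O_diff n ny C P Ad"
  have O: "?O \<in> carrier_mat (n * ny) n" by (simp add: O_diff_def)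
  have Ot: "transpose_mat ?O \<in> carrier_mat n (n * ny)" using O by simp
  have im: "mat_image Zd = mat_image (transpose_mat ?O)"
    by (rule orthonormal_basis_matD(3)[OF Zd])
  have "Zt *\<^sub>v u = 0\<^sub>v d \<longleftrightarrow> ?O *\<^sub>v u = 0\<^sub>v (n * ny)"
  proof
    assume z: "Zt *\<^sub>v u = 0\<^sub>v d"
    have Ou: "?O *\<^sub>v u \<in> carrier_vec (n * ny)" by (rule mult_mat_vec_carrier[OF O u])
    have "transpose_mat ?O *\<^sub>v (?O *\<^sub>v u) \<in> mat_image Zd"
      unfolding im unfolding mat_image_def using Ou O by auto
    then obtain w where w: "w \<in> carrier_vec d" "transpose_mat ?O *\<^sub>v (?O *\<^sub>v u) = Zd *\<^sub>v w"
      using Zd_carrier(1) by (auto simp: mat_image_def)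
    have "(?O *\<^sub>v u) \<bullet> (?O *\<^sub>v u) = (transpose_mat ?O *\<^sub>v (?O *\<^sub>v u)) \<bullet> u"
      by (rule transpose_vec_mult_scalar[OF O u Ou, symmetric])
    also have "\<dots> = u \<bullet> (Zd *\<^sub>v w)"
      unfolding w(2) by (rule comm_scalar_prod[OF mult_mat_vec_carrier[OF Zd_carrier(1) w(1)] u])
    also have "\<dots> = (Zt *\<^sub>v u) \<bullet> w"
      by (rule transpose_vec_mult_scalar[OF Zd_carrier(1) w(1) u, symmetric])
    also have "\<dots> = 0" unfolding z using w(1) by simp
    finally show "?O *\<^sub>v u = 0\<^sub>v (n * ny)"
      by (rule scalar_prod_self_eq_0[OF Ou])
  next
    assume z: "?O *\<^sub>v u = 0\<^sub>v (n * ny)"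
    have Zu: "Zt *\<^sub>v u \<in> carrier_vec d" by (rule mult_mat_vec_carrier[OF Zd_carrier(2) u])
    have "Zd *\<^sub>v (Zt *\<^sub>v u) \<in> mat_image (transpose_mat ?O)"
      unfolding im[symmetric] unfolding mat_image_def using Zu Zd_carrier(1) by (intro imageI) simp
    then obtain y where y: "y \<in> carrier_vec (n * ny)" "Zd *\<^sub>v (Zt *\<^sub>v u) = transpose_mat ?O *\<^sub>v y"
      using O by (auto simp: mat_image_def)
    have "(Zt *\<^sub>v u) \<bullet> (Zt *\<^sub>v u) = u \<bullet> (Zd *\<^sub>v (Zt *\<^sub>v u))"
      by (rule transpose_vec_mult_scalar[OF Zd_carrier(1) Zu u])
    also have "\<dots> = (transpose_mat ?O *\<^sub>v y) \<bullet> u"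
      unfolding y(2) by (rule comm_scalar_prod[OF u mult_mat_vec_carrier[OF Ot y(1)]])
    also have "\<dots> = y \<bullet> (?O *\<^sub>v u)"
      by (rule transpose_vec_mult_scalar[OF O u y(1)])
    also have "\<dots> = 0" unfolding z using y(1) by simp
    finally show "Zt *\<^sub>v u = 0\<^sub>v d"
      by (rule scalar_prod_self_eq_0[OF Zu])
  qed
  with O_diff_kernel_iff[OF u] show ?thesis by simp
qed

lemma kernel_orbit:
  assumes u: "u \<in> carrier_vec n" and z: "Zt *\<^sub>v u = 0\<^sub>v d"
  shows "(C * P) *\<^sub>v (Ad ^\<^sub>m j *\<^sub>v u) = 0\<^sub>v ny"
  using observed_orbit_zero[OF carrier(4) u CP_carrier] z kernel_iff[OF u] by blast

text \<open>Shifting the exponent by one calls for the n-th power too, which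
  \<open>kernel_orbit\<close> supplies.\<close>

lemma kernel_Ad:
  assumes u: "u \<in> carrier_vec n" and z: "Zt *\<^sub>v u = 0\<^sub>v d"
  shows "Zt *\<^sub>v (Ad *\<^sub>v u) = 0\<^sub>v d"
proof -
  have "Ad ^\<^sub>m j *\<^sub>v (Ad *\<^sub>v u) = Ad ^\<^sub>m Suc j *\<^sub>v u" for j
    using assoc_mult_mat_vec[OF pow_carrier_mat[OF carrier(4)] carrier(4) u, of j] by simp
  then have "\<forall>j<n. (C * P) *\<^sub>v (Ad ^\<^sub>m j *\<^sub>v (Ad *\<^sub>v u)) = 0\<^sub>v ny"
    by (simp only: kernel_orbit[OF u z]) simp
  then show ?thesis
    using kernel_iff[OF mult_vec_carrier(2)[OF u]] by blast
qed

lemma residual_kernel: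
  assumes v: "v \<in> carrier_vec n"
  shows "v - Zd *\<^sub>v (Zt *\<^sub>v v) \<in> carrier_vec n" "Zt *\<^sub>v (v - Zd *\<^sub>v (Zt *\<^sub>v v)) = 0\<^sub>v d"
proof -
  have Zv: "Zt *\<^sub>v v \<in> carrier_vec d" by (rule mult_mat_vec_carrier[OF Zd_carrier(2) v])
  note ZZ = mult_mat_vec_carrier[OF Zd_carrier(1) Zv]
  show "v - Zd *\<^sub>v (Zt *\<^sub>v v) \<in> carrier_vec n" using v ZZ by simp
  show "Zt *\<^sub>v (v - Zd *\<^sub>v (Zt *\<^sub>v v)) = 0\<^sub>v d"
    unfolding mult_minus_distrib_mat_vec[OF Zd_carrier(2) v ZZ] Zt_Zd[OF Zv] using Zv by simp
qed

text \<open>The residual of projecting v onto the observable directions lies in the kernel of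
  \<open>Zt\<close>, which is invariant under Ad and produces no output. Replacing v by its
  projection therefore changes nothing that is observed.\<close>

lemma reduced_system:
  assumes v: "v \<in> carrier_vec n"
  shows "Sd *\<^sub>v (Zt *\<^sub>v v) = Zt *\<^sub>v (Ad *\<^sub>v v)" "Rd *\<^sub>v (Zt *\<^sub>v v) = C *\<^sub>v (P *\<^sub>v v)"
proof -
  have Zv: "Zt *\<^sub>v v \<in> carrier_vec d" by (rule mult_mat_vec_carrier[OF Zd_carrier(2) v])
  note ZZ = mult_mat_vec_carrier[OF Zd_carrier(1) Zv]
  note rk = residual_kernel[OF v]
  have "Zt *\<^sub>v (Ad *\<^sub>v v) - Zt *\<^sub>v (Ad *\<^sub>v (Zd *\<^sub>v (Zt *\<^sub>v v))) = 0\<^sub>v d"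
    using kernel_Ad[OF rk]
    unfolding mult_minus_distrib_mat_vec[OF carrier(4) v ZZ]
      mult_minus_distrib_mat_vec[OF Zd_carrier(2) mult_vec_carrier(2)[OF v] mult_vec_carrier(2)[OF ZZ]] .
  then have "Zt *\<^sub>v (Ad *\<^sub>v v) = Zt *\<^sub>v (Ad *\<^sub>v (Zd *\<^sub>v (Zt *\<^sub>v v)))"
    by (rule vec_sub_eq_0D[rotated 2])
      (intro mult_mat_vec_carrier[OF Zd_carrier(2)] mult_vec_carrier v ZZ)+
  also have "\<dots> = Sd *\<^sub>v (Zt *\<^sub>v v)"
    unfolding assoc_mult_mat_vec[OF mult_carrier_mat[OF Zd_carrier(2) carrier(4)] Zd_carrier(1) Zv]
      assoc_mult_mat_vec[OF Zd_carrier(2) carrier(4) ZZ] ..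
  finally show "Sd *\<^sub>v (Zt *\<^sub>v v) = Zt *\<^sub>v (Ad *\<^sub>v v)" by (rule sym)
  have "Ad ^\<^sub>m 0 *\<^sub>v (v - Zd *\<^sub>v (Zt *\<^sub>v v)) = v - Zd *\<^sub>v (Zt *\<^sub>v v)"
    using carrier(4) rk(1) by simp
  then have "(C * P) *\<^sub>v v - (C * P) *\<^sub>v (Zd *\<^sub>v (Zt *\<^sub>v v)) = 0\<^sub>v ny"
    using kernel_orbit[OF rk, of 0] mult_minus_distrib_mat_vec[OF CP_carrier v ZZ] by simp
  then have "(C * P) *\<^sub>v v = (C * P) *\<^sub>v (Zd *\<^sub>v (Zt *\<^sub>v v))"
    by (rule vec_sub_eq_0D[rotated 2]) (intro mult_mat_vec_carrier[OF CP_carrier] v ZZ)+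
  also have "\<dots> = Rd *\<^sub>v (Zt *\<^sub>v v)"
    by (rule assoc_mult_mat_vec[OF CP_carrier Zd_carrier(1) Zv, symmetric])
  finally show "Rd *\<^sub>v (Zt *\<^sub>v v) = C *\<^sub>v (P *\<^sub>v v)"
    using assoc_mult_mat_vec[OF C carrier(3) v] by simp
qed

text \<open>The reduced orbit of w has the outputs of the full orbit of Zd w. If they all vanish, Zd
  w lies in the kernel of \<open>Zt\<close>, but \<open>Zt\<close> recovers w from Zd w.\<close>

lemma reduced_observable:
  assumes w: "w \<in> carrier_vec d" and z: "\<And>j. Rd *\<^sub>v (Sd ^\<^sub>m j *\<^sub>v w) = 0\<^sub>v ny"
  shows "w = 0\<^sub>v d"
proof -
  define v where "v = Zd *\<^sub>v w"
  have v: "v \<in> carrier_vec n" unfolding v_def by (rule mult_mat_vec_carrier[OF Zd_carrier(1) w])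
  have wv: "w = Zt *\<^sub>v v" unfolding v_def by (rule Zt_Zd[OF w, symmetric])
  have Av: "Ad ^\<^sub>m j *\<^sub>v v \<in> carrier_vec n" for j
    by (rule mult_mat_vec_carrier[OF pow_carrier_mat[OF carrier(4)] v])
  have "Sd ^\<^sub>m j *\<^sub>v w = Zt *\<^sub>v (Ad ^\<^sub>m j *\<^sub>v v)" for j
  proof (induction j)
    case 0
    have "Sd ^\<^sub>m 0 = 1\<^sub>m d" "Ad ^\<^sub>m 0 = 1\<^sub>m n" using carrier(4) Zd_carrier by simp_all
    then show ?case using w v by (simp only: one_mult_mat_vec wv)
  next
    case (Suc j)
    have "Sd ^\<^sub>m Suc j *\<^sub>v w = Sd *\<^sub>v (Sd ^\<^sub>m j *\<^sub>v w)"
      unfolding pow_mat_Suc_left[OF Sd_carrier]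
      by (rule assoc_mult_mat_vec[OF Sd_carrier pow_carrier_mat[OF Sd_carrier] w])
    also have "\<dots> = Zt *\<^sub>v (Ad *\<^sub>v (Ad ^\<^sub>m j *\<^sub>v v))"
      unfolding Suc by (rule reduced_system(1)[OF Av])
    also have "Ad *\<^sub>v (Ad ^\<^sub>m j *\<^sub>v v) = Ad ^\<^sub>m Suc j *\<^sub>v v"
      unfolding pow_mat_Suc_left[OF carrier(4)]
      by (rule assoc_mult_mat_vec[OF carrier(4) pow_carrier_mat[OF carrier(4)] v, symmetric])
    finally show ?case .
  qed
  then have "(C * P) *\<^sub>v (Ad ^\<^sub>m j *\<^sub>v v) = 0\<^sub>v ny" for j
    using z[of j] reduced_system(2)[OF Av] assoc_mult_mat_vec[OF C carrier(3) Av] by simp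
  then show ?thesis
    using kernel_iff[OF v] wv by simp
qed

text \<open>The reduced state of the flow solves a linear ODE with zero initial value and stays
  zero, so the output need not be expanded into a power series.\<close>

lemma flow_output_zero:
  assumes w: "w \<in> carrier_vec n" and z: "Zt *\<^sub>v (P *\<^sub>v w) = 0\<^sub>v d" and t: "0 \<le> t"
  shows "C *\<^sub>v (mexp Ad t *\<^sub>v (P *\<^sub>v w)) = 0\<^sub>v ny"
proof -
  have Pw: "P *\<^sub>v w \<in> carrier_vec n" by (rule mult_vec_carrier(1)[OF w])
  define e where "e s = mexp Ad (s - 0) *\<^sub>v (P *\<^sub>v w)" for s
  have e: "e s \<in> carrier_vec n" for s
    unfolding e_def by (rule mult_vec_carrier(5)[OF Pw])
  have Ze: "Zt *\<^sub>v e s \<in> carrier_vec d" for s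
    by (rule mult_mat_vec_carrier[OF Zd_carrier(2) e])
  have der: "((\<lambda>s. (Zt *\<^sub>v e s) $ i) has_real_derivative (Sd *\<^sub>v (Zt *\<^sub>v e s)) $ i) (at s)" if i: "i < d" for s i
    unfolding reduced_system(1)[OF e]
    by (rule mult_mat_vec_has_derivative[OF Zd_carrier(2) e mult_vec_carrier(2)[OF e] _ i])
      (unfold e_def, rule mexp_mult_vec_has_derivative[OF carrier(4) Pw])
  have "Zt *\<^sub>v e t = mexp Sd (t - 0) *\<^sub>v (Zt *\<^sub>v e 0)"
    by (rule linear_ode_unique[OF Sd_carrier Ze t finite.emptyI])
      (auto intro!: der continuous_at_imp_continuous_on DERIV_isCont[OF der])
  also have "e 0 = P *\<^sub>v w"
    unfolding e_def using one_mult_mat_vec[OF Pw] by (simp add: mexp_0[OF carrier(4)])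
  finally have "Zt *\<^sub>v e t = 0\<^sub>v d"
    unfolding z by (simp only: mult_mat_zero_vec[OF mexp_carrier[OF Sd_carrier]])
  then have "C *\<^sub>v (P *\<^sub>v e t) = 0\<^sub>v ny"
    unfolding reduced_system(2)[OF e, symmetric] by (simp only: mult_mat_zero_vec[OF Rd_carrier])
  moreover have "P *\<^sub>v e t = e t"
    unfolding e_def by (rule P_flow[OF w])
  ultimately show ?thesis by (simp add: e_def)
qed

lemma O_imp_mult_vec_nth:
  assumes v: "v \<in> carrier_vec n" and k: "k < (n - 1) * ny"
  shows "(O_imp n ny C Ei *\<^sub>v v) $ k = (C *\<^sub>v (Ei ^\<^sub>m Suc (k div ny) *\<^sub>v v)) $ (k mod ny)"
proof -
  have "ny > 0" using k by (cases ny) auto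
  then have i: "k mod ny < ny" by simp
  have M: "C * Ei ^\<^sub>m Suc (k div ny) \<in> carrier_mat ny n"
    by (rule mult_carrier_mat[OF C pow_carrier_mat[OF carrier(5)]])
  have "(O_imp n ny C Ei *\<^sub>v v) $ k = (\<Sum>l<n. O_imp n ny C Ei $$ (k, l) * v $ l)"
    by (rule mult_mat_vec_nth[OF _ v k]) (simp add: O_imp_def)
  also have "\<dots> = (\<Sum>l<n. (C * Ei ^\<^sub>m Suc (k div ny)) $$ (k mod ny, l) * v $ l)"
    using k by (intro sum.cong) (simp_all add: O_imp_def del: index_mult_mat)
  also have "\<dots> = ((C * Ei ^\<^sub>m Suc (k div ny)) *\<^sub>v v) $ (k mod ny)"
    by (rule mult_mat_vec_nth[OF M v i, symmetric])
  also have "(C * Ei ^\<^sub>m Suc (k div ny)) *\<^sub>v v = C *\<^sub>v (Ei ^\<^sub>m Suc (k div ny) *\<^sub>v v)"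
    by (rule assoc_mult_mat_vec[OF C pow_carrier_mat[OF carrier(5)] v])
  finally show ?thesis .
qed

text \<open>The rows of \<open>O_imp\<close> stop at exponent n - 1, but from exponent n on the
  powers of Ei vanish.\<close>

lemma O_imp_kernel:
  assumes v: "v \<in> carrier_vec n" and z: "O_imp n ny C Ei *\<^sub>v v = 0\<^sub>v ((n - 1) * ny)"
  shows "C *\<^sub>v (Ei ^\<^sub>m Suc l *\<^sub>v v) = 0\<^sub>v ny"
proof (cases "l < n - 1")
  case True
  show ?thesis
  proof (rule eq_vecI)
    fix i assume "i < dim_vec (0\<^sub>v ny)"
    then have i: "i < ny" by simp
    have k: "l * ny + i < (n - 1) * ny" using True i by (rule stacked_index_less)
    from O_imp_mult_vec_nth[OF v k] i k show "(C *\<^sub>v (Ei ^\<^sub>m Suc l *\<^sub>v v)) $ i = 0\<^sub>v ny $ i"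
      unfolding z by simp
  qed (use C in simp)
next
  case False
  then have "n \<le> Suc l" by simp
  from Ei_pow_large[OF v this] show ?thesis
    by (simp only: mult_mat_zero_vec[OF C])
qed

end

section \<open>Local observers evaluate the incoming left limit\<close>

locale observed_solution = mode_solution + observed_mode +
  fixes w
  assumes w: "w = vec_restrict {a..<b} (mat_dist C x)"
begin

lemma w_vrep: "vrep ny w (\<lambda>s. if s \<in> {a..<b} then C *\<^sub>v f s else 0\<^sub>v ny)
    (\<lambda>t l. if t \<in> {a..<b} then C *\<^sub>v c t l else 0\<^sub>v ny)"
  unfolding w by (rule vrep_restrict[OF vrep_mat_dist[OF C x]]) auto

lemma output_eq_reduced:
  assumes "a \<le> s" "s < b"
  shows "C *\<^sub>v f s = Rd *\<^sub>v (Zt *\<^sub>v f s)"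
  unfolding reduced_system(2)[OF f_carrier] consistent[OF assms] ..

text \<open>The open interval discards the impulse at a, and \<open>no_jump\<close> excludes
  impulses inside. What remains is the regular part, into which z enters only through its values
  inside.\<close>

lemma restrict_output:
  assumes z: "\<And>s. a < s \<Longrightarrow> s < b \<Longrightarrow> Rd *\<^sub>v z s = C *\<^sub>v f s"
  shows "vec_restrict {a<..<b} w = fun_dist_vec ny (\<lambda>s. indicator {a<..<b} s \<cdot>\<^sub>v (Rd *\<^sub>v z s))"
proof (rule eq_vecI)
  have dw: "dim_vec w = ny" using vrepD(1)[OF w_vrep] by simp
  show "dim_vec (vec_restrict {a<..<b} w) = dim_vec (fun_dist_vec ny (\<lambda>s. indicator {a<..<b} s \<cdot>\<^sub>v (Rd *\<^sub>v z s)))"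
    by (simp add: vec_restrict_def fun_dist_vec_def dw)
  fix i assume "i < dim_vec (fun_dist_vec ny (\<lambda>s. indicator {a<..<b} s \<cdot>\<^sub>v (Rd *\<^sub>v z s)))"
  then have i: "i < ny" by (simp add: fun_dist_vec_def)
  note rw = vrepD(4)[OF w_vrep i]
  have "(\<Sum>\<^sub>\<infinity>t\<in>{a<..<b}. impulse_at (w $ i) t \<phi>) = (\<Sum>\<^sub>\<infinity>t\<in>{a<..<b}. 0)" for \<phi>
  proof (rule infsum_cong)
    fix t assume t: "t \<in> {a<..<b}"
    then have "C *\<^sub>v c t l = 0\<^sub>v ny" for l
      using no_jump(2)[of t l] mult_mat_zero_vec[OF C] by simp
    then show "impulse_at (w $ i) t \<phi> = 0"
      unfolding impulse_at_rep[OF rw] using t i by (simp add: dirac_sum_def)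
  qed
  then have "vec_restrict {a<..<b} w $ i = fun_dist (\<lambda>s. indicator {a<..<b} s * regular_part (w $ i) s)"
    using i dw by (simp add: vec_restrict_def dist_restrict_def plus_fun_def)
  also have "(\<lambda>s. indicator {a<..<b} s * regular_part (w $ i) s) =
      (\<lambda>s. (indicator {a<..<b} s \<cdot>\<^sub>v (Rd *\<^sub>v z s)) $ i)"
  proof
    fix s
    \<comment> \<open>The product with \<open>Rd\<close> has ny entries for every argument, so
      arbitrary values of z outside the interval are harmless under the zero factor.\<close>
    have "i < dim_vec (Rd *\<^sub>v z s)" using C i by simp
    then show "indicator {a<..<b} s * regular_part (w $ i) s = (indicator {a<..<b} s \<cdot>\<^sub>v (Rd *\<^sub>v z s)) $ i"
      unfolding regular_part_rep[OF rw] using z[of s]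
      by (cases "s \<in> {a<..<b}") (auto simp del: index_mult_mat_vec)
  qed
  finally show "vec_restrict {a<..<b} w $ i =
      fun_dist_vec ny (\<lambda>s. indicator {a<..<b} s \<cdot>\<^sub>v (Rd *\<^sub>v z s)) $ i"
    using i by (simp add: fun_dist_vec_def)
qed

lemma reduced_flow_derivative:
  assumes s: "a < s" "s < b" and i: "i < d"
  shows "((\<lambda>u. (Zt *\<^sub>v f u) $ i) has_real_derivative (Sd *\<^sub>v (Zt *\<^sub>v f s)) $ i) (at s)"
  unfolding reduced_system(1)[OF f_carrier]
proof (rule mult_mat_vec_has_derivative[OF Zd_carrier(2) f_carrier mult_vec_carrier(2)[OF f_carrier] _ i])
  fix k assume k: "k < n"
  have Pl: "P *\<^sub>v left \<in> carrier_vec n" by (intro mult_vec_carrier vleft_carrier)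
  have "\<forall>\<^sub>F u in nhds s. u \<in> {a<..<b}" using s by (intro eventually_nhds_in_open) auto
  then have "\<forall>\<^sub>F u in nhds s. f u $ k = (mexp Ad (u - a) *\<^sub>v (P *\<^sub>v left)) $ k"
    by eventually_elim (simp add: flow)
  then show "((\<lambda>u. f u $ k) has_real_derivative (Ad *\<^sub>v f s) $ k) (at s)"
    using mexp_mult_vec_has_derivative[OF carrier(4) Pl k, of a s] s
      DERIV_cong_ev[of s s "\<lambda>u. f u $ k" "\<lambda>u. (mexp Ad (u - a) *\<^sub>v (P *\<^sub>v left)) $ k"]
    by (simp add: flow)
qed

text \<open>Both candidates have the same output as a distribution, hence pointwise, because the two
  outputs are continuous. The difference y solves the reduced ODE with zero output; differentiating
  this output repeatedly shows that Rd Sd^j annihilates y for all j, and observability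
  concludes.\<close>

lemma reduced_state_unique:
  assumes zc: "\<And>s. a < s \<Longrightarrow> s < b \<Longrightarrow> z s \<in> carrier_vec d"
    and dz: "\<And>s i. a < s \<Longrightarrow> s < b \<Longrightarrow> i < d \<Longrightarrow>
      ((\<lambda>s'. z s' $ i) has_real_derivative (Sd *\<^sub>v z s) $ i) (at s)"
    and out: "vec_restrict {a<..<b} w = fun_dist_vec ny (\<lambda>s. indicator {a<..<b} s \<cdot>\<^sub>v (Rd *\<^sub>v z s))"
    and s: "a < s" "s < b"
  shows "z s = Zt *\<^sub>v f s"
proof -
  \<comment> \<open>The cut-off makes y a vector of dimension d everywhere, although z may have the
    wrong dimension outside the interval.\<close>
  define y where "y u = (if u \<in> {a<..<b} then z u - Zt *\<^sub>v f u else 0\<^sub>v d)" for u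
  have Zf: "Zt *\<^sub>v f u \<in> carrier_vec d" for u by (rule mult_mat_vec_carrier[OF Zd_carrier(2) f_carrier])
  have y: "y u \<in> carrier_vec d" for u using Zf zc by (simp add: y_def)
  have dy: "((\<lambda>u. y u $ i) has_real_derivative (Sd *\<^sub>v y u) $ i) (at u)" if u: "a < u" "u < b" and i: "i < d" for u i
  proof -
    have "((\<lambda>u. z u $ i - (Zt *\<^sub>v f u) $ i) has_real_derivative (Sd *\<^sub>v z u) $ i - (Sd *\<^sub>v (Zt *\<^sub>v f u)) $ i) (at u)"
      by (intro DERIV_diff dz reduced_flow_derivative u i)
    also have "(Sd *\<^sub>v z u) $ i - (Sd *\<^sub>v (Zt *\<^sub>v f u)) $ i = (Sd *\<^sub>v y u) $ i"
    proof -
      have "Sd *\<^sub>v y u = Sd *\<^sub>v z u - Sd *\<^sub>v (Zt *\<^sub>v f u)"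
        using mult_minus_distrib_mat_vec[OF Sd_carrier zc[OF u] Zf[of u]] u by (simp add: y_def)
      then show ?thesis
        using i carrier_vecD[OF mult_mat_vec_carrier[OF Sd_carrier Zf[of u]]] by (simp del: index_mult_mat_vec)
    qed
    finally have "((\<lambda>u. z u $ i - (Zt *\<^sub>v f u) $ i) has_real_derivative (Sd *\<^sub>v y u) $ i) (at u)" .
    moreover have "\<forall>\<^sub>F v in nhds u. v \<in> {a<..<b}" using u by (intro eventually_nhds_in_open) auto
    then have "\<forall>\<^sub>F v in nhds u. y v $ i = z v $ i - (Zt *\<^sub>v f v) $ i"
      by eventually_elim (use i Zf[THEN carrier_vecD] in \<open>simp add: y_def del: index_mult_mat_vec\<close>)
    ultimately show ?thesis
      using DERIV_cong_ev[of u u "\<lambda>u. y u $ i" "\<lambda>v. z v $ i - (Zt *\<^sub>v f v) $ i"] by simp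
  qed
  have Ry: "Rd *\<^sub>v y u = 0\<^sub>v ny" if u: "a < u" "u < b" for u
  proof (rule eq_vecI)
    fix i assume "i < dim_vec (0\<^sub>v ny)"
    then have i: "i < ny" by simp
    have dimR: "dim_vec (Rd *\<^sub>v v) = ny" for v using C by simp
    let ?h = "\<lambda>z s. (indicator {a<..<b} s \<cdot>\<^sub>v (Rd *\<^sub>v z s)) $ i"
    have h: "?h z u = (Rd *\<^sub>v z u) $ i" if "a < u" "u < b" for z :: "real \<Rightarrow> real vec" and u
      using that i by (simp add: dimR del: index_mult_mat_vec)
    have "fun_dist_vec ny (\<lambda>s. indicator {a<..<b} s \<cdot>\<^sub>v (Rd *\<^sub>v z s)) =
        fun_dist_vec ny (\<lambda>s. indicator {a<..<b} s \<cdot>\<^sub>v (Rd *\<^sub>v (Zt *\<^sub>v f s)))"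
      unfolding out[symmetric] by (rule restrict_output) (simp add: output_eq_reduced)
    from arg_cong[OF this, of "\<lambda>x. x $ i"] i
    have fd: "fun_dist (?h z) = fun_dist (?h (\<lambda>s. Zt *\<^sub>v f s))"
      by (simp add: fun_dist_vec_def)
    have cont: "continuous_on {a<..<b} (?h v)"
      if vc: "\<And>s. a < s \<Longrightarrow> s < b \<Longrightarrow> v s \<in> carrier_vec d"
        and dv: "\<And>s k. a < s \<Longrightarrow> s < b \<Longrightarrow> k < d \<Longrightarrow> ((\<lambda>s'. v s' $ k) has_real_derivative (Sd *\<^sub>v v s) $ k) (at s)"
      for v
    proof -
      have "continuous_on {a<..<b} (\<lambda>s. \<Sum>k<d. Rd $$ (i, k) * v s $ k)"
        by (intro continuous_intros continuous_at_imp_continuous_on ballI DERIV_isCont[OF dv]) auto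
      moreover have "?h v s = (\<Sum>k<d. Rd $$ (i, k) * v s $ k)" if "s \<in> {a<..<b}" for s
        using that h[of s v] mult_mat_vec_nth[OF Rd_carrier vc i] by simp
      ultimately show ?thesis
        using continuous_on_cong[of "{a<..<b}" "{a<..<b}" "?h v" "\<lambda>s. \<Sum>k<d. Rd $$ (i, k) * v s $ k"] by blast
    qed
    have "?h z u = ?h (\<lambda>s. Zt *\<^sub>v f s) u"
    proof (rule continuous_eq_if_test_integrals_eq[OF _ _ _ u])
      show "continuous_on {a<..<b} (?h z)" by (rule cont[OF zc dz])
      show "continuous_on {a<..<b} (?h (\<lambda>s. Zt *\<^sub>v f s))" by (rule cont[OF Zf reduced_flow_derivative])
      show "(\<integral>s. ?h z s * tf \<phi> s \<partial>lborel) = (\<integral>s. ?h (\<lambda>s. Zt *\<^sub>v f s) s * tf \<phi> s \<partial>lborel)" for \<phi>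
        using fun_cong[OF fd, of \<phi>] by (simp only: fun_dist_def)
    qed
    then have eq: "(Rd *\<^sub>v z u) $ i = (Rd *\<^sub>v (Zt *\<^sub>v f u)) $ i"
      unfolding h[OF u, of z] h[OF u, of "\<lambda>s. Zt *\<^sub>v f s"] .
    have "Rd *\<^sub>v y u = Rd *\<^sub>v z u - Rd *\<^sub>v (Zt *\<^sub>v f u)"
      using mult_minus_distrib_mat_vec[OF Rd_carrier zc[OF u] Zf[of u]] u by (simp add: y_def)
    then show "(Rd *\<^sub>v y u) $ i = 0\<^sub>v ny $ i"
      using i eq C by (simp del: index_mult_mat_vec)
  qed (use C in simp)
  have Bc: "Rd * Sd ^\<^sub>m j \<in> carrier_mat ny d" for j
    by (rule mult_carrier_mat[OF Rd_carrier pow_carrier_mat[OF Sd_carrier]])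
  have B: "\<forall>u. a < u \<longrightarrow> u < b \<longrightarrow> (Rd * Sd ^\<^sub>m j) *\<^sub>v y u = 0\<^sub>v ny" for j
  proof (induction j)
    case 0
    have "Rd * Sd ^\<^sub>m 0 = Rd" using right_mult_one_mat[OF Rd_carrier] Zd_carrier by simp
    then show ?case using Ry by simp
  next
    case (Suc j)
    show ?case
    proof (intro allI impI eq_vecI)
      fix u i assume u: "a < u" "u < b" and "i < dim_vec (0\<^sub>v ny)"
      then have i: "i < ny" by simp
      have "((\<lambda>u. ((Rd * Sd ^\<^sub>m j) *\<^sub>v y u) $ i) has_real_derivative ((Rd * Sd ^\<^sub>m j) *\<^sub>v (Sd *\<^sub>v y u)) $ i) (at u)"
        by (rule mult_mat_vec_has_derivative[OF Bc y mult_mat_vec_carrier[OF Sd_carrier y] dy[OF u] i])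
      moreover have "\<forall>\<^sub>F v in nhds u. v \<in> {a<..<b}" using u by (intro eventually_nhds_in_open) auto
      then have "\<forall>\<^sub>F v in nhds u. ((Rd * Sd ^\<^sub>m j) *\<^sub>v y v) $ i = 0"
        by eventually_elim (use Suc i in simp)
      then have "((\<lambda>u. ((Rd * Sd ^\<^sub>m j) *\<^sub>v y u) $ i) has_real_derivative 0) (at u)"
        using DERIV_cong_ev[of u u "\<lambda>u. ((Rd * Sd ^\<^sub>m j) *\<^sub>v y u) $ i" "\<lambda>_. 0" 0 0] by simp
      ultimately have "((Rd * Sd ^\<^sub>m j) *\<^sub>v (Sd *\<^sub>v y u)) $ i = 0"
        by (rule DERIV_unique)
      moreover have "(Rd * Sd ^\<^sub>m Suc j) *\<^sub>v y u = (Rd * Sd ^\<^sub>m j) *\<^sub>v (Sd *\<^sub>v y u)"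
        unfolding pow_mat.simps assoc_mult_mat[OF Rd_carrier pow_carrier_mat[OF Sd_carrier] Sd_carrier, symmetric]
        by (rule assoc_mult_mat_vec[OF Bc Sd_carrier y])
      ultimately show "((Rd * Sd ^\<^sub>m Suc j) *\<^sub>v y u) $ i = 0\<^sub>v ny $ i"
        using i by simp
    qed (use C in simp)
  qed
  have "y s = 0\<^sub>v d"
  proof (rule reduced_observable[OF y])
    show "Rd *\<^sub>v (Sd ^\<^sub>m j *\<^sub>v y s) = 0\<^sub>v ny" for j
      using B[of j] s assoc_mult_mat_vec[OF Rd_carrier pow_carrier_mat[OF Sd_carrier] y, of j s] by simp
  qed
  then have "z s - Zt *\<^sub>v f s = 0\<^sub>v d" using s by (simp add: y_def)
  then show ?thesis by (rule vec_sub_eq_0D[OF zc[OF s] Zf])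
qed

text \<open>Existence and uniqueness resolve the definite description in \<open>z_diff_fun\<close>;
  the limit at a then comes from the right continuity of f.\<close>

lemma z_diff_eq: "z_diff Sd Rd a b w = Zt *\<^sub>v f a"
proof -
  have dS: "dim_row Sd = d" "dim_row Rd = ny" using Sd_carrier Rd_carrier by auto
  have Zf: "Zt *\<^sub>v f u \<in> carrier_vec d" for u by (rule mult_mat_vec_carrier[OF Zd_carrier(2) f_carrier])
  have zf: "z_diff_fun Sd Rd a b w = (\<lambda>s\<in>{a<..<b}. Zt *\<^sub>v f s)"
    unfolding z_diff_fun_def dS
  proof (rule the_equality)
    show "(\<lambda>s\<in>{a<..<b}. Zt *\<^sub>v f s) \<in> {a<..<b} \<rightarrow>\<^sub>E carrier_vec d \<and>
      (\<forall>s\<in>{a<..<b}. \<forall>i<d. ((\<lambda>s'. (\<lambda>s\<in>{a<..<b}. Zt *\<^sub>v f s) s' $ i) has_real_derivative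
        (Sd *\<^sub>v (\<lambda>s\<in>{a<..<b}. Zt *\<^sub>v f s) s) $ i) (at s)) \<and>
      vec_restrict {a<..<b} w = fun_dist_vec ny
        (\<lambda>s. indicator {a<..<b} s \<cdot>\<^sub>v (Rd *\<^sub>v (\<lambda>s\<in>{a<..<b}. Zt *\<^sub>v f s) s))"
    proof (intro conjI ballI allI impI)
      show "(\<lambda>s\<in>{a<..<b}. Zt *\<^sub>v f s) \<in> {a<..<b} \<rightarrow>\<^sub>E carrier_vec d" using Zf by auto
      fix s i assume s: "s \<in> {a<..<b}" and i: "i < d"
      have "\<forall>\<^sub>F v in nhds s. v \<in> {a<..<b}" using s by (intro eventually_nhds_in_open) auto
      then have "\<forall>\<^sub>F v in nhds s. (\<lambda>s\<in>{a<..<b}. Zt *\<^sub>v f s) v $ i = (Zt *\<^sub>v f v) $ i"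
        by eventually_elim simp
      then show "((\<lambda>s'. (\<lambda>s\<in>{a<..<b}. Zt *\<^sub>v f s) s' $ i) has_real_derivative
          (Sd *\<^sub>v (\<lambda>s\<in>{a<..<b}. Zt *\<^sub>v f s) s) $ i) (at s)"
        using reduced_flow_derivative[of s i] s i
          DERIV_cong_ev[of s s "\<lambda>s'. (\<lambda>s\<in>{a<..<b}. Zt *\<^sub>v f s) s' $ i" "\<lambda>v. (Zt *\<^sub>v f v) $ i"]
        by simp
    next
      show "vec_restrict {a<..<b} w = fun_dist_vec ny
          (\<lambda>s. indicator {a<..<b} s \<cdot>\<^sub>v (Rd *\<^sub>v (\<lambda>s\<in>{a<..<b}. Zt *\<^sub>v f s) s))"
        by (rule restrict_output) (simp add: output_eq_reduced)
    qed
  next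
    fix z assume z: "z \<in> {a<..<b} \<rightarrow>\<^sub>E carrier_vec d \<and>
      (\<forall>s\<in>{a<..<b}. \<forall>i<d. ((\<lambda>s'. z s' $ i) has_real_derivative (Sd *\<^sub>v z s) $ i) (at s)) \<and>
      vec_restrict {a<..<b} w = fun_dist_vec ny (\<lambda>s. indicator {a<..<b} s \<cdot>\<^sub>v (Rd *\<^sub>v z s))"
    show "z = (\<lambda>s\<in>{a<..<b}. Zt *\<^sub>v f s)"
    proof
      fix s
      show "z s = (\<lambda>s\<in>{a<..<b}. Zt *\<^sub>v f s) s"
      proof (cases "s \<in> {a<..<b}")
        case True
        have "z s = Zt *\<^sub>v f s"
          by (rule reduced_state_unique) (use z True in \<open>auto simp: PiE_def Pi_def\<close>)
        with True show ?thesis by simp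
      next
        case False
        with z show ?thesis by (auto simp: PiE_def extensional_def)
      qed
    qed
  qed
  show ?thesis
    unfolding z_diff_def zf dS
  proof (rule eq_vecI)
    fix i assume "i < dim_vec (Zt *\<^sub>v f a)"
    then have i: "i < d" using Zd_carrier by simp
    have "((\<lambda>s. (Zt *\<^sub>v f s) $ i) \<longlongrightarrow> (Zt *\<^sub>v f a) $ i) (at_right a)"
      by (rule mult_mat_vec_tendsto[OF Zd_carrier(2) f_carrier f_carrier pws_tendsto_right[OF vrepD(5)[OF x]] i])
    moreover have "\<forall>\<^sub>F s in at_right a. (\<lambda>s\<in>{a<..<b}. Zt *\<^sub>v f s) s $ i = (Zt *\<^sub>v f s) $ i"
      unfolding eventually_at_right_field using ab by (intro exI[of _ b]) auto
    ultimately have "((\<lambda>s. (\<lambda>s\<in>{a<..<b}. Zt *\<^sub>v f s) s $ i) \<longlongrightarrow> (Zt *\<^sub>v f a) $ i) (at_right a)"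
      by (simp only: tendsto_cong)
    from tendsto_Lim[OF _ this] i
    show "vec d (\<lambda>i. Lim (at_right a) (\<lambda>s. (\<lambda>s\<in>{a<..<b}. Zt *\<^sub>v f s) s $ i)) $ i = (Zt *\<^sub>v f a) $ i"
      by simp
  qed (use Zd_carrier in simp)
qed

lemma impulse_coeffs_eq: "impulse_coeffs n a w = - (O_imp n ny C Ei *\<^sub>v left)"
proof -
  have dw: "dim_vec w = ny" using vrepD(1)[OF w_vrep] by simp
  have Oc: "O_imp n ny C Ei \<in> carrier_mat ((n - 1) * ny) n" by (simp add: O_imp_def)
  define \<eta> where "\<eta> = - (O_imp n ny C Ei *\<^sub>v left)"
  have \<eta>c: "\<eta> \<in> carrier_vec ((n - 1) * ny)"
    unfolding \<eta>_def using mult_mat_vec_carrier[OF Oc vleft_carrier] by simp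
  have imp: "impulse_at (w $ i) a = dirac_sum (\<lambda>l. (C *\<^sub>v c a l) $ i) a" if "i < ny" for i
    using impulse_at_rep[OF vrepD(4)[OF w_vrep that], of a] ab by simp
  have Cc: "C *\<^sub>v c a l = - (C *\<^sub>v (Ei ^\<^sub>m Suc l *\<^sub>v left))" for l
    unfolding initial_impulses by (rule mult_mat_uminus_vec[OF C mult_vec_carrier(4)[OF vleft_carrier]])
  \<comment> \<open>Order l carries the power Ei^(l+1), which vanishes from l = n - 1 on. Hence n -
    1 blocks of coefficients capture the whole impulse.\<close>
  have high: "\<forall>l\<ge>n - 1. (C *\<^sub>v c a l) $ i = 0" if i: "i < ny" for i
  proof (intro allI impI)
    fix l assume "n - 1 \<le> l"
    then have "n \<le> Suc l" by simp
    from Ei_pow_large[OF vleft_carrier this] have "C *\<^sub>v c a l = - (0\<^sub>v ny)"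
      unfolding Cc by (simp only: mult_mat_zero_vec[OF C])
    with i show "(C *\<^sub>v c a l) $ i = 0" by simp
  qed
  have low: "\<eta> $ (j * ny + i) = (C *\<^sub>v c a j) $ i" if j: "j < n - 1" and i: "i < ny" for j i
  proof -
    have k: "j * ny + i < (n - 1) * ny" using j i by (rule stacked_index_less)
    have "\<eta> $ (j * ny + i) = - (O_imp n ny C Ei *\<^sub>v left) $ (j * ny + i)"
      unfolding \<eta>_def using k Oc by (simp del: index_mult_mat_vec)
    also have "\<dots> = - (C *\<^sub>v (Ei ^\<^sub>m Suc j *\<^sub>v left)) $ i"
      using O_imp_mult_vec_nth[OF vleft_carrier k] i by simp
    also have "\<dots> = (C *\<^sub>v c a j) $ i"
      unfolding Cc using i C by (simp del: index_mult_mat_vec)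
    finally show ?thesis .
  qed
  have "impulse_coeffs n a w = \<eta>"
    unfolding impulse_coeffs_def dw
  proof (rule the_equality)
    show "\<eta> \<in> carrier_vec ((n - 1) * ny) \<and>
      (\<forall>i<ny. impulse_at (w $ i) a = dirac_comb (n - 1) (\<lambda>j. \<eta> $ (j * ny + i)) a)"
    proof (intro conjI allI impI \<eta>c)
      fix i assume i: "i < ny"
      have "impulse_at (w $ i) a = dirac_comb (n - 1) (\<lambda>l. (C *\<^sub>v c a l) $ i) a"
        unfolding imp[OF i] by (rule dirac_sum_eq_dirac_comb[OF high[OF i]])
      also have "\<dots> = dirac_comb (n - 1) (\<lambda>j. \<eta> $ (j * ny + i)) a"
        using low[OF _ i] by (simp add: dirac_comb_def del: index_mult_mat_vec)
      finally show "impulse_at (w $ i) a = dirac_comb (n - 1) (\<lambda>j. \<eta> $ (j * ny + i)) a" .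
    qed
  next
    fix \<eta>' assume *: "\<eta>' \<in> carrier_vec ((n - 1) * ny) \<and>
      (\<forall>i<ny. impulse_at (w $ i) a = dirac_comb (n - 1) (\<lambda>j. \<eta>' $ (j * ny + i)) a)"
    show "\<eta>' = \<eta>"
    proof (rule eq_vecI)
      fix k assume "k < dim_vec \<eta>"
      then have k: "k < (n - 1) * ny" using \<eta>c by simp
      then have "ny > 0" by (cases ny) auto
      define j i where "j = k div ny" and "i = k mod ny"
      have ji: "j < n - 1" "i < ny" "k = j * ny + i"
        using k \<open>ny > 0\<close> by (auto simp: j_def i_def less_mult_imp_div_less)
      have "dirac_sum (\<lambda>l. if l < n - 1 then \<eta>' $ (l * ny + i) else 0) a = dirac_sum (\<lambda>l. (C *\<^sub>v c a l) $ i) a"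
        using * ji(2) imp[OF ji(2)] by (simp add: dirac_comb_eq_dirac_sum)
      then have "(\<lambda>l. if l < n - 1 then \<eta>' $ (l * ny + i) else 0) = (\<lambda>l. (C *\<^sub>v c a l) $ i)"
        by (rule dirac_sum_inject) (use high[OF ji(2)] in \<open>auto intro!: exI[of _ "n - 1"]\<close>)
      from fun_cong[OF this, of j] show "\<eta>' $ k = \<eta> $ k"
        using low[OF ji(1,2)] ji by simp
    qed (use * \<eta>c in simp)
  qed
  then show ?thesis by (simp add: \<eta>_def)
qed

text \<open>Each observer matrix enters transposed, so the observer retraces the factorization of Z.
  The minus sign in the equation for \<open>Uimp\<close> cancels that of the impulse coefficients,
  and the factor P in the first block reflects that the flow starts at P applied to the left
  limit.\<close>

lemma frak_O_eq:
  assumes Zi: "Zi \<in> carrier_mat n l"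
    and Uobs: "Uobs \<in> carrier_mat (d + l) m" "Z = hcat (transpose_mat P * Zd) Zi * Uobs"
    and Uimp: "Uimp \<in> carrier_mat ((n - 1) * ny) l"
      "- transpose_mat (O_imp n ny C Ei) * Uimp = Zi"
  shows "frak_O n C P Ad Zd Uobs Uimp a b w = transpose_mat Z *\<^sub>v left"
proof -
  let ?O = "O_imp n ny C Ei"
  have Oc: "?O \<in> carrier_mat ((n - 1) * ny) n" by (simp add: O_imp_def)
  have Ot: "- transpose_mat ?O \<in> carrier_mat n ((n - 1) * ny)" using Oc by simp
  have Pt: "transpose_mat P \<in> carrier_mat n n" using carrier(3) by simp
  have "transpose_mat Zi *\<^sub>v left = transpose_mat Uimp *\<^sub>v (transpose_mat (- transpose_mat ?O) *\<^sub>v left)"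
    unfolding Uimp(2)[symmetric] by (rule transpose_mult_vec[OF Ot Uimp(1) vleft_carrier])
  also have "transpose_mat (- transpose_mat ?O) = - ?O"
    using Oc by (intro eq_matI) auto
  also have "- ?O *\<^sub>v left = - (?O *\<^sub>v left)"
    using Oc by (intro uminus_mult_mat_vec) (simp add: vleft_def)
  finally have zi: "transpose_mat Uimp *\<^sub>v impulse_coeffs n a w = transpose_mat Zi *\<^sub>v left"
    unfolding impulse_coeffs_eq by simp
  have PZ: "transpose_mat P * Zd \<in> carrier_mat n d" by (rule mult_carrier_mat[OF Pt Zd_carrier(1)])
  have zd: "Zt *\<^sub>v f a = transpose_mat (transpose_mat P * Zd) *\<^sub>v left"
    unfolding initial_value transpose_mult_vec[OF Pt Zd_carrier(1) vleft_carrier] by simp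
  have "frak_O n C P Ad Zd Uobs Uimp a b w = transpose_mat Uobs *\<^sub>v
      (transpose_mat (transpose_mat P * Zd) *\<^sub>v left @\<^sub>v transpose_mat Zi *\<^sub>v left)"
    unfolding frak_O_def Let_def z_diff_eq zi zd ..
  also have "\<dots> = transpose_mat Uobs *\<^sub>v (transpose_mat (hcat (transpose_mat P * Zd) Zi) *\<^sub>v left)"
    unfolding hcat_transpose_mult_vec[OF PZ Zi] ..
  also have "\<dots> = transpose_mat Z *\<^sub>v left"
    unfolding Uobs(2) by (rule transpose_mult_vec[OF hcat_carrier[OF PZ Zi] Uobs(1) vleft_carrier, symmetric])
  finally show ?thesis .
qed

end

section \<open>Combining the local observations\<close>

lemma orth_compl_carrier_vec: "orth_compl m (carrier_vec m) = {0\<^sub>v m}"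
  by (auto simp: orth_compl_def intro: scalar_prod_self_eq_0)

text \<open>Kernels are complements of row spaces, the starting point for presenting all
  unobservable spaces as complements.\<close>

lemma kernel_eq_orth_compl:
  assumes B: "B \<in> carrier_mat m n"
  shows "\<exists>R\<subseteq>carrier_vec n. {v \<in> carrier_vec n. B *\<^sub>v v = 0\<^sub>v m} = orth_compl n R"
proof (intro exI conjI)
  show "(\<lambda>w. transpose_mat B *\<^sub>v w) ` carrier_vec m \<subseteq> carrier_vec n"
    using B by auto
  show "{v \<in> carrier_vec n. B *\<^sub>v v = 0\<^sub>v m} = orth_compl n ((\<lambda>w. transpose_mat B *\<^sub>v w) ` carrier_vec m)"
    using orth_compl_image_transpose[OF B, of "carrier_vec m"] by (simp add: orth_compl_carrier_vec)
qed

lemma local_unobs_orth_compl: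
  assumes P: "P \<in> carrier_mat n n" and Od: "Od \<in> carrier_mat m n" and Oi: "Oi \<in> carrier_mat l n"
  shows "\<exists>R\<subseteq>carrier_vec n. local_unobs P Od Oi = orth_compl n R"
proof -
  obtain R1 where R1: "R1 \<subseteq> carrier_vec n" "{v \<in> carrier_vec n. (Od * P) *\<^sub>v v = 0\<^sub>v m} = orth_compl n R1"
    using kernel_eq_orth_compl[OF mult_carrier_mat[OF Od P]] by blast
  obtain R2 where R2: "R2 \<subseteq> carrier_vec n" "{v \<in> carrier_vec n. Oi *\<^sub>v v = 0\<^sub>v l} = orth_compl n R2"
    using kernel_eq_orth_compl[OF Oi] by blast
  have "local_unobs P Od Oi = {v \<in> carrier_vec n. (Od * P) *\<^sub>v v = 0\<^sub>v m} \<inter> {v \<in> carrier_vec n. Oi *\<^sub>v v = 0\<^sub>v l}"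
    using P Od Oi by (auto simp: local_unobs_def preimage_def mat_kernel_def)
  then have "local_unobs P Od Oi = orth_compl n (R1 \<union> R2)"
    by (simp only: R1(2) R2(2) orth_compl_Un)
  with R1(1) R2(1) show ?thesis by (intro exI[of _ "R1 \<union> R2"]) auto
qed

text \<open>The inverse G of F turns the image under F into a preimage, so that one preimage under G
  P remains, to which \<open>orth_compl_image_transpose\<close> applies.\<close>

lemma preimage_image_inverse:
  assumes F: "F \<in> carrier_mat n n" and G: "G \<in> carrier_mat n n" and FG: "F * G = 1\<^sub>m n" and GF: "G * F = 1\<^sub>m n"
    and P: "P \<in> carrier_mat n n" and V: "V \<subseteq> carrier_vec n"
  shows "preimage P ((\<lambda>v. F *\<^sub>v v) ` V) = {v \<in> carrier_vec n. (G * P) *\<^sub>v v \<in> V}"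
proof -
  have inv: "F *\<^sub>v (G *\<^sub>v v) = v" "G *\<^sub>v (F *\<^sub>v v) = v" if "v \<in> carrier_vec n" for v
    using assoc_mult_mat_vec[OF F G that] assoc_mult_mat_vec[OF G F that] that by (simp_all add: FG GF)
  have key: "P *\<^sub>v v \<in> (\<lambda>v. F *\<^sub>v v) ` V \<longleftrightarrow> G *\<^sub>v (P *\<^sub>v v) \<in> V" if v: "v \<in> carrier_vec n" for v
  proof
    assume "P *\<^sub>v v \<in> (\<lambda>v. F *\<^sub>v v) ` V"
    then show "G *\<^sub>v (P *\<^sub>v v) \<in> V" using inv(2) V by auto
  next
    assume "G *\<^sub>v (P *\<^sub>v v) \<in> V"
    then show "P *\<^sub>v v \<in> (\<lambda>v. F *\<^sub>v v) ` V"
      using inv(1)[OF mult_mat_vec_carrier[OF P v]] by (metis image_eqI)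
  qed
  show ?thesis
  proof (rule Set.set_eqI)
    fix v
    show "v \<in> preimage P ((\<lambda>v. F *\<^sub>v v) ` V) \<longleftrightarrow> v \<in> {v \<in> carrier_vec n. (G * P) *\<^sub>v v \<in> V}"
      using key[of v] P assoc_mult_mat_vec[OF G P, of v] by (auto simp: preimage_def simp del: image_iff)
  qed
qed

lemma orth_compl_subset: "orth_compl n V \<subseteq> carrier_vec n"
  by (auto simp: orth_compl_def)

lemma unobs_space_orth_compl:
  assumes W: "\<And>j. k \<le> j \<Longrightarrow> j \<le> k + m \<Longrightarrow> \<exists>R\<subseteq>carrier_vec n. W j = orth_compl n R"
    and c: "\<And>j. k \<le> j \<Longrightarrow> j \<le> k + m \<Longrightarrow> F j \<in> carrier_mat n n \<and> G j \<in> carrier_mat n n \<and> P j \<in> carrier_mat n n \<and>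
      F j * G j = 1\<^sub>m n \<and> G j * F j = 1\<^sub>m n"
  shows "\<exists>R\<subseteq>carrier_vec n. unobs_space F P W m k = orth_compl n R"
  using assms
proof (induction m arbitrary: k)
  case 0
  then show ?case by simp
next
  case (Suc m)
  have "\<exists>R\<subseteq>carrier_vec n. unobs_space F P W m (Suc k) = orth_compl n R"
    by (rule Suc.IH; rule Suc.prems) auto
  then obtain R where R: "R \<subseteq> carrier_vec n" "unobs_space F P W m (Suc k) = orth_compl n R" by blast
  obtain R' where R': "R' \<subseteq> carrier_vec n" "W k = orth_compl n R'"
    using Suc.prems(1)[of k] by auto
  have ck: "F k \<in> carrier_mat n n" "G k \<in> carrier_mat n n" "P k \<in> carrier_mat n n" "F k * G k = 1\<^sub>m n" "G k * F k = 1\<^sub>m n"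
    using Suc.prems(2)[of k] by auto
  have GP: "G k * P k \<in> carrier_mat n n" by (rule mult_carrier_mat[OF ck(2,3)])
  have "unobs_space F P W (Suc m) k = orth_compl n R' \<inter> {v \<in> carrier_vec n. (G k * P k) *\<^sub>v v \<in> orth_compl n R}"
    using preimage_image_inverse[OF ck(1,2,4,5,3) orth_compl_subset] by (simp add: R(2) R'(2))
  also have "\<dots> = orth_compl n (R' \<union> (\<lambda>w. transpose_mat (G k * P k) *\<^sub>v w) ` R)"
    unfolding orth_compl_image_transpose[OF GP R(1)] orth_compl_Un ..
  finally show ?case
    using R(1) R'(1) GP by (intro exI[of _ "R' \<union> (\<lambda>w. transpose_mat (G k * P k) *\<^sub>v w) ` R"] conjI) auto
qed

text \<open>e' splits into its projection by M' and a rest in N'. F maps the rest into F N', to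
  which the columns of \<Theta> are orthogonal; hence \<Theta> cannot tell e' from the projection,
  which later intervals reconstruct. The relation F e' = P e transports this knowledge back to the
  start of the present interval.\<close>

lemma observation_step:
  assumes \<Theta>: "\<Theta> \<in> carrier_mat n t" "mat_image \<Theta> = orth_compl n ((\<lambda>v. F *\<^sub>v v) ` N')"
    and M': "orthonormal_basis_mat n M' (orth_compl n N')" "M' \<in> carrier_mat n m'"
    and N': "N' = orth_compl n R" "R \<subseteq> carrier_vec n"
    and F: "F \<in> carrier_mat n n" and P: "P \<in> carrier_mat n n"
    and e: "e \<in> carrier_vec n" "e' \<in> carrier_vec n" "F *\<^sub>v e' = P *\<^sub>v e"
    and Z: "Z \<in> carrier_mat n zc" and U: "U \<in> carrier_mat (zc + t) m" "M = hcat Z (transpose_mat P * \<Theta>) * U"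
  shows "transpose_mat M *\<^sub>v e = transpose_mat U *\<^sub>v ((transpose_mat Z *\<^sub>v e) @\<^sub>v
    (transpose_mat \<Theta> *\<^sub>v (F *\<^sub>v (M' *\<^sub>v (transpose_mat M' *\<^sub>v e')))))"
proof -
  have Pt: "transpose_mat P \<in> carrier_mat n n" using P by simp
  have \<Theta>t: "transpose_mat \<Theta> \<in> carrier_mat t n" using \<Theta>(1) by simp
  have P\<Theta>: "transpose_mat P * \<Theta> \<in> carrier_mat n t" by (rule mult_carrier_mat[OF Pt \<Theta>(1)])
  define y where "y = M' *\<^sub>v (transpose_mat M' *\<^sub>v e')"
  have y: "y \<in> carrier_vec n" using M'(2) e(2) by (simp add: y_def)
  define r where "r = e' - y"
  have r: "r \<in> carrier_vec n" using e(2) y by (simp add: r_def)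
  have "r \<in> N'"
    using orthonormal_basis_residual[OF M'(1) e(2)] orth_compl_orth_compl[OF N']
    by (auto simp: r_def y_def)
  have Fr: "F *\<^sub>v r \<in> carrier_vec n" by (rule mult_mat_vec_carrier[OF F r])
  \<comment> \<open>The squared length of this vector is the product of F r, a member of F N', with
    a member of the complement of F N'.\<close>
  have "transpose_mat \<Theta> *\<^sub>v (F *\<^sub>v r) = 0\<^sub>v t"
  proof (rule scalar_prod_self_eq_0)
    show c: "transpose_mat \<Theta> *\<^sub>v (F *\<^sub>v r) \<in> carrier_vec t" by (rule mult_mat_vec_carrier[OF \<Theta>t Fr])
    have "\<Theta> *\<^sub>v (transpose_mat \<Theta> *\<^sub>v (F *\<^sub>v r)) \<in> orth_compl n ((\<lambda>v. F *\<^sub>v v) ` N')"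
      unfolding \<Theta>(2)[symmetric] unfolding mat_image_def using c \<Theta>(1) by (intro imageI) simp
    then have 0: "(\<Theta> *\<^sub>v (transpose_mat \<Theta> *\<^sub>v (F *\<^sub>v r))) \<bullet> (F *\<^sub>v r) = 0"
      using \<open>r \<in> N'\<close> by (auto simp: orth_compl_def)
    have "(transpose_mat \<Theta> *\<^sub>v (F *\<^sub>v r)) \<bullet> (transpose_mat \<Theta> *\<^sub>v (F *\<^sub>v r)) =
        (F *\<^sub>v r) \<bullet> (\<Theta> *\<^sub>v (transpose_mat \<Theta> *\<^sub>v (F *\<^sub>v r)))"
      by (rule transpose_vec_mult_scalar[OF \<Theta>(1) c Fr])
    also have "\<dots> = 0"
      using comm_scalar_prod[OF Fr mult_mat_vec_carrier[OF \<Theta>(1) c]] 0 by simp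
    finally show "(transpose_mat \<Theta> *\<^sub>v (F *\<^sub>v r)) \<bullet> (transpose_mat \<Theta> *\<^sub>v (F *\<^sub>v r)) = 0" .
  qed
  then have "transpose_mat \<Theta> *\<^sub>v (F *\<^sub>v e') - transpose_mat \<Theta> *\<^sub>v (F *\<^sub>v y) = 0\<^sub>v t"
    unfolding r_def mult_minus_distrib_mat_vec[OF F e(2) y]
      mult_minus_distrib_mat_vec[OF \<Theta>t mult_mat_vec_carrier[OF F e(2)] mult_mat_vec_carrier[OF F y]] .
  then have eq: "transpose_mat \<Theta> *\<^sub>v (F *\<^sub>v e') = transpose_mat \<Theta> *\<^sub>v (F *\<^sub>v y)"
    by (rule vec_sub_eq_0D[rotated 2]) (intro mult_mat_vec_carrier[OF \<Theta>t] mult_mat_vec_carrier[OF F] e y)+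
  have "transpose_mat M *\<^sub>v e = transpose_mat U *\<^sub>v (transpose_mat (hcat Z (transpose_mat P * \<Theta>)) *\<^sub>v e)"
    unfolding U(2) by (rule transpose_mult_vec[OF hcat_carrier[OF Z P\<Theta>] U(1) e(1)])
  also have "transpose_mat (hcat Z (transpose_mat P * \<Theta>)) *\<^sub>v e =
      (transpose_mat Z *\<^sub>v e) @\<^sub>v (transpose_mat \<Theta> *\<^sub>v (F *\<^sub>v e'))"
    unfolding hcat_transpose_mult_vec[OF Z P\<Theta>] transpose_mult_vec[OF Pt \<Theta>(1) e(1)] e(3) by simp
  finally show ?thesis
    unfolding eq y_def .
qed

text \<open>Linearity on \<open>carrier_vec m\<close> in the form that matches \<^const>\<open>O_mat\<close>, whose columns are
  images of unit vectors.\<close>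

definition linear_coords :: "nat \<Rightarrow> nat \<Rightarrow> (real vec \<Rightarrow> real vec) \<Rightarrow> bool" where
  "linear_coords m n f \<longleftrightarrow> (\<forall>v. f v \<in> carrier_vec n) \<and>
     (\<forall>v\<in>carrier_vec m. \<forall>i<n. f v $ i = (\<Sum>j<m. v $ j * f (unit_vec m j) $ i))"

section \<open>Linearity of the backward recursion and its matrix form\<close>

lemma linear_coordsD:
  "linear_coords m n f \<Longrightarrow> f v \<in> carrier_vec n"
  "linear_coords m n f \<Longrightarrow> v \<in> carrier_vec m \<Longrightarrow> i < n \<Longrightarrow>
    f v $ i = (\<Sum>j<m. v $ j * f (unit_vec m j) $ i)"
  unfolding linear_coords_def by blast+

lemma linear_coords_mult:
  assumes f: "linear_coords m n f" and A: "A \<in> carrier_mat k n"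
  shows "linear_coords m k (\<lambda>v. A *\<^sub>v f v)"
  unfolding linear_coords_def
proof (intro conjI ballI allI impI)
  have fc: "f v \<in> carrier_vec n" for v by (rule linear_coordsD(1)[OF f])
  show "A *\<^sub>v f v \<in> carrier_vec k" for v by (rule mult_mat_vec_carrier[OF A fc])
  fix v :: "real vec" and i assume v: "v \<in> carrier_vec m" and i: "i < k"
  have "(A *\<^sub>v f v) $ i = (\<Sum>l<n. A $$ (i, l) * (\<Sum>j<m. v $ j * f (unit_vec m j) $ l))"
    unfolding mult_mat_vec_nth[OF A fc i] by (rule sum.cong[OF refl]) (simp only: linear_coordsD(2)[OF f v, symmetric] lessThan_iff)
  also have "\<dots> = (\<Sum>j<m. v $ j * (\<Sum>l<n. A $$ (i, l) * f (unit_vec m j) $ l))"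
    unfolding sum_distrib_left by (subst sum.swap) (simp add: mult.left_commute)
  finally show "(A *\<^sub>v f v) $ i = (\<Sum>j<m. v $ j * (A *\<^sub>v f (unit_vec m j)) $ i)"
    by (simp only: mult_mat_vec_nth[OF A fc i])
qed

lemma linear_coords_append:
  assumes f: "linear_coords m n f" and g: "linear_coords m k g"
  shows "linear_coords m (n + k) (\<lambda>v. f v @\<^sub>v g v)"
  unfolding linear_coords_def
proof (intro conjI ballI allI impI)
  have c: "f v \<in> carrier_vec n" "g v \<in> carrier_vec k" for v
    by (rule linear_coordsD(1)[OF f] linear_coordsD(1)[OF g])+
  show "f v @\<^sub>v g v \<in> carrier_vec (n + k)" for v using c by simp
  have dims: "dim_vec (f v) = n" "dim_vec (g v) = k" for v using c by auto
  fix v :: "real vec" and i assume v: "v \<in> carrier_vec m" and i: "i < n + k"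
  show "(f v @\<^sub>v g v) $ i = (\<Sum>j<m. v $ j * (f (unit_vec m j) @\<^sub>v g (unit_vec m j)) $ i)"
  proof (cases "i < n")
    case True
    then show ?thesis using linear_coordsD(2)[OF f v True] by (simp add: dims)
  next
    case False
    then have "i - n < k" using i by simp
    with False i linear_coordsD(2)[OF g v this] show ?thesis by (simp add: dims)
  qed
qed

lemma linear_coords_unstack:
  assumes "p \<le> k" "k < q"
  shows "linear_coords (\<Sum>l=p..<q. d l) (d k) (\<lambda>v. unstack d p v k)"
  unfolding linear_coords_def
proof (intro conjI ballI allI impI)
  show "unstack d p v k \<in> carrier_vec (d k)" for v by (simp add: unstack_def)
  let ?m = "\<Sum>l=p..<q. d l" and ?o = "\<Sum>l=p..<k. d l"
  fix v :: "real vec" and i assume v: "v \<in> carrier_vec ?m" and i: "i < d k"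
  have "?o + d k = (\<Sum>l=p..<Suc k. d l)" using assms by simp
  also have "\<dots> \<le> ?m" using assms by (intro sum_mono2) auto
  finally have lt: "?o + i < ?m" using i by simp
  have "(\<Sum>j<?m. v $ j * unstack d p (unit_vec ?m j) k $ i) = (\<Sum>j<?m. if j = ?o + i then v $ j else 0)"
    using i lt by (intro sum.cong) (auto simp: unstack_def)
  also have "\<dots> = v $ (?o + i)" using lt by simp
  finally show "unstack d p v k $ i = (\<Sum>j<?m. v $ j * unstack d p (unit_vec ?m j) k $ i)"
    using i by (simp add: unstack_def)
qed

text \<open>On the last interval \<open>mu\<close> returns the block of z itself, so the size d of
  that block has to agree with the number of columns of M there; \<open>last\<close> records
  this.\<close>

lemma mu_linear_coords:
  assumes "p \<le> k" "k + m < q"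
    and M: "\<And>j. k \<le> j \<Longrightarrow> j \<le> k + m \<Longrightarrow> M j \<in> carrier_mat n (mc j)"
    and F: "\<And>j. k \<le> j \<Longrightarrow> j < k + m \<Longrightarrow> F j \<in> carrier_mat n n"
    and \<Theta>: "\<And>j. k \<le> j \<Longrightarrow> j < k + m \<Longrightarrow> \<Theta> j \<in> carrier_mat n (tc j)"
    and U: "\<And>j. k \<le> j \<Longrightarrow> j < k + m \<Longrightarrow> U j \<in> carrier_mat (d j + tc j) (mc j)"
    and last: "d (k + m) = mc (k + m)"
  shows "linear_coords (\<Sum>l=p..<q. d l) (mc k) (\<lambda>v. mu F M \<Theta> U (unstack d p v) m k)"
  using assms
proof (induction m arbitrary: k)
  case 0
  then show ?case using linear_coords_unstack[of p k q d] by simp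
next
  case (Suc m)
  have 1: "linear_coords (\<Sum>l=p..<q. d l) (mc (Suc k)) (\<lambda>v. mu F M \<Theta> U (unstack d p v) m (Suc k))"
    by (rule Suc.IH) (use Suc.prems in auto)
  have c: "M (Suc k) \<in> carrier_mat n (mc (Suc k))" "F k \<in> carrier_mat n n"
    "transpose_mat (\<Theta> k) \<in> carrier_mat (tc k) n" "transpose_mat (U k) \<in> carrier_mat (mc k) (d k + tc k)"
    using Suc.prems by auto
  have 2: "linear_coords (\<Sum>l=p..<q. d l) (d k) (\<lambda>v. unstack d p v k)"
    using Suc.prems by (intro linear_coords_unstack) auto
  note 3 = linear_coords_mult[OF linear_coords_mult[OF linear_coords_mult[OF 1 c(1)] c(2)] c(3)]
  show ?case
    unfolding mu.simps by (rule linear_coords_mult[OF linear_coords_append[OF 2 3] c(4)])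
qed

text \<open>\<open>unstack\<close> recovers the blocks of a stacked vector only for indices in
  range, and \<open>mu\<close> reads no others.\<close>

lemma mu_cong:
  assumes "\<And>j. k \<le> j \<Longrightarrow> j \<le> k + m \<Longrightarrow> z j = z' j"
  shows "mu F M \<Theta> U z m k = mu F M \<Theta> U z' m k"
  using assms
proof (induction m arbitrary: k)
  case (Suc m)
  have "mu F M \<Theta> U z m (Suc k) = mu F M \<Theta> U z' m (Suc k)"
    by (rule Suc.IH) (use Suc.prems in auto)
  with Suc.prems[of k] show ?case by simp
qed simp

lemma stack_carrier:
  assumes "\<And>k. p \<le> k \<Longrightarrow> k < q \<Longrightarrow> z k \<in> carrier_vec (d k)"
  shows "stack p q z \<in> carrier_vec (\<Sum>l=p..<q. d l)"
proof -
  have "length (concat (map (\<lambda>k. list_of_vec (z k)) [p..<q])) = (\<Sum>l\<leftarrow>[p..<q]. dim_vec (z l))"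
    by (simp add: length_concat comp_def)
  also have "\<dots> = (\<Sum>l=p..<q. dim_vec (z l))"
    by (simp add: sum_list_distinct_conv_sum_set)
  also have "\<dots> = (\<Sum>l=p..<q. d l)"
    by (rule sum.cong) (use assms in auto)
  finally show ?thesis
    unfolding stack_def by (intro carrier_vecI) (simp only: dim_vec_of_list)
qed

text \<open>Induction on q: each new block is appended at the end, so the offsets of all earlier
  blocks stay the same.\<close>

lemma unstack_stack:
  assumes "\<And>k. p \<le> k \<Longrightarrow> k < q \<Longrightarrow> z k \<in> carrier_vec (d k)" and "p \<le> k" "k < q"
  shows "unstack d p (stack p q z) k = z k"
  using assms
proof (induction q)
  case (Suc q)
  let ?xs = "\<lambda>q. concat (map (\<lambda>k. list_of_vec (z k)) [p..<q])"
  have pq: "p \<le> q" using Suc.prems by simp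
  have len: "length (?xs q) = (\<Sum>l=p..<q. d l)"
  proof -
    have "stack p q z \<in> carrier_vec (\<Sum>l=p..<q. d l)"
      by (rule stack_carrier) (use Suc.prems(1) in simp)
    then show ?thesis
      unfolding stack_def by (simp only: carrier_vecD dim_vec_of_list[symmetric])
  qed
  have app: "?xs (Suc q) = ?xs q @ list_of_vec (z q)" using pq by simp
  have st: "stack p q' z $ i = ?xs q' ! i" if "i < length (?xs q')" for q' i
    using that by (simp add: stack_def vec_of_list_index)
  have zk: "dim_vec (z k) = d k" using Suc.prems by auto
  show ?case
  proof (cases "k = q")
    case True
    show ?thesis
    proof (rule eq_vecI)
      fix i assume "i < dim_vec (z k)"
      then have i: "i < d k" using zk by simp
      have "stack p (Suc q) z $ ((\<Sum>l=p..<k. d l) + i) = ?xs (Suc q) ! ((\<Sum>l=p..<k. d l) + i)"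
        by (rule st) (unfold app length_append len, use True i zk in simp)
      also have "\<dots> = list_of_vec (z q) ! i"
        unfolding app nth_append len unfolding True by simp
      finally show "unstack d p (stack p (Suc q) z) k $ i = z k $ i"
        using i True zk by (simp add: unstack_def list_of_vec_index)
    qed (simp add: unstack_def zk)
  next
    case False
    then have kq: "k < q" using Suc.prems by simp
    have "unstack d p (stack p (Suc q) z) k = unstack d p (stack p q z) k"
    proof (rule eq_vecI)
      fix i assume "i < dim_vec (unstack d p (stack p q z) k)"
      then have i: "i < d k" by (simp add: unstack_def)
      have "(\<Sum>l=p..<k. d l) + d k = (\<Sum>l=p..<Suc k. d l)" using Suc.prems by simp
      also have "\<dots> \<le> (\<Sum>l=p..<q. d l)" using kq by (intro sum_mono2) auto
      finally have lt: "(\<Sum>l=p..<k. d l) + i < length (?xs q)"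
        unfolding len using i by linarith
      have "stack p (Suc q) z $ ((\<Sum>l=p..<k. d l) + i) = ?xs (Suc q) ! ((\<Sum>l=p..<k. d l) + i)"
        by (rule st) (unfold app length_append, use lt in linarith)
      also have "\<dots> = ?xs q ! ((\<Sum>l=p..<k. d l) + i)"
        unfolding app nth_append using lt by (simp only: if_True)
      also have "\<dots> = stack p q z $ ((\<Sum>l=p..<k. d l) + i)"
        by (rule st[OF lt, symmetric])
      finally show "unstack d p (stack p (Suc q) z) k $ i = unstack d p (stack p q z) k $ i"
        using i by (simp add: unstack_def)
    qed (simp add: unstack_def)
    also have "\<dots> = z k"
      by (rule Suc.IH) (use Suc.prems kq in auto)
    finally show ?thesis .
  qed
qed simp

text \<open>The columns of \<open>O_mat\<close> are images of unit vectors, so its product with a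
  stacked vector is the value of the recursion once the latter is known to be linear.\<close>

lemma O_mat_mult_stack:
  assumes pq: "p < q"
    and M: "\<And>j. p \<le> j \<Longrightarrow> j < q \<Longrightarrow> M j \<in> carrier_mat n (mc j)"
    and F: "\<And>j. p \<le> j \<Longrightarrow> j < q - 1 \<Longrightarrow> F j \<in> carrier_mat n n"
    and \<Theta>: "\<And>j. p \<le> j \<Longrightarrow> j < q - 1 \<Longrightarrow> \<Theta> j \<in> carrier_mat n (tc j)"
    and U: "\<And>j. p \<le> j \<Longrightarrow> j < q - 1 \<Longrightarrow> U j \<in> carrier_mat (d j + tc j) (mc j)"
    and last: "d (q - 1) = mc (q - 1)"
    and z: "\<And>k. p \<le> k \<Longrightarrow> k < q \<Longrightarrow> z k \<in> carrier_vec (d k)"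
  shows "O_mat n d F M \<Theta> U p q *\<^sub>v stack p q z = M p *\<^sub>v mu F M \<Theta> U z (q - 1 - p) p"
proof (rule eq_vecI)
  let ?m = "\<Sum>l=p..<q. d l" and ?f = "\<lambda>v. M p *\<^sub>v mu F M \<Theta> U (unstack d p v) (q - 1 - p) p"
  have Mp: "M p \<in> carrier_mat n (mc p)" using M[of p] pq by simp
  have O: "O_mat n d F M \<Theta> U p q \<in> carrier_mat n ?m" by (simp add: O_mat_def Let_def)
  have "linear_coords ?m (mc p) (\<lambda>v. mu F M \<Theta> U (unstack d p v) (q - 1 - p) p)"
  proof (rule mu_linear_coords[where n = n and tc = tc])
    show "p + (q - 1 - p) < q" using pq by simp
    show "d (p + (q - 1 - p)) = mc (p + (q - 1 - p))" using last pq by simp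
  qed (use M F \<Theta> U pq in auto)
  then have lin: "linear_coords ?m n ?f" by (rule linear_coords_mult[OF _ Mp])
  have sc: "stack p q z \<in> carrier_vec ?m" by (rule stack_carrier[OF z])
  have mu: "mu F M \<Theta> U (unstack d p (stack p q z)) (q - 1 - p) p = mu F M \<Theta> U z (q - 1 - p) p"
    by (rule mu_cong) (use unstack_stack[OF z] pq in auto)
  fix i assume "i < dim_vec (M p *\<^sub>v mu F M \<Theta> U z (q - 1 - p) p)"
  then have i: "i < n" using Mp by simp
  have "(O_mat n d F M \<Theta> U p q *\<^sub>v stack p q z) $ i =
      (\<Sum>j<?m. O_mat n d F M \<Theta> U p q $$ (i, j) * stack p q z $ j)"
    by (rule mult_mat_vec_nth[OF O sc i])
  also have "\<dots> = (\<Sum>j<?m. stack p q z $ j * ?f (unit_vec ?m j) $ i)"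
    using i by (intro sum.cong) (simp_all add: O_mat_def Let_def del: index_mult_mat_vec)
  also have "\<dots> = ?f (stack p q z) $ i"
    by (rule linear_coordsD(2)[OF lin sc i, symmetric])
  finally show "(O_mat n d F M \<Theta> U p q *\<^sub>v stack p q z) $ i = (M p *\<^sub>v mu F M \<Theta> U z (q - 1 - p) p) $ i"
    unfolding mu .
next
  have "M p \<in> carrier_mat n (mc p)" using M[of p] pq by simp
  then show "dim_vec (O_mat n d F M \<Theta> U p q *\<^sub>v stack p q z) = dim_vec (M p *\<^sub>v mu F M \<Theta> U z (q - 1 - p) p)"
    by (simp add: O_mat_def Let_def)
qed

lemma Phi_carrier:
  assumes "\<And>k. p \<le> k \<Longrightarrow> k < p + m \<Longrightarrow> G k \<in> carrier_mat n n \<and> P k \<in> carrier_mat n n"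
  shows "Phi n G P p m \<in> carrier_mat n n"
  using assms
proof (induction m)
  case (Suc m)
  then have "G (p + m) \<in> carrier_mat n n" "P (p + m) \<in> carrier_mat n n" "Phi n G P p m \<in> carrier_mat n n" by auto
  then show ?case by simp
qed simp

lemma Phi_Suc_mult_vec:
  assumes "\<And>k. p \<le> k \<Longrightarrow> k \<le> p + m \<Longrightarrow> G k \<in> carrier_mat n n \<and> P k \<in> carrier_mat n n" and v: "v \<in> carrier_vec n"
  shows "Phi n G P p (Suc m) *\<^sub>v v = G (p + m) *\<^sub>v (P (p + m) *\<^sub>v (Phi n G P p m *\<^sub>v v))"
proof -
  have c: "G (p + m) \<in> carrier_mat n n" "P (p + m) \<in> carrier_mat n n" "Phi n G P p m \<in> carrier_mat n n"
    using assms(1) by (auto intro!: Phi_carrier)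
  have "Phi n G P p (Suc m) *\<^sub>v v = (G (p + m) * P (p + m)) *\<^sub>v (Phi n G P p m *\<^sub>v v)"
    unfolding Phi.simps by (rule assoc_mult_mat_vec[OF mult_carrier_mat[OF c(1,2)] c(3) v])
  also have "\<dots> = G (p + m) *\<^sub>v (P (p + m) *\<^sub>v (Phi n G P p m *\<^sub>v v))"
    by (rule assoc_mult_mat_vec[OF c(1,2) mult_mat_vec_carrier[OF c(3) v]])
  finally show ?thesis .
qed

section \<open>Solutions with prescribed initial value\<close>

lemma pws_sum: "(\<And>k. k \<in> K \<Longrightarrow> pws (f k)) \<Longrightarrow> pws (\<lambda>s. \<Sum>k\<in>K. f k s)"
  by (induction K rule: infinite_finite_induct) (auto intro: pws_add pws_const)

text \<open>Entries of B applied to the flow, for arbitrary B, form a class closed under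
  differentiation: the derivative replaces B by B A.\<close>

lemma smooth_flow:
  assumes A: "A \<in> carrier_mat n n" and w: "w \<in> carrier_vec n" and i: "i < n"
  shows "smooth (\<lambda>s. (mexp A (s - a) *\<^sub>v w) $ i)"
proof (rule smooth_coinduct[where Q = "\<lambda>f. \<exists>B\<in>carrier_mat n n. f = (\<lambda>s. (B *\<^sub>v (mexp A (s - a) *\<^sub>v w)) $ i)"])
  have mc: "mexp A (s - a) *\<^sub>v w \<in> carrier_vec n" for s
    by (rule mult_mat_vec_carrier[OF mexp_carrier[OF A] w])
  show "\<exists>B\<in>carrier_mat n n. (\<lambda>s. (mexp A (s - a) *\<^sub>v w) $ i) = (\<lambda>s. (B *\<^sub>v (mexp A (s - a) *\<^sub>v w)) $ i)"
    by (rule bexI[of _ "1\<^sub>m n"]) (simp_all only: one_mult_mat_vec[OF mc] one_carrier_mat)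
  fix f :: "real \<Rightarrow> real"
  assume "\<exists>B\<in>carrier_mat n n. f = (\<lambda>s. (B *\<^sub>v (mexp A (s - a) *\<^sub>v w)) $ i)"
  then obtain B where B: "B \<in> carrier_mat n n" and f: "f = (\<lambda>s. (B *\<^sub>v (mexp A (s - a) *\<^sub>v w)) $ i)" by blast
  have "(f has_real_derivative ((B * A) *\<^sub>v (mexp A (s - a) *\<^sub>v w)) $ i) (at s)" for s
    unfolding f assoc_mult_mat_vec[OF B A mc]
    by (rule mult_mat_vec_has_derivative[OF B mc mult_mat_vec_carrier[OF A mc] mexp_mult_vec_has_derivative[OF A w] i])
  with mult_carrier_mat[OF B A]
  show "\<exists>f'. (\<exists>B\<in>carrier_mat n n. f' = (\<lambda>s. (B *\<^sub>v (mexp A (s - a) *\<^sub>v w)) $ i)) \<and>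
      (\<forall>x. (f has_real_derivative f' x) (at x))"
    by (intro exI[of _ "\<lambda>s. ((B * A) *\<^sub>v (mexp A (s - a) *\<^sub>v w)) $ i"] conjI bexI[of _ "B * A"]) auto
qed

text \<open>The solution is written down in coordinates: the flow on each half-open interval and the
  forced impulses at its left end. Nilpotency bounds the order of the impulses, as a
  piecewise-smooth distribution requires.\<close>

lemma solution_exists:
  fixes ts :: "nat \<Rightarrow> real"
  assumes ts: "strict_mono ts" and pq: "p < q"
    and Ad: "\<And>k. p \<le> k \<Longrightarrow> k < q \<Longrightarrow> Ad k \<in> carrier_mat n n"
    and P: "\<And>k. p \<le> k \<Longrightarrow> k < q \<Longrightarrow> P k \<in> carrier_mat n n"
    and Ei: "\<And>k. p \<le> k \<Longrightarrow> k < q \<Longrightarrow> Ei k \<in> carrier_mat n n"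
    and nil: "\<And>k v j. p \<le> k \<Longrightarrow> k < q \<Longrightarrow> v \<in> carrier_vec n \<Longrightarrow> n \<le> j \<Longrightarrow> Ei k ^\<^sub>m j *\<^sub>v v = 0\<^sub>v n"
    and xs: "\<And>k. p \<le> k \<Longrightarrow> k \<le> q \<Longrightarrow> xs k \<in> carrier_vec n"
      "\<And>k. p \<le> k \<Longrightarrow> k < q \<Longrightarrow> xs (Suc k) = mexp (Ad k) (ts (Suc k) - ts k) *\<^sub>v (P k *\<^sub>v xs k)"
  shows "\<exists>x f c. vrep n x f c \<and> (\<forall>k. p \<le> k \<longrightarrow> k \<le> q \<longrightarrow> vleft n f (ts k) = xs k) \<and>
    (\<forall>k s. p \<le> k \<longrightarrow> k < q \<longrightarrow> ts k \<le> s \<longrightarrow> s < ts (Suc k) \<longrightarrow>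
      f s = mexp (Ad k) (s - ts k) *\<^sub>v (P k *\<^sub>v xs k) \<and>
      (\<forall>l. c s l = (if s = ts k then - (Ei k ^\<^sub>m Suc l *\<^sub>v xs k) else 0\<^sub>v n)))"
proof -
  define fl where "fl k s = mexp (Ad k) (s - ts k) *\<^sub>v (P k *\<^sub>v xs k)" for k s
  define im where "im k l = - (Ei k ^\<^sub>m Suc l *\<^sub>v xs k)" for k l
  \<comment> \<open>The constant stretch of length 1 before \<open>ts p\<close> realizes the
    prescribed left limit there, about which the DAE says nothing. Outside this stretch and the
    intervals f is zero.\<close>
  define f where "f s = vec n (\<lambda>i. indicator {ts p - 1..<ts p} s * xs p $ i +
    (\<Sum>k\<in>{p..<q}. indicator {ts k..<ts (Suc k)} s * fl k s $ i))" for s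
  define c where "c t l = vec n (\<lambda>i. \<Sum>k\<in>{p..<q}. if t = ts k then im k l $ i else 0)" for t l
  define x where "x = vec n (\<lambda>i \<phi>. (\<integral>s. f s $ i * tf \<phi> s \<partial>lborel) + (\<Sum>\<^sub>\<infinity>t. dirac_sum (\<lambda>l. c t l $ i) t \<phi>))"
  have flc: "fl k s \<in> carrier_vec n" if "p \<le> k" "k < q" for k s
    unfolding fl_def using that
    by (intro mult_mat_vec_carrier[OF mexp_carrier[OF Ad]] mult_mat_vec_carrier[OF P] xs) auto
  have imc: "im k l \<in> carrier_vec n" if "p \<le> k" "k < q" for k l
    unfolding im_def using that
    by (intro uminus_carrier_vec[THEN iffD2] mult_mat_vec_carrier[OF pow_carrier_mat[OF Ei]] xs) auto
  have smooth_fl: "smooth (\<lambda>s. fl k s $ i)" if "p \<le> k" "k < q" "i < n" for k i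
    unfolding fl_def using that by (intro smooth_flow[OF Ad] mult_mat_vec_carrier[OF P] xs) auto
  have vx: "vrep n x f c"
    unfolding vrep_def
  proof (intro conjI allI impI)
    fix i assume i: "i < n"
    have "pws (\<lambda>s. indicator {ts p - 1..<ts p} s * xs p $ i + (\<Sum>k\<in>{p..<q}. indicator {ts k..<ts (Suc k)} s * fl k s $ i))"
      using i by (intro pws_add pws_mult pws_sum pws_indicator pws_const smooth_imp_pws smooth_fl) auto
    moreover have "(\<lambda>s. f s $ i) = (\<lambda>s. indicator {ts p - 1..<ts p} s * xs p $ i +
        (\<Sum>k\<in>{p..<q}. indicator {ts k..<ts (Suc k)} s * fl k s $ i))"
      using i by (simp add: f_def)
    ultimately have "pws (\<lambda>s. f s $ i)" by simp
    moreover have "fin_impulses (\<lambda>t l. c t l $ i)"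
      unfolding fin_impulses_def
    proof (intro conjI allI)
      fix s
      have "\<not> s islimpt ts ` {p..<q}" by (rule islimpt_finite) simp
      then have "\<forall>\<^sub>F t in at s. t \<notin> ts ` {p..<q}" by (simp add: islimpt_iff_eventually)
      then show "\<forall>\<^sub>F t in at s. \<forall>l. c t l $ i = 0"
        by (rule eventually_mono) (use i in \<open>auto simp: c_def intro!: sum.neutral\<close>)
    next
      fix t
      have "c t l $ i = 0" if l: "n \<le> l" for l
      proof -
        have "im k l $ i = 0" if "p \<le> k" "k < q" for k
          unfolding im_def using nil[OF that xs(1)[of k], of "Suc l"] that l i by simp
        then show ?thesis using i by (auto simp: c_def intro!: sum.neutral)
      qed
      then show "\<exists>m. \<forall>l\<ge>m. c t l $ i = 0" by blast
    qed
    ultimately show "rep (x $ i) (\<lambda>s. f s $ i) (\<lambda>t l. c t l $ i)"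
      using i by (simp add: rep_def x_def)
  qed (simp_all add: x_def f_def c_def)
  have mono: "ts j \<le> ts k \<longleftrightarrow> j \<le> k" "ts j < ts k \<longleftrightarrow> j < k" "ts j = ts k \<longleftrightarrow> j = k" for j k
    using ts by (simp_all add: strict_mono_less_eq strict_mono_less strict_mono_eq)
  \<comment> \<open>The half-open intervals are disjoint, so exactly one summand is active at
    s.\<close>
  have ind: "indicator {ts j..<ts (Suc j)} s = (if j = k then 1 else 0 :: real)"
    if s: "ts k \<le> s" "s < ts (Suc k)" for j k s
  proof (cases "j = k")
    case False
    have "\<not> (ts j \<le> s \<and> s < ts (Suc j))"
    proof
      assume "ts j \<le> s \<and> s < ts (Suc j)"
      with s have "ts j < ts (Suc k)" "ts k < ts (Suc j)" by linarith+
      then have "j < Suc k" "k < Suc j" by (simp_all only: mono)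
      with False show False by simp
    qed
    with False show ?thesis by simp
  qed (use s in simp)
  have val: "f s = fl k s \<and> (\<forall>l. c s l = (if s = ts k then im k l else 0\<^sub>v n))"
    if k: "p \<le> k" "k < q" and s: "ts k \<le> s" "s < ts (Suc k)" for k s
  proof (intro conjI allI)
    have "ts p \<le> s" using k(1) s(1) mono(1)[of p k] by linarith
    show "f s = fl k s"
    proof (rule eq_vecI)
      fix i assume "i < dim_vec (fl k s)"
      then have i: "i < n" using carrier_vecD[OF flc[OF k]] by simp
      have "f s $ i = (\<Sum>j\<in>{p..<q}. indicator {ts j..<ts (Suc j)} s * fl j s $ i)"
        using i \<open>ts p \<le> s\<close> by (simp add: f_def)
      also have "\<dots> = (\<Sum>j\<in>{p..<q}. if j = k then fl k s $ i else 0)"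
        by (rule sum.cong[OF refl]) (simp add: ind[OF s] del: indicator_simps)
      also have "\<dots> = fl k s $ i" using k by simp
      finally show "f s $ i = fl k s $ i" .
    qed (simp add: f_def carrier_vecD[OF flc[OF k]])
    fix l
    have ne: "s = ts j \<longleftrightarrow> s = ts k \<and> j = k" for j
    proof
      assume sj: "s = ts j"
      then have "ts k \<le> ts j" "ts j < ts (Suc k)" using s by simp_all
      then have "j = k" by (simp only: mono) 
      with sj show "s = ts k \<and> j = k" by simp
    qed simp
    show "c s l = (if s = ts k then im k l else 0\<^sub>v n)"
    proof (rule eq_vecI)
      fix i assume "i < dim_vec (if s = ts k then im k l else 0\<^sub>v n)"
      then have i: "i < n" using carrier_vecD[OF imc[OF k, of l]] by (simp split: if_splits)
      have "c s l $ i = (\<Sum>j\<in>{p..<q}. if s = ts j then im j l $ i else 0)"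
        using i by (simp add: c_def)
      also have "\<dots> = (\<Sum>j\<in>{p..<q}. if j = k then (if s = ts k then im k l $ i else 0) else 0)"
      proof (rule sum.cong[OF refl])
        fix j
        show "(if s = ts j then im j l $ i else 0) = (if j = k then (if s = ts k then im k l $ i else 0) else 0)"
        proof (cases "j = k")
          case False
          then have "s \<noteq> ts j" using ne[of j] by blast
          with False show ?thesis by simp
        qed simp
      qed
      also have "\<dots> = (if s = ts k then im k l else 0\<^sub>v n) $ i" using k i by simp
      finally show "c s l $ i = (if s = ts k then im k l else 0\<^sub>v n) $ i" .
    qed (simp add: c_def carrier_vecD[OF imc[OF k, of l]])
  qed
  have "vleft n f (ts k) = xs k" if k: "p \<le> k" "k \<le> q" for k
  proof (rule eq_vecI)
    fix i assume "i < dim_vec (xs k)"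
    then have i: "i < n" using xs(1)[OF k] by simp
    have "((\<lambda>s. f s $ i) \<longlongrightarrow> xs k $ i) (at_left (ts k))"
    proof (cases "k = p")
      case True
      have "f s $ i = xs p $ i" if "ts p - 1 < s" "s < ts p" for s
      proof -
        have "indicator {ts j..<ts (Suc j)} s = (0 :: real)" if "j \<in> {p..<q}" for j
          using that \<open>s < ts p\<close> mono(1)[of p j] by auto
        then show ?thesis using i that by (simp add: f_def)
      qed
      then have "\<forall>\<^sub>F s in at_left (ts k). f s $ i = xs k $ i"
        unfolding True eventually_at_left_field by (intro exI[of _ "ts p - 1"]) auto
      then show ?thesis by (rule tendsto_eventually)
    next
      case False
      \<comment> \<open>For later k the left limit is the end value of the preceding flow, which the
        recursion for \<open>xs\<close> identifies with \<open>xs k\<close>.\<close>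
      then obtain j where j: "k = Suc j" "p \<le> j" "j < q" using k by (cases k) auto
      have "fl j (ts k) = xs k"
        using xs(2)[OF j(2,3)] j(1) by (simp add: fl_def)
      then have "((\<lambda>s. fl j s $ i) \<longlongrightarrow> xs k $ i) (at_left (ts k))"
        using smooth_tendsto[OF smooth_fl[OF j(2,3) i], of "ts k" "{..<ts k}"] by simp
      moreover have "\<forall>\<^sub>F s in at_left (ts k). f s $ i = fl j s $ i"
        unfolding eventually_at_left_field using val[OF j(2,3)] mono(2)[of j k] j(1)
        by (intro exI[of _ "ts j"]) auto
      ultimately show ?thesis by (simp only: tendsto_cong)
    qed
    from left_limit_eqI[OF this] show "vleft n f (ts k) $ i = xs k $ i"
      using i by (simp add: vleft_def)
  qed (use xs(1)[OF k] in \<open>simp add: vleft_def\<close>)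
  with vx val show ?thesis
    unfolding fl_def im_def by (intro exI[of _ x] exI[of _ f] exI[of _ c]) blast
qed

lemma vnorm_tendsto:
  assumes f: "\<And>s. f s \<in> carrier_vec n" and w: "w \<in> carrier_vec n"
    and lim: "\<And>i. i < n \<Longrightarrow> ((\<lambda>s. f s $ i) \<longlongrightarrow> w $ i) F"
  shows "((\<lambda>s. vnorm (f s)) \<longlongrightarrow> vnorm w) F"
proof -
  have "((\<lambda>s. sqrt (\<Sum>i<n. f s $ i * f s $ i)) \<longlongrightarrow> sqrt (\<Sum>i<n. w $ i * w $ i)) F"
    by (intro tendsto_real_sqrt tendsto_sum tendsto_mult lim) auto
  then show ?thesis
    using carrier_vecD[OF f] carrier_vecD[OF w] by (simp add: vnorm_def scalar_prod_def lessThan_atLeast0)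
qed

section \<open>The estimate\<close>

lemma dae_solution_interval:
  assumes "dae_solution n nu ny ts E A B C D {ts p..<ts q} x u y" "strict_mono ts" "p \<le> k" "k < q"
  shows "vec_restrict {ts k..<ts (Suc k)} (mat_dist (E k) (vec_deriv x)) =
      vec_restrict {ts k..<ts (Suc k)} (mat_dist (A k) x + mat_dist (B k) u)"
    and "vec_restrict {ts k..<ts (Suc k)} y =
      vec_restrict {ts k..<ts (Suc k)} (mat_dist (C k) x + mat_dist (D k) u)"
proof -
  have "ts p \<le> ts k" "ts (Suc k) \<le> ts q"
    using assms(2-4) by (simp_all add: strict_mono_less_eq)
  then have J: "{ts p..<ts q} \<inter> {ts k..<ts (Suc k)} = {ts k..<ts (Suc k)}" by auto
  from assms(1) have "let J = {ts p..<ts q} \<inter> {ts k..<ts (Suc k)} in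
      vec_restrict J (mat_dist (E k) (vec_deriv x)) = vec_restrict J (mat_dist (A k) x + mat_dist (B k) u) \<and>
      vec_restrict J y = vec_restrict J (mat_dist (C k) x + mat_dist (D k) u)"
    unfolding dae_solution_def by blast
  then show "vec_restrict {ts k..<ts (Suc k)} (mat_dist (E k) (vec_deriv x)) =
      vec_restrict {ts k..<ts (Suc k)} (mat_dist (A k) x + mat_dist (B k) u)"
    "vec_restrict {ts k..<ts (Suc k)} y =
      vec_restrict {ts k..<ts (Suc k)} (mat_dist (C k) x + mat_dist (D k) u)"
    unfolding Let_def J by blast+
qed

lemma zero_output_solution:
  assumes dae: "switched_dae n nu ny ts E A B C D"
    and x: "vrep n x f c"
    and hom: "\<And>k. p \<le> k \<Longrightarrow> k < q \<Longrightarrow> homogeneous_piece n (E k) (A k) (ts k) (ts (Suc k)) f c"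
    and out: "\<And>k s. p \<le> k \<Longrightarrow> k < q \<Longrightarrow> ts k \<le> s \<Longrightarrow> s < ts (Suc k) \<Longrightarrow>
      C k *\<^sub>v f s = 0\<^sub>v ny \<and> (\<forall>l. C k *\<^sub>v c s l = 0\<^sub>v ny)"
  shows "dae_solution n nu ny ts E A B C D {ts p..<ts q} x (0\<^sub>v nu) (0\<^sub>v ny)"
  unfolding dae_solution_def Let_def
proof (intro conjI allI)
  show "x \<in> pw_smooth_vecs n" "0\<^sub>v nu \<in> pw_smooth_vecs nu" "0\<^sub>v ny \<in> pw_smooth_vecs ny"
    by (rule vrep_pw_smooth_vecs, rule x vrep_0)+
  fix k
  have ts: "strict_mono ts" and cm: "E k \<in> carrier_mat n n" "A k \<in> carrier_mat n n" "B k \<in> carrier_mat n nu"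
    "C k \<in> carrier_mat ny n" "D k \<in> carrier_mat ny nu"
    using dae by (auto simp: switched_dae_def)
  have add0: "v + 0\<^sub>v m = v" if "v \<in> carrier_vec m" for v :: "real vec" and m
    using that by simp
  note c = vrepD(2,3)[OF x]
  note rE = vrep_mat_dist[OF cm(1) vrep_deriv[OF x]]
    and rA = vrep_add[OF vrep_mat_dist[OF cm(2) x] vrep_mat_dist[OF cm(3) vrep_0]]
    and rC = vrep_add[OF vrep_mat_dist[OF cm(4) x] vrep_mat_dist[OF cm(5) vrep_0]]
  show "vec_restrict ({ts p..<ts q} \<inter> {ts k..<ts (Suc k)}) (mat_dist (E k) (vec_deriv x)) =
      vec_restrict ({ts p..<ts q} \<inter> {ts k..<ts (Suc k)}) (mat_dist (A k) x + mat_dist (B k) (0\<^sub>v nu))"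
    and "vec_restrict ({ts p..<ts q} \<inter> {ts k..<ts (Suc k)}) (0\<^sub>v ny) =
      vec_restrict ({ts p..<ts q} \<inter> {ts k..<ts (Suc k)}) (mat_dist (C k) x + mat_dist (D k) (0\<^sub>v nu))"
  proof -
    \<comment> \<open>Solutions are tested for every mode index k. Outside the range the
      intersection is empty and is written as \<open>{0..<0}\<close>, so that
      \<open>vec_restrict_eq_iff\<close> applies in both cases.\<close>
    define a b where "a = (if p \<le> k \<and> k < q then ts k else 0)" and "b = (if p \<le> k \<and> k < q then ts (Suc k) else 0)"
    have J: "{ts p..<ts q} \<inter> {ts k..<ts (Suc k)} = {a..<b}"
    proof (cases "p \<le> k \<and> k < q")
      case True
      then have "ts p \<le> ts k" "ts (Suc k) \<le> ts q"
        using ts by (simp_all add: strict_mono_less_eq)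
      with True show ?thesis by (auto simp: a_def b_def)
    next
      case False
      then have "ts (Suc k) \<le> ts p \<or> ts q \<le> ts k"
        using ts by (auto simp: strict_mono_less_eq)
      with False show ?thesis by (auto simp: a_def b_def)
    qed
    have k: "p \<le> k" "k < q" "ts k \<le> s" "s < ts (Suc k)" if "s \<in> {a..<b}" for s
      using that by (auto simp: a_def b_def split: if_splits)
    show "vec_restrict ({ts p..<ts q} \<inter> {ts k..<ts (Suc k)}) (mat_dist (E k) (vec_deriv x)) =
        vec_restrict ({ts p..<ts q} \<inter> {ts k..<ts (Suc k)}) (mat_dist (A k) x + mat_dist (B k) (0\<^sub>v nu))"
      unfolding J vec_restrict_eq_iff[OF rE rA] mult_mat_zero_vec[OF cm(3)]
        add0[OF mult_mat_vec_carrier[OF cm(2) c(1)]] add0[OF mult_mat_vec_carrier[OF cm(2) c(2)]]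
    proof
      fix s assume "s \<in> {a..<b}"
      from hom[OF k(1,2)[OF this]] k(3,4)[OF this]
      have h: "E k *\<^sub>v vright_deriv n f s = A k *\<^sub>v f s" "E k *\<^sub>v (f s - vleft n f s) = A k *\<^sub>v c s 0"
        "\<forall>l. E k *\<^sub>v c s l = A k *\<^sub>v c s (Suc l)"
        by (auto simp: homogeneous_piece_def)
      then show "E k *\<^sub>v vright_deriv n f s = A k *\<^sub>v f s \<and>
          (\<forall>l. E k *\<^sub>v (case l of 0 \<Rightarrow> f s - vleft n f s | Suc l \<Rightarrow> c s l) = A k *\<^sub>v c s l)"
        by (simp split: nat.split)
    qed
    show "vec_restrict ({ts p..<ts q} \<inter> {ts k..<ts (Suc k)}) (0\<^sub>v ny) =
        vec_restrict ({ts p..<ts q} \<inter> {ts k..<ts (Suc k)}) (mat_dist (C k) x + mat_dist (D k) (0\<^sub>v nu))"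
      unfolding J vec_restrict_eq_iff[OF vrep_0 rC] mult_mat_zero_vec[OF cm(5)]
        add0[OF mult_mat_vec_carrier[OF cm(4) c(1)]] add0[OF mult_mat_vec_carrier[OF cm(4) c(2)]]
    proof
      fix s assume "s \<in> {a..<b}"
      from out[OF k[OF this]] show "0\<^sub>v ny = C k *\<^sub>v f s \<and> (\<forall>l. 0\<^sub>v ny = C k *\<^sub>v c s l)" by simp
    qed
  qed
qed

lemma detectable_left_limit:
  assumes det: "interval_detectable n nu ny ts E A B C D p q \<beta>"
    and left_cont: "\<forall>r\<ge>0. continuous (at_left (ts q - ts p)) (\<beta> r)"
    and lt: "ts p < ts q"
    and x: "vrep n x f c"
    and sol: "dae_solution n nu ny ts E A B C D {ts p..<ts q} x (0\<^sub>v nu) (0\<^sub>v ny)"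
  shows "vnorm (vleft n f (ts q)) \<le> \<beta> (vnorm (vleft n f (ts p))) (ts q - ts p)"
proof -
  define r where "r = vnorm (vleft n f (ts p))"
  have r: "r \<ge> 0" by (simp add: r_def vnorm_def scalar_prod_self_nonneg)
  have bound: "vnorm (f t) \<le> \<beta> r (t - ts p)" if "ts p \<le> t" "t < ts q" for t
    using det sol that unfolding interval_detectable_def right_value_vrep[OF x, symmetric] r_def
      left_value_vrep[OF x, symmetric] by auto
  have "((\<lambda>t. vnorm (f t)) \<longlongrightarrow> vnorm (vleft n f (ts q))) (at_left (ts q))"
    by (rule vnorm_tendsto[OF vrepD(2)[OF x] vleft_carrier vleft_tendsto[OF x]])
  moreover have "((\<lambda>t. \<beta> r (t - ts p)) \<longlongrightarrow> \<beta> r (ts q - ts p)) (at_left (ts q))"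
  proof (rule filterlim_compose[of "\<beta> r" _ "at_left (ts q - ts p)"])
    show "(\<beta> r \<longlongrightarrow> \<beta> r (ts q - ts p)) (at_left (ts q - ts p))"
      using left_cont r by (simp add: continuous_within)
    \<comment> \<open>Continuity of beta is assumed from the left only, so the shifted time has to
      approach its limit strictly from below.\<close>
    show "LIM t at_left (ts q). t - ts p :> at_left (ts q - ts p)"
      unfolding filterlim_at
    proof
      show "\<forall>\<^sub>F t in at_left (ts q). t - ts p \<in> {..<ts q - ts p} \<and> t - ts p \<noteq> ts q - ts p"
        unfolding eventually_at_left_field by (intro exI[of _ "ts p"]) (use lt in auto)
      show "((\<lambda>t. t - ts p) \<longlongrightarrow> ts q - ts p) (at_left (ts q))"
        by (intro tendsto_intros)
    qed
  qed
  moreover have "\<forall>\<^sub>F t in at_left (ts q). vnorm (f t) \<le> \<beta> r (t - ts p)"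
    unfolding eventually_at_left_field using bound lt by (intro exI[of _ "ts p"]) auto
  ultimately have "vnorm (vleft n f (ts q)) \<le> \<beta> r (ts q - ts p)"
    by (intro tendsto_le[of "at_left (ts q)"]) auto
  then show ?thesis by (simp add: r_def)
qed

lemma vnorm_pos: "v \<in> carrier_vec n \<Longrightarrow> v \<noteq> 0\<^sub>v n \<Longrightarrow> vnorm v > 0"
  using scalar_prod_self_nonneg[of v] scalar_prod_self_eq_0[of v n] by (auto simp: vnorm_def order_le_less)

theorem theorem13:
  fixes n nu ny :: nat
    and ts :: "nat \<Rightarrow> real"
    and E A B C D :: "nat \<Rightarrow> real mat"
    and p q :: nat
    and \<beta> :: "real \<Rightarrow> real \<Rightarrow> real"
    and x xh u y yh ye :: "distr vec"
    and P Ad Ei Od Oi F G Z Zd Zi Uobs Uimp M \<Theta> U :: "nat \<Rightarrow> real mat"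
    and W N :: "nat \<Rightarrow> real vec set"
    and z :: "nat \<Rightarrow> real vec"
    and \<xi> :: "real vec"
  assumes dae: "switched_dae n nu ny ts E A B C D"
    and regular: "\<forall>k. regular_pair (E k) (A k)"
    and pq: "p < q"
    and detectable: "interval_detectable n nu ny ts E A B C D p q \<beta>"
    \<comment> \<open>Class KL does not include continuity in time, but detectability bounds the state only before
      \<open>ts q\<close> and the claim concerns the left limit there; it fails if \<open>\<beta> r\<close> jumps down at \<open>ts q - ts p\<close>.\<close>
    and left_cont: "\<forall>r\<ge>0. continuous (at_left (ts q - ts p)) (\<beta> r)"
    and sol: "dae_solution n nu ny ts E A B C D {ts p..<ts q} x u y"
    and copy: "dae_solution n nu ny ts E A B C D {ts p..<ts q} xh u yh"
    and ye: "ye = yh - y"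
    and mode: "\<forall>k\<in>{p..<q}. mode_matrices n (E k) (A k) (P k) (Ad k) (Ei k)"
    and Od: "\<forall>k\<in>{p..<q}. Od k = O_diff n ny (C k) (P k) (Ad k)"
    and Oi: "\<forall>k\<in>{p..<q}. Oi k = O_imp n ny (C k) (Ei k)"
    and W: "\<forall>k\<in>{p..<q}. W k = local_unobs (P k) (Od k) (Oi k)"
    and Z: "\<forall>k\<in>{p..<q}. orthonormal_basis_mat n (Z k) (orth_compl n (W k))"
    and Zd: "\<forall>k\<in>{p..<q}. orthonormal_basis_mat n (Zd k) (mat_image (transpose_mat (Od k)))"
    and Zi: "\<forall>k\<in>{p..<q}. orthonormal_basis_mat n (Zi k) (mat_image (transpose_mat (Oi k)))"
    and Uobs: "\<forall>k\<in>{p..<q}.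
        Uobs k \<in> carrier_mat (dim_col (Zd k) + dim_col (Zi k)) (dim_col (Z k)) \<and>
        Z k = hcat (transpose_mat (P k) * Zd k) (Zi k) * Uobs k"
    and Uimp: "\<forall>k\<in>{p..<q}. Uimp k \<in> carrier_mat ((n - 1) * ny) (dim_col (Zi k)) \<and>
        - transpose_mat (Oi k) * Uimp k = Zi k"
    and F: "\<forall>k\<in>{p..<q}. F k = mat_exp (- (ts (Suc k) - ts k) \<cdot>\<^sub>m Ad k)"
    and G: "\<forall>k\<in>{p..<q}. G k = mat_exp ((ts (Suc k) - ts k) \<cdot>\<^sub>m Ad k)"
    and N: "\<forall>k\<in>{p..<q}. N k = unobs_space F P W (q - 1 - k) k"
    and M: "\<forall>k\<in>{p..<q}. orthonormal_basis_mat n (M k) (orth_compl n (N k))"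
    and M_last: "M (q - 1) = Z (q - 1)"
    and \<Theta>: "\<forall>k\<in>{p..<q - 1}. dim_row (\<Theta> k) = n \<and>
        mat_image (\<Theta> k) = orth_compl n ((\<lambda>v. F k *\<^sub>v v) ` N (Suc k))"
    and U: "\<forall>k\<in>{p..<q - 1}.
        U k \<in> carrier_mat (dim_col (Z k) + dim_col (\<Theta> k)) (dim_col (M k)) \<and>
        M k = hcat (Z k) (transpose_mat (P k) * \<Theta> k) * U k"
    and z: "\<forall>k\<in>{p..<q}. z k =
        frak_O n (C k) (P k) (Ad k) (Zd k) (Uobs k) (Uimp k) (ts k) (ts (Suc k))
          (vec_restrict {ts k..<ts (Suc k)} ye)"
    and \<xi>: "\<xi> = Phi n G P p (q - p) * O_mat n (\<lambda>k. dim_col (Z k)) F M \<Theta> U p q *\<^sub>v stack p q z"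
  shows "vnorm (left_value xh (ts q) - \<xi> - left_value x (ts q))
           \<le> \<beta> (vnorm (left_value xh (ts p) - left_value x (ts p))) (ts q - ts p) \<and>
         (left_value xh (ts p) \<noteq> left_value x (ts p) \<longrightarrow>
           \<beta> (vnorm (left_value xh (ts p) - left_value x (ts p))) (ts q - ts p)
             < vnorm (left_value xh (ts p) - left_value x (ts p)))"
proof -
  have ts: "strict_mono ts"
    and mats: "E k \<in> carrier_mat n n" "A k \<in> carrier_mat n n" "B k \<in> carrier_mat n nu"
      "C k \<in> carrier_mat ny n" "D k \<in> carrier_mat ny nu" for k
    using dae by (auto simp: switched_dae_def)
  have step: "ts k < ts (Suc k)" for k
    using ts by (simp add: strict_mono_less)
  have lt: "ts p < ts q"
    using ts pq by (simp add: strict_mono_less)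
  \<comment> \<open>The transformations behind the mode matrices are not among the data; one is
    chosen here for each mode in range.\<close>
  have "\<exists>X Y. mode_algebra n (E k) (A k) (P k) (Ad k) (Ei k) X Y" if "p \<le> k" "k < q" for k
    using mode_matrices_algebra[OF _ mats(1,2)] mode that by simp
  then obtain X Y where XY: "\<And>k. p \<le> k \<Longrightarrow> k < q \<Longrightarrow> mode_algebra n (E k) (A k) (P k) (Ad k) (Ei k) (X k) (Y k)"
    by metis
  have md: "mode n (E k) (A k) (P k) (Ad k) (Ei k) (X k) (Y k)" if "p \<le> k" "k < q" for k
    using XY[OF that] by (rule mode.intro)
  note cm = mode.carrier[OF md]
  have FG: "F k = mexp (Ad k) (- (ts (Suc k) - ts k))" "G k = mexp (Ad k) (ts (Suc k) - ts k)"
    if "p \<le> k" "k < q" for k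
    using F G that by (simp_all add: mexp_def)
  have FGc: "F k \<in> carrier_mat n n \<and> G k \<in> carrier_mat n n \<and> P k \<in> carrier_mat n n \<and>
      F k * G k = 1\<^sub>m n \<and> G k * F k = 1\<^sub>m n" if "p \<le> k" "k < q" for k
    unfolding FG[OF that]
    by (intro conjI mexp_carrier mexp_minus_mult mexp_mult_minus cm(3,4)[OF that])
  have OdOi: "Od k \<in> carrier_mat (n * ny) n" "Oi k \<in> carrier_mat ((n - 1) * ny) n" if "p \<le> k" "k < q" for k
    using Od Oi that by (simp_all add: O_diff_def O_imp_def)

  obtain fx cx fh ch gu du gy dy gh dh where reps: "vrep n x fx cx" "vrep n xh fh ch" "vrep nu u gu du"
    "vrep ny y gy dy" "vrep ny yh gh dh"
    using sol copy unfolding dae_solution_def by (meson pw_smooth_vecs_vrep)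
  define f c where "f = (\<lambda>s. fh s - fx s)" and "c = (\<lambda>t l. ch t l - cx t l)"
  have e: "vrep n (xh - x) f c"
    unfolding f_def c_def by (rule vrep_diff[OF reps(2,1)])
  define ev where "ev k = vleft n f (ts k)" for k
  have evc: "ev k \<in> carrier_vec n" for k
    by (simp add: ev_def)
  have hom: "homogeneous_piece n (E k) (A k) (ts k) (ts (Suc k)) f c"
    and out: "vec_restrict {ts k..<ts (Suc k)} ye = vec_restrict {ts k..<ts (Suc k)} (mat_dist (C k) (xh - x))"
    if k: "p \<le> k" "k < q" for k
    unfolding f_def c_def ye
    by (rule dae_difference[OF mats reps dae_solution_interval(1)[OF sol ts k] dae_solution_interval(1)[OF copy ts k]
          dae_solution_interval(2)[OF sol ts k] dae_solution_interval(2)[OF copy ts k]])+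
  have ms: "mode_solution n (E k) (A k) (P k) (Ad k) (Ei k) (X k) (Y k) (xh - x) f c (ts k) (ts (Suc k))"
    if k: "p \<le> k" "k < q" for k
    by (intro mode_solution.intro mode_solution_axioms.intro md e hom step k)
  have ob: "observed_mode n (E k) (A k) (P k) (Ad k) (Ei k) (X k) (Y k) ny (dim_col (Zd k)) (C k) (Zd k)"
    if k: "p \<le> k" "k < q" for k
  proof (intro observed_mode.intro observed_mode_axioms.intro md mats k)
    have zd: "orthonormal_basis_mat n (Zd k) (mat_image (transpose_mat (Od k)))" "Od k = O_diff n ny (C k) (P k) (Ad k)"
      using Zd Od k by simp_all
    from zd(1) show "Zd k \<in> carrier_mat n (dim_col (Zd k))" by (rule orthonormal_basis_matD(1))
    from zd show "orthonormal_basis_mat n (Zd k) (mat_image (transpose_mat (O_diff n ny (C k) (P k) (Ad k))))" by simp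
  qed
  have zk: "z k = transpose_mat (Z k) *\<^sub>v ev k" if k: "p \<le> k" "k < q" for k
  proof -
    have os: "observed_solution n (E k) (A k) (P k) (Ad k) (Ei k) (X k) (Y k) (xh - x) f c (ts k) (ts (Suc k))
        ny (dim_col (Zd k)) (C k) (Zd k) (vec_restrict {ts k..<ts (Suc k)} ye)"
      by (intro observed_solution.intro observed_solution_axioms.intro ms ob out k)
    have "orthonormal_basis_mat n (Zi k) (mat_image (transpose_mat (Oi k)))"
      using Zi k by simp
    then have zi: "Zi k \<in> carrier_mat n (dim_col (Zi k))" by (rule orthonormal_basis_matD(1))
    have kk: "k \<in> {p..<q}" using k by simp
    note u = bspec[OF Uobs kk, THEN conjunct1] bspec[OF Uobs kk, THEN conjunct2]
      bspec[OF Uimp kk, THEN conjunct1] bspec[OF Uimp kk, THEN conjunct2, unfolded bspec[OF Oi kk]]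
    have "z k = frak_O n (C k) (P k) (Ad k) (Zd k) (Uobs k) (Uimp k) (ts k) (ts (Suc k))
        (vec_restrict {ts k..<ts (Suc k)} ye)"
      using z k by simp
    also have "\<dots> = transpose_mat (Z k) *\<^sub>v ev k"
      unfolding ev_def by (rule observed_solution.frak_O_eq[OF os zi u])
    finally show ?thesis .
  qed
  have ev_Suc: "ev (Suc k) = G k *\<^sub>v (P k *\<^sub>v ev k)" if k: "p \<le> k" "k < q" for k
    unfolding ev_def FG(2)[OF k] by (rule mode_solution.final_value[OF ms[OF k]])

  have Wk: "\<exists>R\<subseteq>carrier_vec n. W k = orth_compl n R" if k: "p \<le> k" "k < q" for k
    using local_unobs_orth_compl[OF cm(3)[OF k] OdOi[OF k]] W k by simp
  have Nk: "\<exists>R\<subseteq>carrier_vec n. N k = orth_compl n R" if k: "p \<le> k" "k < q" for k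
  proof -
    have "\<exists>R\<subseteq>carrier_vec n. unobs_space F P W (q - 1 - k) k = orth_compl n R"
      by (rule unobs_space_orth_compl[where G = G]) (use Wk FGc k in auto)
    then show ?thesis using N k by simp
  qed
  have N_Suc: "N k = W k \<inter> preimage (P k) ((\<lambda>v. F k *\<^sub>v v) ` N (Suc k))" if k: "p \<le> k" "Suc k < q" for k
  proof -
    have "q - 1 - k = Suc (q - 1 - Suc k)" using k by simp
    moreover have "N k = unobs_space F P W (q - 1 - k) k" "N (Suc k) = unobs_space F P W (q - 1 - Suc k) (Suc k)"
      using N k by simp_all
    ultimately show ?thesis by simp
  qed
  have N_W: "N k \<subseteq> W k" if k: "p \<le> k" "k < q" for k
  proof (cases "Suc k < q")
    case True
    then show ?thesis using N_Suc[OF k(1)] by simp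
  next
    case False
    then have "q - 1 - k = 0" using k by simp
    moreover have "N k = unobs_space F P W (q - 1 - k) k" using N k by simp
    ultimately show ?thesis by simp
  qed
  have Mk: "orthonormal_basis_mat n (M k) (orth_compl n (N k))" "M k \<in> carrier_mat n (dim_col (M k))"
    if k: "p \<le> k" "k < q" for k
  proof -
    show "orthonormal_basis_mat n (M k) (orth_compl n (N k))" using M k by simp
    then show "M k \<in> carrier_mat n (dim_col (M k))" by (rule orthonormal_basis_matD(1))
  qed
  have Zk: "Z k \<in> carrier_mat n (dim_col (Z k))" if k: "p \<le> k" "k < q" for k
  proof (rule orthonormal_basis_matD(1))
    show "orthonormal_basis_mat n (Z k) (orth_compl n (W k))" using Z k by simp
  qed
  have \<Theta>k: "\<Theta> k \<in> carrier_mat n (dim_col (\<Theta> k))" "mat_image (\<Theta> k) = orth_compl n ((\<lambda>v. F k *\<^sub>v v) ` N (Suc k))"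
    if k: "p \<le> k" "k < q - 1" for k
    using \<Theta> k carrier_matI[OF _ refl] by auto
  have Uk: "U k \<in> carrier_mat (dim_col (Z k) + dim_col (\<Theta> k)) (dim_col (M k))"
    "M k = hcat (Z k) (transpose_mat (P k) * \<Theta> k) * U k" if k: "p \<le> k" "k < q - 1" for k
  proof -
    have "k \<in> {p..<q - 1}" using k by simp
    from bspec[OF U this] show "U k \<in> carrier_mat (dim_col (Z k) + dim_col (\<Theta> k)) (dim_col (M k))"
      "M k = hcat (Z k) (transpose_mat (P k) * \<Theta> k) * U k" by blast+
  qed
  \<comment> \<open>Downward induction on k, run as induction on the number m of later intervals to
    match the recursion of \<open>mu\<close>.\<close>
  have mu: "p \<le> k \<Longrightarrow> k + m = q - 1 \<Longrightarrow> mu F M \<Theta> U z m k = transpose_mat (M k) *\<^sub>v ev k" for k m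
  proof (induction m arbitrary: k)
    case 0
    then show ?case using zk[of k] M_last pq by simp
  next
    case (Suc m)
    then have k: "p \<le> k" "k < q" "k < q - 1" "p \<le> Suc k" "Suc k < q" by simp_all
    have IH: "mu F M \<Theta> U z m (Suc k) = transpose_mat (M (Suc k)) *\<^sub>v ev (Suc k)"
      using Suc by simp
    obtain R where R: "R \<subseteq> carrier_vec n" "N (Suc k) = orth_compl n R"
      using Nk[OF k(4,5)] by blast
    note fg = FGc[OF k(1,2)]
    have Pe: "P k *\<^sub>v ev k \<in> carrier_vec n"
      using fg evc by (intro mult_mat_vec_carrier) auto
    have Fe: "F k *\<^sub>v ev (Suc k) = P k *\<^sub>v ev k"
      unfolding ev_Suc[OF k(1,2)] using assoc_mult_mat_vec[of "F k" n n "G k" n, OF _ _ Pe] fg Pe by simp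
    show ?case
      unfolding mu.simps IH zk[OF k(1,2)]
      by (rule observation_step[OF \<Theta>k[OF k(1,3)] Mk[OF k(4,5)] R(2,1) _ _ evc evc Fe Zk[OF k(1,2)] Uk[OF k(1,3)],
            symmetric]) (use fg in auto)
  qed
  define mp where "mp = M p *\<^sub>v (transpose_mat (M p) *\<^sub>v ev p)"
  define n0 where "n0 = ev p - mp"
  note Mp = Mk[OF order_refl pq]
  have mpc: "mp \<in> carrier_vec n"
    unfolding mp_def
    by (intro mult_mat_vec_carrier[OF Mp(2)] mult_mat_vec_carrier[OF _ evc] transpose_carrier_mat[THEN iffD2] Mp(2))
  have n0c: "n0 \<in> carrier_vec n" using mpc evc by (simp add: n0_def)
  have n0N: "n0 \<in> N p"
  proof -
    obtain R where R: "R \<subseteq> carrier_vec n" "N p = orth_compl n R"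
      using Nk[OF order_refl pq] by blast
    from orthonormal_basis_residual[OF Mp(1) evc[of p]] orth_compl_orth_compl[OF R(2,1)]
    show ?thesis by (auto simp: n0_def mp_def)
  qed
  \<comment> \<open>Orthonormality of the columns of M p enters here: detectability will bound the
    end value through n0, while the claim speaks of the whole initial error.\<close>
  have n0le: "vnorm n0 \<le> vnorm (ev p)"
    unfolding n0_def mp_def by (rule orthonormal_basis_residual_vnorm[OF Mp(1) evc])

  define Ph where "Ph m = Phi n G P p m" for m
  have GPc: "G k \<in> carrier_mat n n \<and> P k \<in> carrier_mat n n" if "p \<le> k" "k < q" for k
    using FGc[OF that] by blast
  have Phc: "Ph m \<in> carrier_mat n n" if "p + m \<le> q" for m
    unfolding Ph_def by (rule Phi_carrier) (use GPc that in auto)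
  have Ph_Suc: "Ph (Suc m) *\<^sub>v v = G (p + m) *\<^sub>v (P (p + m) *\<^sub>v (Ph m *\<^sub>v v))"
    if "p + m < q" "v \<in> carrier_vec n" for m v
    unfolding Ph_def by (rule Phi_Suc_mult_vec[OF _ that(2)]) (use GPc that in auto)
  have Ph_0: "Ph 0 *\<^sub>v v = v" if "v \<in> carrier_vec n" for v
    using that by (simp add: Ph_def)
  \<comment> \<open>The error is propagated by the same matrices as the auxiliary solution, so
    subtracting the propagated mp at the end amounts to subtracting mp at the beginning.\<close>
  have Ph_ev: "p + m \<le> q \<Longrightarrow> Ph m *\<^sub>v ev p = ev (p + m)" for m
  proof (induction m)
    case 0
    show ?case using Ph_0[OF evc] by simp
  next
    case (Suc m)
    then show ?case using Ph_Suc[OF _ evc, of m p] ev_Suc[of "p + m"] by simp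
  qed
  have Om: "O_mat n (\<lambda>k. dim_col (Z k)) F M \<Theta> U p q *\<^sub>v stack p q z = mp"
  proof -
    have "O_mat n (\<lambda>k. dim_col (Z k)) F M \<Theta> U p q *\<^sub>v stack p q z = M p *\<^sub>v mu F M \<Theta> U z (q - 1 - p) p"
    proof (rule O_mat_mult_stack[OF pq Mk(2) _ \<Theta>k(1) Uk(1)])
      show "F j \<in> carrier_mat n n" if "p \<le> j" "j < q - 1" for j
        using FGc[of j] that by auto
      show "dim_col (Z (q - 1)) = dim_col (M (q - 1))" using M_last by simp
      show "z k \<in> carrier_vec (dim_col (Z k))" if "p \<le> k" "k < q" for k
        unfolding zk[OF that]
        by (intro mult_mat_vec_carrier[OF _ evc] transpose_carrier_mat[THEN iffD2] Zk that)
    qed auto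
    also have "mu F M \<Theta> U z (q - 1 - p) p = transpose_mat (M p) *\<^sub>v ev p"
      by (rule mu) (use pq in auto)
    finally show ?thesis by (simp add: mp_def)
  qed
  have \<xi>': "\<xi> = Ph (q - p) *\<^sub>v mp"
  proof -
    have O: "O_mat n (\<lambda>k. dim_col (Z k)) F M \<Theta> U p q \<in> carrier_mat n (\<Sum>l=p..<q. dim_col (Z l))"
      by (simp add: O_mat_def Let_def)
    have s: "stack p q z \<in> carrier_vec (\<Sum>l=p..<q. dim_col (Z l))"
    proof (rule stack_carrier)
      show "z k \<in> carrier_vec (dim_col (Z k))" if "p \<le> k" "k < q" for k
        unfolding zk[OF that]
        by (intro mult_mat_vec_carrier[OF _ evc] transpose_carrier_mat[THEN iffD2] Zk that)
    qed
    have "p + (q - p) \<le> q" using pq by simp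
    from assoc_mult_mat_vec[OF Phc[OF this] O s] show ?thesis
      unfolding \<xi> Om Ph_def by simp
  qed
  have \<xi>c: "\<xi> \<in> carrier_vec n"
    unfolding \<xi>' by (rule mult_mat_vec_carrier[OF Phc mpc]) (use pq in simp)

  \<comment> \<open>The left limits of the auxiliary solution at the switching times.\<close>
  define xs where "xs k = Ph (k - p) *\<^sub>v n0" for k
  have xsc: "xs k \<in> carrier_vec n" if "p \<le> k" "k \<le> q" for k
    unfolding xs_def by (rule mult_mat_vec_carrier[OF Phc n0c]) (use that in simp)
  have xs_p: "xs p = n0" using Ph_0[OF n0c] by (simp add: xs_def)
  have xs_Suc: "xs (Suc k) = G k *\<^sub>v (P k *\<^sub>v xs k)" if "p \<le> k" "k < q" for k
    using Ph_Suc[OF _ n0c, of "k - p"] that by (simp add: xs_def Suc_diff_le)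
  have xs_q: "xs q = ev q - \<xi>"
    unfolding xs_def n0_def \<xi>' using mult_minus_distrib_mat_vec[OF Phc evc mpc, of "q - p"] Ph_ev[of "q - p"] pq
    by simp
  \<comment> \<open>Membership in N at index p + m provides v in the next unobservable space with P
    xs = F v; G undoes F, so v is the next left limit.\<close>
  have xsN: "xs (p + m) \<in> N (p + m)" if "p + m < q" for m
    using that
  proof (induction m)
    case 0
    show ?case using n0N xs_p by simp
  next
    case (Suc m)
    then have k: "p \<le> p + m" "p + m < q" "Suc (p + m) < q" by simp_all
    have fg: "F (p + m) \<in> carrier_mat n n" "G (p + m) \<in> carrier_mat n n" "G (p + m) * F (p + m) = 1\<^sub>m n"
      using FGc[OF k(1,2)] by auto
    obtain R where R: "N (Suc (p + m)) = orth_compl n R"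
      using Nk[of "Suc (p + m)"] k by auto
    have "xs (p + m) \<in> N (p + m)" using Suc by simp
    then obtain v where v: "v \<in> N (Suc (p + m))" "P (p + m) *\<^sub>v xs (p + m) = F (p + m) *\<^sub>v v"
      unfolding N_Suc[OF k(1,3)] by (auto simp: preimage_def)
    then have vc: "v \<in> carrier_vec n" using R orth_compl_subset by auto
    have "xs (Suc (p + m)) = G (p + m) *\<^sub>v (F (p + m) *\<^sub>v v)"
      unfolding xs_Suc[OF k(1,2)] v(2) ..
    also have "\<dots> = v"
      using assoc_mult_mat_vec[OF fg(2,1) vc] fg(3) vc by simp
    finally show ?case using v(1) by simp
  qed
  \<comment> \<open>Membership in W k is what makes the k-th interval produce neither regular output
    nor output impulses.\<close>
  have xsW: "xs k \<in> W k" if k: "p \<le> k" "k < q" for k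
    using xsN[of "k - p"] N_W[OF k] k by auto
  have "\<exists>x' f' c'. vrep n x' f' c' \<and> (\<forall>k. p \<le> k \<longrightarrow> k \<le> q \<longrightarrow> vleft n f' (ts k) = xs k) \<and>
    (\<forall>k s. p \<le> k \<longrightarrow> k < q \<longrightarrow> ts k \<le> s \<longrightarrow> s < ts (Suc k) \<longrightarrow>
      f' s = mexp (Ad k) (s - ts k) *\<^sub>v (P k *\<^sub>v xs k) \<and>
      (\<forall>l. c' s l = (if s = ts k then - (Ei k ^\<^sub>m Suc l *\<^sub>v xs k) else 0\<^sub>v n)))"
  proof (rule solution_exists[OF ts pq cm(4) cm(3) cm(5)])
    show "Ei k ^\<^sub>m j *\<^sub>v v = 0\<^sub>v n" if "p \<le> k" "k < q" "v \<in> carrier_vec n" "n \<le> j" for k v j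
      by (rule mode.Ei_pow_large[OF md[OF that(1,2)] that(3,4)])
    show "xs (Suc k) = mexp (Ad k) (ts (Suc k) - ts k) *\<^sub>v (P k *\<^sub>v xs k)" if "p \<le> k" "k < q" for k
      using xs_Suc[OF that] FG(2)[OF that] by simp
  qed (use xsc in auto)
  then obtain x' f' c' where x': "vrep n x' f' c'" and left': "\<And>k. p \<le> k \<Longrightarrow> k \<le> q \<Longrightarrow> vleft n f' (ts k) = xs k"
    and flow': "\<And>k s. p \<le> k \<Longrightarrow> k < q \<Longrightarrow> ts k \<le> s \<Longrightarrow> s < ts (Suc k) \<Longrightarrow>
      f' s = mexp (Ad k) (s - ts k) *\<^sub>v (P k *\<^sub>v xs k) \<and>
      (\<forall>l. c' s l = (if s = ts k then - (Ei k ^\<^sub>m Suc l *\<^sub>v xs k) else 0\<^sub>v n))"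
    by blast
  have "dae_solution n nu ny ts E A B C D {ts p..<ts q} x' (0\<^sub>v nu) (0\<^sub>v ny)"
  proof (rule zero_output_solution[OF dae x'])
    fix k assume k: "p \<le> k" "k < q"
    have xk: "xs k \<in> carrier_vec n" using xsc k by simp
    show "homogeneous_piece n (E k) (A k) (ts k) (ts (Suc k)) f' c'"
      by (rule mode.flow_homogeneous[OF md[OF k] x' step xk left'])
        (use k flow'[OF k] step[of k] in auto)
    fix s assume s: "ts k \<le> s" "s < ts (Suc k)"
    from xsW[OF k] have ker: "Od k *\<^sub>v (P k *\<^sub>v xs k) = 0\<^sub>v (n * ny)" "Oi k *\<^sub>v xs k = 0\<^sub>v ((n - 1) * ny)"
      using W OdOi[OF k] k by (auto simp: local_unobs_def preimage_def mat_kernel_def)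
    have Pxk: "P k *\<^sub>v xs k \<in> carrier_vec n" by (rule mult_mat_vec_carrier[OF cm(3)[OF k] xk])
    have "transpose_mat (Zd k) *\<^sub>v (P k *\<^sub>v xs k) = 0\<^sub>v (dim_col (Zd k))"
      using ker(1) Od k observed_mode.kernel_iff[OF ob[OF k] Pxk] observed_mode.O_diff_kernel_iff[OF ob[OF k] Pxk] by simp
    then have "C k *\<^sub>v (mexp (Ad k) (s - ts k) *\<^sub>v (P k *\<^sub>v xs k)) = 0\<^sub>v ny"
      by (rule observed_mode.flow_output_zero[OF ob[OF k] xk]) (use s in simp)
    moreover have imp: "C k *\<^sub>v (Ei k ^\<^sub>m Suc l *\<^sub>v xs k) = 0\<^sub>v ny" for l
      by (rule observed_mode.O_imp_kernel[OF ob[OF k] xk]) (use ker(2) Oi k in simp)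
    have "C k *\<^sub>v (- (Ei k ^\<^sub>m Suc l *\<^sub>v xs k)) = 0\<^sub>v ny" for l
    proof -
      have "C k *\<^sub>v (- (Ei k ^\<^sub>m Suc l *\<^sub>v xs k)) = - (C k *\<^sub>v (Ei k ^\<^sub>m Suc l *\<^sub>v xs k))"
        by (rule mult_mat_uminus_vec[OF mats(4) mult_mat_vec_carrier[OF pow_carrier_mat[OF cm(5)[OF k]] xk]])
      also have "\<dots> = 0\<^sub>v ny" unfolding imp by (rule eq_vecI) auto
      finally show ?thesis .
    qed
    ultimately show "C k *\<^sub>v f' s = 0\<^sub>v ny \<and> (\<forall>l. C k *\<^sub>v c' s l = 0\<^sub>v ny)"
      using flow'[OF k s] mult_mat_zero_vec[OF mats(4)] by (simp del: pow_mat.simps)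
  qed
  from detectable_left_limit[OF detectable left_cont lt x' this]
  have main: "vnorm (ev q - \<xi>) \<le> \<beta> (vnorm n0) (ts q - ts p)"
    using left'[of p] left'[of q] pq xs_p xs_q by simp
  have T: "0 \<le> ts q - ts p" using lt by simp
  \<comment> \<open>Strict monotonicity compares distinct arguments only; equal ones are treated
    apart.\<close>
  have "\<beta> (vnorm n0) (ts q - ts p) \<le> \<beta> (vnorm (ev p)) (ts q - ts p)"
  proof (cases "vnorm n0 = vnorm (ev p)")
    case False
    then have "vnorm n0 < vnorm (ev p)" using n0le by simp
    moreover have "strict_mono_on {0..} (\<lambda>r. \<beta> r (ts q - ts p))"
      using detectable T by (simp add: interval_detectable_def class_KL_def)
    moreover have "0 \<le> vnorm n0" "0 \<le> vnorm (ev p)"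
      by (simp_all add: vnorm_def scalar_prod_self_nonneg)
    ultimately show ?thesis
      using strict_mono_onD[of "{0..}" "\<lambda>r. \<beta> r (ts q - ts p)" "vnorm n0" "vnorm (ev p)"] by simp
  qed simp
  with main have est: "vnorm (ev q - \<xi>) \<le> \<beta> (vnorm (ev p)) (ts q - ts p)" by linarith
  have left: "ev k = left_value xh (ts k) - left_value x (ts k)" for k
    unfolding ev_def f_def left_value_vrep[OF reps(1)] left_value_vrep[OF reps(2)] by (rule vleft_diff[OF reps(2,1)])
  have lc: "left_value x (ts k) \<in> carrier_vec n" "left_value xh (ts k) \<in> carrier_vec n" for k
    unfolding left_value_vrep[OF reps(1)] left_value_vrep[OF reps(2)] by simp_all
  have "left_value xh (ts q) - \<xi> - left_value x (ts q) = ev q - \<xi>"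
    unfolding left using lc[of q] \<xi>c by (intro eq_vecI) auto
  \<comment> \<open>The contraction of beta is available only for positive arguments, hence the
    restriction to a nonzero initial error.\<close>
  moreover have "\<beta> (vnorm (ev p)) (ts q - ts p) < vnorm (ev p)" if "left_value xh (ts p) \<noteq> left_value x (ts p)"
  proof -
    have "ev p \<noteq> 0\<^sub>v n"
      using that vec_sub_eq_0D[OF lc(2,1)] unfolding left by blast
    then have "vnorm (ev p) > 0" by (rule vnorm_pos[OF evc])
    then show ?thesis using detectable by (simp add: interval_detectable_def)
  qed
  ultimately show ?thesis
    using est unfolding left[symmetric] by simp
qed

end
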